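(* Assume that ${\rm conv}(A)$ is a simplex. Then the ring $\mathbf k[\mathbf NA]=\mathbf k[\partial]/I_A$ is Cohen-Macaulay if and only if $\mathcal E(A)=\emptyset$.
   Context: Let $\mathbf N=\{0,1,2,\dots\}$ and let $\mathbf k$ be a field of characteristic zero. Let $A=(a_1,\dots,a_n)=(a_{ij})$ be a $d\times n$ integer matrix of rank $d$ whose columns all lie on one hyperplane of $\mathbf Q^d$ not containing the origin; $A$ also denotes the set of its columns, $\mathbf NA$, $\mathbf ZA$ the monoid and the group they generate, and $\mathbf k[\mathbf NA]$ the monoid algebra. $I_A=\langle \partial^u-\partial^v : u,v\in\mathbf N^n,\ Au=Av\rangle\subset\mathbf k[\partial]=\mathbf k[\partial_1,\dots,\partial_n]$. For $\beta\in\mathbf k^d$, $H_A(\beta)$ is the left ideal of the Weyl algebra $D=\mathbf k\langle x_1,\dots,x_n,\partial_1,\dots,\partial_n\rangle$ generated by $I_A$ and $\sum_{j}a_{ij}x_j\partial_j-\beta_i$ ($i=1,\dots,d$); $M_A(\beta)=D/H_A(\beta)$, and ${\rm rank}(M_A(\beta))=\dim_{\mathbf k(x)}\mathbf k(x)\otimes_{\mathbf k[x]}M_A(\beta)$ is its holonomic rank. ${\rm vol}(A)$ is the normalized volume of ${\rm conv}(A)$; in the simplex case ${\rm vol}(A)=[\mathbf ZA:\sum_{j\in V}\mathbf Za_j]$, where $V$ is the set of indices of the vertices of ${\rm conv}(A)$. The exceptional set is $\mathcal E(A)=\{\beta\in\mathbf k^d : {\rm rank}(M_A(\beta))>{\rm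 vol}(A)\}$. *)

theory Defs
  imports
    "HOL-Analysis.Analysis"
    "HOL-Algebra.Algebra"
    "HOL-Algebra.Algebraic_Closure_Type"
    "HOL-Library.Poly_Mapping"
    "HOL-Library.Extended_Nat"
    "HOL-Computational_Algebra.Polynomial_Factorial"
    "Jordan_Normal_Form.Missing_VectorSpace"
begin

section \<open>Cohen--Macaulay rings\<close>

definition regular_sequence :: "('a, 'b) ring_scheme \<Rightarrow> 'a list \<Rightarrow> bool" where
  "regular_sequence R xs \<longleftrightarrow>
     set xs \<subseteq> carrier R \<and>
     (\<forall>i<length xs. \<forall>r\<in>carrier R.
        xs ! i \<otimes>\<^bsub>R\<^esub> r \<in> genideal R (set (take i xs)) \<longrightarrow> r \<in> genideal R (set (take i xs))) \<and>
     genideal R (set xs) \<noteq> carrier R"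

definition ideal_depth :: "('a, 'b) ring_scheme \<Rightarrow> 'a set \<Rightarrow> enat" where
  "ideal_depth R I = (SUP xs \<in> {xs. regular_sequence R xs \<and> set xs \<subseteq> I}. enat (length xs))"

definition prime_height :: "('a, 'b) ring_scheme \<Rightarrow> 'a set \<Rightarrow> enat" where
  "prime_height R P =
     (SUP Ps \<in> {Ps. Ps \<noteq> [] \<and> last Ps = P \<and> sorted_wrt (\<subset>) Ps \<and> (\<forall>Q\<in>set Ps. primeideal Q R)}.
        enat (length Ps - 1))"

text \<open>This is the definition in Eisenbud, \<^emph>\<open>Commutative Algebra\<close>, Section 18.2: a Noetherian
  ring in which depth and codimension agree for every maximal ideal.\<close>

definition cohen_macaulay :: "('a, 'b) ring_scheme \<Rightarrow> bool" where
  "cohen_macaulay R \<longleftrightarrow> cring R \<and> noetherian_ring R \<and>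
     (\<forall>\<mm>. maximalideal \<mm> R \<longrightarrow> ideal_depth R \<mm> = prime_height R \<mm>)"


section \<open>The matrix, its monoid, its lattice and its polytope\<close>

definition cone_monoid :: "int ^ 'n ^ 'd \<Rightarrow> (int ^ 'd) set" where
  "cone_monoid A = {\<Sum>j\<in>UNIV. int (u j) *s column j A | u. True}"

definition column_lattice :: "int ^ 'n ^ 'd \<Rightarrow> 'n set \<Rightarrow> (int ^ 'd) set" where
  "column_lattice A J = {\<Sum>j\<in>J. c j *s column j A | c. True}"

definition column_polytope :: "int ^ 'n ^ 'd \<Rightarrow> (real ^ 'd) set" where
  "column_polytope A = convex hull (columns (map_matrix real_of_int A))"

definition vertex_indices :: "int ^ 'n ^ 'd \<Rightarrow> 'n set" where
  "vertex_indices A =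
     {j. column j (map_matrix real_of_int A) extreme_point_of column_polytope A}"

text \<open>The normalized volume in the case where \<^const>\<open>column_polytope\<close> is a simplex, as the index
  of the lattice spanned by the vertices in the lattice spanned by all columns.\<close>

definition simplex_vol :: "int ^ 'n ^ 'd \<Rightarrow> nat" where
  "simplex_vol A =
     card (rcosets\<^bsub>\<lparr>carrier = column_lattice A UNIV, monoid.mult = (+), one = 0\<rparr>\<^esub>
             (column_lattice A (vertex_indices A)))"

text \<open>The monoid algebra of a submonoid \<open>S\<close>, inside the algebra of all finitely supported
  functions, on which \<^const>\<open>times\<close> is convolution.\<close>

definition monoid_algebra :: "'m::comm_monoid_add set \<Rightarrow> ('m \<Rightarrow>\<^sub>0 'k::comm_ring_1) ring" where
  "monoid_algebra S =
     \<lparr>carrier = {f. Poly_Mapping.keys f \<subseteq> S}, monoid.mult = (*), one = 1, ring.zero = 0, add = (+)\<rparr>"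


section \<open>Polynomials and the Weyl algebra\<close>

text \<open>The type of polynomials in variables indexed by \<open>'n\<close>. It serves both for
  \<open>k[x]\<close> and for the commutative ring \<open>k[\<partial>]\<close>.\<close>

type_synonym ('n, 'k) mpoly = "('n \<Rightarrow>\<^sub>0 nat) \<Rightarrow>\<^sub>0 'k"

definition mconst :: "'k \<Rightarrow> ('n, 'k::zero) mpoly" where
  "mconst c = Poly_Mapping.single 0 c"

definition mvar :: "'n \<Rightarrow> ('n, 'k::zero_neq_one) mpoly" where
  "mvar j = Poly_Mapping.single (Poly_Mapping.single j 1) 1"

definition mderiv :: "'n \<Rightarrow> ('n, 'k::comm_ring_1) mpoly \<Rightarrow> ('n, 'k) mpoly" where
  "mderiv j p =
     (\<Sum>m\<in>Poly_Mapping.keys p.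
        Poly_Mapping.single (m - Poly_Mapping.single j 1)
          (of_nat (Poly_Mapping.lookup m j) * Poly_Mapping.lookup p m))"

text \<open>Over a field of characteristic zero the Weyl algebra is the subalgebra of the \<open>k\<close>-linear
  endomorphisms of \<open>k[x]\<close> generated by the multiplications by the variables and the partial
  derivatives.\<close>

inductive_set weyl_operators :: "(('n, 'k::comm_ring_1) mpoly \<Rightarrow> ('n, 'k) mpoly) set" where
  scalar: "(\<lambda>p. mconst c * p) \<in> weyl_operators"
| var: "(\<lambda>p. mvar j * p) \<in> weyl_operators"
| deriv: "mderiv j \<in> weyl_operators"
| add: "\<lbrakk>P \<in> weyl_operators; Q \<in> weyl_operators\<rbrakk> \<Longrightarrow> (\<lambda>p. P p + Q p) \<in> weyl_operators"
| comp: "\<lbrakk>P \<in> weyl_operators; Q \<in> weyl_operators\<rbrakk> \<Longrightarrow> P \<circ> Q \<in> weyl_operators"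

definition weyl_algebra :: "(('n, 'k::comm_ring_1) mpoly \<Rightarrow> ('n, 'k) mpoly) ring" where
  "weyl_algebra =
     \<lparr>carrier = weyl_operators, monoid.mult = (\<circ>), one = id, ring.zero = (\<lambda>_. 0),
      add = (\<lambda>P Q p. P p + Q p)\<rparr>"

text \<open>The embeddings of \<open>k[x]\<close> and of \<open>k[\<partial>]\<close> into the Weyl algebra. The order of
  composition in \<open>\<partial>\<^sup>u\<close> is immaterial since partial derivatives commute.\<close>

definition mult_operator :: "('n, 'k::comm_ring_1) mpoly \<Rightarrow> ('n, 'k) mpoly \<Rightarrow> ('n, 'k) mpoly" where
  "mult_operator f = (\<lambda>p. f * p)"

definition deriv_monomial ::
    "('n::{finite,linorder} \<Rightarrow>\<^sub>0 nat) \<Rightarrow> ('n, 'k::comm_ring_1) mpoly \<Rightarrow> ('n, 'k) mpoly" where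
  "deriv_monomial u =
     foldr (\<lambda>j P. (mderiv j ^^ Poly_Mapping.lookup u j) \<circ> P) (sorted_list_of_set UNIV) id"

definition deriv_operator ::
    "('n::{finite,linorder}, 'k::comm_ring_1) mpoly \<Rightarrow> ('n, 'k) mpoly \<Rightarrow> ('n, 'k) mpoly" where
  "deriv_operator f =
     (\<lambda>p. \<Sum>u\<in>Poly_Mapping.keys f. mconst (Poly_Mapping.lookup f u) * deriv_monomial u p)"


section \<open>Left ideals, cyclic modules and extension of scalars\<close>

definition left_ideal :: "'a set \<Rightarrow> ('a, 'b) ring_scheme \<Rightarrow> bool" where
  "left_ideal J R \<longleftrightarrow> additive_subgroup J R \<and> (\<forall>r\<in>carrier R. \<forall>a\<in>J. r \<otimes>\<^bsub>R\<^esub> a \<in> J)"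

definition gen_left_ideal :: "('a, 'b) ring_scheme \<Rightarrow> 'a set \<Rightarrow> 'a set" where
  "gen_left_ideal R S = \<Inter>{J. left_ideal J R \<and> S \<subseteq> J}"

text \<open>The quotient of a ring \<open>D\<close> by a left ideal \<open>H\<close>, as a module over a ring mapping to \<open>D\<close>
  by \<open>\<iota>\<close>. The ring multiplication contained in the record type of modules plays no role.\<close>

definition left_quotient_module ::
    "('r \<Rightarrow> 'd) \<Rightarrow> ('d, 'b) ring_scheme \<Rightarrow> 'd set \<Rightarrow> ('r, 'd set) module" where
  "left_quotient_module \<iota> D H =
     \<lparr>carrier = a_rcosets\<^bsub>D\<^esub> H, monoid.mult = undefined, one = undefined,
      ring.zero = H, add = set_add D,
      smult = (\<lambda>r C. \<Union>w\<in>C. H +>\<^bsub>D\<^esub> (\<iota> r \<otimes>\<^bsub>D\<^esub> w))\<rparr>"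

text \<open>The tensor product \<open>K \<otimes>\<^sub>R M\<close> along a ring homomorphism \<open>\<phi>\<close> from \<open>R\<close> to \<open>K\<close>: the
  free abelian group on pairs modulo the bilinearity relations, with \<open>K\<close> acting on the first
  factor.\<close>

definition tensor_relations ::
    "('r, 'a) ring_scheme \<Rightarrow> ('K, 'b) ring_scheme \<Rightarrow> ('r \<Rightarrow> 'K) \<Rightarrow> ('r, 'm, 'c) module_scheme
      \<Rightarrow> ('K \<times> 'm \<Rightarrow>\<^sub>0 int) set" where
  "tensor_relations R K \<phi> M =
     {frag_of (a \<oplus>\<^bsub>K\<^esub> b, m) - frag_of (a, m) - frag_of (b, m) | a b m.
        a \<in> carrier K \<and> b \<in> carrier K \<and> m \<in> carrier M} \<union>
     {frag_of (a, m \<oplus>\<^bsub>M\<^esub> m') - frag_of (a, m) - frag_of (a, m') | a m m'.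
        a \<in> carrier K \<and> m \<in> carrier M \<and> m' \<in> carrier M} \<union>
     {frag_of (a \<otimes>\<^bsub>K\<^esub> \<phi> r, m) - frag_of (a, r \<odot>\<^bsub>M\<^esub> m) | a r m.
        a \<in> carrier K \<and> r \<in> carrier R \<and> m \<in> carrier M}"

definition base_change ::
    "('r, 'a) ring_scheme \<Rightarrow> ('K, 'b) ring_scheme \<Rightarrow> ('r \<Rightarrow> 'K) \<Rightarrow> ('r, 'm, 'c) module_scheme
      \<Rightarrow> ('K, ('K \<times> 'm \<Rightarrow>\<^sub>0 int) set) module" where
  "base_change R K \<phi> M =
     (let F = free_Abelian_group (carrier K \<times> carrier M);
          N = generate F (tensor_relations R K \<phi> M)
      in \<lparr>carrier = rcosets\<^bsub>F\<^esub> N, monoid.mult = undefined, one = undefined,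
          ring.zero = N, add = set_mult F,
          smult = (\<lambda>c C. \<Union>f\<in>C. N #>\<^bsub>F\<^esub> (frag_extend (\<lambda>(a, m). frag_of (c \<otimes>\<^bsub>K\<^esub> a, m)) f))\<rparr>)"

text \<open>\<^const>\<open>vectorspace.dim\<close> is meaningful only for finite-dimensional spaces.\<close>

definition vs_dim :: "('K, 'b) ring_scheme \<Rightarrow> ('K, 'm, 'c) module_scheme \<Rightarrow> enat" where
  "vs_dim K V = (if vectorspace.fin_dim K V then enat (vectorspace.dim K V) else \<infinity>)"


section \<open>A-hypergeometric systems\<close>

definition exponent_degree :: "int ^ 'n ^ 'd \<Rightarrow> ('n \<Rightarrow>\<^sub>0 nat) \<Rightarrow> int ^ 'd" where
  "exponent_degree A u = A *v (\<chi> j. int (Poly_Mapping.lookup u j))"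

definition toric_ideal :: "int ^ 'n ^ 'd \<Rightarrow> ('n, 'k::comm_ring_1) mpoly set" where
  "toric_ideal A =
     genideal ring_of_type_algebra
       {Poly_Mapping.single u 1 - Poly_Mapping.single v 1 | u v.
          exponent_degree A u = exponent_degree A v}"

definition euler_operator ::
    "int ^ 'n ^ 'd \<Rightarrow> 'k ^ 'd \<Rightarrow> 'd \<Rightarrow> ('n, 'k::comm_ring_1) mpoly \<Rightarrow> ('n, 'k) mpoly" where
  "euler_operator A \<beta> i =
     (\<lambda>p. (\<Sum>j\<in>UNIV. of_int (A $ i $ j) * (mvar j * mderiv j p)) - mconst (\<beta> $ i) * p)"

definition hypergeometric_ideal ::
    "int ^ 'n::{finite,linorder} ^ 'd \<Rightarrow> 'k::field_char_0 ^ 'd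
      \<Rightarrow> (('n, 'k) mpoly \<Rightarrow> ('n, 'k) mpoly) set" where
  "hypergeometric_ideal A \<beta> =
     gen_left_ideal weyl_algebra
       (deriv_operator ` toric_ideal A \<union> range (euler_operator A \<beta>))"

definition hypergeometric_module ::
    "int ^ 'n::{finite,linorder} ^ 'd \<Rightarrow> 'k::field_char_0 ^ 'd
      \<Rightarrow> (('n, 'k) mpoly, (('n, 'k) mpoly \<Rightarrow> ('n, 'k) mpoly) set) module" where
  "hypergeometric_module A \<beta> =
     left_quotient_module mult_operator weyl_algebra (hypergeometric_ideal A \<beta>)"

text \<open>The linear order on \<open>'n\<close> enters through the library's instance making
  \<^typ>\<open>('n, 'k) mpoly\<close> an integral domain, needed for its field of fractions \<open>k(x)\<close>.\<close>

definition holonomic_rank ::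
    "int ^ 'n::{finite,linorder} ^ 'd \<Rightarrow> 'k::field_char_0 ^ 'd \<Rightarrow> enat" where
  "holonomic_rank A \<beta> =
     (let K = ring_of_type_algebra :: ('n, 'k) mpoly fract ring
      in vs_dim K
           (base_change ring_of_type_algebra K to_fract (hypergeometric_module A \<beta>)))"

definition exceptional_set ::
    "int ^ 'n::{finite,linorder} ^ 'd \<Rightarrow> ('k::field_char_0 ^ 'd) set" where
  "exceptional_set A = {\<beta>. holonomic_rank A \<beta> > enat (simplex_vol A)}"

end

theory Submission
  imports Defs
begin

text \<open>
  Write \<open>S\<close> for \<open>\<nat>A\<close>, let \<open>v\<^sub>l\<close> be the vertices of the simplex and \<open>L\<close> the lattice they span. Both
  properties are equivalent to the condition (\<open>star\<close>) that \<open>z \<in> \<int>A\<close> and \<open>z + v\<^sub>i, z + v\<^sub>j \<in> S\<close> with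
  \<open>i \<noteq> j\<close> imply \<open>z \<in> S\<close>.

  Let \<open>t\<^sub>l\<close> be the monomial of \<open>v\<^sub>l\<close>. If \<open>k[S]\<close> is Cohen--Macaulay, the Koszul cohomology of \<open>t\<^sub>i\<close>, \<open>t\<^sub>j\<close>
  and high powers of the other \<open>t\<^sub>l\<close> vanishes below the top degree, so \<open>t\<^sub>i\<close> is a nonzerodivisor modulo
  the others, which a violation \<open>z\<close> of (\<open>star\<close>) contradicts. Conversely, under (\<open>star\<close>) every coset of \<open>L\<close>
  in \<open>\<int>A\<close> contains exactly one element of the set \<open>Ap\<close> of all \<open>s \<in> S\<close> with \<open>s - v\<^sub>l \<notin> S\<close> for every
  \<open>l\<close>, and \<open>k[S]\<close> is free over \<open>k[t\<^sub>1, \<dots>, t\<^sub>d]\<close> with the monomials of \<open>Ap\<close> as a basis.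

  The operators \<open>\<partial>\<^sup>u\<close> with \<open>Au \<in> Ap\<close> generate \<open>k(x) \<otimes> M\<^sub>A(\<beta>)\<close> for every \<open>\<beta>\<close>, since the Euler operators
  express the other monomials through them by a linear system that becomes the identity matrix when
  the vertex variables are \<open>1\<close> and the others \<open>0\<close>. Hence the rank is at most \<open>|Ap|\<close>, which under
  (\<open>star\<close>) is the number \<open>vol(A)\<close> of cosets. If \<open>z\<close> violates (\<open>star\<close>), take \<open>\<beta> = z\<close>: every coset
  provides a formal series solution with minimal negative support, and the coset of \<open>z\<close> provides
  two. The operators \<open>x\<^sub>j \<partial>\<^sub>j\<close> separate the initial exponents of these series, so the rank exceeds \<open>vol(A)\<close>.
\<close>

section \<open>Rings inside a type, prime chains\<close>

text \<open>The Cohen-Macaulay condition concerns every maximal ideal, whereas the vertex monomials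
  all lie in the graded one. Elsewhere they are replaced by monic polynomials in single vertex
  monomials, which Zariski's lemma places in any maximal ideal; division with remainder by them
  imitates division by a monomial, and (\<open>star\<close>) makes the remainders stable under the
  other vertices. For the converse only the graded maximal ideal is used, but nothing is known about
  the regular sequence found there. Koszul cohomology transfers its length to the vertex monomials.

  The field is arbitrary of characteristic zero, so solutions are plain functions on rational
  exponents without convergence. Polynomials act on them by finite sums, rational functions do not;
  hence independence over \<open>k(x)\<close> is first reduced to relations with polynomial
  coefficients.

  Why a violation \<open>z\<close> gives two series: \<open>z + V i\<close> in \<open>S\<close>
  yields an exponent over \<open>z\<close> with at most the coordinate of \<open>V i\<close>
  negative, and likewise for \<open>V j\<close>. An exponent without negative coordinates would put
  \<open>z\<close> into \<open>S\<close>. So both negative supports are singletons, minimal and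
  distinct.\<close>

definition sring :: "'a::comm_ring_1 set \<Rightarrow> bool" where
  "sring R \<longleftrightarrow> 1 \<in> R \<and> (\<forall>x\<in>R. \<forall>y\<in>R. x - y \<in> R \<and> x * y \<in> R)"

definition ideal_in :: "'a::comm_ring_1 set \<Rightarrow> 'a set \<Rightarrow> bool" where
  "ideal_in R I \<longleftrightarrow> I \<subseteq> R \<and> 0 \<in> I \<and> (\<forall>x\<in>I. \<forall>y\<in>I. x + y \<in> I) \<and> (\<forall>r\<in>R. \<forall>x\<in>I. r * x \<in> I)"

definition prime_in :: "'a::comm_ring_1 set \<Rightarrow> 'a set \<Rightarrow> bool" where
  "prime_in R P \<longleftrightarrow> ideal_in R P \<and> 1 \<notin> P \<and> (\<forall>x\<in>R. \<forall>y\<in>R. x * y \<in> P \<longrightarrow> x \<in> P \<or> y \<in> P)"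

text \<open>Peeling off one generator at a time gives an induction rule for membership. When
  \<open>G\<close> lies outside \<open>R\<close> the same set is the \<open>R\<close>-submodule
  spanned by \<open>G\<close>; Hilbert's basis theorem and Zariski's lemma use it in that
  sense.\<close>

inductive_set igen :: "'a::comm_ring_1 set \<Rightarrow> 'a set \<Rightarrow> 'a set" for R G where
  zero: "0 \<in> igen R G"
| step: "r \<in> R \<Longrightarrow> g \<in> G \<Longrightarrow> x \<in> igen R G \<Longrightarrow> r * g + x \<in> igen R G"

lemma sring_one: "sring R \<Longrightarrow> 1 \<in> R"
  and sring_diff: "sring R \<Longrightarrow> x \<in> R \<Longrightarrow> y \<in> R \<Longrightarrow> x - y \<in> R"
  and sring_mult: "sring R \<Longrightarrow> x \<in> R \<Longrightarrow> y \<in> R \<Longrightarrow> x * y \<in> R"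
  by (auto simp: sring_def)

lemma sring_zero: "sring R \<Longrightarrow> 0 \<in> R"
  using sring_diff[of R 1 1] by (simp add: sring_one)

lemma sring_uminus: "sring R \<Longrightarrow> x \<in> R \<Longrightarrow> - x \<in> R"
  using sring_diff[of R 0 x] by (simp add: sring_zero)

lemma sring_add: "sring R \<Longrightarrow> x \<in> R \<Longrightarrow> y \<in> R \<Longrightarrow> x + y \<in> R"
  using sring_diff[of R x "- y"] by (simp add: sring_uminus)

lemma sring_power: "sring R \<Longrightarrow> x \<in> R \<Longrightarrow> x ^ n \<in> R"
  by (induction n) (auto simp: sring_one sring_mult)

lemma sring_sum: "sring R \<Longrightarrow> (\<And>i. i \<in> I \<Longrightarrow> f i \<in> R) \<Longrightarrow> sum f I \<in> R"
  by (induction I rule: infinite_finite_induct) (auto simp: sring_zero sring_add)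

lemmas sring_closed = sring_one sring_zero sring_diff sring_uminus sring_add sring_mult sring_power

lemma ideal_inD:
  assumes "ideal_in R I"
  shows "x \<in> I \<Longrightarrow> x \<in> R" "0 \<in> I" "x \<in> I \<Longrightarrow> y \<in> I \<Longrightarrow> x + y \<in> I" "r \<in> R \<Longrightarrow> x \<in> I \<Longrightarrow> r * x \<in> I"
  using assms by (auto simp: ideal_in_def)

lemma ideal_in_uminus: "sring R \<Longrightarrow> ideal_in R I \<Longrightarrow> x \<in> I \<Longrightarrow> - x \<in> I"
  using ideal_inD(4)[of R I "-1" x] by (simp add: sring_uminus sring_one)

lemma ideal_in_diff: "sring R \<Longrightarrow> ideal_in R I \<Longrightarrow> x \<in> I \<Longrightarrow> y \<in> I \<Longrightarrow> x - y \<in> I"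
  using ideal_inD(3)[of R I x "-y"] by (simp add: ideal_in_uminus)

lemma ideal_in_sum: "ideal_in R I \<Longrightarrow> (\<And>i. i \<in> A \<Longrightarrow> f i \<in> I) \<Longrightarrow> sum f A \<in> I"
  by (induction A rule: infinite_finite_induct) (auto simp: ideal_inD)

lemma ideal_in_mult_right: "ideal_in R I \<Longrightarrow> r \<in> R \<Longrightarrow> x \<in> I \<Longrightarrow> x * r \<in> I"
  using ideal_inD(4)[of R I r x] by (simp add: mult.commute)

lemma igen_add: "x \<in> igen R G \<Longrightarrow> y \<in> igen R G \<Longrightarrow> x + y \<in> igen R G"
proof (induction rule: igen.induct)
  case (step r g x)
  have "r * g + (x + y) \<in> igen R G" using step by (intro igen.step) auto
  then show ?case by (simp add: add.assoc)
qed auto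

lemma igen_subset:
  assumes "ideal_in R I" "G \<subseteq> I" shows "igen R G \<subseteq> I"
proof
  fix x assume "x \<in> igen R G"
  then show "x \<in> I" by induction (use assms in \<open>auto simp: ideal_inD\<close>)
qed

lemma ideal_in_self: "sring R \<Longrightarrow> ideal_in R R"
  by (auto simp: ideal_in_def sring_closed)

lemma igen_mult: assumes "sring R" "s \<in> R" "x \<in> igen R G" shows "s * x \<in> igen R G"
  using assms(3)
proof induction
  case (step r g x)
  then show ?case
    using igen.step[of "s * r" R g G "s * x"] assms by (simp add: sring_mult algebra_simps)
qed (simp add: igen.zero)

lemma ideal_in_igen: assumes "sring R" "G \<subseteq> R" shows "ideal_in R (igen R G)"
  unfolding ideal_in_def
  using igen_subset[OF ideal_in_self[OF assms(1)] assms(2)] igen.zero igen_add igen_mult[OF assms(1)]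
  by blast

lemma igen_gen: "sring R \<Longrightarrow> g \<in> G \<Longrightarrow> g \<in> igen R G"
  using igen.step[of 1 R g G 0] by (simp add: sring_one igen.zero)

lemma igen_mono: "G \<subseteq> H \<Longrightarrow> igen R G \<subseteq> igen R H"
proof
  fix x assume "G \<subseteq> H" "x \<in> igen R G"
  from this(2,1) show "x \<in> igen R H" by induction (auto intro: igen.intros)
qed

lemma igen_empty: "igen R {} = {0}"
  by (auto elim: igen.cases intro: igen.zero)

lemma igen_insert:
  assumes "sring R" "x \<in> igen R (insert g G)"
  shows "\<exists>r\<in>R. \<exists>y\<in>igen R G. x = r * g + y"
  using assms(2)
proof induction
  case zero then show ?case
    by (intro bexI[of _ 0]) (auto simp: igen.zero sring_zero[OF assms(1)])
next
  case (step r h x)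
  then obtain r' y where *: "r' \<in> R" "y \<in> igen R G" "x = r' * g + y" by auto
  show ?case
  proof (cases "h = g")
    case True
    then show ?thesis using * step
      by (intro bexI[of _ "r + r'"] bexI[of _ y]) (auto simp: algebra_simps sring_add[OF assms(1)])
  next
    case False
    then show ?thesis using * step
      by (intro bexI[of _ "r'"] bexI[of _ "r * h + y"]) (auto simp: add.left_commute intro: igen.step)
  qed
qed

lemma ideal_in_adjoin:
  assumes "sring R" "ideal_in R K" "x \<in> R"
  shows "ideal_in R {x * r + y | r y. r \<in> R \<and> y \<in> K}"
  unfolding ideal_in_def
proof (intro conjI ballI subsetI)
  fix z assume "z \<in> {x * r + y | r y. r \<in> R \<and> y \<in> K}"
  then show "z \<in> R" using assms by (auto simp: sring_closed ideal_inD)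
next
  show "0 \<in> {x * r + y | r y. r \<in> R \<and> y \<in> K}"
    using assms by (auto intro!: exI[of _ 0] simp: ideal_inD sring_closed)
next
  fix z w assume "z \<in> {x * r + y | r y. r \<in> R \<and> y \<in> K}" "w \<in> {x * r + y | r y. r \<in> R \<and> y \<in> K}"
  then obtain r y r' y' where "z = x * r + y" "w = x * r' + y'" "r \<in> R" "r' \<in> R" "y \<in> K" "y' \<in> K" by auto
  moreover from this have "z + w = x * (r + r') + (y + y')" by (simp add: algebra_simps)
  ultimately show "z + w \<in> {x * r + y | r y. r \<in> R \<and> y \<in> K}"
    using assms by (smt (verit) mem_Collect_eq ideal_inD(3) sring_add)
next
  fix s z assume s: "s \<in> R" and "z \<in> {x * r + y | r y. r \<in> R \<and> y \<in> K}"
  then obtain r y where "z = x * r + y" and r: "r \<in> R" "y \<in> K" by auto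
  then have "s * z = x * (s * r) + s * y" by (simp add: algebra_simps)
  moreover have "s * r \<in> R" "s * y \<in> K" using r s assms by (auto simp: ideal_inD sring_closed)
  ultimately show "s * z \<in> {x * r + y | r y. r \<in> R \<and> y \<in> K}" by auto
qed

text \<open>Zorn's lemma gives an ideal maximal among those that contain \<open>K\<close> and miss
  \<open>T\<close>. Adjoining an element outside it produces an element of \<open>T\<close>; if two
  outside elements had their product inside, the product of the two elements of \<open>T\<close> so
  obtained would lie in the ideal.\<close>

lemma prime_in_disjoint:
  assumes R: "sring R" and K: "ideal_in R K" and T: "T \<subseteq> R" "1 \<in> T" "\<And>a b. a \<in> T \<Longrightarrow> b \<in> T \<Longrightarrow> a * b \<in> T"
    and disj: "K \<inter> T = {}"
  obtains Q where "prime_in R Q" "K \<subseteq> Q" "Q \<inter> T = {}"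
proof -
  define F where "F = {J. ideal_in R J \<and> K \<subseteq> J \<and> J \<inter> T = {}}"
  have "\<exists>Q\<in>F. (\<forall>Y\<in>F. Q \<subseteq> Y \<longrightarrow> Y = Q)"
  proof (rule subset_Zorn)
    fix C assume C: "subset.chain F C"
    show "\<exists>U\<in>F. \<forall>Z\<in>C. Z \<subseteq> U"
    proof (cases "C = {}")
      case True
      then show ?thesis using K disj by (auto simp: F_def intro!: bexI[of _ K])
    next
      case False
      have CF: "\<And>Z. Z \<in> C \<Longrightarrow> Z \<in> F" and lin: "\<And>Z Y. Z \<in> C \<Longrightarrow> Y \<in> C \<Longrightarrow> Z \<subseteq> Y \<or> Y \<subseteq> Z"
        using C by (auto simp: subset.chain_def subset_chain_def)
      have "\<Union>C \<in> F"
        unfolding F_def mem_Collect_eq ideal_in_def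
      proof (intro conjI ballI)
        show "\<Union>C \<subseteq> R" using CF ideal_inD(1) unfolding F_def by blast
        show "0 \<in> \<Union>C" using CF False ideal_inD(2) unfolding F_def by blast
        show "K \<subseteq> \<Union>C" using CF False unfolding F_def by blast
        show "\<Union>C \<inter> T = {}" using CF unfolding F_def by blast
      next
        fix x y assume "x \<in> \<Union>C" "y \<in> \<Union>C"
        then obtain Y Z where "Y \<in> C" "Z \<in> C" "x \<in> Y" "y \<in> Z" by auto
        then show "x + y \<in> \<Union>C"
          using lin[of Y Z] CF ideal_inD(3) unfolding F_def by blast
      next
        fix r x assume "r \<in> R" "x \<in> \<Union>C"
        then show "r * x \<in> \<Union>C" using CF ideal_inD(4) unfolding F_def by blast
      qed
      then show ?thesis by blast
    qed
  qed
  then obtain Q where Q: "Q \<in> F" "\<And>Z. Z \<in> F \<Longrightarrow> Q \<subseteq> Z \<Longrightarrow> Z = Q" by blast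
  have iQ: "ideal_in R Q" "K \<subseteq> Q" "Q \<inter> T = {}" using Q(1) by (auto simp: F_def)
  have meet: "\<exists>r\<in>R. \<exists>y\<in>Q. x * r + y \<in> T" if "x \<in> R" "x \<notin> Q" for x
  proof (rule ccontr)
    assume no: "\<not> ?thesis"
    let ?Z = "{x * r + y | r y. r \<in> R \<and> y \<in> Q}"
    have sub: "Q \<subseteq> ?Z"
    proof
      fix z assume "z \<in> Q"
      then have "z = x * 0 + z" "0 \<in> R" using R by (auto simp: sring_closed)
      then show "z \<in> ?Z" using \<open>z \<in> Q\<close> by blast
    qed
    have "x \<in> ?Z" using R iQ by (intro CollectI exI[of _ 1] exI[of _ 0]) (auto simp: sring_closed ideal_inD)
    moreover have "?Z \<in> F"
      using ideal_in_adjoin[OF R iQ(1) that(1)] sub iQ(2) no unfolding F_def by auto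
    ultimately show False using Q(2)[of ?Z] sub that(2) by auto
  qed
  have "prime_in R Q"
    unfolding prime_in_def
  proof (intro conjI ballI impI iQ(1))
    show "1 \<notin> Q" using iQ(3) T(2) by auto
    fix x y assume xy: "x \<in> R" "y \<in> R" "x * y \<in> Q"
    show "x \<in> Q \<or> y \<in> Q"
    proof (rule ccontr)
      assume "\<not> ?thesis"
      then obtain r u s v where h: "r \<in> R" "u \<in> Q" "x * r + u \<in> T" "s \<in> R" "v \<in> Q" "y * s + v \<in> T"
        using meet[of x] meet[of y] xy by auto
      have "(x * r + u) * (y * s + v) = (r * s) * (x * y) + (x * r + u) * v + (y * s) * u"
        by (simp add: algebra_simps)
      also have "\<dots> \<in> Q"
      proof (intro ideal_inD(3)[OF iQ(1)])
        show "(r * s) * (x * y) \<in> Q" using ideal_inD(4)[OF iQ(1), of "r * s" "x * y"] h xy R by (simp add: sring_mult)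
        show "(x * r + u) * v \<in> Q" using h T(1) by (intro ideal_inD(4)[OF iQ(1)]) auto
        show "(y * s) * u \<in> Q" using h xy R by (intro ideal_inD(4)[OF iQ(1)] sring_mult)
      qed
      finally show False using T(3)[OF h(3,6)] iQ(3) by auto
    qed
  qed
  then show ?thesis using that iQ by blast
qed

text \<open>Localizing at the powers of \<open>x\<close> times the complement of \<open>P\<close> avoids both \<open>K\<close> and minimal primes.\<close>

lemma prime_below_avoiding:
  assumes R: "sring R" and K: "ideal_in R K" and P: "prime_in R P" and KP: "K \<subseteq> P" and x: "x \<in> R"
    and nzd: "\<And>r. r \<in> R \<Longrightarrow> x * r \<in> K \<Longrightarrow> r \<in> K"
  obtains Q where "prime_in R Q" "K \<subseteq> Q" "Q \<subseteq> P" "x \<notin> Q"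
proof -
  have iP: "ideal_in R P" and oP: "1 \<notin> P" using P by (auto simp: prime_in_def)
  define T where "T = {x ^ n * s | n s. s \<in> R \<and> s \<notin> P}"
  have nz: "x ^ n * s \<in> K \<Longrightarrow> s \<in> K" if "s \<in> R" for n s
    by (induction n) (auto simp: mult.assoc that x R sring_closed dest: nzd[rotated])
  obtain Q where Q: "prime_in R Q" "K \<subseteq> Q" "Q \<inter> T = {}"
  proof (rule prime_in_disjoint[OF R K, of T])
    show "T \<subseteq> R" using x R by (auto simp: T_def sring_closed)
    show "1 \<in> T" using oP R unfolding T_def by (intro CollectI exI[of _ 0] exI[of _ 1]) (auto simp: sring_closed)
    show "K \<inter> T = {}" using nz KP by (auto simp: T_def)
    fix a b assume "a \<in> T" "b \<in> T"
    then obtain n s m t where h: "a = x ^ n * s" "b = x ^ m * t" "s \<in> R" "t \<in> R" "s \<notin> P" "t \<notin> P"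
      by (auto simp: T_def)
    moreover have "s * t \<notin> P" "s * t \<in> R" using h P R by (auto simp: prime_in_def sring_closed)
    moreover have "a * b = x ^ (n + m) * (s * t)" using h by (simp add: power_add algebra_simps)
    ultimately show "a * b \<in> T" unfolding T_def by blast
  qed blast
  have "Q \<subseteq> P"
  proof
    fix s assume "s \<in> Q"
    then have "s \<in> R" using Q(1) by (auto simp: prime_in_def ideal_inD)
    moreover have "s \<in> T" if "s \<notin> P" using that \<open>s \<in> R\<close> by (auto simp: T_def intro!: exI[of _ 0] exI[of _ s])
    ultimately show "s \<in> P" using \<open>s \<in> Q\<close> Q(3) by auto
  qed
  moreover have "x \<notin> Q"
  proof
    assume "x \<in> Q"
    moreover have "x \<in> T" unfolding T_def using oP R by (intro CollectI exI[of _ 1] exI[of _ 1]) (auto simp: sring_closed)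
    ultimately show False using Q(3) by auto
  qed
  ultimately show ?thesis using that Q by blast
qed

text \<open>Descent from the top: since \<open>x n\<close> is a nonzerodivisor modulo
  \<open>K n\<close>, some prime between \<open>K n\<close> and the current one avoids
  \<open>x n\<close>, and \<open>x n\<close> makes the inclusion strict. This serves both to bound
  depth by height and to build a long chain below the graded maximal ideal.\<close>

lemma prime_chain:
  assumes R: "sring R" and K: "\<And>i. i \<le> n \<Longrightarrow> ideal_in R (K i)" and x: "\<And>i. i < n \<Longrightarrow> x i \<in> K (Suc i)"
    and mono: "\<And>i. i < n \<Longrightarrow> K i \<subseteq> K (Suc i)"
    and nzd: "\<And>i r. i < n \<Longrightarrow> r \<in> R \<Longrightarrow> x i * r \<in> K i \<Longrightarrow> r \<in> K i"
    and P: "prime_in R P" "K n \<subseteq> P"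
  shows "\<exists>Ps. length Ps = Suc n \<and> last Ps = P \<and> sorted_wrt (\<subset>) Ps \<and> (\<forall>Q\<in>set Ps. prime_in R Q)"
  using assms
proof (induction n arbitrary: P)
  case 0
  then show ?case by (intro exI[of _ "[P]"]) auto
next
  case (Suc n)
  have xn: "x n \<in> K (Suc n)" "x n \<in> R" using Suc.prems(2)[of "Suc n"] Suc.prems(3)[of n] by (auto simp: ideal_inD)
  obtain Q where Q: "prime_in R Q" "K n \<subseteq> Q" "Q \<subseteq> P" "x n \<notin> Q"
    by (rule prime_below_avoiding[OF R Suc.prems(2)[of n] Suc.prems(6), of "x n"])
      (use Suc.prems(4)[of n] Suc.prems(5)[of n] Suc.prems(7) xn in auto)
  obtain Ps where Ps: "length Ps = Suc n" "last Ps = Q" "sorted_wrt (\<subset>) Ps" "\<forall>Q\<in>set Ps. prime_in R Q"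
    using Suc.IH[OF R Suc.prems(2) Suc.prems(3) Suc.prems(4) Suc.prems(5) Q(1,2)] by auto
  have QP: "Q \<subset> P" using Q xn Suc.prems(7) by auto
  have "Z \<subset> P" if "Z \<in> set Ps" for Z
  proof -
    obtain Qs where "Ps = Qs @ [Q]" using Ps by (metis append_butlast_last_id length_0_conv nat.distinct(1))
    then show ?thesis using that Ps(3) QP by (auto simp: sorted_wrt_append)
  qed
  then show ?case using Ps Suc.prems(6)
    by (intro exI[of _ "Ps @ [P]"]) (auto simp: sorted_wrt_append)
qed

section \<open>Depth sensitivity of the Koszul complex\<close>

text \<open>A cochain is a function on Boolean lists, the indicators of the subsets of the sequence. Splitting
  off the first entry of the sequence accounts for the signs.\<close>

fun koszul_d :: "'a::comm_ring_1 list \<Rightarrow> (bool list \<Rightarrow> 'a) \<Rightarrow> bool list \<Rightarrow> 'a" where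
  "koszul_d (x # xs) c (False # I) = koszul_d xs (\<lambda>I. c (False # I)) I"
| "koszul_d (x # xs) c (True # I) = x * c (False # I) - koszul_d xs (\<lambda>I. c (True # I)) I"
| "koszul_d _ c _ = 0"

text \<open>Contraction against the vector \<open>hs\<close>, with the sign convention of
  \<open>koszul_d\<close>; it is the homotopy that trivializes multiplication by the pairing of
  \<open>xs\<close> and \<open>hs\<close>.\<close>

fun koszul_h :: "'a::comm_ring_1 list \<Rightarrow> (bool list \<Rightarrow> 'a) \<Rightarrow> bool list \<Rightarrow> 'a" where
  "koszul_h (h # hs) c (False # I) = koszul_h hs (\<lambda>I. c (False # I)) I + h * c (True # I)"
| "koszul_h (h # hs) c (True # I) = - koszul_h hs (\<lambda>I. c (True # I)) I"
| "koszul_h _ c _ = 0"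

definition cochain :: "'a::comm_ring_1 set \<Rightarrow> nat \<Rightarrow> (bool list \<Rightarrow> 'a) \<Rightarrow> bool" where
  "cochain R i c \<longleftrightarrow> range c \<subseteq> R \<and> (\<forall>I. length (filter id I) \<noteq> i \<longrightarrow> c I = 0)"

lemma koszul_d_add: "koszul_d xs (\<lambda>I. a I + b I) I = koszul_d xs a I + koszul_d xs b I"
proof (induction xs a I arbitrary: b rule: koszul_d.induct)
  case 1
  show ?case by (simp only: koszul_d.simps 1, (simp add: algebra_simps)?)
next
  case 2
  show ?case by (simp only: koszul_d.simps 2, (simp add: algebra_simps)?)
qed auto

lemma koszul_d_scale: "koszul_d xs (\<lambda>I. r * a I) I = r * koszul_d xs a I"
proof (induction xs a I rule: koszul_d.induct)
  case 1
  show ?case by (simp only: koszul_d.simps 1, (simp add: algebra_simps)?)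
next
  case 2
  show ?case by (simp only: koszul_d.simps 2, (simp add: algebra_simps)?)
qed auto

lemma koszul_d_lin:
  "koszul_d xs (\<lambda>I. a I + b I) I = koszul_d xs a I + koszul_d xs b I"
  "koszul_d xs (\<lambda>I. a I - b I) I = koszul_d xs a I - koszul_d xs b I"
  "koszul_d xs (\<lambda>I. r * a I) I = r * koszul_d xs a I"
  "koszul_d xs (\<lambda>I. - a I) I = - koszul_d xs a I"
  using koszul_d_add[of xs a b I] koszul_d_add[of xs a "\<lambda>I. (-1) * b I" I]
    koszul_d_scale[of xs "-1" a I] koszul_d_scale[of xs "-1" b I] koszul_d_scale[of xs r a I]
  by simp_all

lemma koszul_h_add: "koszul_h xs (\<lambda>I. a I + b I) I = koszul_h xs a I + koszul_h xs b I"
proof (induction xs a I arbitrary: b rule: koszul_h.induct)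
  case 1
  show ?case by (simp only: koszul_h.simps 1, (simp add: algebra_simps)?)
next
  case 2
  show ?case by (simp only: koszul_h.simps 2, (simp add: algebra_simps)?)
qed auto

lemma koszul_h_scale: "koszul_h xs (\<lambda>I. r * a I) I = r * koszul_h xs a I"
proof (induction xs a I rule: koszul_h.induct)
  case 1
  show ?case by (simp only: koszul_h.simps 1, (simp add: algebra_simps)?)
next
  case 2
  show ?case by (simp only: koszul_h.simps 2, (simp add: algebra_simps)?)
qed auto

lemma koszul_h_lin:
  "koszul_h xs (\<lambda>I. a I + b I) I = koszul_h xs a I + koszul_h xs b I"
  "koszul_h xs (\<lambda>I. a I - b I) I = koszul_h xs a I - koszul_h xs b I"
  "koszul_h xs (\<lambda>I. r * a I) I = r * koszul_h xs a I"
  "koszul_h xs (\<lambda>I. - a I) I = - koszul_h xs a I"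
  using koszul_h_add[of xs a b I] koszul_h_add[of xs a "\<lambda>I. (-1) * b I" I]
    koszul_h_scale[of xs "-1" a I] koszul_h_scale[of xs "-1" b I] koszul_h_scale[of xs r a I]
  by simp_all

lemma koszul_d_zero: "koszul_d xs (\<lambda>I. 0) I = 0"
  by (induction xs "\<lambda>I::bool list. 0::'a" I rule: koszul_d.induct) auto

lemma koszul_dd: "koszul_d xs (koszul_d xs c) I = 0"
proof (induction xs c I rule: koszul_d.induct)
  case (1 x xs c I)
  then show ?case by simp
next
  case (2 x xs c I)
  then show ?case by (simp add: koszul_d_lin)
qed (auto simp: koszul_d_zero)

text \<open>On splitting off the first entry the mixed terms cancel and \<open>x * h\<close>
  remains. Consequently every element of the ideal generated by \<open>xs\<close> acts as zero on
  Koszul cohomology.\<close>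

lemma koszul_homotopy:
  "length xs = length hs \<Longrightarrow> length I = length xs \<Longrightarrow>
   koszul_d xs (koszul_h hs c) I + koszul_h hs (koszul_d xs c) I = (\<Sum>(x, h)\<leftarrow>zip xs hs. x * h) * c I"
proof (induction xs hs arbitrary: c I rule: list_induct2)
  case (Cons x xs h hs)
  obtain b J where I: "I = b # J" using Cons.prems by (cases I) auto
  then have J: "length J = length xs" using Cons.prems by simp
  show ?case
    using Cons.IH[OF J, of "\<lambda>I. c (b # I)"]
    by (cases b) (simp_all add: I koszul_d_lin koszul_h_lin algebra_simps)
qed auto

lemma koszul_d_range:
  assumes "sring R" "set xs \<subseteq> R" "ideal_in R K" "range c \<subseteq> K" shows "koszul_d xs c I \<in> K"
  using assms(2,4)
  by (induction xs c I rule: koszul_d.induct)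
    (auto simp: image_subset_iff ideal_inD(2)[OF assms(3)]
      intro!: ideal_in_diff[OF assms(1,3)] ideal_inD(4)[OF assms(3)])

lemma koszul_h_range:
  assumes "sring R" "set xs \<subseteq> R" "ideal_in R K" "\<And>J. length J = length I \<Longrightarrow> c J \<in> K" shows "koszul_h xs c I \<in> K"
  using assms(2,4)
  by (induction xs c I rule: koszul_h.induct)
    (auto simp: image_subset_iff ideal_inD(2)[OF assms(3)]
      intro!: ideal_in_uminus[OF assms(1,3)] ideal_inD(3)[OF assms(3)] ideal_inD(4)[OF assms(3)])

lemma koszul_d_igen:
  assumes "sring R" "range c \<subseteq> R" shows "koszul_d xs c I \<in> igen R (set xs)"
  using assms(2)
proof (induction xs c I rule: koszul_d.induct)
  case (1 x xs c I)
  then show ?case using igen_mono[of "set xs" "insert x (set xs)" R] by (auto simp: image_subset_iff)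
next
  case (2 x xs c I)
  have "koszul_d xs (\<lambda>I. c (True # I)) I \<in> igen R (insert x (set xs))"
    using 2 igen_mono[of "set xs" "insert x (set xs)" R] by (auto simp: image_subset_iff)
  then have "(-1) * koszul_d xs (\<lambda>I. c (True # I)) I \<in> igen R (insert x (set xs))"
    using assms(1) by (intro igen_mult) (auto simp: sring_closed)
  then have "c (False # I) * x + (-1) * koszul_d xs (\<lambda>I. c (True # I)) I \<in> igen R (insert x (set xs))"
    using 2 by (intro igen.step) (auto simp: image_subset_iff)
  then show ?case by (simp add: mult.commute)
qed (auto intro: igen.zero)

lemma koszul_d_degree:
  "(\<And>I. length (filter id I) \<noteq> i \<Longrightarrow> c I = 0) \<Longrightarrow> length (filter id I) \<noteq> Suc i \<Longrightarrow> koszul_d xs c I = 0"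
proof (induction xs c I arbitrary: i rule: koszul_d.induct)
  case (1 x xs c I)
  show ?case using 1(1)[of i] 1(2,3) by auto
next
  case (2 x xs c I)
  have "c (False # I) = 0" using 2(2,3) by auto
  moreover have "koszul_d xs (\<lambda>I. c (True # I)) I = 0"
  proof (cases i)
    case 0
    then have "(\<lambda>I. c (True # I)) = (\<lambda>I. 0)" using 2(2) by auto
    then show ?thesis by (simp add: koszul_d_zero)
  next
    case (Suc j)
    then show ?thesis using 2(1)[of j] 2(2,3) by auto
  qed
  ultimately show ?case by simp
qed auto

lemma koszul_h_degree:
  "(\<And>I. length (filter id I) \<noteq> i \<Longrightarrow> c I = 0) \<Longrightarrow> Suc (length (filter id I)) \<noteq> i \<Longrightarrow> koszul_h xs c I = 0"
proof (induction xs c I arbitrary: i rule: koszul_h.induct)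
  case (1 x xs c I)
  show ?case using 1(1)[of i] 1(2,3) by auto
next
  case (2 x xs c I)
  have "koszul_h xs (\<lambda>I. c (True # I)) I = 0"
  proof (cases i)
    case 0
    then show ?thesis using 2(1)[of 0] 2(2) by auto
  next
    case (Suc j)
    then show ?thesis using 2(1)[of j] 2(2,3) by auto
  qed
  then show ?case by simp
qed auto

text \<open>The cohomology \<open>H\<^sup>i\<close> with coefficients in \<open>R/J k\<close> vanishes for \<open>i + k < d\<close>: multiplication by \<open>f k\<close> is injective on it by the vanishing for \<open>k + 1\<close> in
  degree \<open>i - 1\<close>, and it is nilpotent because a power of \<open>f k\<close> is null-homotopic.\<close>

lemma koszul_vanishing:
  assumes R: "sring R" and xs: "set xs \<subseteq> R"
    and J: "\<And>k. k \<le> d \<Longrightarrow> ideal_in R (J k)"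
    and f: "\<And>k. k < d \<Longrightarrow> f k \<in> R"
    and step: "\<And>k. k < d \<Longrightarrow> J (Suc k) = {f k * r + y | r y. r \<in> R \<and> y \<in> J k}"
    and nzd: "\<And>k r. k < d \<Longrightarrow> r \<in> R \<Longrightarrow> f k * r \<in> J k \<Longrightarrow> r \<in> J k"
    and rad: "\<And>k. k < d \<Longrightarrow> \<exists>N hs. length hs = length xs \<and> set hs \<subseteq> R \<and> f k ^ N = (\<Sum>(x, h)\<leftarrow>zip xs hs. x * h)"
  shows "i + k < d \<Longrightarrow> cochain R i c \<Longrightarrow> (\<And>I. length I = length xs \<Longrightarrow> koszul_d xs c I \<in> J k) \<Longrightarrow>
    \<exists>b. (i = 0 \<longrightarrow> b = (\<lambda>_. 0)) \<and> cochain R (i - 1) b \<and> (\<forall>I. length I = length xs \<longrightarrow> c I - koszul_d xs b I \<in> J k)"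
proof (induction i arbitrary: k c rule: less_induct)
  case (less i)
  have k: "k < d" and Jk: "ideal_in R (J k)" and fk: "f k \<in> R" using less.prems(1) J f by auto
  note JI = ideal_inD[OF Jk]
  let ?D = "koszul_d xs"
  have zero: "cochain R j (\<lambda>_. 0)" for j using R by (auto simp: cochain_def sring_closed)
  have inj: "\<exists>g. (i = 0 \<longrightarrow> g = (\<lambda>_. 0)) \<and> cochain R (i - 1) g \<and> (\<forall>I. length I = length xs \<longrightarrow> c I - ?D g I \<in> J k)"
    if c: "cochain R i c" and b: "i = 0 \<longrightarrow> b = (\<lambda>_. 0)" "cochain R (i - 1) b" 
      and bc: "\<And>I. length I = length xs \<Longrightarrow> f k * c I - ?D b I \<in> J k" for b c
  proof (cases i)
    case 0
    have "c I \<in> J k" if "length I = length xs" for I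
      using bc[OF that] b(1) 0 c nzd[OF k, of "c I"] by (auto simp: koszul_d_zero cochain_def)
    then show ?thesis using 0 zero by (intro exI[of _ "\<lambda>_. 0"]) (auto simp: koszul_d_zero)
  next
    case (Suc i')
    have bR: "\<And>I. b I \<in> R" and bz: "\<And>I. length (filter id I) \<noteq> i' \<Longrightarrow> b I = 0"
      using b(2) Suc by (auto simp: cochain_def)
    have cR: "\<And>I. c I \<in> R" using c by (auto simp: cochain_def)
    \<comment> \<open>Modulo \<open>J k\<close> the differential of \<open>b\<close> is
      \<open>f k * c\<close>, which dies modulo \<open>J (Suc k)\<close>. So \<open>b\<close> is a
      cocycle there, and the induction hypothesis, one degree lower, makes it a coboundary up to a
      multiple of \<open>f k\<close>.\<close>
    have cyc: "?D b I \<in> J (Suc k)" if "length I = length xs" for I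
    proof -
      have "?D b I = f k * c I + (-1) * (f k * c I - ?D b I)" by simp
      moreover have "(-1) * (f k * c I - ?D b I) \<in> J k" using ideal_in_uminus[OF R Jk bc[OF that]] by simp
      ultimately show ?thesis using step[OF k] cR by blast
    qed
    obtain e where e: "i' = 0 \<longrightarrow> e = (\<lambda>_. 0)" "cochain R (i' - 1) e"
        "\<And>I. length I = length xs \<Longrightarrow> b I - ?D e I \<in> J (Suc k)"
      using less.IH[of i' "Suc k" b] Suc less.prems(1) b(2) cyc by auto
    have ez: "?D e I = 0" if "length (filter id I) \<noteq> i'" for I
    proof (cases i')
      case 0 then show ?thesis using e(1) by (simp add: koszul_d_zero)
    next
      case (Suc j) then show ?thesis using e(2) that by (intro koszul_d_degree[of j]) (auto simp: cochain_def)
    qed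
    have "\<exists>r. r \<in> R \<and> (length (filter id I) \<noteq> i' \<longrightarrow> r = 0) \<and> (length I = length xs \<longrightarrow> b I - ?D e I - f k * r \<in> J k)" for I
    proof (cases "length (filter id I) = i' \<and> length I = length xs")
      case True
      then obtain r y where "b I - ?D e I = f k * r + y" "r \<in> R" "y \<in> J k"
        using e(3)[of I] step[OF k] by auto
      then show ?thesis using True by (intro exI[of _ r]) auto
    next
      case False
      then show ?thesis using bz[of I] ez[of I] R JI(2) by (intro exI[of _ 0]) (auto simp: sring_closed)
    qed
    then obtain g where g: "\<And>I. g I \<in> R" "\<And>I. length (filter id I) \<noteq> i' \<Longrightarrow> g I = 0"
        "\<And>I. length I = length xs \<Longrightarrow> b I - ?D e I - f k * g I \<in> J k" by metis
    \<comment> \<open>The membership in \<open>J k\<close> is known only for lists of the right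
      length. The value 0 elsewhere puts the whole range into \<open>J k\<close>, and
      \<open>Dlen\<close> shows that the differential does not see the change.\<close>
    define w where "w = (\<lambda>I. if length I = length xs then b I - ?D e I - f k * g I else 0)"
    have Dlen: "?D u I = ?D v I" if "length I = length xs" "\<And>I. length I = length xs \<Longrightarrow> u I = v I" for u v I
      using that
    proof (induction xs u I arbitrary: v rule: koszul_d.induct)
      case (1 x xs c I)
      show ?case using 1(1)[of "\<lambda>I. v (False # I)"] 1(2,3) by simp
    next
      case (2 x xs c I)
      show ?case using 2(1)[of "\<lambda>I. v (True # I)"] 2(2,3) by simp
    qed auto
    have "c I - ?D g I \<in> J k" if I: "length I = length xs" for I
    proof (rule nzd[OF k])
      show "c I - ?D g I \<in> R"
        using cR koszul_d_range[OF R xs ideal_in_self[OF R], of g] g(1)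
        by (intro sring_diff[OF R]) (auto simp: image_subset_iff)
      have "?D w I \<in> J k" using g(3) JI(2) by (intro koszul_d_range[OF R xs Jk]) (auto simp: w_def)
      also have "?D w I = ?D (\<lambda>I. b I - ?D e I - f k * g I) I" by (intro Dlen I) (auto simp: w_def)
      also have "\<dots> = ?D b I - f k * ?D g I" by (simp add: koszul_d_lin koszul_dd)
      finally have "(f k * c I - ?D b I) + (?D b I - f k * ?D g I) \<in> J k" by (intro JI bc I)
      then show "f k * (c I - ?D g I) \<in> J k" by (simp add: algebra_simps)
    qed
    then show ?thesis using g Suc by (intro exI[of _ g]) (auto simp: cochain_def)
  qed
  have pow: "\<exists>g. (i = 0 \<longrightarrow> g = (\<lambda>_. 0)) \<and> cochain R (i - 1) g \<and> (\<forall>I. length I = length xs \<longrightarrow> c I - ?D g I \<in> J k)"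
    if "cochain R i c" "i = 0 \<longrightarrow> b = (\<lambda>_. 0)" "cochain R (i - 1) b"
      "\<And>I. length I = length xs \<Longrightarrow> f k ^ n * c I - ?D b I \<in> J k" for n b c
    using that
  proof (induction n arbitrary: c b)
    case 0
    then show ?case by (intro exI[of _ b]) auto
  next
    case (Suc n)
    have "cochain R i (\<lambda>I. f k * c I)" using Suc.prems(1) R fk by (auto simp: cochain_def image_subset_iff sring_closed)
    moreover have "f k ^ n * (f k * c I) - ?D b I \<in> J k" if "length I = length xs" for I
      using Suc.prems(4)[OF that] by (simp add: mult.assoc mult.commute mult.left_commute)
    ultimately obtain g where "i = 0 \<longrightarrow> g = (\<lambda>_. 0)" "cochain R (i - 1) g"
      "\<forall>I. length I = length xs \<longrightarrow> f k * c I - ?D g I \<in> J k"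
      using Suc.IH[of "\<lambda>I. f k * c I" b] Suc.prems(2,3) by auto
    then show ?case using inj[OF Suc.prems(1)] by auto
  qed
  obtain N hs where hs: "length hs = length xs" "set hs \<subseteq> R" "f k ^ N = (\<Sum>(x, h)\<leftarrow>zip xs hs. x * h)"
    using rad[OF k] by auto
  \<comment> \<open>Because \<open>c\<close> is a cocycle modulo \<open>J k\<close>, the homotopy
    formula makes this a primitive of \<open>f k ^ N * c\<close>; \<open>pow\<close> then strips the
    factor \<open>f k\<close> off \<open>N\<close> times.\<close>
  let ?b = "koszul_h hs c"
  have cR: "c I \<in> R" and cz: "length (filter id I) \<noteq> i \<Longrightarrow> c I = 0" for I
    using less.prems(2) by (auto simp: cochain_def)
  have "i = 0 \<longrightarrow> ?b = (\<lambda>_. 0)" using koszul_h_degree[of 0 c, OF cz] by auto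
  moreover have "cochain R (i - 1) ?b"
    using koszul_h_range[OF R hs(2) ideal_in_self[OF R], of _ c] koszul_h_degree[of i c, OF cz] cR
    by (auto simp: cochain_def image_subset_iff)
  moreover have "f k ^ N * c I - ?D ?b I \<in> J k" if I: "length I = length xs" for I
  proof -
    have "f k ^ N * c I - ?D ?b I = koszul_h hs (?D c) I"
      using koszul_homotopy[of xs hs I c] I hs by (simp add: algebra_simps)
    also have "\<dots> \<in> J k"
      using I less.prems(3) by (intro koszul_h_range[OF R hs(2) Jk]) auto
    finally show ?thesis .
  qed
  ultimately show ?case using pow[OF less.prems(2)] by auto
qed

text \<open>The relation says that \<open>y1\<close> and \<open>y2\<close>, placed at the index sets
  omitting only \<open>x0\<close> and only \<open>x1\<close>, form a cocycle of degree
  \<open>d - 1\<close>. The regular sequence \<open>f\<close> of length \<open>d\<close> makes it a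
  coboundary, and its value at the set omitting \<open>x0\<close> is the claim.\<close>

lemma koszul_syzygy:
  assumes R: "sring R" and xs: "set (x0 # x1 # rest) \<subseteq> R" and d: "d = length (x0 # x1 # rest)"
    and J: "\<And>k. k \<le> d \<Longrightarrow> ideal_in R (J k)" "J 0 = {0}"
    and f: "\<And>k. k < d \<Longrightarrow> f k \<in> R"
    and step: "\<And>k. k < d \<Longrightarrow> J (Suc k) = {f k * r + y | r y. r \<in> R \<and> y \<in> J k}"
    and nzd: "\<And>k r. k < d \<Longrightarrow> r \<in> R \<Longrightarrow> f k * r \<in> J k \<Longrightarrow> r \<in> J k"
    and rad: "\<And>k. k < d \<Longrightarrow> \<exists>N hs. length hs = d \<and> set hs \<subseteq> R \<and>
      f k ^ N = (\<Sum>(x, h)\<leftarrow>zip (x0 # x1 # rest) hs. x * h)"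
    and y: "y1 \<in> R" "y2 \<in> R" "x0 * y1 = x1 * y2"
  shows "\<exists>r\<in>R. \<exists>z\<in>igen R (set rest). y1 = x1 * r + z"
proof -
  let ?xs = "x0 # x1 # rest" and ?n = "length rest"
  let ?I1 = "False # True # replicate ?n True" and ?I2 = "True # False # replicate ?n True"
  define c where "c = (\<lambda>I. if I = ?I1 then y1 else if I = ?I2 then y2 else 0)"
  have co: "cochain R (d - 1) c" using y R d by (auto simp: cochain_def c_def sring_closed)
  have full: "I = True # True # replicate ?n True" if "length I = d" "length (filter id I) = d" for I
  proof -
    have "\<forall>b\<in>set I. b" using that by (metis id_apply length_filter_less less_irrefl)
    then have "I = replicate d True" using that(1) by (metis (full_types) replicate_eqI)
    then show ?thesis using d by simp
  qed
  have rest0: "koszul_d rest (\<lambda>I. c (True # True # I)) J = 0" for J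
    by (simp add: c_def koszul_d_zero)
  have top: "koszul_d ?xs c (True # True # replicate ?n True) = 0"
    using y(3) rest0 by (simp add: c_def)
  have cyc: "koszul_d ?xs c I \<in> J 0" if I: "length I = length ?xs" for I
  proof (cases "length (filter id I) = d")
    case True
    then show ?thesis using full[of I] I d top J(2) by simp
  next
    case False
    then show ?thesis using koszul_d_degree[of "d - 1" c I ?xs] co d J(2) by (auto simp: cochain_def)
  qed
  have "\<exists>b. (d - 1 = 0 \<longrightarrow> b = (\<lambda>_. 0)) \<and> cochain R (d - 1 - 1) b \<and>
      (\<forall>I. length I = length ?xs \<longrightarrow> c I - koszul_d ?xs b I \<in> J 0)"
    by (rule koszul_vanishing[where R = R and xs = ?xs and d = d and J = J and f = f and k = 0 and i = "d - 1" and c = c])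
      (use R xs J f step nzd co cyc rad d in auto)
  then obtain b where b: "cochain R (d - 1 - 1) b" "\<And>I. length I = length ?xs \<Longrightarrow> c I - koszul_d ?xs b I \<in> J 0"
    by auto
  have bR: "\<And>I. b I \<in> R" using b(1) by (auto simp: cochain_def)
  have "c ?I1 = koszul_d ?xs b ?I1" using b(2)[of ?I1] J(2) by simp
  then have y1: "y1 = x1 * b (False # False # replicate ?n True) + (-1) * koszul_d rest (\<lambda>I. b (False # True # I)) (replicate ?n True)"
    by (simp add: c_def)
  moreover have "(-1) * koszul_d rest (\<lambda>I. b (False # True # I)) (replicate ?n True) \<in> igen R (set rest)"
    using R bR by (intro igen_mult koszul_d_igen) (auto simp: sring_closed)
  ultimately show ?thesis using bR by blast
qed

section \<open>Noetherian rings and dimension of monoid algebras\<close>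

text \<open>Elimination of one unknown per equation. It later provides a dependence between powers
  modulo a maximal ideal, an algebraic dependence of \<open>d + 1\<close> elements, and a functional
  vanishing on too few vertices.\<close>

lemma homogeneous_system_nontrivial:
  fixes a :: "'e \<Rightarrow> 'u \<Rightarrow> 'k::field"
  assumes "finite E" "finite U" "card E < card U"
  shows "\<exists>x. (\<exists>u\<in>U. x u \<noteq> 0) \<and> (\<forall>e\<in>E. (\<Sum>u\<in>U. a e u * x u) = 0)"
  using assms
proof (induction E arbitrary: U a rule: finite_induct)
  case empty
  then have "U \<noteq> {}" by auto
  then obtain u where "u \<in> U" by blast
  then show ?case by (intro exI[of _ "\<lambda>_. 1"]) auto
next
  case (insert e E)
  show ?case
  proof (cases "\<forall>u\<in>U. a e u = 0")
    case True
    obtain x where "\<exists>u\<in>U. x u \<noteq> 0" "\<forall>e\<in>E. (\<Sum>u\<in>U. a e u * x u) = 0"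
      using insert.IH[of U a] insert.prems insert.hyps by auto
    then show ?thesis using True by (intro exI[of _ x]) auto
  next
    case False
    then obtain v where v: "v \<in> U" "a e v \<noteq> 0" by auto
    define b where "b = (\<lambda>f u. a f u - a f v * a e u / a e v)"
    have "card E < card (U - {v})" using insert.prems insert.hyps v by simp
    then obtain y where y: "\<exists>u\<in>U - {v}. y u \<noteq> 0" "\<forall>f\<in>E. (\<Sum>u\<in>U - {v}. b f u * y u) = 0"
      using insert.IH[of "U - {v}" b] insert.prems(1) by auto
    define x where "x = y(v := - (\<Sum>u\<in>U - {v}. a e u * y u) / a e v)"
    have split: "(\<Sum>u\<in>U. a f u * x u) = a f v * x v + (\<Sum>u\<in>U - {v}. a f u * y u)" for f
      by (subst sum.remove[OF insert.prems(1) v(1)]) (auto simp: x_def intro!: sum.cong)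
    have "(\<Sum>u\<in>U. a f u * x u) = 0" if "f \<in> insert e E" for f
    proof (cases "f = e")
      case True
      then show ?thesis unfolding split using v(2) by (simp add: x_def)
    next
      case False
      then have "0 = (\<Sum>u\<in>U - {v}. b f u * y u)" using y(2) that by auto
      also have "\<dots> = (\<Sum>u\<in>U - {v}. a f u * y u) - a f v / a e v * (\<Sum>u\<in>U - {v}. a e u * y u)"
        by (simp add: b_def left_diff_distrib sum_subtractf sum_distrib_left algebra_simps)
      finally have "(\<Sum>u\<in>U - {v}. a f u * y u) = a f v / a e v * (\<Sum>u\<in>U - {v}. a e u * y u)" by simp
      moreover have "a f v * x v = - (a f v / a e v * (\<Sum>u\<in>U - {v}. a e u * y u))" by (simp add: x_def)
      ultimately show ?thesis unfolding split by simp
    qed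
    moreover have "\<exists>u\<in>U. x u \<noteq> 0" using y(1) by (auto simp: x_def)
    ultimately show ?thesis by blast
  qed
qed

text \<open>Multiplication by generators only keeps inductions short; closure under products is
  derived, and subtraction comes from having \<open>-1\<close> among the generators.\<close>

inductive_set alg_hull :: "'a::comm_ring_1 set \<Rightarrow> 'a set" for G where
  one: "1 \<in> alg_hull G"
| gen: "g \<in> G \<Longrightarrow> x \<in> alg_hull G \<Longrightarrow> g * x \<in> alg_hull G"
| add: "x \<in> alg_hull G \<Longrightarrow> y \<in> alg_hull G \<Longrightarrow> x + y \<in> alg_hull G"

lemma alg_hull_gen: "g \<in> G \<Longrightarrow> g \<in> alg_hull G"
  by (metis mult.right_neutral alg_hull.gen alg_hull.one)

lemma alg_hull_mult: "x \<in> alg_hull G \<Longrightarrow> y \<in> alg_hull G \<Longrightarrow> x * y \<in> alg_hull G"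
  by (induction rule: alg_hull.induct) (simp_all add: mult.assoc distrib_right alg_hull.gen alg_hull.add)

lemma sring_alg_hull: assumes "-1 \<in> G" shows "sring (alg_hull G)"
  unfolding sring_def
proof (intro conjI ballI)
  fix x y assume "x \<in> alg_hull G" "y \<in> alg_hull G"
  then show "x - y \<in> alg_hull G"
    using alg_hull.add[OF _ alg_hull.gen[OF assms], of x y] by simp
qed (simp_all add: alg_hull.one alg_hull_mult)

lemma alg_hull_mono: "G \<subseteq> H \<Longrightarrow> alg_hull G \<subseteq> alg_hull H"
proof
  fix x assume "G \<subseteq> H" "x \<in> alg_hull G"
  from this(2,1) show "x \<in> alg_hull H" by induction (simp_all add: alg_hull.one alg_hull.gen alg_hull.add subset_iff)
qed

lemma alg_hull_subset: assumes "sring R" "G \<subseteq> R" shows "alg_hull G \<subseteq> R"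
proof
  fix x assume "x \<in> alg_hull G"
  then show "x \<in> R" by induction (use assms in \<open>auto simp: sring_closed\<close>)
qed

lemma igen_coeff_mult:
  assumes "sring B" "\<And>g. g \<in> G \<Longrightarrow> y * g \<in> igen B H" "x \<in> igen B G" shows "y * x \<in> igen B H"
  using assms(3)
proof induction
  case (step r g x)
  have "r * (y * g) + y * x \<in> igen B H" using step assms by (intro igen_add[OF igen_mult[OF assms(1)]]) auto
  then show ?case by (simp add: algebra_simps)
qed (auto intro: igen.zero)

lemma alg_hull_insert:
  assumes "-1 \<in> G" shows "alg_hull (insert x G) = igen (alg_hull G) (range (\<lambda>j. x ^ j))"
proof
  note R = sring_alg_hull[OF assms]
  let ?P = "range (\<lambda>j. x ^ j)"
  show "alg_hull (insert x G) \<subseteq> igen (alg_hull G) ?P"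
  proof
    fix z assume "z \<in> alg_hull (insert x G)"
    then show "z \<in> igen (alg_hull G) ?P"
    proof induction
      case one
      show ?case using igen_gen[OF R rangeI[of "\<lambda>j. x ^ j" 0]] by simp
    next
      case (gen g z)
      show ?case
      proof (cases "g \<in> G")
        case True
        then show ?thesis by (intro igen_mult[OF R] alg_hull_gen gen(3))
      next
        case False
        then have "g = x" using gen by auto
        moreover have "x * x ^ j \<in> igen (alg_hull G) ?P" for j
          using igen_gen[OF R rangeI[of "\<lambda>j. x ^ j" "Suc j"]] by simp
        ultimately have "g * h \<in> igen (alg_hull G) ?P" if "h \<in> ?P" for h using that by blast
        then show ?thesis by (intro igen_coeff_mult[OF R _ gen(3)]) simp
      qed
    qed (rule igen_add)
  qed
  show "igen (alg_hull G) ?P \<subseteq> alg_hull (insert x G)"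
  proof
    fix z assume "z \<in> igen (alg_hull G) ?P"
    then show "z \<in> alg_hull (insert x G)"
    proof induction
      case zero
      show ?case using sring_zero[OF sring_alg_hull[of "insert x G"]] assms by simp
    next
      case (step r g z)
      have "x \<in> alg_hull (insert x G)" by (auto intro: alg_hull_gen)
      then have "g \<in> alg_hull (insert x G)" using step(2) sring_power[OF sring_alg_hull[of "insert x G"]] assms by blast
      moreover have "r \<in> alg_hull (insert x G)" using step alg_hull_mono[of G "insert x G"] by auto
      ultimately show ?case using step by (intro alg_hull.add alg_hull_mult)
    qed
  qed
qed

section \<open>Hilbert's basis theorem\<close>

definition noeth :: "'a::comm_ring_1 set \<Rightarrow> bool" where
  "noeth R \<longleftrightarrow> (\<forall>I. ideal_in R I \<longrightarrow> (\<exists>G. finite G \<and> G \<subseteq> I \<and> I = igen R G))"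

lemma igen_power_less_Suc:
  assumes "sring B" "f \<in> igen B ((\<lambda>j. x ^ j) ` {..<Suc n})"
  shows "\<exists>b\<in>B. \<exists>p\<in>igen B ((\<lambda>j. x ^ j) ` {..<n}). f = b * x ^ n + p"
  using igen_insert[OF assms(1), of f "x ^ n" "(\<lambda>j. x ^ j) ` {..<n}"] assms(2) by (simp add: lessThan_Suc)

lemma igen_finite_support:
  "x \<in> igen R (range f) \<Longrightarrow> \<exists>n. x \<in> igen R (f ` {..<n::nat})"
proof (induction rule: igen.induct)
  case zero
  show ?case by (auto intro: igen.zero)
next
  case (step r g x)
  then obtain n j where h: "x \<in> igen R (f ` {..<n})" "g = f j" by auto
  then have "x \<in> igen R (f ` {..<max n (Suc j)})" using igen_mono[OF image_mono, of "{..<n}" "{..<max n (Suc j)}" R f] by auto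
  then show ?case using step(1) h(2) by (intro exI[of _ "max n (Suc j)"] igen.step) auto
qed

text \<open>Hilbert's basis theorem; the element \<open>x\<close> need not be transcendental over \<open>B\<close>, since only
  the ideals \<open>L n\<close> of possible coefficients of \<open>x ^ n\<close> enter.\<close>

lemma noeth_adjoin:
  assumes B: "sring B" and N: "noeth B" and B': "B' = igen B (range (\<lambda>j. x ^ j))" and R': "sring B'"
  shows "noeth B'"
  unfolding noeth_def
proof (intro allI impI)
  fix I assume I: "ideal_in B' I"
  note II = ideal_inD[OF I]
  \<comment> \<open>As \<open>x\<close> may be algebraic over \<open>B\<close>, leading coefficients
    are not defined. \<open>Low n\<close> collects the values of polynomials of degree below
    \<open>n\<close>, and \<open>L n\<close> the coefficients that can stand before
    \<open>x ^ n\<close> in some expression of an element of \<open>I\<close>.\<close>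
  define Low where "Low n = igen B ((\<lambda>j. x ^ j) ` {..<n})" for n
  define L where "L n = {b\<in>B. \<exists>p\<in>Low n. b * x ^ n + p \<in> I}" for n
  have xB': "x ^ j \<in> B'" for j unfolding B' by (intro igen_gen B) auto
  have BB': "B \<subseteq> B'"
  proof
    fix b assume "b \<in> B"
    then have "b * x ^ 0 + 0 \<in> B'" unfolding B' using rangeI[of "\<lambda>j. x ^ j" 0] by (intro igen.intros)
    then show "b \<in> B'" by simp
  qed
  have LowB': "Low n \<subseteq> B'" for n unfolding Low_def B' by (intro igen_mono) auto
  have Low_add: "p \<in> Low n \<Longrightarrow> q \<in> Low n \<Longrightarrow> p + q \<in> Low n" for p q n
    unfolding Low_def by (rule igen_add)
  have Low_mult: "b \<in> B \<Longrightarrow> p \<in> Low n \<Longrightarrow> b * p \<in> Low n" for b p n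
    unfolding Low_def by (rule igen_mult[OF B])
  have Low0: "0 \<in> Low n" for n unfolding Low_def by (rule igen.zero)
  have Low_shift: "x ^ k * p \<in> Low (k + n)" if "p \<in> Low n" for k n p
    unfolding Low_def
  proof (rule igen_coeff_mult[OF B _ that[unfolded Low_def]])
    fix g assume "g \<in> (\<lambda>j. x ^ j) ` {..<n}"
    then show "x ^ k * g \<in> igen B ((\<lambda>j. x ^ j) ` {..<k + n})"
      by (auto simp: power_add[symmetric] intro!: igen_gen[OF B])
  qed
  have Lid: "ideal_in B (L n)" for n
    unfolding ideal_in_def
  proof (intro conjI ballI)
    show "L n \<subseteq> B" by (auto simp: L_def)
    show "0 \<in> L n" using B II Low0 by (auto simp: L_def sring_closed intro!: bexI[of _ 0])
  next
    fix b c assume "b \<in> L n" "c \<in> L n"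
    then obtain p q where h: "b \<in> B" "c \<in> B" "p \<in> Low n" "q \<in> Low n" "b * x ^ n + p \<in> I" "c * x ^ n + q \<in> I"
      by (auto simp: L_def)
    then have "(b * x ^ n + p) + (c * x ^ n + q) \<in> I" by (rule_tac II(3))
    then have "(b + c) * x ^ n + (p + q) \<in> I" by (simp add: algebra_simps)
    then show "b + c \<in> L n" using h Low_add B by (auto simp: L_def sring_closed)
  next
    fix r b assume r: "r \<in> B" and "b \<in> L n"
    then obtain p where h: "b \<in> B" "p \<in> Low n" "b * x ^ n + p \<in> I" by (auto simp: L_def)
    then have "r * (b * x ^ n + p) \<in> I" using r BB' II(4) by blast
    then have "(r * b) * x ^ n + r * p \<in> I" by (simp add: distrib_left mult.assoc)
    then show "r * b \<in> L n" using h r Low_mult B by (auto simp: L_def sring_closed)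
  qed
  have Lshift: "L n \<subseteq> L (k + n)" for k n
  proof
    fix b assume "b \<in> L n"
    then obtain p where h: "b \<in> B" "p \<in> Low n" "b * x ^ n + p \<in> I" by (auto simp: L_def)
    then have "x ^ k * (b * x ^ n + p) \<in> I" using xB' II(4) by blast
    moreover have "x ^ k * (b * x ^ n + p) = b * x ^ (k + n) + x ^ k * p" by (simp add: algebra_simps power_add)
    ultimately have "b * x ^ (k + n) + x ^ k * p \<in> I" by simp
    then show "b \<in> L (k + n)" using h Low_shift by (auto simp: L_def)
  qed
  have Lmono: "L n \<subseteq> L m" if "n \<le> m" for n m using Lshift[of n "m - n"] that by simp
  have "ideal_in B (\<Union>n. L n)"
    unfolding ideal_in_def
  proof (intro conjI ballI)
    show "(\<Union>n. L n) \<subseteq> B" by (auto simp: L_def)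
    show "0 \<in> (\<Union>n. L n)" using ideal_inD(2)[OF Lid] by auto
  next
    fix b c assume "b \<in> (\<Union>n. L n)" "c \<in> (\<Union>n. L n)"
    then obtain n m where "b \<in> L n" "c \<in> L m" by auto
    then have "b \<in> L (max n m)" "c \<in> L (max n m)" using Lmono[of n "max n m"] Lmono[of m "max n m"] by auto
    then show "b + c \<in> (\<Union>n. L n)" using ideal_inD(3)[OF Lid] by blast
  next
    fix r b assume "r \<in> B" "b \<in> (\<Union>n. L n)"
    then show "r * b \<in> (\<Union>n. L n)" using ideal_inD(4)[OF Lid] by blast
  qed
  from N[unfolded noeth_def, rule_format, OF this]
  obtain G where G: "finite G" "G \<subseteq> (\<Union>n. L n)" "(\<Union>n. L n) = igen B G" by (elim exE conjE)
  \<comment> \<open>The ideals \<open>L n\<close> increase, and finitely many generators of their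
    union already lie in one of them, so the chain is constant from \<open>N\<close> on.\<close>
  have "\<exists>N. G \<subseteq> L N" using G(1,2)
  proof (induction G rule: finite_induct)
    case (insert g G)
    then obtain N n where "G \<subseteq> L N" "g \<in> L n" by auto
    then have "insert g G \<subseteq> L (max N n)" using Lmono[of N "max N n"] Lmono[of n "max N n"] by auto
    then show ?case by blast
  qed auto
  then obtain N where "G \<subseteq> L N" by blast
  then have LN: "L n \<subseteq> L N" for n
    using igen_subset[OF Lid[of N] \<open>G \<subseteq> L N\<close>] unfolding G(3)[symmetric] by blast
  have "\<forall>n. \<exists>G. finite G \<and> G \<subseteq> L n \<and> L n = igen B G" using N[unfolded noeth_def, rule_format, OF Lid] ..
  from choice[OF this] obtain H where "\<forall>n. finite (H n) \<and> H n \<subseteq> L n \<and> L n = igen B (H n)" ..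
  then have "finite (H n) \<and> H n \<subseteq> L n \<and> L n = igen B (H n)" for n ..
  note H = this[THEN conjunct1] this[THEN conjunct2, THEN conjunct1] this[THEN conjunct2, THEN conjunct2]
  have "\<forall>n. \<forall>g\<in>H n. \<exists>e\<in>I. e - g * x ^ n \<in> Low n"
  proof (intro allI ballI)
    fix n g assume "g \<in> H n"
    then have "g \<in> L n" using H(2) by auto
    then obtain p where "p \<in> Low n" "g * x ^ n + p \<in> I" by (auto simp: L_def)
    then show "\<exists>e\<in>I. e - g * x ^ n \<in> Low n" by (intro bexI[of _ "g * x ^ n + p"]) simp_all
  qed
  then have "\<forall>n. \<exists>e. \<forall>g\<in>H n. e g \<in> I \<and> e g - g * x ^ n \<in> Low n" unfolding Bex_def using bchoice by (intro allI) (drule spec, erule bchoice)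
  from choice[OF this] obtain e where "\<forall>n. \<forall>g\<in>H n. e n g \<in> I \<and> e n g - g * x ^ n \<in> Low n" ..
  then have e: "\<And>n g. g \<in> H n \<Longrightarrow> e n g \<in> I" "\<And>n g. g \<in> H n \<Longrightarrow> e n g - g * x ^ n \<in> Low n" by simp_all
  \<comment> \<open>One lift for each generator of each \<open>L n\<close> with \<open>n\<close> at
    most \<open>N\<close>. In degrees above \<open>N\<close> the lifts for \<open>L N\<close> are
    multiplied by powers of \<open>x\<close>, which is the role of \<open>k\<close> in
    \<open>lead\<close>.\<close>
  define F where "F = (\<Union>n\<in>{..N}. e n ` H n)"
  have FI: "F \<subseteq> I" using e by (auto simp: F_def)
  have lead: "\<exists>q\<in>igen B' F. q - b * x ^ (k + n) \<in> Low (k + n)" if "b \<in> igen B (H n)" "n \<le> N" for b k n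
    using that(1)
  proof induction
    case zero
    show ?case using Low0 by (intro bexI[of _ 0]) (simp_all add: igen.zero)
  next
    case (step r g b)
    then obtain q where q: "q \<in> igen B' F" "q - b * x ^ (k + n) \<in> Low (k + n)" by blast
    have "(r * x ^ k) * e n g + q \<in> igen B' F"
    proof (rule igen.step)
      show "r * x ^ k \<in> B'" using step(1) BB' xB' by (intro sring_mult[OF R']) blast+
      show "e n g \<in> F" using step(2) that(2) unfolding F_def by blast
    qed (rule q(1))
    moreover have "r * (x ^ k * (e n g - g * x ^ n)) + (q - b * x ^ (k + n)) \<in> Low (k + n)"
      using q(2) by (rule Low_add[OF Low_mult[OF step(1) Low_shift[OF e(2)[OF step(2)]]]])
    moreover have "r * (x ^ k * (e n g - g * x ^ n)) + (q - b * x ^ (k + n)) = (r * x ^ k) * e n g + q - (r * g + b) * x ^ (k + n)"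
      by (simp add: algebra_simps power_add)
    ultimately show ?case by (intro bexI[of _ "(r * x ^ k) * e n g + q"]) simp_all
  qed
  have main: "f \<in> Low n \<Longrightarrow> f \<in> I \<Longrightarrow> f \<in> igen B' F" for f n
  proof (induction n arbitrary: f)
    case 0
    then show ?case by (simp add: Low_def igen_empty igen.zero)
  next
    case (Suc n)
    obtain b p where bp: "b \<in> B" "p \<in> Low n" "f = b * x ^ n + p"
      using igen_power_less_Suc[OF B, of f x n] Suc.prems(1) unfolding Low_def by blast
    then have bL: "b \<in> L n" using Suc.prems(2) unfolding L_def by blast
    have "b \<in> igen B (H (min n N))"
      by (cases "n \<le> N") (use bL LN[of n] H(3)[of n] H(3)[of N] in \<open>simp_all add: min_def subset_iff\<close>)
    then obtain q where q: "q \<in> igen B' F" "q - b * x ^ n \<in> Low n"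
      using lead[of b "min n N" "n - min n N"] by (auto simp: min_def split: if_splits)
    have "- 1 \<in> B" using B by (simp add: sring_closed)
    then have "p + (-1) * (q - b * x ^ n) \<in> Low n" using bp q by (intro Low_add Low_mult)
    then have 1: "f - q \<in> Low n" by (simp add: bp algebra_simps)
    have "q \<in> I" using igen_subset[OF I FI] q by auto
    then have "f - q \<in> I" by (rule ideal_in_diff[OF R' I Suc.prems(2)])
    then have "f - q \<in> igen B' F" by (rule Suc.IH[OF 1])
    from igen_add[OF this q(1)] show ?case by simp
  qed
  have "I = igen B' F"
  proof
    show "igen B' F \<subseteq> I" by (rule igen_subset[OF I FI])
    show "I \<subseteq> igen B' F"
    proof
      fix f assume f: "f \<in> I"
      have "f \<in> igen B (range (\<lambda>j. x ^ j))" using II(1)[OF f] unfolding B' .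
      from igen_finite_support[OF this] obtain n where "f \<in> Low n" unfolding Low_def ..
      then show "f \<in> igen B' F" using f by (rule main)
    qed
  qed
  moreover have "finite F" using H(1) by (simp add: F_def)
  ultimately show "\<exists>G. finite G \<and> G \<subseteq> I \<and> I = igen B' G" using FI by blast
qed

lemma noeth_field:
  assumes "sring C" "\<And>x. x \<in> C \<Longrightarrow> x \<noteq> 0 \<Longrightarrow> \<exists>y\<in>C. y * x = 1"
  shows "noeth C"
  unfolding noeth_def
proof (intro allI impI)
  fix I assume I: "ideal_in C I"
  show "\<exists>G. finite G \<and> G \<subseteq> I \<and> I = igen C G"
  proof (cases "\<exists>x\<in>I. x \<noteq> 0")
    case False
    then have "I = {0}" using ideal_inD(2)[OF I] by blast
    then have "finite {} \<and> {} \<subseteq> I \<and> I = igen C {}" by (simp add: igen_empty)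
    then show ?thesis by blast
  next
    case True
    then obtain x where x: "x \<in> I" "x \<noteq> 0" by blast
    obtain y where y: "y \<in> C" "y * x = 1" using assms(2)[OF ideal_inD(1)[OF I x(1)] x(2)] by blast
    have 1: "1 \<in> I" using ideal_inD(4)[OF I y(1) x(1)] y(2) by simp
    have "z \<in> igen C {1}" if "z \<in> I" for z
      using igen.step[of z C 1 "{1}" 0] ideal_inD(1)[OF I that] igen.zero[of C "{1}"] by simp
    moreover have "igen C {1} \<subseteq> I" using 1 by (intro igen_subset[OF I]) simp
    ultimately have "finite {1} \<and> {1} \<subseteq> I \<and> I = igen C {1}" using 1 by blast
    then show ?thesis by blast
  qed
qed

lemma noeth_alg_hull:
  assumes "finite G" "sring C" "\<And>x. x \<in> C \<Longrightarrow> x \<noteq> 0 \<Longrightarrow> \<exists>y\<in>C. y * x = 1"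
  shows "noeth (alg_hull (C \<union> G))"
  using assms(1)
proof (induction G rule: finite_induct)
  case empty
  have "alg_hull C = C"
    using alg_hull_subset[OF assms(2) order_refl] alg_hull_gen[of _ C] by (intro equalityI subsetI) auto
  then show ?case using noeth_field[OF assms(2,3)] by simp
next
  case (insert x G)
  have m1: "-1 \<in> C \<union> G" using assms(2) by (simp add: sring_closed)
  have eq: "alg_hull (C \<union> insert x G) = igen (alg_hull (C \<union> G)) (range (\<lambda>j. x ^ j))"
    using alg_hull_insert[OF m1] by simp
  have "sring (alg_hull (C \<union> insert x G))" using m1 by (intro sring_alg_hull) simp
  from noeth_adjoin[OF sring_alg_hull[OF m1] insert.IH eq this] show ?case .
qed

section \<open>Algebraic independence along a chain of primes\<close>

fun mon :: "'a::comm_monoid_mult list \<Rightarrow> nat list \<Rightarrow> 'a" where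
  "mon (x # xs) (e # es) = x ^ e * mon xs es"
| "mon _ _ = 1"

lemma mon_closed: "sring R \<Longrightarrow> set xs \<subseteq> R \<Longrightarrow> mon xs es \<in> R"
  by (induction xs es rule: mon.induct) (auto simp: sring_closed)

definition ring_hom_into :: "('k::field \<Rightarrow> 'a::comm_ring_1) \<Rightarrow> 'a set \<Rightarrow> bool" where
  "ring_hom_into f R \<longleftrightarrow> f 1 = 1 \<and> (\<forall>x y. f (x + y) = f x + f y) \<and> (\<forall>x y. f (x * y) = f x * f y) \<and> range f \<subseteq> R"

lemma ring_hom_intoD:
  assumes "ring_hom_into f R"
  shows "f 1 = 1" "f (x + y) = f x + f y" "f (x * y) = f x * f y" "f x \<in> R" "f 0 = 0" "f (- x) = - f x"
    "f (x - y) = f x - f y" "f (sum g A) = (\<Sum>a\<in>A. f (g a))"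
proof -
  show 1: "f 1 = 1" "f (x + y) = f x + f y" "f (x * y) = f x * f y" "f x \<in> R" for x y
    using assms by (auto simp: ring_hom_into_def)
  show 0: "f 0 = 0" using 1(2)[of 0 0] by simp
  show m: "f (- x) = - f x" for x using 1(2)[of x "- x"] 0 by (simp add: eq_neg_iff_add_eq_0 add.commute)
  show "f (x - y) = f x - f y" using 1(2)[of x "- y"] m by simp
  show "f (sum g A) = (\<Sum>a\<in>A. f (g a))"
    by (induction A rule: infinite_finite_induct) (simp_all add: 0 1)
qed

text \<open>Suppose a relation held modulo \<open>P 0\<close>. The lowest power of the first element
  can be cancelled, since \<open>P 0\<close> is prime and does not contain it. Modulo
  \<open>P 1\<close> that element vanishes, and the terms in which it no longer occurs form a
  nontrivial relation between the remaining elements along the shorter chain.\<close>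

lemma no_relation:
  fixes f :: "'k::field \<Rightarrow> 'a::comm_ring_1"
  assumes R: "sring R" and f: "ring_hom_into f R"
  shows "(\<And>i. i \<le> length xs \<Longrightarrow> prime_in R (P i)) \<Longrightarrow>
    (\<And>i. i < length xs \<Longrightarrow> xs ! i \<in> P (Suc i) \<and> xs ! i \<notin> P i \<and> P i \<subseteq> P (Suc i)) \<Longrightarrow>
    finite A \<Longrightarrow> A \<noteq> {} \<Longrightarrow> (\<And>\<alpha>. \<alpha> \<in> A \<Longrightarrow> length \<alpha> = length xs \<and> c \<alpha> \<noteq> 0) \<Longrightarrow>
    (\<Sum>\<alpha>\<in>A. f (c \<alpha>) * mon xs \<alpha>) \<notin> P 0"
proof (induction xs arbitrary: P A c)
  case Nil
  have P: "ideal_in R (P 0)" "1 \<notin> P 0" using Nil.prems(1)[of 0] by (auto simp: prime_in_def)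
  have "A = {[]}" using Nil.prems(4,5) by auto
  then have "c [] \<noteq> 0" using Nil.prems(5) by auto
  show ?case
  proof
    assume "(\<Sum>\<alpha>\<in>A. f (c \<alpha>) * mon [] \<alpha>) \<in> P 0"
    then have "f (c []) \<in> P 0" by (simp add: \<open>A = {[]}\<close>)
    then have "f (inverse (c [])) * f (c []) \<in> P 0" using ideal_inD(4)[OF P(1)] ring_hom_intoD(4)[OF f] by blast
    then show False using P(2) \<open>c [] \<noteq> 0\<close> by (simp add: ring_hom_intoD(3)[OF f, symmetric] ring_hom_intoD(1)[OF f])
  qed
next
  case (Cons x xs)
  have P0: "prime_in R (P 0)" and P1: "prime_in R (P 1)" using Cons.prems(1)[of 0] Cons.prems(1)[of 1] by auto
  then have i1: "ideal_in R (P 1)" and i0: "ideal_in R (P 0)" by (auto simp: prime_in_def)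
  have x: "x \<in> P 1" "x \<notin> P 0" "P 0 \<subseteq> P 1" using Cons.prems(2)[of 0] by auto
  have xs: "set xs \<subseteq> R"
  proof
    fix y assume "y \<in> set xs"
    then obtain i where i: "i < length xs" "y = xs ! i" by (auto simp: in_set_conv_nth)
    then have "prime_in R (P (Suc (Suc i)))" "y \<in> P (Suc (Suc i))" using Cons.prems(1)[of "Suc (Suc i)"] Cons.prems(2)[of "Suc i"] by auto
    then show "y \<in> R" by (auto simp: prime_in_def ideal_inD)
  qed
  have xR: "x \<in> R" using x ideal_inD(1)[OF i1] by auto
  define e where "e = Min (hd ` A)"
  have eA: "e \<in> hd ` A" using Cons.prems(3,4) by (simp add: e_def)
  have le: "e \<le> hd \<alpha>" if "\<alpha> \<in> A" for \<alpha> using that Cons.prems(3) by (simp add: e_def)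
  have shape: "\<alpha> = hd \<alpha> # tl \<alpha>" "length (tl \<alpha>) = length xs" if "\<alpha> \<in> A" for \<alpha>
    using Cons.prems(5)[OF that] by (cases \<alpha>; simp)+
  define g where "g \<alpha> = f (c \<alpha>) * (x ^ (hd \<alpha> - e) * mon xs (tl \<alpha>))" for \<alpha>
  have gR: "g \<alpha> \<in> R" for \<alpha> unfolding g_def
    using xR ring_hom_intoD(4)[OF f] mon_closed[OF R xs] by (intro sring_mult[OF R] sring_power[OF R]) 
  have eq: "(\<Sum>\<alpha>\<in>A. f (c \<alpha>) * mon (x # xs) \<alpha>) = x ^ e * (\<Sum>\<alpha>\<in>A. g \<alpha>)"
    unfolding sum_distrib_left
  proof (rule sum.cong[OF refl])
    fix \<alpha> assume a: "\<alpha> \<in> A"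
    have "mon (x # xs) \<alpha> = x ^ hd \<alpha> * mon xs (tl \<alpha>)" using shape(1)[OF a] by (metis mon.simps(1))
    also have "x ^ hd \<alpha> = x ^ e * x ^ (hd \<alpha> - e)" using le[OF a] by (simp add: power_add[symmetric])
    finally show "f (c \<alpha>) * mon (x # xs) \<alpha> = x ^ e * g \<alpha>" by (simp add: g_def mult_ac)
  qed
  define A0 where "A0 = {\<alpha>\<in>A. hd \<alpha> = e}"
  have A0: "finite A0" "A0 \<noteq> {}" "A0 \<subseteq> A" using Cons.prems(3) eA by (auto simp: A0_def)
  have e_tl: "\<alpha> = e # tl \<alpha>" if "\<alpha> \<in> A0" for \<alpha> 
  proof -
    from that have "\<alpha> \<in> A" "hd \<alpha> = e" by (simp_all add: A0_def)
    have "\<alpha> = hd \<alpha> # tl \<alpha>" by (rule shape(1)) fact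
    also have "hd \<alpha> = e" by fact
    finally show ?thesis .
  qed
  have inj: "inj_on tl A0"
  proof (rule inj_onI)
    fix \<alpha> \<beta> assume h: "\<alpha> \<in> A0" "\<beta> \<in> A0" "tl \<alpha> = tl \<beta>"
    show "\<alpha> = \<beta>" by (subst e_tl[OF h(1)], subst e_tl[OF h(2)], simp only: h(3))
  qed
  show ?case
  proof
    assume "(\<Sum>\<alpha>\<in>A. f (c \<alpha>) * mon (x # xs) \<alpha>) \<in> P 0"
    then have "x ^ e * (\<Sum>\<alpha>\<in>A. g \<alpha>) \<in> P 0" by (simp add: eq)
    moreover have sR: "(\<Sum>\<alpha>\<in>A. g \<alpha>) \<in> R" using gR by (intro sring_sum[OF R])
    moreover have "x ^ n \<notin> P 0" for n
    proof (induction n)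
      case 0 then show ?case using P0 by (auto simp: prime_in_def)
    next
      case (Suc n) then show ?case using P0 x(2) xR sring_power[OF R xR, of n] by (auto simp: prime_in_def)
    qed
    ultimately have "(\<Sum>\<alpha>\<in>A. g \<alpha>) \<in> P 0" using P0 sring_power[OF R xR, of e] unfolding prime_in_def by blast
    then have s1: "(\<Sum>\<alpha>\<in>A. g \<alpha>) \<in> P 1" using x(3) by blast
    have s2: "(\<Sum>\<alpha>\<in>A - A0. g \<alpha>) \<in> P 1"
    proof (rule ideal_in_sum[OF i1])
      fix \<alpha> assume "\<alpha> \<in> A - A0"
      then have "0 < hd \<alpha> - e" using le[of \<alpha>] by (auto simp: A0_def)
      then obtain k where k: "hd \<alpha> - e = Suc k" using gr0_implies_Suc by blast
      have "g \<alpha> = (f (c \<alpha>) * (x ^ k * mon xs (tl \<alpha>))) * x" by (simp add: g_def k mult_ac)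
      moreover have "f (c \<alpha>) * (x ^ k * mon xs (tl \<alpha>)) \<in> R"
        using xR ring_hom_intoD(4)[OF f] mon_closed[OF R xs] by (intro sring_mult[OF R] sring_power[OF R])
      ultimately show "g \<alpha> \<in> P 1" using ideal_inD(4)[OF i1 _ x(1)] by simp
    qed
    have "(\<Sum>\<alpha>\<in>A. g \<alpha>) - (\<Sum>\<alpha>\<in>A - A0. g \<alpha>) = (\<Sum>\<alpha>\<in>A0. g \<alpha>)"
      using sum_diff[OF Cons.prems(3) A0(3), of g] by simp
    with ideal_in_diff[OF R i1 s1 s2] have "(\<Sum>\<alpha>\<in>A0. g \<alpha>) \<in> P 1" by simp
    also have "(\<Sum>\<alpha>\<in>A0. g \<alpha>) = (\<Sum>\<alpha>\<in>A0. f (c (e # tl \<alpha>)) * mon xs (tl \<alpha>))"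
    proof (rule sum.cong[OF refl])
      fix \<alpha> assume "\<alpha> \<in> A0"
      then have "hd \<alpha> = e" and eq: "e # tl \<alpha> = \<alpha>" by (simp add: A0_def, rule e_tl[symmetric])
      then show "g \<alpha> = f (c (e # tl \<alpha>)) * mon xs (tl \<alpha>)" unfolding eq by (simp add: g_def)
    qed
    also have "\<dots> = (\<Sum>\<beta>\<in>tl ` A0. f (c (e # \<beta>)) * mon xs \<beta>)" by (simp add: sum.reindex[OF inj])
    finally have "(\<Sum>\<beta>\<in>tl ` A0. f (c (e # \<beta>)) * mon xs \<beta>) \<in> P (Suc 0)" unfolding One_nat_def .
    moreover have "(\<Sum>\<beta>\<in>tl ` A0. f (c (e # \<beta>)) * mon xs \<beta>) \<notin> P (Suc 0)"
    proof (rule Cons.IH[where P = "\<lambda>i. P (Suc i)"])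
      fix i assume "i \<le> length xs" then show "prime_in R (P (Suc i))" using Cons.prems(1)[of "Suc i"] by simp
    next
      fix i assume "i < length xs"
      then show "xs ! i \<in> P (Suc (Suc i)) \<and> xs ! i \<notin> P (Suc i) \<and> P (Suc i) \<subseteq> P (Suc (Suc i))"
        using Cons.prems(2)[of "Suc i"] by simp
    next
      fix \<beta> assume "\<beta> \<in> tl ` A0"
      then obtain \<alpha> where a: "\<alpha> \<in> A0" "\<beta> = tl \<alpha>" by auto
      then have "\<alpha> \<in> A" by (simp add: A0_def)
      have "length \<beta> = length xs" unfolding a(2) by (rule shape(2)) fact
      moreover have "e # \<beta> = \<alpha>" unfolding a(2) by (rule e_tl[OF a(1), symmetric])
      ultimately show "length \<beta> = length xs \<and> c (e # \<beta>) \<noteq> 0"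
        using Cons.prems(5)[OF \<open>\<alpha> \<in> A\<close>, THEN conjunct2] by simp
    qed (use A0 in auto)
    ultimately show False by contradiction
  qed
qed

section \<open>Evaluation of polynomials, Nakayama's lemma and separating weights\<close>

definition pm_eval :: "('k::comm_ring_1 \<Rightarrow> 'a::comm_ring_1) \<Rightarrow> ('m \<Rightarrow> 'a) \<Rightarrow> ('m \<Rightarrow>\<^sub>0 'k) \<Rightarrow> 'a" where
  "pm_eval f \<phi> p = (\<Sum>m\<in>Poly_Mapping.keys p. f (Poly_Mapping.lookup p m) * \<phi> m)"

lemma pm_sum_single: "p = (\<Sum>m\<in>Poly_Mapping.keys p. Poly_Mapping.single m (Poly_Mapping.lookup p m))"
  by (rule poly_mapping_eqI)
    (simp add: lookup_sum lookup_single when_def in_keys_iff)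

locale pm_hom =
  fixes f :: "'k::comm_ring_1 \<Rightarrow> 'a::comm_ring_1" and \<phi> :: "'m::comm_monoid_add \<Rightarrow> 'a"
  assumes f1: "f 1 = 1" and fadd: "f (x + y) = f x + f y" and fmult: "f (x * y) = f x * f y"
    and \<phi>0: "\<phi> 0 = 1" and \<phi>add: "\<phi> (u + v) = \<phi> u * \<phi> v"
begin

lemma f0: "f 0 = 0" using fadd[of 0 0] by simp

lemma eval_superset: "finite A \<Longrightarrow> Poly_Mapping.keys p \<subseteq> A \<Longrightarrow>
    pm_eval f \<phi> p = (\<Sum>m\<in>A. f (Poly_Mapping.lookup p m) * \<phi> m)"
  unfolding pm_eval_def by (rule sum.mono_neutral_left) (auto simp: in_keys_iff f0)

lemma eval_add: "pm_eval f \<phi> (p + q) = pm_eval f \<phi> p + pm_eval f \<phi> q"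
proof -
  let ?A = "Poly_Mapping.keys p \<union> Poly_Mapping.keys q"
  have fin: "finite ?A" by simp
  show ?thesis
    unfolding eval_superset[OF fin keys_add] eval_superset[OF fin Un_upper1] eval_superset[OF fin Un_upper2]
    by (simp add: lookup_add fadd distrib_right sum.distrib)
qed

lemma eval_single: "pm_eval f \<phi> (Poly_Mapping.single m c) = f c * \<phi> m"
  using eval_superset[of "{m}" "Poly_Mapping.single m c"] by simp

lemma eval_0: "pm_eval f \<phi> 0 = 0" by (simp add: pm_eval_def)

lemma eval_1: "pm_eval f \<phi> 1 = 1" using eval_single[of 0 1] by (simp add: f1 \<phi>0)

lemma eval_sum: "pm_eval f \<phi> (sum g A) = (\<Sum>a\<in>A. pm_eval f \<phi> (g a))"
  by (induction A rule: infinite_finite_induct) (simp_all add: eval_0 eval_add)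

lemma eval_mult: "pm_eval f \<phi> (p * q) = pm_eval f \<phi> p * pm_eval f \<phi> q"
proof -
  let ?s = "\<lambda>p m. Poly_Mapping.single m (Poly_Mapping.lookup p m)"
  have "p * q = (\<Sum>m\<in>Poly_Mapping.keys p. ?s p m) * (\<Sum>n\<in>Poly_Mapping.keys q. ?s q n)"
    by (rule arg_cong2[where f = "(*)", OF pm_sum_single pm_sum_single])
  also have "pm_eval f \<phi> \<dots> = (\<Sum>m\<in>Poly_Mapping.keys p. \<Sum>n\<in>Poly_Mapping.keys q.
      (f (Poly_Mapping.lookup p m) * \<phi> m) * (f (Poly_Mapping.lookup q n) * \<phi> n))"
    by (simp add: sum_product eval_sum mult_single eval_single fmult \<phi>add mult_ac)
  also have "\<dots> = pm_eval f \<phi> p * pm_eval f \<phi> q" by (simp add: pm_eval_def sum_product)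
  finally show ?thesis .
qed

end

text \<open>Instead of a determinant, one generator is eliminated at a time. With \<open>g\<close>
  thrown into \<open>N\<close>, the induction hypothesis gives a factor \<open>1 + a * b\<close>
  carrying the other generators into the span of \<open>g\<close> plus \<open>N\<close>;
  substituting this into the equation for \<open>g\<close> leaves a multiple of \<open>g\<close>
  alone.\<close>

lemma nakayama:
  fixes B :: "'a::comm_ring_1 set"
  assumes "finite G" and B: "sring B" and a: "a \<in> B"
  shows "0 \<in> N \<Longrightarrow> (\<And>x y. x \<in> N \<Longrightarrow> y \<in> N \<Longrightarrow> x + y \<in> N) \<Longrightarrow> (\<And>r x. r \<in> B \<Longrightarrow> x \<in> N \<Longrightarrow> r * x \<in> N) \<Longrightarrow>
    (\<And>g. g \<in> G \<Longrightarrow> \<exists>h\<in>igen B G. g - a * h \<in> N) \<Longrightarrow> \<exists>b\<in>B. \<forall>g\<in>G. (1 + a * b) * g \<in> N"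
  using assms(1)
proof (induction G arbitrary: N rule: finite_induct)
  case empty
  show ?case using sring_zero[OF B] by blast
next
  case (insert g G)
  define N1 where "N1 = {\<beta> * g + n | \<beta> n. \<beta> \<in> B \<and> n \<in> N}"
  have N1I: "\<beta> * g + n \<in> N1" if "\<beta> \<in> B" "n \<in> N" for \<beta> n using that unfolding N1_def by blast
  have "\<exists>b\<in>B. \<forall>h\<in>G. (1 + a * b) * h \<in> N1"
  proof (rule insert.IH)
    show "0 \<in> N1" using N1I[OF sring_zero[OF B] insert.prems(1)] by simp
  next
    fix x y assume "x \<in> N1" "y \<in> N1"
    then obtain \<beta> n \<gamma> k where h: "x = \<beta> * g + n" "y = \<gamma> * g + k" "\<beta> \<in> B" "n \<in> N" "\<gamma> \<in> B" "k \<in> N"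
      unfolding N1_def by blast
    have "(\<beta> + \<gamma>) * g + (n + k) \<in> N1" using h B by (intro N1I insert.prems(2) sring_add)
    then show "x + y \<in> N1" by (simp add: h algebra_simps)
  next
    fix r x assume r: "r \<in> B" and "x \<in> N1"
    then obtain \<beta> n where h: "x = \<beta> * g + n" "\<beta> \<in> B" "n \<in> N" unfolding N1_def by blast
    have "(r * \<beta>) * g + r * n \<in> N1" using h B r by (intro N1I insert.prems(3) sring_mult)
    then show "r * x \<in> N1" by (simp add: h algebra_simps)
  next
    fix h assume "h \<in> G"
    then obtain k where k: "k \<in> igen B (insert g G)" "h - a * k \<in> N" using insert.prems(4)[of h] by blast
    obtain \<gamma> l where l: "\<gamma> \<in> B" "l \<in> igen B G" "k = \<gamma> * g + l" using igen_insert[OF B k(1)] by blast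
    have "(a * \<gamma>) * g + (h - a * k) \<in> N1" using l k B a by (intro N1I sring_mult)
    then have "h - a * l \<in> N1" by (simp add: l algebra_simps)
    then show "\<exists>l\<in>igen B G. h - a * l \<in> N1" using l(2) by blast
  qed
  then obtain b where b: "b \<in> B" "\<And>h. h \<in> G \<Longrightarrow> (1 + a * b) * h \<in> N1" by blast
  let ?e = "1 + a * b"
  have eB: "?e \<in> B" using a b B by (simp add: sring_closed)
  have igN1: "?e * l \<in> N1" if "l \<in> igen B G" for l
    using that
  proof induction
    case zero
    show ?case using N1I[OF sring_zero[OF B] insert.prems(1)] by simp
  next
    case (step r h x)
    obtain \<beta> n where 1: "?e * h = \<beta> * g + n" "\<beta> \<in> B" "n \<in> N" using b(2)[OF step(2)] unfolding N1_def by blast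
    obtain \<gamma> k where 2: "?e * x = \<gamma> * g + k" "\<gamma> \<in> B" "k \<in> N" using step(4) unfolding N1_def by blast
    have "(r * \<beta> + \<gamma>) * g + (r * n + k) \<in> N1"
      using 1(2,3) 2(2,3) step(1) B by (intro N1I insert.prems(2,3) sring_add sring_mult)
    also have "(r * \<beta> + \<gamma>) * g + (r * n + k) = r * (\<beta> * g + n) + (\<gamma> * g + k)" by (simp add: algebra_simps)
    also have "\<dots> = ?e * (r * h + x)" unfolding 1(1)[symmetric] 2(1)[symmetric] by (simp add: algebra_simps)
    finally show ?case .
  qed
  obtain k where k: "k \<in> igen B (insert g G)" "g - a * k \<in> N" using insert.prems(4)[of g] by blast
  obtain \<gamma> l where l: "\<gamma> \<in> B" "l \<in> igen B G" "k = \<gamma> * g + l" using igen_insert[OF B k(1)] by blast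
  obtain \<beta> n where n: "?e * l = \<beta> * g + n" "\<beta> \<in> B" "n \<in> N" using igN1[OF l(2)] unfolding N1_def by blast
  \<comment> \<open>Read off from \<open>?e * g - a * \<gamma> * ?e * g - a * \<beta> * g\<close>,
    which has to be \<open>(1 + a * b') * g\<close>.\<close>
  define b' where "b' = b - \<gamma> * ?e - \<beta>"
  have b': "b' \<in> B" using b(1) l(1) n(2) eB B unfolding b'_def by (intro sring_diff sring_mult)
  have "?e * (g - a * k) + a * n \<in> N" using insert.prems(2,3) k(2) n(3) eB a by blast
  also have "?e * (g - a * k) + a * n = ?e * g - a * \<gamma> * ?e * g - a * (?e * l) + a * n"
    by (simp add: l(3) algebra_simps)
  also have "\<dots> = (1 + a * b') * g" unfolding n(1) b'_def by (simp add: algebra_simps)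
  finally have gN: "(1 + a * b') * g \<in> N" .
  define b2 where "b2 = b + b' + a * b * b'"
  have e2: "1 + a * b2 = (1 + a * b') * ?e" by (simp add: b2_def algebra_simps)
  have b2: "b2 \<in> B" using b b' a B unfolding b2_def by (intro sring_add sring_mult)
  have e'B: "1 + a * b' \<in> B" using a b' B by (simp add: sring_closed)
  have "(1 + a * b2) * h \<in> N" if h: "h \<in> insert g G" for h
  proof (cases "h = g")
    case True
    have "?e * ((1 + a * b') * g) \<in> N" using gN eB insert.prems(3) by blast
    then show ?thesis unfolding e2 True by (simp only: mult_ac)
  next
    case False
    then obtain \<beta> n where 1: "?e * h = \<beta> * g + n" "\<beta> \<in> B" "n \<in> N" using b(2)[of h] h unfolding N1_def by blast
    have "\<beta> * ((1 + a * b') * g) + (1 + a * b') * n \<in> N" using 1(2,3) gN e'B insert.prems(2,3) by blast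
    also have "\<beta> * ((1 + a * b') * g) + (1 + a * b') * n = (1 + a * b') * (?e * h)" unfolding 1(1) by (simp add: algebra_simps)
    finally show ?thesis unfolding e2 by (simp only: mult.assoc)
  qed
  then show ?case using b2 by blast
qed

text \<open>Each pair of distinct exponents excludes only the roots of a nonzero polynomial in
  \<open>W\<close>. In Noether's change of variables \<open>W ^ i\<close> becomes the degree in
  \<open>y\<close> of the variable with index \<open>i\<close>, so distinct monomials get distinct
  degrees.\<close>

lemma weights_separate:
  assumes "finite K" "\<And>m. m \<in> K \<Longrightarrow> Poly_Mapping.keys m \<subseteq> {..<r}"
  shows "\<exists>W::nat. W > 0 \<and> inj_on (\<lambda>m. \<Sum>i<r. Poly_Mapping.lookup m i * W ^ i) K"
proof -
  define P where "P m m' = (\<Sum>i<r. Polynomial.monom (int (Poly_Mapping.lookup m i) - int (Poly_Mapping.lookup m' i)) i)" 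
    for m m' :: "nat \<Rightarrow>\<^sub>0 nat"
  have coeff: "Polynomial.coeff (P m m') i = int (Poly_Mapping.lookup m i) - int (Poly_Mapping.lookup m' i)" if "i < r" for m m' i
    using that by (simp add: P_def Polynomial.coeff_sum)
  have nz: "P m m' \<noteq> 0" if "m \<in> K" "m' \<in> K" "m \<noteq> m'" for m m'
  proof
    assume "P m m' = 0"
    then have eq: "Poly_Mapping.lookup m i = Poly_Mapping.lookup m' i" if "i < r" for i using coeff[OF that, of m m'] by simp
    have "m = m'"
    proof (rule poly_mapping_eqI)
      fix i show "Poly_Mapping.lookup m i = Poly_Mapping.lookup m' i"
      proof (cases "i < r")
        case False
        then have "i \<notin> Poly_Mapping.keys m" "i \<notin> Poly_Mapping.keys m'" using assms(2) that by auto
        then show ?thesis by (simp add: in_keys_iff)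
      qed (rule eq)
    qed
    then show False using that by simp
  qed
  define Bad where "Bad = (\<Union>m\<in>K. \<Union>m'\<in>K - {m}. {x. poly (P m m') x = 0})"
  have "finite Bad" unfolding Bad_def using nz assms(1) by (auto intro!: poly_roots_finite)
  moreover have "infinite (int ` {0<..})" using infinite_Ioi[of "0::nat"] by (simp add: finite_image_iff)
  ultimately have "\<not> int ` {0<..} \<subseteq> Bad" using finite_subset by blast
  then obtain W where W: "W > 0" "int W \<notin> Bad" by auto
  have "inj_on (\<lambda>m. \<Sum>i<r. Poly_Mapping.lookup m i * W ^ i) K"
  proof (rule inj_onI, rule ccontr)
    fix m m' assume h: "m \<in> K" "m' \<in> K" "(\<Sum>i<r. Poly_Mapping.lookup m i * W ^ i) = (\<Sum>i<r. Poly_Mapping.lookup m' i * W ^ i)" "m \<noteq> m'"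
    have "poly (P m m') (int W) = int (\<Sum>i<r. Poly_Mapping.lookup m i * W ^ i) - int (\<Sum>i<r. Poly_Mapping.lookup m' i * W ^ i)"
      by (simp add: P_def poly_sum poly_monom left_diff_distrib sum_subtractf)
    also have "\<dots> = 0" using h(3) by simp
    finally show False using W(2) h unfolding Bad_def by blast
  qed
  then show ?thesis using W(1) by blast
qed

section \<open>Maximal ideals of monoid algebras\<close>

text \<open>Invertibility modulo \<open>M\<close> of everything outside \<open>M\<close>: the
  quotient is a field, expressed without forming it.\<close>

definition maximal_in :: "'a::comm_ring_1 set \<Rightarrow> 'a set \<Rightarrow> bool" where
  "maximal_in R M \<longleftrightarrow> ideal_in R M \<and> 1 \<notin> M \<and> (\<forall>x\<in>R. x \<notin> M \<longrightarrow> (\<exists>u\<in>R. x * u - 1 \<in> M))"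

text \<open>In other words, the quotient of \<open>R\<close> by \<open>M\<close> is a finitely
  generated module over the image of \<open>B\<close>.\<close>

definition finite_over :: "'a::comm_ring_1 set \<Rightarrow> 'a set \<Rightarrow> 'a set \<Rightarrow> bool" where
  "finite_over R M B \<longleftrightarrow> (\<exists>G. finite G \<and> G \<subseteq> R \<and> (\<forall>r\<in>R. \<exists>h\<in>igen B G. r - h \<in> M))"

text \<open>Setting for Zariski's lemma. The quotient is a field finite over a subalgebra with
  generators \<open>ys\<close>; a field cannot be finite over a polynomial ring in at least one
  variable, so the generators satisfy a relation, which is used to get by with one generator fewer
  until none is left.\<close>

locale zariski =
  fixes R M :: "'a::comm_ring_1 set" and f :: "'k::field \<Rightarrow> 'a"
  assumes R: "sring R" and f: "ring_hom_into f R" and M: "maximal_in R M"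
begin

lemma iM: "ideal_in R M" and oM: "1 \<notin> M"
  using M by (auto simp: maximal_in_def)

lemmas MI = ideal_inD[OF iM]
lemmas M_diff = ideal_in_diff[OF R iM]
lemmas fD = ring_hom_intoD[OF f]

definition ev :: "'a list \<Rightarrow> ((nat \<Rightarrow>\<^sub>0 nat) \<Rightarrow>\<^sub>0 'k) \<Rightarrow> 'a" where
  "ev ys = pm_eval f (\<lambda>m. \<Prod>i<length ys. (ys ! i) ^ Poly_Mapping.lookup m i)"

definition vars :: "nat \<Rightarrow> ((nat \<Rightarrow>\<^sub>0 nat) \<Rightarrow>\<^sub>0 'k) set" where
  "vars r = {p. \<forall>m\<in>Poly_Mapping.keys p. Poly_Mapping.keys m \<subseteq> {..<r}}"

lemma pm_hom_ev: "pm_hom f (\<lambda>m. \<Prod>i<length ys. (ys ! i) ^ Poly_Mapping.lookup m i)"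
  by unfold_locales (simp_all add: fD lookup_add power_add prod.distrib)

lemmas ev_add = pm_hom.eval_add[OF pm_hom_ev, folded ev_def]
  and ev_mult = pm_hom.eval_mult[OF pm_hom_ev, folded ev_def]
  and ev_1 = pm_hom.eval_1[OF pm_hom_ev, folded ev_def]
  and ev_single = pm_hom.eval_single[OF pm_hom_ev, folded ev_def]

lemma vars_add: "p \<in> vars r \<Longrightarrow> q \<in> vars r \<Longrightarrow> p + q \<in> vars r"
  using keys_add[of p q] unfolding vars_def by blast

lemma vars_mult:
  assumes "p \<in> vars r" "q \<in> vars r" shows "p * q \<in> vars r"
  unfolding vars_def
proof (intro CollectI ballI)
  fix m assume "m \<in> Poly_Mapping.keys (p * q)"
  then obtain a b where "m = a + b" "a \<in> Poly_Mapping.keys p" "b \<in> Poly_Mapping.keys q" using keys_mult by blast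
  moreover have "Poly_Mapping.keys (a + b) \<subseteq> Poly_Mapping.keys a \<union> Poly_Mapping.keys b" by (rule keys_add)
  ultimately show "Poly_Mapping.keys m \<subseteq> {..<r}" using assms unfolding vars_def by blast
qed

lemma ev_var: "i < length ys \<Longrightarrow> ev ys (Poly_Mapping.single (Poly_Mapping.single i 1) 1) = ys ! i"
proof -
  assume i: "i < length ys"
  have "(\<Prod>j<length ys. (ys ! j) ^ Poly_Mapping.lookup (Poly_Mapping.single i 1) j) = (\<Prod>j<length ys. if j = i then ys ! j else 1)"
    by (intro prod.cong) (auto simp: lookup_single when_def)
  also have "\<dots> = ys ! i" using i by simp
  finally show ?thesis by (simp add: ev_single fD)
qed

lemma var_in_vars: "i < r \<Longrightarrow> Poly_Mapping.single (Poly_Mapping.single i 1) 1 \<in> vars r"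
  by (simp add: vars_def)

lemma alg_hull_ev: "b \<in> alg_hull (range f \<union> set ys) \<Longrightarrow> \<exists>p\<in>vars (length ys). ev ys p = b"
proof (induction rule: alg_hull.induct)
  case one
  show ?case using ev_1[of ys] by (intro bexI[of _ 1]) (auto simp: vars_def)
next
  case (gen g x)
  then obtain p where p: "p \<in> vars (length ys)" "ev ys p = x" by blast
  have "\<exists>q\<in>vars (length ys). ev ys q = g"
  proof (cases "g \<in> range f")
    case True
    then obtain c where "g = f c" by auto
    then show ?thesis by (intro bexI[of _ "Poly_Mapping.single 0 c"]) (auto simp: ev_single vars_def)
  next
    case False
    then obtain i where "i < length ys" "g = ys ! i" using gen(1) by (auto simp: in_set_conv_nth)
    then show ?thesis using ev_var var_in_vars by blast
  qed
  then obtain q where "q \<in> vars (length ys)" "ev ys q = g" by blast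
  then show ?case using p vars_mult ev_mult by blast
next
  case (add x y)
  then show ?case using vars_add ev_add by blast
qed

lemma sring_hull: "sring (alg_hull (range f \<union> Z))"
  using fD(1) fD(6)[of 1] by (intro sring_alg_hull) (metis UnI1 rangeI)

text \<open>Noether's change of variables: modulo \<open>M\<close> a nontrivial relation becomes monic in \<open>y\<close>.\<close>

lemma finite_over_eliminate:
  assumes ys: "set (y # ws) \<subseteq> R" and p: "p \<in> vars (length (y # ws))" "p \<noteq> 0" "ev (y # ws) p \<in> M"
    and fin: "finite_over R M (alg_hull (range f \<union> set (y # ws)))"
  obtains zs where "length zs = length ws" "set zs \<subseteq> R" "finite_over R M (alg_hull (range f \<union> set zs))"
proof -
  let ?ys = "y # ws" let ?r = "length ?ys"
  obtain W where W: "W > 0" "inj_on (\<lambda>m. \<Sum>i<?r. Poly_Mapping.lookup m i * W ^ i) (Poly_Mapping.keys p)"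
    using weights_separate[of "Poly_Mapping.keys p" ?r] p(1) unfolding vars_def by auto
  define wt where "wt = (\<lambda>m. \<Sum>i<?r. Poly_Mapping.lookup m i * W ^ i)"
  \<comment> \<open>Noether's substitution. The list \<open>ws\<close> starts at index 1 of
    \<open>?ys\<close>, whence \<open>Suc i\<close>. In terms of \<open>y\<close> and
    \<open>zs\<close>, a monomial becomes a power of \<open>y\<close>, of exponent its weight, plus
    lower powers with coefficients in \<open>Z\<close>.\<close>
  define zs where "zs = map (\<lambda>i. ws ! i - y ^ (W ^ Suc i)) [0..<length ws]"
  define Z where "Z = alg_hull (range f \<union> set zs)"
  have Z: "sring Z" unfolding Z_def by (rule sring_hull)
  have yR: "y \<in> R" using ys by simp
  have wR: "ws ! i \<in> R" if "i < length ws" for i using ys that by auto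
  have zsR: "set zs \<subseteq> R" using R yR wR by (auto simp: zs_def intro!: sring_diff[OF R] sring_power[OF R])
  have ZR: "Z \<subseteq> R" unfolding Z_def using zsR fD(4) by (intro alg_hull_subset[OF R]) auto
  define Low where "Low n = igen Z ((\<lambda>j. y ^ j) ` {..<n})" for n
  have Low_add: "a \<in> Low n \<Longrightarrow> b \<in> Low n \<Longrightarrow> a + b \<in> Low n" for a b n unfolding Low_def by (rule igen_add)
  have Low_mult: "c \<in> Z \<Longrightarrow> a \<in> Low n \<Longrightarrow> c * a \<in> Low n" for a c n unfolding Low_def by (rule igen_mult[OF Z])
  have Low0: "0 \<in> Low n" for n unfolding Low_def by (rule igen.zero)
  have Low_mono: "a \<in> Low n \<Longrightarrow> n \<le> m \<Longrightarrow> a \<in> Low m" for a n m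
    unfolding Low_def using igen_mono[OF image_mono[of "{..<n}" "{..<m}"]] by blast
  have Low_y: "y ^ j \<in> Low n" if "j < n" for j n unfolding Low_def using that by (intro igen_gen[OF Z]) auto
  have Low_shift: "y ^ k * a \<in> Low (k + n)" if "a \<in> Low n" for k n a
    unfolding Low_def
  proof (rule igen_coeff_mult[OF Z _ that[unfolded Low_def]])
    fix g assume "g \<in> (\<lambda>j. y ^ j) ` {..<n}"
    then obtain j where "j < n" "g = y ^ j" by blast
    then show "y ^ k * g \<in> igen Z ((\<lambda>j. y ^ j) ` {..<k + n})"
      using Low_y[of "k + j" "k + n"] unfolding Low_def by (simp add: power_add)
  qed
  have Low_prod: "a * b \<in> Low (e + n)" if "a \<in> Low e" "b \<in> Low n" for a b e n
    using that(1)[unfolded Low_def]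
  proof induction
    case zero show ?case using Low0 by simp
  next
    case (step r g x)
    then obtain j where j: "j < e" "g = y ^ j" by blast
    have "r * (y ^ j * b) \<in> Low (e + n)" using j step(1) that(2) by (intro Low_mult Low_mono[OF Low_shift]) auto
    from Low_add[OF this step(4)] show ?case by (simp add: j(2) algebra_simps)
  qed
  \<comment> \<open>\<open>a - y ^ e \<in> Low e\<close> expresses that \<open>a\<close> is monic of
    degree \<open>e\<close> in \<open>y\<close> over \<open>Z\<close>. Monic elements are closed
    under products, hence all monomials in \<open>?ys\<close> are monic of degree their
    weight.\<close>
  have Mon_prod: "a * b - y ^ (e + n) \<in> Low (e + n)" if a: "a - y ^ e \<in> Low e" and b: "b - y ^ n \<in> Low n" for a b e n
  proof -
    have "y ^ n * (a - y ^ e) \<in> Low (e + n)" using Low_shift[OF a, of n] by (simp add: add.commute)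
    then have "y ^ e * (b - y ^ n) + y ^ n * (a - y ^ e) + (a - y ^ e) * (b - y ^ n) \<in> Low (e + n)"
      using Low_shift[OF b, of e] Low_prod[OF a b] Low_add by blast
    also have "y ^ e * (b - y ^ n) + y ^ n * (a - y ^ e) + (a - y ^ e) * (b - y ^ n) = a * b - y ^ (e + n)"
      by (simp add: algebra_simps power_add)
    finally show ?thesis .
  qed
  have Mon_gen: "?ys ! i - y ^ (W ^ i) \<in> Low (W ^ i)" if "i < ?r" for i
  proof (cases i)
    case 0 then show ?thesis using Low0 by simp
  next
    case (Suc j)
    then have j: "j < length ws" using that by simp
    then have "ws ! j - y ^ (W ^ Suc j) \<in> Z" unfolding Z_def zs_def by (intro alg_hull_gen) auto
    moreover have "y ^ 0 \<in> Low (W ^ Suc j)" using W(1) by (intro Low_y) simp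
    ultimately have "(ws ! j - y ^ (W ^ Suc j)) * y ^ 0 \<in> Low (W ^ Suc j)" by (rule Low_mult)
    then show ?thesis using Suc by simp
  qed
  have Mon_pow: "a ^ k - y ^ (k * e) \<in> Low (k * e)" if "a - y ^ e \<in> Low e" for a e k
  proof (induction k)
    case 0 then show ?case using Low0 by simp
  next
    case (Suc k) from Mon_prod[OF that Suc] show ?case by simp
  qed
  have Mon_mono: "(\<Prod>i<n. (?ys ! i) ^ Poly_Mapping.lookup m i) - y ^ (\<Sum>i<n. Poly_Mapping.lookup m i * W ^ i)
      \<in> Low (\<Sum>i<n. Poly_Mapping.lookup m i * W ^ i)" if "n \<le> ?r" for n m
    using that
  proof (induction n)
    case 0 then show ?case using Low0 by simp
  next
    case (Suc n)
    have "(?ys ! n) ^ Poly_Mapping.lookup m n - y ^ (Poly_Mapping.lookup m n * W ^ n) \<in> Low (Poly_Mapping.lookup m n * W ^ n)"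
      using Suc.prems by (intro Mon_pow Mon_gen) simp
    from Mon_prod[OF Suc.IH this] Suc.prems show ?case by simp
  qed
  define K where "K = Poly_Mapping.keys p"
  have K: "finite K" "K \<noteq> {}" using p(2) by (simp_all add: K_def)
  define D where "D = Max (wt ` K)"
  have "D \<in> wt ` K" unfolding D_def using K by (intro Max_in) auto
  then obtain m0 where m0: "m0 \<in> K" "wt m0 = D" by auto
  define mo where "mo = (\<lambda>m. \<Prod>i<?r. (?ys ! i) ^ Poly_Mapping.lookup m i)"
  have mo: "mo m - y ^ wt m \<in> Low (wt m)" for m unfolding mo_def wt_def by (rule Mon_mono) simp
  have fZ: "f c \<in> Z" for c unfolding Z_def by (intro alg_hull_gen) simp
  define c0 where "c0 = Poly_Mapping.lookup p m0"
  have c0: "c0 \<noteq> 0" using m0(1) by (simp add: c0_def K_def in_keys_iff)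
  have lower: "f (Poly_Mapping.lookup p m) * mo m \<in> Low D" if "m \<in> K - {m0}" for m
  proof -
    have "wt m \<le> D" unfolding D_def using that K by simp
    moreover have "wt m \<noteq> D" using W(2) that m0 unfolding wt_def K_def inj_on_def by blast
    ultimately have lt: "wt m < D" by simp
    have "(mo m - y ^ wt m) + y ^ wt m \<in> Low D" using lt by (intro Low_add Low_mono[OF mo] Low_y) simp_all
    then show ?thesis by (intro Low_mult fZ) simp
  qed
  define l where "l = f c0 * (mo m0 - y ^ D) + (\<Sum>m\<in>K - {m0}. f (Poly_Mapping.lookup p m) * mo m)"
  have sum_Low: "(\<Sum>m\<in>S. f (Poly_Mapping.lookup p m) * mo m) \<in> Low D" if "S \<subseteq> K - {m0}" for S
    using that by (induction S rule: infinite_finite_induct) (auto simp: Low0 intro!: Low_add lower)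
  have lLow: "l \<in> Low D" unfolding l_def using mo[of m0] m0(2) sum_Low[of "K - {m0}"] fZ by (intro Low_add Low_mult) auto
  have "ev ?ys p = (\<Sum>m\<in>K. f (Poly_Mapping.lookup p m) * mo m)" by (simp add: ev_def pm_eval_def K_def mo_def)
  also have "\<dots> = f c0 * mo m0 + (\<Sum>m\<in>K - {m0}. f (Poly_Mapping.lookup p m) * mo m)"
    unfolding c0_def by (rule sum.remove[OF K(1) m0(1)])
  also have "\<dots> = f c0 * y ^ D + l" by (simp add: l_def algebra_simps)
  finally have evM: "f c0 * y ^ D + l \<in> M" using p(3) by simp
  define l' where "l' = f (inverse c0) * l"
  have l': "l' \<in> Low D" unfolding l'_def using lLow fZ by (intro Low_mult)
  have "f (inverse c0) * (f c0 * y ^ D + l) \<in> M" using evM fD(4) by (intro MI(4))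
  also have "f (inverse c0) * (f c0 * y ^ D + l) = f (inverse c0 * c0) * y ^ D + l'" unfolding fD(3) l'_def by (simp add: algebra_simps)
  finally have yD: "y ^ D + l' \<in> M" using c0 by (simp add: fD)
  have D: "D > 0"
  proof (rule ccontr)
    assume "\<not> D > 0"
    then have "D = 0" by simp
    then have "l' = 0" using l' by (simp add: Low_def igen_empty)
    then show False using yD oM \<open>D = 0\<close> by simp
  qed
  \<comment> \<open>The elements that reduce modulo \<open>M\<close> to degree below
    \<open>D\<close> in \<open>y\<close>. The relation, now monic of degree \<open>D\<close>, makes
    \<open>Q\<close> stable under \<open>y\<close>, and \<open>y\<close> together with
    \<open>Z\<close> generates all of \<open>ws\<close>.\<close>
  define Q where "Q = {x. \<exists>b\<in>Low D. x - b \<in> M}"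
  have Qadd: "x + x' \<in> Q" if "x \<in> Q" "x' \<in> Q" for x x'
  proof -
    obtain b b' where "b \<in> Low D" "x - b \<in> M" "b' \<in> Low D" "x' - b' \<in> M" using \<open>x \<in> Q\<close> \<open>x' \<in> Q\<close> unfolding Q_def by blast
    then have "b + b' \<in> Low D" "(x - b) + (x' - b') \<in> M" using Low_add MI(3) by blast+
    moreover have "(x - b) + (x' - b') = (x + x') - (b + b')" by simp
    ultimately show ?thesis unfolding Q_def by auto
  qed
  have QZ: "c * x \<in> Q" if "c \<in> Z" "x \<in> Q" for c x
  proof -
    obtain b where b: "b \<in> Low D" "x - b \<in> M" using \<open>x \<in> Q\<close> unfolding Q_def by blast
    then have "c * b \<in> Low D" "c * (x - b) \<in> M" using that(1) ZR by (auto intro: Low_mult MI(4))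
    then show ?thesis unfolding Q_def by (auto simp: right_diff_distrib)
  qed
  have Qy: "y * x \<in> Q" if xQ: "x \<in> Q" for x
  proof -
    obtain b where b: "b \<in> Low D" "x - b \<in> M" using xQ unfolding Q_def by blast
    have "y * b \<in> Low (Suc D)" using Low_shift[OF b(1), of 1] by simp
    then obtain c q where c: "c \<in> Z" "q \<in> Low D" "y * b = c * y ^ D + q"
      using igen_power_less_Suc[OF Z] unfolding Low_def by blast
    have "(- 1) * c \<in> Z" using c(1) Z by (simp add: sring_closed)
    then have "q + ((-1) * c) * l' \<in> Low D" using c l' by (intro Low_add Low_mult)
    moreover have "y * (x - b) + c * (y ^ D + l') \<in> M" using b(2) yR c(1) ZR yD by (intro MI(3)[OF MI(4) MI(4)]) auto
    moreover have "y * (x - b) + c * (y ^ D + l') = y * x - (q + ((-1) * c) * l')"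
      using c(3) by (simp add: algebra_simps)
    ultimately show ?thesis unfolding Q_def by auto
  qed
  have Qyp: "y ^ k * x \<in> Q" if "x \<in> Q" for k x
    by (induction k) (simp_all add: that Qy mult.assoc)
  have hullQ: "h \<in> Q" if "h \<in> alg_hull (range f \<union> set ?ys)" for h
    using that
  proof induction
    case one
    have "y ^ 0 \<in> Low D" using D by (rule Low_y)
    then show ?case unfolding Q_def using MI(2) by (intro CollectI bexI[of _ 1]) auto
  next
    case (gen g x)
    consider c where "g = f c" | "g = y" | j where "j < length ws" "g = ws ! j"
      using gen(1) by (auto simp: in_set_conv_nth)
    then show ?case
    proof cases
      case 1 then show ?thesis using QZ[OF fZ gen(3)] by simp
    next
      case 2 then show ?thesis using Qy[OF gen(3)] by simp
    next
      case 3
      have "ws ! j - y ^ (W ^ Suc j) \<in> Z" using 3 unfolding Z_def zs_def by (intro alg_hull_gen) auto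
      then have "(ws ! j - y ^ (W ^ Suc j)) * x + y ^ (W ^ Suc j) * x \<in> Q" using gen(3) by (intro Qadd QZ Qyp)
      then show ?thesis using 3 by (simp add: algebra_simps)
    qed
  qed (rule Qadd)
  obtain G where G: "finite G" "G \<subseteq> R" "\<And>r. r \<in> R \<Longrightarrow> \<exists>h\<in>igen (alg_hull (range f \<union> set ?ys)) G. r - h \<in> M"
    using fin unfolding finite_over_def by blast
  define G' where "G' = (\<lambda>(g, j). y ^ j * g) ` (G \<times> {..<D})"
  have reduce: "\<exists>h'\<in>igen Z G'. h - h' \<in> M" if "h \<in> igen (alg_hull (range f \<union> set ?ys)) G" for h
    using that
  proof induction
    case zero show ?case using igen.zero MI(2) by (intro bexI[of _ 0]) auto
  next
    case (step r g x)
    obtain h' where h': "h' \<in> igen Z G'" "x - h' \<in> M" using step(4) by blast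
    obtain b where b: "b \<in> Low D" "r - b \<in> M" using hullQ[OF step(1)] unfolding Q_def by blast
    have "g * b \<in> igen Z G'"
    proof (rule igen_coeff_mult[OF Z _ b(1)[unfolded Low_def]])
      fix q assume "q \<in> (\<lambda>j. y ^ j) ` {..<D}"
      then obtain j where "j < D" "q = y ^ j" by blast
      then have "g * q \<in> G'" using step(2) unfolding G'_def by (auto simp: mult.commute)
      then show "g * q \<in> igen Z G'" by (rule igen_gen[OF Z])
    qed
    then have "g * b + h' \<in> igen Z G'" using h' by (intro igen_add)
    moreover have "g * (r - b) + (x - h') \<in> M" using b(2) h'(2) step(2) G(2) by (intro MI(3) MI(4)) auto
    moreover have "g * (r - b) + (x - h') = r * g + x - (g * b + h')" by (simp add: algebra_simps)
    ultimately show ?case by auto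
  qed
  have "finite_over R M Z"
    unfolding finite_over_def
  proof (intro exI[of _ G'] conjI ballI)
    show "finite G'" using G(1) by (simp add: G'_def)
    show "G' \<subseteq> R" using G(2) yR by (auto simp: G'_def intro!: sring_mult[OF R] sring_power[OF R])
    fix r assume "r \<in> R"
    then obtain h where h: "h \<in> igen (alg_hull (range f \<union> set ?ys)) G" "r - h \<in> M" using G(3) by blast
    obtain h' where h': "h' \<in> igen Z G'" "h - h' \<in> M" using reduce[OF h(1)] by blast
    have "(r - h) + (h - h') \<in> M" using h(2) h'(2) by (rule MI(3))
    then show "\<exists>h\<in>igen Z G'. r - h \<in> M" using h'(1) by auto
  qed
  moreover have "length zs = length ws" by (simp add: zs_def)
  ultimately show ?thesis using that zsR unfolding Z_def by blast
qed

end

context zariski begin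

text \<open>Without a relation \<open>y\<close> is nonzero, hence invertible, modulo
  \<open>M\<close>. Then every module generator \<open>g\<close> is \<open>y\<close> times a
  combination of generators, and Nakayama's lemma puts some \<open>1 + y * b\<close> into
  \<open>M\<close>. This is itself a relation, nontrivial because its constant coefficient is
  1.\<close>

lemma not_independent:
  assumes ys: "set (y # ws) \<subseteq> R" and fin: "finite_over R M (alg_hull (range f \<union> set (y # ws)))"
  shows "\<exists>p\<in>vars (length (y # ws)). p \<noteq> 0 \<and> ev (y # ws) p \<in> M"
proof (rule ccontr)
  let ?ys = "y # ws" let ?B = "alg_hull (range f \<union> set (y # ws))"
  assume no: "\<not> ?thesis"
  let ?x = "Poly_Mapping.single (Poly_Mapping.single 0 1) 1 :: (nat \<Rightarrow>\<^sub>0 nat) \<Rightarrow>\<^sub>0 'k"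
  have x0: "?x \<noteq> 0" 
  proof
    assume "?x = 0"
    then have "Poly_Mapping.lookup ?x (Poly_Mapping.single 0 1) =
        Poly_Mapping.lookup (0 :: (nat \<Rightarrow>\<^sub>0 nat) \<Rightarrow>\<^sub>0 'k) (Poly_Mapping.single 0 1)"
      by (rule arg_cong)
    then show False by (simp only: lookup_single_eq lookup_zero one_neq_zero)
  qed
  have xv: "?x \<in> vars (length ?ys)" by (intro var_in_vars) simp
  have evx: "ev ?ys ?x = y" using ev_var[of 0 ?ys] by simp
  have "ev ?ys ?x \<notin> M" using no xv x0 by blast
  then have "y \<notin> M" by (simp only: evx not_False_eq_True)
  moreover have "y \<in> R" using ys by simp
  ultimately obtain u where u: "u \<in> R" "y * u - 1 \<in> M" using M unfolding maximal_in_def by blast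
  have B: "sring ?B" by (rule sring_hull)
  have BR: "?B \<subseteq> R" using ys fD(4) by (intro alg_hull_subset[OF R]) auto
  have yB: "y \<in> ?B" by (intro alg_hull_gen) simp
  obtain G where G: "finite G" "G \<subseteq> R" "\<And>r. r \<in> R \<Longrightarrow> \<exists>h\<in>igen ?B G. r - h \<in> M"
    using fin unfolding finite_over_def by blast
  have "\<exists>b\<in>?B. \<forall>g\<in>G. (1 + y * b) * g \<in> M"
  proof (rule nakayama[OF G(1) B yB MI(2) MI(3)])
    fix g assume g: "g \<in> G"
    then have "u * g \<in> R" using G(2) u(1) by (intro sring_mult[OF R]) auto
    then obtain h where h: "h \<in> igen ?B G" "u * g - h \<in> M" using G(3) by blast
    have "y * (u * g - h) - g * (y * u - 1) \<in> M"
      using h(2) u(2) g G(2) yB BR by (intro M_diff[OF MI(4) MI(4)]) auto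
    also have "y * (u * g - h) - g * (y * u - 1) = g - y * h" by (simp add: algebra_simps)
    finally show "\<exists>h\<in>igen ?B G. g - y * h \<in> M" using h(1) by blast
  qed (use BR MI(4) in auto)
  then obtain b where b: "b \<in> ?B" "\<And>g. g \<in> G \<Longrightarrow> (1 + y * b) * g \<in> M" by blast
  have "(1 + y * b) * h \<in> M" if "h \<in> igen ?B G" for h
    using that
  proof induction
    case zero show ?case using MI(2) by simp
  next
    case (step r g x)
    have "r * ((1 + y * b) * g) + (1 + y * b) * x \<in> M"
      using step BR b(2)[OF step(2)] by (intro MI(3)[OF MI(4)]) auto
    then show ?case by (simp add: algebra_simps)
  qed
  moreover obtain h where h: "h \<in> igen ?B G" "1 - h \<in> M" using G(3)[OF sring_one[OF R]] by blast
  moreover have "1 + y * b \<in> R" using yB b(1) BR R by (intro sring_add sring_mult sring_one) auto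
  ultimately have "(1 + y * b) * (1 - h) + (1 + y * b) * h \<in> M" by (intro MI(3)[OF MI(4)]) auto
  then have 1: "1 + y * b \<in> M" by (simp add: algebra_simps)
  obtain q where q: "q \<in> vars (length ?ys)" "ev ?ys q = b" using alg_hull_ev[OF b(1)] by blast
  let ?p = "1 + ?x * q"
  have "ev ?ys ?p = 1 + y * b" by (simp only: ev_add ev_mult ev_1 evx q(2))
  with 1 have "ev ?ys ?p \<in> M" by (simp only:)
  moreover have "?p \<in> vars (length ?ys)" using xv q(1) by (intro vars_add vars_mult) (auto simp: vars_def)
  moreover have "?p \<noteq> 0"
  proof -
    have "0 \<notin> Poly_Mapping.keys (?x * q)"
    proof
      assume "0 \<in> Poly_Mapping.keys (?x * q)"
      then obtain a where "(0::nat \<Rightarrow>\<^sub>0 nat) = Poly_Mapping.single 0 1 + a" using keys_mult[of ?x q] by auto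
      then have "Poly_Mapping.lookup (0::nat \<Rightarrow>\<^sub>0 nat) 0 = Poly_Mapping.lookup (Poly_Mapping.single 0 1 + a) 0" by simp
      then show False by (simp add: lookup_add)
    qed
    then have "Poly_Mapping.lookup ?p 0 = 1" by (simp add: lookup_add in_keys_iff lookup_one)
    then show ?thesis by (auto simp only: lookup_zero zero_neq_one)
  qed
  ultimately show False using no by blast
qed

lemma finite_over_field:
  assumes "set ys \<subseteq> R" "finite_over R M (alg_hull (range f \<union> set ys))"
  shows "finite_over R M (range f)"
  using assms
proof (induction "length ys" arbitrary: ys)
  case 0
  have "sring (range f)"
    unfolding sring_def 
  proof (intro conjI ballI)
    show "1 \<in> range f" using rangeI[of f 1] by (simp only: fD(1))
    fix x y assume "x \<in> range f" "y \<in> range f"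
    then obtain a b where ab: "x = f a" "y = f b" by blast
    show "x - y \<in> range f" unfolding ab fD(7)[symmetric] by (rule rangeI)
    show "x * y \<in> range f" unfolding ab fD(3)[symmetric] by (rule rangeI)
  qed
  then have "alg_hull (range f) \<subseteq> range f" by (rule alg_hull_subset) simp
  moreover have "range f \<subseteq> alg_hull (range f)" by (intro subsetI alg_hull_gen)
  ultimately have eq: "alg_hull (range f) = range f" by (rule equalityI)
  have "ys = []" using 0(1)[symmetric] by simp
  then show ?case using 0(3) by (simp add: eq)
next
  case (Suc n)
  have "length ys = Suc n" using Suc.hyps(2) by (rule sym)
  then obtain y ws where ys: "ys = y # ws" unfolding length_Suc_conv by (elim exE conjE)
  have pr: "set (y # ws) \<subseteq> R" "finite_over R M (alg_hull (range f \<union> set (y # ws)))"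
    using Suc.prems by (simp_all only: ys)
  obtain p where p: "p \<in> vars (length (y # ws))" "p \<noteq> 0" "ev (y # ws) p \<in> M"
    using not_independent[OF pr] by blast
  obtain zs where "length zs = length ws" "set zs \<subseteq> R" "finite_over R M (alg_hull (range f \<union> set zs))"
    by (rule finite_over_eliminate[OF pr(1) p pr(2)])
  moreover from this have "n = length zs" using Suc.hyps(2) ys by simp
  ultimately show ?case using Suc.hyps(1) by blast
qed

lemma igen_range_coeffs:
  assumes "finite G" "h \<in> igen (range f) G" shows "\<exists>c. h = (\<Sum>g\<in>G. f (c g) * g)"
  using assms(2)
proof induction
  case zero
  show ?case by (intro exI[of _ "\<lambda>_. 0"]) (simp add: fD)
next
  case (step r g x)
  obtain a where a: "r = f a" using step(1) by blast
  obtain c where c: "x = (\<Sum>g\<in>G. f (c g) * g)" using step(4) by (elim exE)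
  have "(\<Sum>k\<in>G. f ((c(g := c g + a)) k) * k) = (\<Sum>k\<in>G. f (c k) * k + (if k = g then f a * k else 0))"
    by (intro sum.cong) (simp_all add: fD distrib_right)
  also have "\<dots> = r * g + x" unfolding a c using step(2) assms(1) by (simp add: sum.distrib)
  finally show ?case by (intro exI[of _ "c(g := c g + a)"]) (rule sym)
qed

text \<open>The quotient is spanned over the field by \<open>G\<close>, so the powers of
  \<open>t\<close> up to \<open>card G\<close> are linearly dependent there; dividing by the last
  nonzero coefficient makes the dependence monic.\<close>

theorem algebraic_mod_maximal:
  assumes "set ys \<subseteq> R" "R \<subseteq> alg_hull (range f \<union> set ys)" "t \<in> R"
  shows "\<exists>n c. t ^ n + (\<Sum>i<n. f (c i) * t ^ i) \<in> M"
proof -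
  have "finite_over R M (alg_hull (range f \<union> set ys))"
    unfolding finite_over_def
  proof (intro exI[of _ "{1}"] conjI ballI)
    fix r assume "r \<in> R"
    then have "r * 1 + 0 \<in> igen (alg_hull (range f \<union> set ys)) {1}" using assms(2) by (intro igen.intros) auto
    then show "\<exists>h\<in>igen (alg_hull (range f \<union> set ys)) {1}. r - h \<in> M" using MI(2) by (intro bexI[of _ r]) simp_all
  qed (simp_all add: sring_one[OF R])
  from finite_over_field[OF assms(1) this]
  obtain G where G: "finite G" "G \<subseteq> R" "\<And>r. r \<in> R \<Longrightarrow> \<exists>h\<in>igen (range f) G. r - h \<in> M"
    unfolding finite_over_def by blast
  have "\<exists>c. t ^ i - (\<Sum>g\<in>G. f (c g) * g) \<in> M" for i
    using G(3)[OF sring_power[OF R assms(3)], of i] igen_range_coeffs[OF G(1)] by blast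
  then have "\<forall>i. \<exists>c. t ^ i - (\<Sum>g\<in>G. f (c g) * g) \<in> M" by simp
  from choice[OF this] obtain a where a: "\<And>i. t ^ i - (\<Sum>g\<in>G. f (a i g) * g) \<in> M" by blast
  obtain x where x: "\<exists>i\<in>{..card G}. x i \<noteq> 0" "\<forall>g\<in>G. (\<Sum>i\<in>{..card G}. a i g * x i) = 0"
    using homogeneous_system_nontrivial[OF G(1), of "{..card G}" "\<lambda>g i. a i g"] by auto
  define n where "n = Max {i\<in>{..card G}. x i \<noteq> 0}"
  have "n \<in> {i\<in>{..card G}. x i \<noteq> 0}" unfolding n_def using x(1) by (intro Max_in) auto
  then have n: "x n \<noteq> 0" "n \<le> card G" by auto
  have nmax: "x i = 0" if "i \<le> card G" "n < i" for i
  proof (rule ccontr)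
    assume "x i \<noteq> 0"
    then have "i \<le> n" unfolding n_def using that by (intro Max_ge) auto
    then show False using that by simp
  qed
  have "(\<Sum>i\<le>card G. f (x i) * (t ^ i - (\<Sum>g\<in>G. f (a i g) * g))) \<in> M"
    using a fD(4) by (intro ideal_in_sum[OF iM] MI(4)) auto
  also have "(\<Sum>i\<le>card G. f (x i) * (t ^ i - (\<Sum>g\<in>G. f (a i g) * g))) =
      (\<Sum>i\<le>card G. f (x i) * t ^ i) - (\<Sum>i\<le>card G. \<Sum>g\<in>G. f (a i g * x i) * g)"
    by (simp add: right_diff_distrib sum_subtractf sum_distrib_left fD mult_ac)
  also have "(\<Sum>i\<le>card G. \<Sum>g\<in>G. f (a i g * x i) * g) = (\<Sum>g\<in>G. f (\<Sum>i\<le>card G. a i g * x i) * g)"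
    by (subst sum.swap) (simp add: fD(8) sum_distrib_right)
  also have "\<dots> = 0" using x(2) by (simp add: fD(5))
  also have "(\<Sum>i\<le>card G. f (x i) * t ^ i) = (\<Sum>i\<le>n. f (x i) * t ^ i)"
    using nmax n(2) by (intro sum.mono_neutral_right) (auto simp: fD(5))
  also have "\<dots> = f (x n) * t ^ n + (\<Sum>i<n. f (x i) * t ^ i)"
    by (simp add: lessThan_Suc_atMost[symmetric] add.commute)
  finally have "f (x n) * t ^ n + (\<Sum>i<n. f (x i) * t ^ i) \<in> M" by simp
  then have "f (inverse (x n)) * (f (x n) * t ^ n + (\<Sum>i<n. f (x i) * t ^ i)) \<in> M" using fD(4) by (intro MI(4))
  also have "f (inverse (x n)) * (f (x n) * t ^ n + (\<Sum>i<n. f (x i) * t ^ i)) =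
      f (inverse (x n) * x n) * t ^ n + (\<Sum>i<n. f (inverse (x n) * x i) * t ^ i)"
    by (simp only: fD(3) distrib_left sum_distrib_left mult.assoc)
  finally have "t ^ n + (\<Sum>i<n. f (inverse (x n) * x i) * t ^ i) \<in> M" using n(1) by (simp add: fD(1))
  then show ?thesis by (intro exI[of _ n] exI[of _ "\<lambda>i. inverse (x n) * x i"])
qed

end

lemma keys_single_0_mult: "Poly_Mapping.lookup (Poly_Mapping.single 0 c * p) m = c * Poly_Mapping.lookup p m"
proof -
  have "Poly_Mapping.single 0 c * p = (\<Sum>k\<in>Poly_Mapping.keys p. Poly_Mapping.single k (c * Poly_Mapping.lookup p k))"
    by (subst pm_sum_single[of p]) (simp add: sum_distrib_left mult_single)
  then show ?thesis by (simp add: lookup_sum lookup_single when_def in_keys_iff)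
qed

section \<open>Algebraic dependence of \<open>d + 1\<close> elements by counting lattice
  points\<close>

definition int_box :: "nat \<Rightarrow> (int ^ 'd) set" where
  "int_box L = {s. \<forall>i. \<bar>s $ i\<bar> \<le> int L}"

lemma int_box_finite_card: "finite (int_box L :: (int ^ 'd) set)" "card (int_box L :: (int ^ 'd) set) \<le> (2 * L + 1) ^ CARD('d)"
proof -
  let ?P = "PiE (UNIV :: 'd set) (\<lambda>_. {- int L..int L})"
  have "(int_box L :: (int ^ 'd) set) \<subseteq> (\<lambda>f. \<chi> i. f i) ` ?P"
  proof
    fix s :: "int ^ 'd" assume "s \<in> int_box L"
    then have "(\<lambda>i. s $ i) \<in> ?P" by (auto simp: int_box_def abs_le_iff minus_le_iff)
    then show "s \<in> (\<lambda>f. \<chi> i. f i) ` ?P" by (intro image_eqI[of _ _ "\<lambda>i. s $ i"]) (auto simp: vec_eq_iff)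
  qed
  note sub = this
  have fin: "finite ?P" by (intro finite_PiE) auto
  from finite_subset[OF sub finite_imageI[OF this]] show "finite (int_box L :: (int ^ 'd) set)" .
  have "card (int_box L :: (int ^ 'd) set) \<le> card ((\<lambda>f. (\<chi> i. f i) :: int ^ 'd) ` ?P)"
    by (rule card_mono[OF finite_imageI[OF fin] sub])
  also have "\<dots> \<le> card ?P" by (rule card_image_le[OF fin])
  also have "\<dots> = (2 * L + 1) ^ CARD('d)" by (simp add: card_PiE nat_add_distrib nat_mult_distrib)
  finally show "card (int_box L :: (int ^ 'd) set) \<le> (2 * L + 1) ^ CARD('d)" .
qed

lemma int_box_add: "s \<in> int_box a \<Longrightarrow> t \<in> int_box b \<Longrightarrow> s + t \<in> int_box (a + b)"
  unfolding int_box_def mem_Collect_eq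
proof
  fix i assume "\<forall>i. \<bar>s $ i\<bar> \<le> int a" "\<forall>i. \<bar>t $ i\<bar> \<le> int b"
  then have "\<bar>s $ i\<bar> \<le> int a" "\<bar>t $ i\<bar> \<le> int b" by blast+
  then show "\<bar>(s + t) $ i\<bar> \<le> int (a + b)" by simp
qed

lemma int_box_mono: "a \<le> b \<Longrightarrow> int_box a \<subseteq> int_box b"
  unfolding int_box_def by (auto intro: order_trans)

lemma keys_mult_box:
  fixes p q :: "int ^ 'd \<Rightarrow>\<^sub>0 'k::comm_ring_1"
  assumes "Poly_Mapping.keys p \<subseteq> int_box a" "Poly_Mapping.keys q \<subseteq> int_box b"
  shows "Poly_Mapping.keys (p * q) \<subseteq> int_box (a + b)"
proof
  fix m assume "m \<in> Poly_Mapping.keys (p * q)"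
  then obtain k l where "m = k + l" "k \<in> Poly_Mapping.keys p" "l \<in> Poly_Mapping.keys q" using keys_mult by blast
  then show "m \<in> int_box (a + b)" using assms by (auto intro: int_box_add)
qed

lemma keys_one_box: "Poly_Mapping.keys (1 :: int ^ 'd \<Rightarrow>\<^sub>0 'k::comm_ring_1) \<subseteq> int_box 0"
  by (simp add: int_box_def)

lemma keys_mon_box:
  fixes xs :: "(int ^ 'd \<Rightarrow>\<^sub>0 'k::comm_ring_1) list"
  assumes "\<And>x. x \<in> set xs \<Longrightarrow> Poly_Mapping.keys x \<subseteq> int_box b"
  shows "Poly_Mapping.keys (mon xs \<alpha>) \<subseteq> int_box (b * sum_list \<alpha>)"
  using assms
proof (induction xs \<alpha> rule: mon.induct)
  case (1 x xs e es)
  have "Poly_Mapping.keys (x ^ e) \<subseteq> int_box (b * e)"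
  proof (induction e)
    case (Suc e)
    show ?case using keys_mult_box[OF _ Suc, of x b] 1(2)[of x] by (simp add: add.commute)
  qed (use keys_one_box in simp)
  from keys_mult_box[OF this 1(1)] show ?case using 1(2) by (simp add: distrib_left)
qed (simp_all only: mon.simps, (rule subset_trans[OF keys_one_box int_box_mono], simp)+)

text \<open>There are \<open>N ^ (d + 1)\<close> monomials in the given elements with exponents
  below \<open>N\<close>, but their supports lie in a box of side proportional to \<open>N\<close>
  in dimension \<open>d\<close>. For large \<open>N\<close> there are more unknown coefficients than
  linear conditions.\<close>

lemma algebraically_dependent:
  fixes xs :: "(int ^ 'd \<Rightarrow>\<^sub>0 'k::field) list"
  assumes len: "length xs = Suc (CARD('d))"
  shows "\<exists>A c. finite A \<and> A \<noteq> {} \<and> (\<forall>\<alpha>\<in>A. length \<alpha> = length xs \<and> c \<alpha> \<noteq> 0) \<and>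
    (\<Sum>\<alpha>\<in>A. Poly_Mapping.single 0 (c \<alpha>) * mon xs \<alpha>) = 0"
proof -
  let ?d = "CARD('d)"
  define F where "F = (\<Union>x\<in>set xs. Poly_Mapping.keys x)"
  define b where "b = nat (Max (insert 0 ((\<lambda>(s, i). \<bar>s $ i\<bar>) ` (F \<times> UNIV))))"
  have finF: "finite F" by (simp add: F_def)
  have "F \<subseteq> int_box b"
  proof
    fix s assume "s \<in> F"
    then have 1: "\<bar>s $ i\<bar> \<le> Max (insert 0 ((\<lambda>(s, i). \<bar>s $ i\<bar>) ` (F \<times> UNIV)))" for i
      using finF by (intro Max_ge) auto
    have "0 \<le> Max (insert 0 ((\<lambda>(s, i). \<bar>s $ i\<bar>) ` (F \<times> (UNIV :: 'd set))))"
      using finF by (intro Max_ge) auto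
    then have "int b = Max (insert 0 ((\<lambda>(s, i). \<bar>s $ i\<bar>) ` (F \<times> (UNIV :: 'd set))))" unfolding b_def by (rule nat_0_le)
    then show "s \<in> int_box b" using 1 unfolding int_box_def by simp
  qed
  then have xb: "Poly_Mapping.keys x \<subseteq> int_box b" if "x \<in> set xs" for x using that by (auto simp: F_def)
  \<comment> \<open>The box has at most \<open>(q * N) ^ d\<close> points, and any \<open>N\<close>
    exceeding \<open>q ^ d\<close> makes this smaller than \<open>N ^ (d + 1)\<close>.\<close>
  define q where "q = 2 * (b * Suc ?d) + 1"
  define N where "N = q ^ ?d + 1"
  have N1: "1 \<le> N" by (simp only: N_def le_add2)
  define U where "U = {\<alpha>. set \<alpha> \<subseteq> {..<N} \<and> length \<alpha> = length xs}"
  define E where "E = (int_box (b * (Suc ?d * N)) :: (int ^ 'd) set)"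
  have U: "finite U" "card U = N ^ Suc ?d"
    using finite_lists_length_eq[of "{..<N}" "length xs"] card_lists_length_eq[of "{..<N}" "length xs"] len
    by (simp_all add: U_def)
  have "card E \<le> (2 * (b * (Suc ?d * N)) + 1) ^ ?d" unfolding E_def by (rule int_box_finite_card)
  also have "\<dots> \<le> (q * N) ^ ?d"
  proof (rule power_mono)
    have "2 * (b * (Suc ?d * N)) + 1 \<le> 2 * (b * (Suc ?d * N)) + N" using N1 by simp
    also have "\<dots> = q * N" unfolding q_def add_mult_distrib by (simp only: mult.assoc mult_1)
    finally show "2 * (b * (Suc ?d * N)) + 1 \<le> q * N" .
  qed simp
  also have "\<dots> = q ^ ?d * N ^ ?d" by (rule power_mult_distrib)
  also have "\<dots> < N * N ^ ?d"
  proof (rule mult_strict_right_mono)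
    show "q ^ ?d < N" by (simp only: N_def less_add_one)
    show "0 < N ^ ?d" using N1 by simp
  qed
  also have "\<dots> = card U" using U(2) by simp
  finally have cardE: "card E < card U" .
  have keysE: "Poly_Mapping.keys (mon xs \<alpha>) \<subseteq> E" if "\<alpha> \<in> U" for \<alpha>
  proof -
    have "x \<le> N" if "x \<in> set \<alpha>" for x using that \<open>\<alpha> \<in> U\<close> by (auto simp: U_def)
    then have "sum_list \<alpha> \<le> length \<alpha> * N" by (induction \<alpha>) (auto intro: add_mono)
    then have "b * sum_list \<alpha> \<le> b * (Suc ?d * N)" using that len by (intro mult_left_mono) (auto simp: U_def)
    then show ?thesis using keys_mon_box[of xs b \<alpha>] xb int_box_mono unfolding E_def by blast
  qed
  obtain x where x: "\<exists>\<alpha>\<in>U. x \<alpha> \<noteq> 0" "\<forall>e\<in>E. (\<Sum>\<alpha>\<in>U. Poly_Mapping.lookup (mon xs \<alpha>) e * x \<alpha>) = 0"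
    using homogeneous_system_nontrivial[of E U "\<lambda>e \<alpha>. Poly_Mapping.lookup (mon xs \<alpha>) e"] U cardE int_box_finite_card(1)
    unfolding E_def by blast
  define A where "A = {\<alpha>\<in>U. x \<alpha> \<noteq> 0}"
  have "(\<Sum>\<alpha>\<in>A. Poly_Mapping.single 0 (x \<alpha>) * mon xs \<alpha>) = (\<Sum>\<alpha>\<in>U. Poly_Mapping.single 0 (x \<alpha>) * mon xs \<alpha>)"
    using U by (intro sum.mono_neutral_left) (auto simp: A_def)
  also have "\<dots> = 0"
  proof (rule poly_mapping_eqI)
    fix e
    show "Poly_Mapping.lookup (\<Sum>\<alpha>\<in>U. Poly_Mapping.single 0 (x \<alpha>) * mon xs \<alpha>) e = Poly_Mapping.lookup 0 e"
    proof (cases "e \<in> E")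
      case True
      from x(2)[rule_format, OF this] show ?thesis
        unfolding lookup_sum keys_single_0_mult lookup_zero by (simp only: mult.commute)
    next
      case False
      then have "Poly_Mapping.lookup (mon xs \<alpha>) e = 0" if "\<alpha> \<in> U" for \<alpha> using keysE[OF that] by (auto simp: in_keys_iff)
      then show ?thesis by (simp add: lookup_sum keys_single_0_mult)
    qed
  qed
  finally have "(\<Sum>\<alpha>\<in>A. Poly_Mapping.single 0 (x \<alpha>) * mon xs \<alpha>) = 0" .
  moreover have "finite A" using U(1) by (simp add: A_def)
  moreover have "A \<noteq> {}" using x(1) by (auto simp: A_def)
  moreover have "\<forall>\<alpha>\<in>A. length \<alpha> = length xs \<and> x \<alpha> \<noteq> 0" by (simp add: A_def U_def)
  ultimately show ?thesis by blast
qed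

section \<open>Simplicial affine monoids\<close>

text \<open>\<open>sg\<close> selects a column at each vertex, \<open>cc\<close> gives the rational coordinates with respect to the
  selected columns, and \<open>hh\<close> is the functional that is \<open>1\<close> on the hyperplane of the columns.\<close>

locale simplicial =
  fixes A :: "int ^ 'n::finite ^ 'd" and sg :: "'d \<Rightarrow> 'n" and cc :: "'d \<Rightarrow> int ^ 'd \<Rightarrow> rat" and hh :: "int ^ 'd \<Rightarrow> rat"
  assumes cc_add: "cc l (x + y) = cc l x + cc l y"
    and cc_vert: "cc l (column (sg m) A) = (if l = m then 1 else 0)"
    and cc_nonneg: "0 \<le> cc l (column j A)"
    and cc_inj: "(\<And>l. cc l x = 0) \<Longrightarrow> x = 0"
    and hh_add: "hh (x + y) = hh x + hh y"
    and hh_col: "hh (column j A) = 1"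
    and vertex_lattice: "column_lattice A (vertex_indices A) = column_lattice A (range sg)"
begin

abbreviation "S \<equiv> cone_monoid A"
abbreviation "ZA \<equiv> column_lattice A UNIV"
abbreviation "a j \<equiv> column j A"
abbreviation "V l \<equiv> column (sg l) A"

definition lat :: "('d \<Rightarrow> int) \<Rightarrow> int ^ 'd" where "lat z = (\<Sum>l\<in>UNIV. z l *s V l)"
definition L :: "(int ^ 'd) set" where "L = range lat"

lemma sg_inj: "inj sg"
proof (rule injI)
  fix l m assume "sg l = sg m"
  then show "l = m" using cc_vert[of l l] cc_vert[of l m] by (simp split: if_splits)
qed

lemma cc_0: "cc l 0 = 0" using cc_add[of l 0 0] by simp
lemma hh_0: "hh 0 = 0" using hh_add[of 0 0] by simp
lemma cc_minus: "cc l (- x) = - cc l x" using cc_add[of l x "- x"] cc_0[of l] by simp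
lemma cc_diff: "cc l (x - y) = cc l x - cc l y" using cc_add[of l x "- y"] cc_minus[of l y] by simp
lemma hh_minus: "hh (- x) = - hh x" using hh_add[of x "- x"] hh_0 by simp
lemma hh_diff: "hh (x - y) = hh x - hh y" using hh_add[of x "- y"] hh_minus[of y] by simp
lemma cc_sum: "cc l (sum g I) = (\<Sum>i\<in>I. cc l (g i))"
  by (induction I rule: infinite_finite_induct) (simp_all add: cc_0 cc_add)
lemma hh_sum: "hh (sum g I) = (\<Sum>i\<in>I. hh (g i))"
  by (induction I rule: infinite_finite_induct) (simp_all add: hh_0 hh_add)

lemma of_nat_smult: "int (Suc n) *s (x :: int ^ 'd) = x + int n *s x"
  by (simp add: vec_eq_iff algebra_simps)

lemma zero_smult: "(0::int) *s (x :: int ^ 'd) = 0" by (simp add: vec_eq_iff)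

lemma cc_smult_nat: "cc l (int n *s x) = of_nat n * cc l x"
  by (induction n) (simp_all only: of_nat_smult cc_add, simp_all add: zero_smult cc_0 algebra_simps)
lemma hh_smult_nat: "hh (int n *s x) = of_nat n * hh x"
  by (induction n) (simp_all only: of_nat_smult hh_add, simp_all add: zero_smult hh_0 algebra_simps)

lemma smult_neg: "(- c) *s (x :: int ^ 'd) = - (c *s x)" by (simp add: vec_eq_iff)

lemma cc_smult: "cc l (c *s x) = of_int c * cc l x"
proof (cases "c \<ge> 0")
  case True
  then show ?thesis using cc_smult_nat[of l "nat c" x] by simp
next
  case False
  then show ?thesis using cc_smult_nat[of l "nat (- c)" x] by (simp add: smult_neg cc_minus)
qed
lemma hh_smult: "hh (c *s x) = of_int c * hh x"
proof (cases "c \<ge> 0")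
  case True
  then show ?thesis using hh_smult_nat[of "nat c" x] by simp
next
  case False
  then show ?thesis using hh_smult_nat[of "nat (- c)" x] by (simp add: smult_neg hh_minus)
qed

lemma cc_eqI: "(\<And>l. cc l x = cc l y) \<Longrightarrow> x = y"
  using cc_inj[of "x - y"] by (simp add: cc_diff)

lemma cc_lat: "cc l (lat z) = of_int (z l)"
  by (simp add: lat_def cc_sum cc_smult cc_vert if_distrib cong: if_cong)

lemma lat_add: "lat (\<lambda>l. z l + w l) = lat z + lat w"
  by (rule cc_eqI) (simp add: cc_lat cc_add)
lemma lat_diff: "lat (\<lambda>l. z l - w l) = lat z - lat w"
  by (rule cc_eqI) (simp add: cc_lat cc_diff)
lemma lat_0: "lat (\<lambda>l. 0) = 0"
  by (rule cc_eqI) (simp add: cc_lat cc_0)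
lemma lat_unit: "lat (\<lambda>l. if l = m then c else 0) = c *s V m"
  by (rule cc_eqI) (simp add: cc_lat cc_smult cc_vert)

lemma L_add: "x \<in> L \<Longrightarrow> y \<in> L \<Longrightarrow> x + y \<in> L"
  unfolding L_def by (elim rangeE) (simp only: lat_add[symmetric] rangeI)
lemma L_diff: "x \<in> L \<Longrightarrow> y \<in> L \<Longrightarrow> x - y \<in> L"
  unfolding L_def by (elim rangeE) (simp only: lat_diff[symmetric] rangeI)
lemma L_0: "0 \<in> L" unfolding L_def lat_0[symmetric] by (rule rangeI)

lemma pos_entry:
  fixes p :: "'d \<Rightarrow> int"
  assumes "\<And>l. 0 \<le> p l" "p \<noteq> (\<lambda>_. 0)" shows "\<exists>l. 0 < p l"
proof (rule ccontr)
  assume no: "\<not> ?thesis"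
  have "p l = 0" for l
  proof (rule antisym)
    show "p l \<le> 0" using no by (simp add: not_less)
  qed (rule assms(1))
  then have "p = (\<lambda>_. 0)" by (rule ext)
  with assms(2) show False by contradiction
qed

lemma vertex_lattice_L: "column_lattice A (vertex_indices A) = L"
  unfolding vertex_lattice unfolding column_lattice_def L_def
proof (intro equalityI subsetI)
  fix x assume "x \<in> {\<Sum>j\<in>range sg. c j *s a j | c. True}"
  then obtain c where "x = (\<Sum>j\<in>range sg. c j *s a j)" by blast
  also have "\<dots> = lat (\<lambda>l. c (sg l))" by (simp add: sum.reindex[OF sg_inj] o_def lat_def)
  finally have e: "x = lat (\<lambda>l. c (sg l))" .
  show "x \<in> range lat" unfolding e by (rule rangeI)
next
  fix x assume "x \<in> range lat"
  then obtain z where x: "x = lat z" by blast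
  have "x = (\<Sum>j\<in>range sg. z (the_inv sg j) *s a j)"
    unfolding x by (simp add: sum.reindex[OF sg_inj] o_def the_inv_f_f[OF sg_inj] lat_def)
  then show "x \<in> {\<Sum>j\<in>range sg. c j *s a j | c. True}" by (intro CollectI exI[of _ "\<lambda>j. z (the_inv sg j)"]) simp
qed

lemma S_I: "(\<Sum>j\<in>UNIV. int (u j) *s a j) \<in> S"
  unfolding cone_monoid_def by blast

lemma S_E: assumes "s \<in> S" obtains u where "s = (\<Sum>j\<in>UNIV. int (u j) *s a j)"
  using assms unfolding cone_monoid_def by blast

lemma S_0: "0 \<in> S" using S_I[of "\<lambda>_. 0"] by (simp add: zero_smult)

lemma S_add: assumes "s \<in> S" "t \<in> S" shows "s + t \<in> S"
proof -
  obtain u where su: "s = (\<Sum>j\<in>UNIV. int (u j) *s a j)" using assms(1) by (rule S_E)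
  obtain w where tw: "t = (\<Sum>j\<in>UNIV. int (w j) *s a j)" using assms(2) by (rule S_E)
  from su tw have "s + t = (\<Sum>j\<in>UNIV. int (u j + w j) *s a j)"
    by (simp add: vector_sadd_rdistrib sum.distrib)
  then show ?thesis using S_I[of "\<lambda>j. u j + w j"] by simp
qed

lemma S_col: "a j \<in> S"
proof -
  have "(\<Sum>i\<in>UNIV. int (if i = j then 1 else 0) *s a i) = a j"
    by (subst sum.remove[of _ j]) (auto simp: zero_smult intro!: sum.neutral)
  then show ?thesis using S_I[of "\<lambda>i. if i = j then 1 else 0"] by simp
qed

lemma S_sum: "(\<And>i. i \<in> I \<Longrightarrow> g i \<in> S) \<Longrightarrow> sum g I \<in> S"
  by (induction I rule: infinite_finite_induct) (simp_all add: S_0 S_add)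

lemma S_smult: "s \<in> S \<Longrightarrow> int n *s s \<in> S"
  by (induction n) (simp_all only: of_nat_smult S_add, simp add: zero_smult S_0)

lemma S_lat: "s \<in> S \<Longrightarrow> (\<And>l. 0 \<le> z l) \<Longrightarrow> s + lat z \<in> S"
  unfolding lat_def
proof (rule S_add, assumption, rule S_sum)
  fix l assume "\<And>l. 0 \<le> z l"
  then have "z l = int (nat (z l))" by simp
  then show "z l *s V l \<in> S" using S_smult[OF S_col, of "nat (z l)" "sg l"] by simp
qed

lemma S_cc_nonneg: "s \<in> S \<Longrightarrow> 0 \<le> cc l s"
  by (erule S_E) (auto simp: cc_sum cc_smult cc_nonneg intro!: sum_nonneg mult_nonneg_nonneg)

lemma hh_S_E: assumes "s \<in> S" obtains n where "hh s = of_nat n"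
proof -
  obtain u where "s = (\<Sum>j\<in>UNIV. int (u j) *s a j)" using assms by (rule S_E)
  then have "hh s = of_nat (\<Sum>j\<in>UNIV. u j)" by (simp add: hh_sum hh_smult hh_col)
  then show ?thesis by (rule that)
qed

definition deg :: "int ^ 'd \<Rightarrow> nat" where "deg s = nat \<lfloor>hh s\<rfloor>"

lemma hh_deg: "s \<in> S \<Longrightarrow> hh s = of_nat (deg s)"
  by (erule hh_S_E) (simp add: deg_def)

lemma deg_add: assumes "s \<in> S" "t \<in> S" shows "deg (s + t) = deg s + deg t"
proof -
  have "(of_nat (deg (s + t)) :: rat) = of_nat (deg s + deg t)"
    using hh_deg[OF assms(1)] hh_deg[OF assms(2)] hh_deg[OF S_add[OF assms]] hh_add[of s t] by simp
  then show ?thesis by (simp only: of_nat_eq_iff)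
qed

lemma deg_col: "deg (a j) = 1" by (simp add: deg_def hh_col)

lemma deg_0_iff: assumes "s \<in> S" shows "deg s = 0 \<longleftrightarrow> s = 0"
proof
  obtain u where u: "s = (\<Sum>j\<in>UNIV. int (u j) *s a j)" using assms by (rule S_E)
  then have h: "hh s = of_nat (\<Sum>j\<in>UNIV. u j)" by (simp add: hh_sum hh_smult hh_col)
  assume "deg s = 0"
  then have "(of_nat (\<Sum>j\<in>UNIV. u j) :: rat) = of_nat 0" using hh_deg[OF assms] unfolding h by (simp only:)
  then have "(\<Sum>j\<in>UNIV. u j) = 0" by (simp only: of_nat_eq_iff)
  then have "u = (\<lambda>_. 0)" by auto
  then show "s = 0" by (simp add: u zero_smult)
qed (simp add: deg_def hh_0)

lemma ZA_I: "(\<Sum>j\<in>UNIV. c j *s a j) \<in> ZA" unfolding column_lattice_def by blast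

lemma S_ZA: "s \<in> S \<Longrightarrow> s \<in> ZA"
  by (erule S_E) (simp only: ZA_I)

lemma ZA_E: assumes "s \<in> ZA" obtains c where "s = (\<Sum>j\<in>UNIV. c j *s a j)"
  using assms unfolding column_lattice_def by blast

lemma ZA_add: assumes "s \<in> ZA" "t \<in> ZA" shows "s + t \<in> ZA"
proof -
  obtain u where su: "s = (\<Sum>j\<in>UNIV. u j *s a j)" using assms(1) by (rule ZA_E)
  obtain w where tw: "t = (\<Sum>j\<in>UNIV. w j *s a j)" using assms(2) by (rule ZA_E)
  from su tw have "s + t = (\<Sum>j\<in>UNIV. (u j + w j) *s a j)"
    by (simp add: vector_sadd_rdistrib sum.distrib)
  then show ?thesis using ZA_I[of "\<lambda>j. u j + w j"] by simp
qed

lemma ZA_uminus: assumes "s \<in> ZA" shows "- s \<in> ZA"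
proof -
  obtain u where "s = (\<Sum>j\<in>UNIV. u j *s a j)" using assms by (rule ZA_E)
  then have "- s = (\<Sum>j\<in>UNIV. (- u j) *s a j)" by (simp add: smult_neg sum_negf)
  then show ?thesis using ZA_I[of "\<lambda>j. - u j"] by simp
qed

lemma ZA_diff: "s \<in> ZA \<Longrightarrow> t \<in> ZA \<Longrightarrow> s - t \<in> ZA"
  using ZA_add[of s "- t"] ZA_uminus by simp

lemma ZA_smult: assumes "s \<in> ZA" shows "c *s s \<in> ZA"
proof -
  obtain u where "s = (\<Sum>j\<in>UNIV. u j *s a j)" using assms by (rule ZA_E)
  then have "c *s s = (\<Sum>j\<in>UNIV. (c * u j) *s a j)" by (simp add: vec_eq_iff sum_distrib_left mult.assoc)
  then show ?thesis using ZA_I[of "\<lambda>j. c * u j"] by simp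
qed

lemma ZA_sum: "(\<And>i. i \<in> I \<Longrightarrow> g i \<in> ZA) \<Longrightarrow> sum g I \<in> ZA"
  by (induction I rule: infinite_finite_induct) (simp_all add: S_ZA[OF S_0] ZA_add)

lemma ZA_lat: "lat z \<in> ZA" unfolding lat_def by (intro ZA_sum ZA_smult S_ZA S_col)

text \<open>The product of all denominators of the coordinates clears them, and nonnegativity of the
  coordinates survives. Thus a fixed multiple of every column lies in the monoid of the
  vertices.\<close>

lemma common_multiple: "\<exists>N>0. \<forall>j. \<exists>w. (\<forall>l. 0 \<le> w l) \<and> int N *s a j = lat w"
proof -
  define N where "N = nat (\<Prod>j\<in>UNIV. \<Prod>l\<in>UNIV. snd (quotient_of (cc l (a j))))"
  have dpos: "snd (quotient_of r) > 0" for r :: rat by (rule quotient_of_denom_pos')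
  have N: "int N = (\<Prod>j\<in>UNIV. \<Prod>l\<in>UNIV. snd (quotient_of (cc l (a j))))"
    unfolding N_def by (intro nat_0_le prod_nonneg ballI less_imp_le[OF dpos])
  have "0 < int N" unfolding N by (intro prod_pos ballI dpos)
  moreover have "\<exists>w. (\<forall>l. 0 \<le> w l) \<and> int N *s a j = lat w" for j
  proof -
    have "\<exists>w::int. of_int (int N) * cc l (a j) = of_int w" for l
    proof -
      have d: "snd (quotient_of (cc l (a j))) dvd int N"
      proof -
        let ?d = "\<lambda>j l. snd (quotient_of (cc l (a j)))"
        have "?d j l dvd (\<Prod>l\<in>UNIV. ?d j l)" by (rule dvd_prodI) simp_all
        also have "\<dots> dvd (\<Prod>j\<in>UNIV. \<Prod>l\<in>UNIV. ?d j l)"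
          using dvd_prodI[of UNIV j "\<lambda>j. \<Prod>l\<in>UNIV. ?d j l"] by simp
        finally show ?thesis unfolding N .
      qed
      then obtain k where k: "int N = snd (quotient_of (cc l (a j))) * k" by (elim dvdE)
      obtain p q where pq: "quotient_of (cc l (a j)) = (p, q)" by (cases "quotient_of (cc l (a j))")
      have "cc l (a j) = of_int p / of_int q" using quotient_of_div[OF pq] .
      moreover have "(of_int q :: rat) \<noteq> 0" using dpos[of "cc l (a j)"] pq by simp
      ultimately have "of_int (int N) * cc l (a j) = of_int (k * p)" unfolding k pq by simp
      then show ?thesis by blast
    qed
    then have "\<forall>l. \<exists>w::int. of_int (int N) * cc l (a j) = of_int w" by simp
    from choice[OF this] obtain w :: "'d \<Rightarrow> int" where w: "\<And>l. of_int (int N) * cc l (a j) = of_int (w l)" by blast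
    have "0 \<le> w l" for l
    proof -
      have "(0::rat) \<le> of_int (int N) * cc l (a j)" using cc_nonneg by simp
      then show ?thesis unfolding w by simp
    qed
    moreover have "int N *s a j = lat w" by (rule cc_eqI) (simp only: cc_smult cc_lat w)
    ultimately show ?thesis by blast
  qed
  ultimately show ?thesis by (intro exI[of _ N]) simp
qed

definition NN :: nat where "NN = (SOME N. N > 0 \<and> (\<forall>j. \<exists>w. (\<forall>l. 0 \<le> w l) \<and> int N *s a j = lat w))"

lemma NN: "NN > 0" "\<exists>w. (\<forall>l. 0 \<le> w l) \<and> int NN *s a j = lat w"
  using someI_ex[OF common_multiple] unfolding NN_def by blast+

lemma NN_S: assumes "s \<in> S" shows "\<exists>w. (\<forall>l. 0 \<le> w l) \<and> int NN *s s = lat w"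
proof -
  obtain u where u: "s = (\<Sum>j\<in>UNIV. int (u j) *s a j)" using assms by (rule S_E)
  have "\<forall>j. \<exists>w. (\<forall>l. 0 \<le> w l) \<and> int NN *s a j = lat w" using NN(2) by blast
  from choice[OF this] obtain w where w: "\<And>j l. 0 \<le> w j l" "\<And>j. int NN *s a j = lat (w j)" by blast
  have "int NN *s s = lat (\<lambda>l. \<Sum>j\<in>UNIV. int (u j) * w j l)"
  proof (rule cc_eqI)
    fix l
    have "of_nat NN * cc l (a j) = of_int (w j l)" for j
      using arg_cong[OF w(2), of "cc l" j] by (simp add: cc_smult cc_lat)
    then have "(\<Sum>j\<in>UNIV. of_nat (u j) * (of_nat NN * cc l (a j))) = (\<Sum>j\<in>UNIV. of_nat (u j) * of_int (w j l))"
      by simp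
    then show "cc l (int NN *s s) = cc l (lat (\<lambda>l. \<Sum>j\<in>UNIV. int (u j) * w j l))"
      by (simp add: u cc_smult cc_sum cc_lat sum_distrib_left mult.left_commute)
  qed
  then show ?thesis using w(1) by (intro exI[of _ "\<lambda>l. \<Sum>j\<in>UNIV. int (u j) * w j l"]) (simp add: sum_nonneg)
qed

text \<open>Adding a multiple of \<open>NN\<close> copies of a column changes a point only by an
  element of \<open>L\<close>; \<open>\<bar>c j\<bar> * NN\<close> copies suffice to make the
  coefficient of \<open>a j\<close> nonnegative.\<close>

lemma coset_meets_S: assumes "z \<in> ZA" shows "\<exists>s\<in>S. s - z \<in> L"
proof -
  obtain c where c: "z = (\<Sum>j\<in>UNIV. c j *s a j)" using assms by (rule ZA_E)
  have "\<forall>j. \<exists>w. (\<forall>l. 0 \<le> w l) \<and> int NN *s a j = lat w" using NN(2) by blast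
  from choice[OF this] obtain w where w: "\<And>j. int NN *s a j = lat (w j)" by blast
  define u where "u j = nat (c j + \<bar>c j\<bar> * int NN)" for j
  have u: "int (u j) = c j + \<bar>c j\<bar> * int NN" for j
  proof -
    have "\<bar>c j\<bar> * 1 \<le> \<bar>c j\<bar> * int NN" using NN(1) by (intro mult_left_mono) auto
    then show ?thesis unfolding u_def by (intro nat_0_le) linarith
  qed
  have "(\<Sum>j\<in>UNIV. int (u j) *s a j) - z = (\<Sum>j\<in>UNIV. \<bar>c j\<bar> *s (int NN *s a j))"
    unfolding c u by (simp add: vector_sadd_rdistrib sum.distrib vector_smult_assoc)
  also have "\<dots> = lat (\<lambda>l. \<Sum>j\<in>UNIV. \<bar>c j\<bar> * w j l)"
    by (rule cc_eqI) (simp only: w cc_sum cc_smult cc_lat of_int_sum of_int_mult)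
  finally show ?thesis using S_I[of u] unfolding L_def by (intro bexI[of _ "\<Sum>j\<in>UNIV. int (u j) *s a j"]) simp_all
qed

definition star :: bool where
  "star \<longleftrightarrow> (\<forall>z\<in>ZA. \<forall>i j. i \<noteq> j \<longrightarrow> z + V i \<in> S \<longrightarrow> z + V j \<in> S \<longrightarrow> z \<in> S)"

lemma lat_step: "z i > 0 \<Longrightarrow> lat z = V i + lat (z(i := z i - 1))"
  by (rule cc_eqI) (simp add: cc_lat cc_add cc_vert)

text \<open>Under \<open>star\<close>, the part of \<open>S\<close> in each coset of \<open>L\<close> is closed under meets.\<close>

lemma star_between:
  assumes star
  shows "z \<in> ZA \<Longrightarrow> (\<And>l. 0 \<le> p l \<and> 0 \<le> q l \<and> (p l = 0 \<or> q l = 0)) \<Longrightarrow> z + lat p \<in> S \<Longrightarrow> z + lat q \<in> S \<Longrightarrow> z \<in> S"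
proof (induction "nat (\<Sum>l\<in>UNIV. p l + q l)" arbitrary: z p q rule: less_induct)
  case less
  show ?case
  proof (cases "(\<exists>i. p i > 0) \<and> (\<exists>j. q j > 0)")
    case False
    have p0: "0 \<le> p l" and q0: "0 \<le> q l" for l using less.prems(2)[of l] by simp_all
    have "p = (\<lambda>_. 0) \<or> q = (\<lambda>_. 0)" using pos_entry[of p, OF p0] pos_entry[of q, OF q0] False by blast
    then show ?thesis using less.prems(3,4) by (elim disjE) (simp_all add: lat_0)
  next
    case True
    then obtain i j where ij: "p i > 0" "q j > 0" by blast
    then have "i \<noteq> j" using less.prems(2)[of i] by auto
    have drop: "(\<Sum>l\<in>UNIV. (p'(k := p' k - 1)) l + q' l) = (\<Sum>l\<in>UNIV. p' l + q' l) - (1::int)" for p' q' :: "'d \<Rightarrow> int" and k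
    proof -
      have "(\<Sum>l\<in>UNIV. (p'(k := p' k - 1)) l + q' l) = (\<Sum>l\<in>UNIV. (p' l + q' l) - (if l = k then 1 else 0))"
        by (intro sum.cong) auto
      then show ?thesis by (simp add: sum_subtractf)
    qed
    have pos: "0 < (\<Sum>l\<in>UNIV. p l + q l)"
    proof (rule sum_pos2[of _ i])
      show "0 < p i + q i" using ij less.prems(2)[of i] by simp
      fix l show "0 \<le> p l + q l" using less.prems(2)[of l] by simp
    qed simp_all
    \<comment> \<open>One unit of \<open>p\<close> is absorbed into the base point, which decreases
      the measure; the same with \<open>q\<close> gives \<open>z + V j\<close>. As \<open>p\<close>
      and \<open>q\<close> have disjoint supports, \<open>i\<close> and \<open>j\<close> differ and
      \<open>star\<close> applies to \<open>z\<close>.\<close>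
    have "z + V i \<in> S"
    proof (rule less.hyps[of "p(i := p i - 1)" q])
      show "nat (\<Sum>l\<in>UNIV. (p(i := p i - 1)) l + q l) < nat (\<Sum>l\<in>UNIV. p l + q l)" unfolding drop using pos by simp
      show "z + V i \<in> ZA" using less.prems(1) by (intro ZA_add S_ZA[OF S_col])
      show "z + V i + lat (p(i := p i - 1)) \<in> S" using less.prems(3) lat_step[of p i] ij by (simp add: add.assoc)
      have "(z + lat q) + V i \<in> S" by (rule S_add[OF less.prems(4) S_col])
      then show "z + V i + lat q \<in> S" by (simp add: add_ac)
      fix l show "0 \<le> (p(i := p i - 1)) l \<and> 0 \<le> q l \<and> ((p(i := p i - 1)) l = 0 \<or> q l = 0)"
        using less.prems(2)[of l] ij by auto
    qed
    moreover have "z + V j \<in> S"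
    proof (rule less.hyps[of p "q(j := q j - 1)"])
      have "(\<Sum>l\<in>UNIV. p l + (q(j := q j - 1)) l) = (\<Sum>l\<in>UNIV. p l + q l) - 1" using drop[of q j p] by (simp add: add.commute)
      then show "nat (\<Sum>l\<in>UNIV. p l + (q(j := q j - 1)) l) < nat (\<Sum>l\<in>UNIV. p l + q l)" using pos by simp
      show "z + V j \<in> ZA" using less.prems(1) by (intro ZA_add S_ZA[OF S_col])
      show "z + V j + lat (q(j := q j - 1)) \<in> S" using less.prems(4) lat_step[of q j] ij by (simp add: add.assoc)
      have "(z + lat p) + V j \<in> S" by (rule S_add[OF less.prems(3) S_col])
      then show "z + V j + lat p \<in> S" by (simp add: add_ac)
      fix l show "0 \<le> p l \<and> 0 \<le> (q(j := q j - 1)) l \<and> (p l = 0 \<or> (q(j := q j - 1)) l = 0)"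
        using less.prems(2)[of l] ij by auto
    qed
    ultimately show ?thesis using assms less.prems(1) \<open>i \<noteq> j\<close> unfolding star_def by blast
  qed
qed

text \<open>The analogue, for all vertices simultaneously, of the Apery set of a numerical
  semigroup.\<close>

definition Ap :: "(int ^ 'd) set" where "Ap = {s\<in>S. \<forall>l. s - V l \<notin> S}"

lemma Ap_descend: assumes "s \<in> S" shows "\<exists>w\<in>Ap. \<exists>z. (\<forall>l. 0 \<le> z l) \<and> s = w + lat z"
  using assms
proof (induction "deg s" arbitrary: s rule: less_induct)
  case less
  show ?case
  proof (cases "s \<in> Ap")
    case True
    then show ?thesis by (intro bexI[of _ s] exI[of _ "\<lambda>_. 0"]) (simp_all add: lat_0)
  next
    case False
    then obtain l where l: "s - V l \<in> S" using less.prems by (auto simp: Ap_def)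
    have "deg s = deg (s - V l) + 1" using deg_add[OF l S_col[of "sg l"]] by (simp add: deg_col)
    then obtain w z where w: "w \<in> Ap" "\<And>l. 0 \<le> z l" "s - V l = w + lat z" using less.hyps[OF _ l] by auto
    have "s = w + lat (\<lambda>m. z m + (if m = l then 1 else 0))"
      using w(3) by (simp add: lat_add lat_unit algebra_simps)
    then show ?thesis using w(1,2) by (intro bexI[of _ w] exI[of _ "\<lambda>m. z m + (if m = l then 1 else 0)"]) auto
  qed
qed

text \<open>\<open>NN\<close> copies of one column form a nonzero element of the vertex monoid, from
  which a vertex can be subtracted. So every representation of an element of \<open>Ap\<close> has
  all multiplicities below \<open>NN\<close>.\<close>

lemma finite_Ap: "finite Ap"
proof -
  have "Ap \<subseteq> (\<lambda>u. \<Sum>j\<in>UNIV. int (u j) *s a j) ` (PiE UNIV (\<lambda>_. {..<NN}))"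
  proof
    fix s assume s: "s \<in> Ap"
    then obtain u where u: "s = (\<Sum>j\<in>UNIV. int (u j) *s a j)" unfolding Ap_def by (auto elim: S_E)
    have "u j < NN" for j
    proof (rule ccontr)
      assume "\<not> u j < NN"
      define u' where "u' = u(j := u j - NN)"
      have uu: "u = (\<lambda>i. u' i + (if i = j then NN else 0))" using \<open>\<not> u j < NN\<close> by (auto simp: u'_def)
      have "s = (\<Sum>i\<in>UNIV. int (u' i) *s a i) + (\<Sum>i\<in>UNIV. if i = j then int NN *s a i else 0)"
        unfolding u sum.distrib[symmetric] by (intro sum.cong) (simp_all add: uu vector_sadd_rdistrib zero_smult)
      then have s1: "s = (\<Sum>i\<in>UNIV. int (u' i) *s a i) + int NN *s a j" by simp
      obtain w where w: "\<And>l. 0 \<le> w l" "int NN *s a j = lat w" using NN(2)[of j] by blast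
      have "hh (int NN *s a j) > 0" using NN(1) by (simp add: hh_smult hh_col)
      then have "lat w \<noteq> 0" using w(2) hh_0 by auto
      then have "w \<noteq> (\<lambda>_. 0)" using lat_0 by auto
      from pos_entry[OF w(1) this] obtain l where "w l > 0" ..
      then have "s - V l = (\<Sum>i\<in>UNIV. int (u' i) *s a i) + lat (w(l := w l - 1))"
        using s1 w(2) lat_step[of w l] by simp
      also have "\<dots> \<in> S" using w(1) \<open>w l > 0\<close> by (intro S_lat S_I) auto
      finally show False using s unfolding Ap_def by blast
    qed
    then have "u \<in> PiE UNIV (\<lambda>_. {..<NN})" by auto
    then show "s \<in> (\<lambda>u. \<Sum>j\<in>UNIV. int (u j) *s a j) ` (PiE UNIV (\<lambda>_. {..<NN}))" unfolding u by (rule imageI)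
  qed
  then show ?thesis by (rule finite_subset) (intro finite_imageI finite_PiE, simp_all)
qed

definition coset :: "int ^ 'd \<Rightarrow> (int ^ 'd) set" where "coset s = {l + s | l. l \<in> L}"

lemma coset_eq_iff: "coset s = coset t \<longleftrightarrow> s - t \<in> L"
proof
  assume "coset s = coset t"
  moreover have "0 + s \<in> coset s" unfolding coset_def using L_0 by blast
  ultimately have "0 + s \<in> coset t" by simp
  then obtain l where "l \<in> L" "0 + s = l + t" unfolding coset_def by blast
  then show "s - t \<in> L" by (simp add: algebra_simps)
next
  have sub: "coset s \<subseteq> coset t" if "s - t \<in> L" for s t
  proof
    fix x assume "x \<in> coset s"
    then obtain l where l: "l \<in> L" "x = l + s" unfolding coset_def by blast
    have "l + (s - t) \<in> L" "x = (l + (s - t)) + t" using L_add[OF l(1) that] l(2) by simp_all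
    then show "x \<in> coset t" unfolding coset_def by blast
  qed
  assume st: "s - t \<in> L"
  have "t - s \<in> L" using L_diff[OF L_0 st] by simp
  then show "coset s = coset t" using sub st by blast
qed

text \<open>Every coset meets \<open>S\<close>, and removing vertices as long as possible leads to
  \<open>Ap\<close> within the coset. In general several elements of \<open>Ap\<close> may share a
  coset; excluding this is the contribution of \<open>star\<close>.\<close>

lemma vol_eq: "simplex_vol A = card (coset ` Ap)"
proof -
  have "rcosets\<^bsub>\<lparr>carrier = ZA, monoid.mult = (+), one = 0\<rparr>\<^esub> L = coset ` ZA"
  proof -
    have "(L #>\<^bsub>\<lparr>carrier = ZA, monoid.mult = (+), one = 0\<rparr>\<^esub> z) = coset z" for z
      unfolding r_coset_def coset_def by (simp, blast)
    then show ?thesis unfolding RCOSETS_def by (simp add: UNION_singleton_eq_range)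
  qed
  also have "\<dots> = coset ` Ap"
  proof (intro equalityI subsetI)
    fix C assume "C \<in> coset ` ZA"
    then obtain z where z: "z \<in> ZA" "C = coset z" by blast
    obtain s where s: "s \<in> S" "s - z \<in> L" using coset_meets_S[OF z(1)] by blast
    obtain w y where w: "w \<in> Ap" "s = w + lat y" using Ap_descend[OF s(1)] by blast
    have "s - w \<in> L" using w(2) unfolding L_def by simp
    then have "coset s = coset w" "coset s = coset z" using s(2) by (simp_all only: coset_eq_iff)
    then show "C \<in> coset ` Ap" using w(1) z(2) by blast
  next
    fix C assume "C \<in> coset ` Ap"
    then show "C \<in> coset ` ZA" using S_ZA unfolding Ap_def by blast
  qed
  finally show ?thesis unfolding simplex_vol_def vertex_lattice_L by simp
qed

text \<open>Two elements of \<open>Ap\<close> in the same coset have a meet \<open>b\<close>, which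
  lies in \<open>S\<close> by \<open>star_between\<close>. Each of them is \<open>b\<close> plus a
  nonnegative combination of vertices, and membership in \<open>Ap\<close> forces that combination
  to be zero.\<close>

lemma star_card_Ap: assumes star shows "card Ap = simplex_vol A"
proof -
  have "inj_on coset Ap"
  proof (rule inj_onI)
    fix s t assume st: "s \<in> Ap" "t \<in> Ap" "coset s = coset t"
    then have "s - t \<in> L" by (simp only: coset_eq_iff)
    then obtain z where z: "s - t = lat z" unfolding L_def by blast
    define p q where "p l = max (z l) 0" and "q l = max (- z l) 0" for l
    have zpq: "z = (\<lambda>l. p l - q l)" by (auto simp: p_def q_def)
    define b where "b = s - lat p"
    have b2: "b = t - lat q" using z unfolding b_def zpq by (simp add: lat_diff algebra_simps)
    have "b \<in> ZA" unfolding b_def using st(1) by (intro ZA_diff ZA_lat S_ZA) (simp add: Ap_def)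
    then have bS: "b \<in> S"
    proof (rule star_between[OF assms, of b p q])
      show "0 \<le> p l \<and> 0 \<le> q l \<and> (p l = 0 \<or> q l = 0)" for l by (auto simp: p_def q_def)
      show "b + lat p \<in> S" using st(1) by (simp add: b_def Ap_def)
      show "b + lat q \<in> S" using st(2) by (simp add: b2 Ap_def)
    qed
    have zero: "r = (\<lambda>_. 0)" if "\<And>l. 0 \<le> r l" "x \<in> Ap" "x = b + lat r" for r x
    proof (rule ccontr)
      assume "r \<noteq> (\<lambda>_. 0)"
      from pos_entry[OF that(1) this] obtain l where "r l > 0" ..
      then have "x - V l = b + lat (r(l := r l - 1))" using that(3) lat_step[of r l] by simp
      also have "\<dots> \<in> S" using bS that(1) \<open>r l > 0\<close> by (intro S_lat) auto
      finally show False using that(2) unfolding Ap_def by blast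
    qed
    have "p = (\<lambda>_. 0)" by (rule zero[of p s]) (simp_all add: st p_def b_def)
    moreover have "q = (\<lambda>_. 0)" by (rule zero[of q t]) (simp_all add: st q_def b2)
    ultimately show "s = t" using b2 unfolding b_def by (simp add: lat_0)
  qed
  then show ?thesis unfolding vol_eq by (simp add: card_image)
qed

end

section \<open>Translation between subsets of a type and ring records\<close>

definition ring_on :: "'a::comm_ring_1 set \<Rightarrow> 'a ring" where
  "ring_on R = \<lparr>carrier = R, monoid.mult = (*), one = 1, ring.zero = 0, add = (+)\<rparr>"

lemma ring_on_simps [simp]:
  "carrier (ring_on R) = R" "x \<otimes>\<^bsub>ring_on R\<^esub> y = x * y" "\<one>\<^bsub>ring_on R\<^esub> = 1" "\<zero>\<^bsub>ring_on R\<^esub> = 0"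
  "x \<oplus>\<^bsub>ring_on R\<^esub> y = x + y"
  by (simp_all add: ring_on_def)

lemma ring_on_cring: assumes R: "sring R" shows "cring (ring_on R)"
proof (rule cringI)
  show "abelian_group (ring_on R)"
  proof (rule abelian_groupI)
    fix x assume "x \<in> carrier (ring_on R)"
    then show "\<exists>y\<in>carrier (ring_on R). y \<oplus>\<^bsub>ring_on R\<^esub> x = \<zero>\<^bsub>ring_on R\<^esub>"
      using R by (intro bexI[of _ "- x"]) (simp_all add: sring_closed)
  qed (use R in \<open>simp_all add: sring_closed add_ac\<close>)
  show "Group.comm_monoid (ring_on R)"
    by (rule comm_monoidI) (use R in \<open>simp_all add: sring_closed mult_ac\<close>)
qed (simp add: distrib_right)

lemma ideal_ring_on: assumes R: "sring R" shows "ideal J (ring_on R) \<longleftrightarrow> ideal_in R J"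
proof
  assume "ideal J (ring_on R)"
  then interpret ideal J "ring_on R" .
  show "ideal_in R J" unfolding ideal_in_def
    using a_subset additive_subgroup.zero_closed[OF additive_subgroup_axioms]
      additive_subgroup.a_closed[OF additive_subgroup_axioms] I_l_closed by simp
next
  assume J: "ideal_in R J"
  show "ideal J (ring_on R)"
  proof (rule idealI)
    show "ring (ring_on R)" using ring_on_cring[OF R] by (simp add: cring_def)
    have inv: "inv\<^bsub>add_monoid (ring_on R)\<^esub> x \<in> J" if "x \<in> J" for x
    proof -
      interpret ab: abelian_group "ring_on R" using ring_on_cring[OF R] by (simp add: cring_def ring_def)
      have x: "x \<in> R" using that ideal_inD(1)[OF J] by blast
      have "\<ominus>\<^bsub>ring_on R\<^esub> x = - x"
        by (rule ab.minus_equality) (use x R in \<open>simp_all add: sring_closed\<close>)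
      then show ?thesis using ideal_in_uminus[OF R J that] by (simp add: a_inv_def)
    qed
    show "subgroup J (add_monoid (ring_on R))"
    proof
      show "J \<subseteq> carrier (add_monoid (ring_on R))" using J by (simp add: ideal_in_def)
    qed (use J inv in \<open>simp_all add: ideal_inD\<close>)
  qed (use J in \<open>simp_all add: ideal_inD ideal_in_mult_right\<close>)
qed

lemma genideal_ring_on: assumes R: "sring R" and G: "G \<subseteq> R" shows "genideal (ring_on R) G = igen R G"
  unfolding genideal_def ideal_ring_on[OF R]
proof
  show "\<Inter> {J. ideal_in R J \<and> G \<subseteq> J} \<subseteq> igen R G"
    using ideal_in_igen[OF R G] igen_gen[OF R, of _ G] by (intro Inter_lower CollectI conjI subsetI)
  show "igen R G \<subseteq> \<Inter> {J. ideal_in R J \<and> G \<subseteq> J}"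
    by (intro Inter_greatest) (simp add: igen_subset)
qed

lemma ideal_in_one: "ideal_in R J \<Longrightarrow> 1 \<in> J \<Longrightarrow> J = R"
  unfolding ideal_in_def using mult_1_right by (intro equalityI subsetI) (auto, metis mult_1_right)

lemma prime_ring_on: assumes R: "sring R" shows "primeideal P (ring_on R) \<longleftrightarrow> prime_in R P"
proof
  assume "primeideal P (ring_on R)"
  then interpret primeideal P "ring_on R" .
  have "ideal_in R P" using is_ideal ideal_ring_on[OF R] by blast
  then show "prime_in R P" unfolding prime_in_def
    using I_notcarr I_prime ideal_in_one[of R P] by auto
next
  assume P: "prime_in R P"
  then have i: "ideal_in R P" by (simp add: prime_in_def)
  show "primeideal P (ring_on R)"
  proof (rule primeidealI)
    show "ideal P (ring_on R)" using i ideal_ring_on[OF R] by blast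
    show "carrier (ring_on R) \<noteq> P" using P sring_one[OF R] by (auto simp: prime_in_def)
  qed (use P ring_on_cring[OF R] in \<open>auto simp: prime_in_def\<close>)
qed

lemma maximal_ring_on: assumes R: "sring R" shows "maximalideal P (ring_on R) \<longleftrightarrow> maximal_in R P"
proof
  assume "maximalideal P (ring_on R)"
  then interpret maximalideal P "ring_on R" .
  have i: "ideal_in R P" using is_ideal ideal_ring_on[OF R] by blast
  have "1 \<notin> P" using I_notcarr ideal_in_one[OF i] by auto
  moreover have "\<exists>u\<in>R. x * u - 1 \<in> P" if x: "x \<in> R" "x \<notin> P" for x
  proof -
    define J where "J = {x * r + y | r y. r \<in> R \<and> y \<in> P}"
    have J: "ideal_in R J" unfolding J_def by (rule ideal_in_adjoin[OF R i x(1)])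
    have PJ: "P \<subseteq> J"
    proof
      fix y assume "y \<in> P"
      then have "y = x * 0 + y" "0 \<in> R" using sring_zero[OF R] by simp_all
      then show "y \<in> J" unfolding J_def using \<open>y \<in> P\<close> by blast
    qed
    have "x * 1 + 0 \<in> J" unfolding J_def using ideal_inD(2)[OF i] sring_one[OF R] by blast
    then have "J \<noteq> P" using x(2) by auto
    moreover have "J = P \<or> J = carrier (ring_on R)"
      using J PJ ideal_inD(1)[OF J] by (intro I_maximal) (auto simp: ideal_ring_on[OF R])
    ultimately have "1 \<in> J" using sring_one[OF R] by simp
    then obtain r y where ry: "1 = x * r + y" "r \<in> R" "y \<in> P" unfolding J_def by blast
    then have "x * r - 1 = - y" by (simp add: algebra_simps)
    then show ?thesis using ideal_in_uminus[OF R i ry(3)] ry(2) by (intro bexI[of _ r]) simp_all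
  qed
  ultimately show "maximal_in R P" unfolding maximal_in_def using i by blast
next
  assume P: "maximal_in R P"
  then have i: "ideal_in R P" by (simp add: maximal_in_def)
  show "maximalideal P (ring_on R)"
  proof (rule maximalidealI)
    show "ideal P (ring_on R)" using i ideal_ring_on[OF R] by blast
    show "carrier (ring_on R) \<noteq> P" using P sring_one[OF R] by (auto simp: maximal_in_def)
    fix J assume J: "ideal J (ring_on R)" "P \<subseteq> J" "J \<subseteq> carrier (ring_on R)"
    then have iJ: "ideal_in R J" using ideal_ring_on[OF R] by blast
    show "J = P \<or> J = carrier (ring_on R)"
    proof (cases "J \<subseteq> P")
      case False
      then obtain x where x: "x \<in> J" "x \<notin> P" by blast
      then obtain u where u: "u \<in> R" "x * u - 1 \<in> P" using P ideal_inD(1)[OF iJ] unfolding maximal_in_def by blast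
      have "x * u - (x * u - 1) \<in> J" using ideal_in_diff[OF R iJ ideal_in_mult_right[OF iJ u(1) x(1)]] u(2) J(2) by blast
      then show ?thesis using ideal_in_one[OF iJ] by simp
    qed (use J in blast)
  qed
qed

lemma maximal_in_prime: assumes R: "sring R" and "maximal_in R P" shows "prime_in R P"
  unfolding prime_in_def
proof (intro conjI ballI impI)
  show i: "ideal_in R P" and "1 \<notin> P" using assms(2) by (simp_all add: maximal_in_def)
  fix x y assume xy: "x \<in> R" "y \<in> R" "x * y \<in> P"
  show "x \<in> P \<or> y \<in> P"
  proof (rule disjCI)
    assume "y \<notin> P"
    then obtain u where u: "u \<in> R" "y * u - 1 \<in> P" using assms(2) xy unfolding maximal_in_def by blast
    have "(x * y) * u - x * (y * u - 1) \<in> P"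
      using u xy ideal_in_mult_right[OF i u(1) xy(3)] ideal_inD(4)[OF i xy(1) u(2)] by (intro ideal_in_diff[OF R i])
    then show "x \<in> P" by (simp add: algebra_simps)
  qed
qed

lemma noeth_ring_on: assumes R: "sring R" and N: "noeth R" shows "noetherian_ring (ring_on R)"
proof (rule noetherian_ring.intro)
  show "ring (ring_on R)" using ring_on_cring[OF R] by (simp add: cring_def)
  show "noetherian_ring_axioms (ring_on R)"
  proof
    fix J assume "ideal J (ring_on R)"
    then have J: "ideal_in R J" using ideal_ring_on[OF R] by blast
    from N[unfolded noeth_def, rule_format, OF J] obtain G where G: "finite G" "G \<subseteq> J" "J = igen R G" by (elim exE conjE)
    have "G \<subseteq> R" using G(2) ideal_inD(1)[OF J] by blast
    then have "J = genideal (ring_on R) G" using genideal_ring_on[OF R] G(3) by simp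
    then show "\<exists>A\<subseteq>carrier (ring_on R). finite A \<and> J = Idl\<^bsub>ring_on R\<^esub> A"
      using G(1) \<open>G \<subseteq> R\<close> by auto
  qed
qed

lemma regular_ring_on:
  assumes R: "sring R"
  shows "regular_sequence (ring_on R) xs \<longleftrightarrow> set xs \<subseteq> R \<and>
    (\<forall>i<length xs. \<forall>r\<in>R. xs ! i * r \<in> igen R (set (take i xs)) \<longrightarrow> r \<in> igen R (set (take i xs))) \<and> igen R (set xs) \<noteq> R"
proof (cases "set xs \<subseteq> R")
  case True
  have "genideal (ring_on R) (set (take i xs)) = igen R (set (take i xs))" for i
    using True set_take_subset[of i xs] by (intro genideal_ring_on[OF R]) blast
  then show ?thesis using True genideal_ring_on[OF R True] by (simp add: regular_sequence_def)
qed (simp add: regular_sequence_def)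

lemma igen_take_Suc:
  assumes "sring R" "i < length xs"
  shows "igen R (set (take (Suc i) xs)) = {xs ! i * r + y | r y. r \<in> R \<and> y \<in> igen R (set (take i xs))}"
proof -
  have s: "set (take (Suc i) xs) = insert (xs ! i) (set (take i xs))" using assms(2) by (simp add: take_Suc_conv_app_nth)
  show ?thesis unfolding s
  proof (intro equalityI subsetI)
    fix x assume "x \<in> igen R (insert (xs ! i) (set (take i xs)))"
    from igen_insert[OF assms(1) this] obtain r y where "r \<in> R" "y \<in> igen R (set (take i xs))" "x = r * xs ! i + y" by blast
    then show "x \<in> {xs ! i * r + y | r y. r \<in> R \<and> y \<in> igen R (set (take i xs))}"
      by (intro CollectI exI[of _ r] exI[of _ y]) (simp add: mult.commute)
  next
    fix x assume "x \<in> {xs ! i * r + y | r y. r \<in> R \<and> y \<in> igen R (set (take i xs))}"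
    then obtain r y where h: "r \<in> R" "y \<in> igen R (set (take i xs))" "x = xs ! i * r + y" by blast
    have "y \<in> igen R (insert (xs ! i) (set (take i xs)))" using h(2) igen_mono[OF subset_insertI] by blast
    then have "r * xs ! i + y \<in> igen R (insert (xs ! i) (set (take i xs)))" using h(1) by (intro igen.step) simp_all
    then show "x \<in> igen R (insert (xs ! i) (set (take i xs)))" by (simp add: h(3) mult.commute)
  qed
qed

text \<open>The ideals generated by the initial segments of the sequence are the ladder along which
  \<open>prime_chain\<close> descends.\<close>

lemma regular_sequence_length_le_height:
  assumes R: "sring R" and P: "prime_in R P" and xs: "regular_sequence (ring_on R) xs" "set xs \<subseteq> P"
  shows "enat (length xs) \<le> prime_height (ring_on R) P"
proof -
  note reg = xs(1)[unfolded regular_ring_on[OF R]]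
  have iP: "ideal_in R P" using P by (simp add: prime_in_def)
  have tk: "set (take i xs) \<subseteq> R" for i using reg set_take_subset[of i xs] by blast
  have "\<exists>Ps. length Ps = Suc (length xs) \<and> last Ps = P \<and> sorted_wrt (\<subset>) Ps \<and> (\<forall>Q\<in>set Ps. prime_in R Q)"
  proof (rule prime_chain[OF R, where K = "\<lambda>i. igen R (set (take i xs))" and x = "\<lambda>i. xs ! i"])
    show "ideal_in R (igen R (set (take i xs)))" for i by (rule ideal_in_igen[OF R tk])
    show "xs ! i \<in> igen R (set (take (Suc i) xs))" if "i < length xs" for i
      using that by (intro igen_gen[OF R]) (simp add: take_Suc_conv_app_nth)
    show "igen R (set (take i xs)) \<subseteq> igen R (set (take (Suc i) xs))" for i
      by (intro igen_mono set_take_subset_set_take) simp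
    show "prime_in R P" by (rule P)
    show "igen R (set (take (length xs) xs)) \<subseteq> P" using xs(2) by (simp add: igen_subset[OF iP])
  qed (use reg in blast)
  then obtain Ps where "length Ps = Suc (length xs)" "last Ps = P" "sorted_wrt (\<subset>) Ps" "\<forall>Q\<in>set Ps. prime_in R Q"
    by (elim exE conjE)
  then show ?thesis unfolding prime_height_def
    by (intro SUP_upper2[of Ps]) (auto simp: prime_ring_on[OF R])
qed

lemma binomial_radical:
  assumes R: "sring R" and J: "ideal_in R J" and x: "x \<in> R" "x ^ n \<in> J" and y: "y \<in> R" "y ^ m \<in> J"
  shows "(x + y) ^ (n + m) \<in> J"
  unfolding binomial_ring
proof (rule ideal_in_sum[OF J])
  fix k assume "k \<in> {..n + m}"
  have ofn: "(of_nat b :: 'a) \<in> R" for b by (induction b) (use R in \<open>simp_all add: sring_closed\<close>)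
  have big: "z ^ b \<in> J" if "z \<in> R" "z ^ a \<in> J" "a \<le> b" for z a b
  proof -
    have "z ^ (b - a) * z ^ a \<in> J" using that by (intro ideal_inD(4)[OF J] sring_power[OF R])
    then show ?thesis using that(3) by (simp add: power_add[symmetric])
  qed
  show "of_nat (n + m choose k) * x ^ k * y ^ (n + m - k) \<in> J"
  proof (cases "n \<le> k")
    case True
    have "x ^ k \<in> J" by (rule big[OF x True])
    then show ?thesis by (rule ideal_in_mult_right[OF J sring_power[OF R y(1)] ideal_inD(4)[OF J ofn]])
  next
    case False
    have "y ^ (n + m - k) \<in> J" using False by (intro big[OF y]) simp
    then show ?thesis by (rule ideal_inD(4)[OF J sring_mult[OF R ofn sring_power[OF R x(1)]]])
  qed
qed

lemma radical_sum:
  assumes R: "sring R" and J: "ideal_in R J" and "finite K" "\<And>k. k \<in> K \<Longrightarrow> g k \<in> R \<and> (\<exists>n. g k ^ n \<in> J)"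
  shows "\<exists>n. (sum g K) ^ n \<in> J"
  using assms(3,4)
proof (induction K rule: finite_induct)
  case empty
  then show ?case using ideal_inD(2)[OF J] by (intro exI[of _ 1]) simp
next
  case (insert k K)
  have "sum g K \<in> R" using insert.prems by (intro sring_sum[OF R]) simp
  moreover obtain n where "(sum g K) ^ n \<in> J" using insert by auto
  moreover obtain m where "g k ^ m \<in> J" using insert.prems by auto
  moreover have "g k \<in> R" using insert.prems by simp
  ultimately have "(g k + sum g K) ^ (m + n) \<in> J" by (intro binomial_radical[OF R J])
  then show ?case using insert.hyps by auto
qed

lemma igen_set_coeffs:
  assumes R: "sring R" shows "x \<in> igen R (set xs) \<Longrightarrow>
    \<exists>hs. length hs = length xs \<and> set hs \<subseteq> R \<and> x = (\<Sum>(x, h)\<leftarrow>zip xs hs. x * h)"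
proof (induction xs arbitrary: x)
  case Nil
  then show ?case by (simp add: igen_empty)
next
  case (Cons a xs)
  then obtain r y where ry: "r \<in> R" "y \<in> igen R (set xs)" "x = r * a + y" using igen_insert[OF R, of x a "set xs"] by auto
  obtain hs where "length hs = length xs" "set hs \<subseteq> R" "y = (\<Sum>(x, h)\<leftarrow>zip xs hs. x * h)" using Cons.IH[OF ry(2)] by blast
  then show ?case using ry by (intro exI[of _ "r # hs"]) (simp add: mult.commute)
qed

section \<open>Cohen--Macaulayness of the monoid algebra\<close>

lemma lookup_single_mult:
  fixes u :: "'g::ab_group_add"
  shows "Poly_Mapping.lookup (Poly_Mapping.single u c * p) m = c * Poly_Mapping.lookup p (m - u)"
proof -
  have "Poly_Mapping.single u c * p = (\<Sum>k\<in>Poly_Mapping.keys p. Poly_Mapping.single (u + k) (c * Poly_Mapping.lookup p k))"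
    by (subst pm_sum_single[of p]) (simp add: sum_distrib_left mult_single)
  then have "Poly_Mapping.lookup (Poly_Mapping.single u c * p) m =
      (\<Sum>k\<in>Poly_Mapping.keys p. if k = m - u then c * Poly_Mapping.lookup p k else 0)"
    by (simp add: lookup_sum lookup_single when_def eq_diff_eq add.commute)
  then show ?thesis by (simp add: in_keys_iff)
qed

lemma keys_single_mult:
  fixes u :: "'g::ab_group_add"
  shows "Poly_Mapping.keys (Poly_Mapping.single u c * p) \<subseteq> (\<lambda>k. u + k) ` Poly_Mapping.keys p"
proof
  fix m assume "m \<in> Poly_Mapping.keys (Poly_Mapping.single u c * p)"
  then have "m - u \<in> Poly_Mapping.keys p" by (auto simp: in_keys_iff lookup_single_mult)
  then show "m \<in> (\<lambda>k. u + k) ` Poly_Mapping.keys p" by (rule image_eqI[rotated]) simp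
qed

lemma single_power: "Poly_Mapping.single (s :: int ^ 'd) (c :: 'k::comm_ring_1) ^ n = Poly_Mapping.single (int n *s s) (c ^ n)"
proof (induction n)
  case 0
  have "int 0 *s s = 0" by (simp add: vec_eq_iff)
  then show ?case by simp
next
  case (Suc n)
  have "int (Suc n) *s s = s + int n *s s" by (simp add: vec_eq_iff algebra_simps)
  then show ?case by (simp only: power_Suc Suc mult_single)
qed

context simplicial begin

definition MA :: "(int ^ 'd \<Rightarrow>\<^sub>0 'k::field) set" where "MA = {f. Poly_Mapping.keys f \<subseteq> S}"

definition MI :: "(int ^ 'd) set \<Rightarrow> (int ^ 'd \<Rightarrow>\<^sub>0 'k::field) set" where "MI T = {f. Poly_Mapping.keys f \<subseteq> T}"

lemma monoid_algebra_eq: "monoid_algebra S = ring_on MA"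
  by (simp add: monoid_algebra_def ring_on_def MA_def)

lemma sring_MA: "sring (MA :: (int ^ 'd \<Rightarrow>\<^sub>0 'k::field) set)"
  unfolding sring_def
proof (intro conjI ballI)
  show "1 \<in> (MA :: (int ^ 'd \<Rightarrow>\<^sub>0 'k) set)" by (simp add: MA_def S_0)
  fix x y :: "int ^ 'd \<Rightarrow>\<^sub>0 'k" assume xy: "x \<in> MA" "y \<in> MA"
  show "x - y \<in> MA" using xy keys_diff[of x y] unfolding MA_def by blast
  show "x * y \<in> MA" unfolding MA_def
  proof (intro CollectI subsetI)
    fix m assume "m \<in> Poly_Mapping.keys (x * y)"
    then obtain a b where "m = a + b" "a \<in> Poly_Mapping.keys x" "b \<in> Poly_Mapping.keys y" using keys_mult by blast
    then show "m \<in> S" using xy unfolding MA_def by (auto intro: S_add)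
  qed
qed

lemma MI_ideal:
  assumes "T \<subseteq> S" "\<And>s t. s \<in> S \<Longrightarrow> t \<in> T \<Longrightarrow> s + t \<in> T"
  shows "ideal_in (MA :: (int ^ 'd \<Rightarrow>\<^sub>0 'k::field) set) (MI T)"
  unfolding ideal_in_def
proof (intro conjI ballI)
  show "MI T \<subseteq> (MA :: (int ^ 'd \<Rightarrow>\<^sub>0 'k::field) set)" using assms(1) unfolding MI_def MA_def by blast
  show "(0 :: int ^ 'd \<Rightarrow>\<^sub>0 'k) \<in> MI T" by (simp add: MI_def)
next
  fix x y :: "int ^ 'd \<Rightarrow>\<^sub>0 'k" assume "x \<in> MI T" "y \<in> MI T"
  then show "x + y \<in> MI T" using keys_add[of x y] unfolding MI_def by blast
next
  fix r x :: "int ^ 'd \<Rightarrow>\<^sub>0 'k" assume rx: "r \<in> MA" "x \<in> MI T"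
  show "r * x \<in> MI T" unfolding MI_def
  proof (intro CollectI subsetI)
    fix m assume "m \<in> Poly_Mapping.keys (r * x)"
    then obtain a b where "m = a + b" "a \<in> Poly_Mapping.keys r" "b \<in> Poly_Mapping.keys x" using keys_mult by blast
    then show "m \<in> T" using rx assms(2) unfolding MI_def MA_def by blast
  qed
qed

lemma single_MA: "s \<in> S \<Longrightarrow> Poly_Mapping.single s c \<in> MA"
  by (simp add: MA_def)

definition iota :: "'k::field \<Rightarrow> (int ^ 'd \<Rightarrow>\<^sub>0 'k)" where "iota c = Poly_Mapping.single 0 c"

lemma ring_hom_iota: "ring_hom_into iota MA"
  by (auto simp: ring_hom_into_def iota_def single_add mult_single single_MA S_0)

definition m0 :: "(int ^ 'd \<Rightarrow>\<^sub>0 'k::field) set" where "m0 = MI (S - {0})"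

lemma S_pointed: "s \<in> S \<Longrightarrow> t \<in> S \<Longrightarrow> s + t = 0 \<Longrightarrow> t = 0"
  using deg_add[of s t] deg_0_iff[of t] deg_0_iff[OF S_0] by simp

lemma m0_ideal: "ideal_in MA (m0 :: (int ^ 'd \<Rightarrow>\<^sub>0 'k::field) set)"
  unfolding m0_def by (rule MI_ideal) (auto intro: S_add dest: S_pointed)

lemma m0_maximal: "maximal_in MA (m0 :: (int ^ 'd \<Rightarrow>\<^sub>0 'k::field) set)"
  unfolding maximal_in_def
proof (intro conjI ballI impI)
  show "ideal_in MA (m0 :: (int ^ 'd \<Rightarrow>\<^sub>0 'k) set)" by (rule m0_ideal)
  show "(1 :: int ^ 'd \<Rightarrow>\<^sub>0 'k) \<notin> m0" by (simp add: m0_def MI_def)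
  fix x :: "int ^ 'd \<Rightarrow>\<^sub>0 'k" assume x: "x \<in> MA" "x \<notin> m0"
  define c where "c = Poly_Mapping.lookup x 0"
  have "0 \<in> Poly_Mapping.keys x" using x unfolding MA_def m0_def MI_def by blast
  then have c: "c \<noteq> 0" by (simp add: c_def in_keys_iff)
  have "x * iota (inverse c) - 1 \<in> m0"
    unfolding m0_def MI_def
  proof (intro CollectI subsetI)
    fix m assume m: "m \<in> Poly_Mapping.keys (x * iota (inverse c) - 1)"
    have l: "Poly_Mapping.lookup (x * iota (inverse c) - 1) m = inverse c * Poly_Mapping.lookup x m - (1 when m = 0)"
      using keys_single_0_mult[of "inverse c" x m] by (simp add: iota_def lookup_minus lookup_one mult.commute)
    have "m \<noteq> 0"
    proof
      assume "m = 0"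
      then have "Poly_Mapping.lookup (x * iota (inverse c) - 1) m = 0" unfolding l using c by (simp add: c_def)
      then show False using m by (simp add: in_keys_iff)
    qed
    then have "Poly_Mapping.lookup x m \<noteq> 0" using m unfolding in_keys_iff l by auto
    then have "m \<in> S" using x(1) unfolding MA_def by (auto simp: in_keys_iff)
    then show "m \<in> S - {0}" using \<open>m \<noteq> 0\<close> by simp
  qed
  then show "\<exists>u\<in>MA. x * u - 1 \<in> m0" by (intro bexI[of _ "iota (inverse c)"]) (simp_all add: iota_def single_MA S_0)
qed

text \<open>\<open>T i\<close> consists of the monoid elements outside the face on which the first
  \<open>i\<close> coordinates vanish. Modulo the ideal of \<open>T i\<close> the next vertex
  monomial is a nonzerodivisor, since adding that vertex does not change the first \<open>i\<close>
  coordinates.\<close>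

lemma height_m0: "enat (CARD('d)) \<le> prime_height (ring_on MA) (m0 :: (int ^ 'd \<Rightarrow>\<^sub>0 'k::field) set)"
proof -
  obtain e :: "nat \<Rightarrow> 'd" where e: "bij_betw e {..<CARD('d)} UNIV"
    using ex_bij_betw_nat_finite[of "UNIV :: 'd set"] by (auto simp: atLeast0LessThan)
  define T where "T i = {s\<in>S. \<exists>l<i. cc (e l) s > 0}" for i
  have "\<exists>Ps. length Ps = Suc (CARD('d)) \<and> last Ps = (m0 :: (int ^ 'd \<Rightarrow>\<^sub>0 'k) set) \<and>
      sorted_wrt (\<subset>) Ps \<and> (\<forall>Q\<in>set Ps. prime_in MA Q)"
  proof (rule prime_chain[OF sring_MA, where K = "\<lambda>i. MI (T i)" and x = "\<lambda>i. Poly_Mapping.single (V (e i)) 1"])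
    fix i assume "i \<le> CARD('d)"
    show "ideal_in MA (MI (T i) :: (int ^ 'd \<Rightarrow>\<^sub>0 'k) set)"
    proof (rule MI_ideal)
      fix s t assume "s \<in> S" "t \<in> T i"
      then show "s + t \<in> T i" using S_cc_nonneg[of s] unfolding T_def by (auto intro: S_add simp: cc_add add_nonneg_pos)
    qed (auto simp: T_def)
  next
    fix i assume "i < CARD('d)"
    show "(Poly_Mapping.single (V (e i)) 1 :: int ^ 'd \<Rightarrow>\<^sub>0 'k) \<in> MI (T (Suc i))"
      unfolding MI_def T_def using cc_vert[of "e i" "e i"] S_col by auto
    show "MI (T i) \<subseteq> (MI (T (Suc i)) :: (int ^ 'd \<Rightarrow>\<^sub>0 'k) set)"
      unfolding MI_def T_def using less_SucI by blast
  next
    fix i and r :: "int ^ 'd \<Rightarrow>\<^sub>0 'k"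
    assume i: "i < CARD('d)" and r: "r \<in> MA" "Poly_Mapping.single (V (e i)) 1 * r \<in> MI (T i)"
    show "r \<in> MI (T i)" unfolding MI_def
    proof (intro CollectI subsetI)
      fix s assume s: "s \<in> Poly_Mapping.keys r"
      then have "V (e i) + s \<in> Poly_Mapping.keys (Poly_Mapping.single (V (e i)) 1 * r)"
        by (simp add: in_keys_iff lookup_single_mult)
      then have "V (e i) + s \<in> T i" using r(2) unfolding MI_def by blast
      then obtain l where l: "l < i" "cc (e l) (V (e i) + s) > 0" unfolding T_def by blast
      have "e l \<noteq> e i" using e i l(1) unfolding bij_betw_def inj_on_def by auto
      then have "cc (e l) s > 0" using l(2) by (simp add: cc_add cc_vert)
      then show "s \<in> T i" unfolding T_def using s r(1) l(1) unfolding MA_def by blast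
    qed
  next
    show "prime_in MA (m0 :: (int ^ 'd \<Rightarrow>\<^sub>0 'k) set)" by (rule maximal_in_prime[OF sring_MA m0_maximal])
    have "T (CARD('d)) \<subseteq> S - {0}" unfolding T_def by (auto simp: cc_0)
    then show "MI (T CARD('d)) \<subseteq> (m0 :: (int ^ 'd \<Rightarrow>\<^sub>0 'k) set)" unfolding m0_def MI_def by blast
  qed
  then obtain Ps where "length Ps = Suc (CARD('d))" "last Ps = (m0 :: (int ^ 'd \<Rightarrow>\<^sub>0 'k) set)"
    "sorted_wrt (\<subset>) Ps" "\<forall>Q\<in>set Ps. prime_in MA Q" by (elim exE conjE)
  then show ?thesis unfolding prime_height_def
    by (intro SUP_upper2[of Ps]) (auto simp: prime_ring_on[OF sring_MA])
qed

text \<open>A suitable multiple of any nonzero element of \<open>S\<close> is a nonzero element of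
  the vertex monoid, so a power of its monomial is divisible by the required power of some vertex
  monomial. Sums of such monomials follow by the binomial theorem.\<close>

lemma m0_radical:
  fixes f :: "int ^ 'd \<Rightarrow>\<^sub>0 'k::field"
  assumes J: "ideal_in MA J" and V: "\<And>l. \<exists>n. Poly_Mapping.single (int n *s V l) (1 :: 'k) \<in> J" and f: "f \<in> m0"
  shows "\<exists>n. f ^ n \<in> J"
proof -
  have "\<forall>l. \<exists>n. Poly_Mapping.single (int n *s V l) (1 :: 'k) \<in> J" using V by blast
  from choice[OF this] obtain k where k: "\<And>l. Poly_Mapping.single (int (k l) *s V l) (1 :: 'k) \<in> J" by blast
  define M where "M = Max (range k)"
  have kM: "k l \<le> M" for l unfolding M_def by (rule Max_ge) auto
  have mono: "\<exists>n. Poly_Mapping.single s c ^ n \<in> J" if s: "s \<in> S" "s \<noteq> 0" for s and c :: 'k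
  proof -
    obtain w where w: "\<And>l. 0 \<le> w l" "int NN *s s = lat w" using NN_S[OF s(1)] by blast
    have "hh (int NN *s s) \<noteq> 0" using s NN(1) deg_0_iff[OF s(1)] hh_deg[OF s(1)] by (simp add: hh_smult)
    then have "w \<noteq> (\<lambda>_. 0)" using w(2) lat_0 hh_0 by auto
    from pos_entry[OF w(1) this] obtain l where l: "0 < w l" ..
    \<comment> \<open>What is left of \<open>M * NN\<close> copies of \<open>s\<close> after taking
      out \<open>k l\<close> copies of \<open>V l\<close>; it is nonnegative because
      \<open>w l\<close> is at least 1 and \<open>M\<close> bounds all \<open>k\<close>.\<close>
    define z where "z = (\<lambda>m. int M * w m - (if m = l then int (k l) else 0))"
    have z0: "0 \<le> z m" for m
    proof (cases "m = l")
      case True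
      have "int M * 1 \<le> int M * w l" using l by (intro mult_left_mono) simp_all
      then show ?thesis using True kM[of l] by (simp add: z_def)
    qed (simp add: z_def w(1))
    have eq: "int (M * NN) *s s = int (k l) *s V l + lat z"
    proof (rule cc_eqI)
      fix m
      have h: "of_nat NN * cc m s = of_int (w m)" using arg_cong[OF w(2), of "cc m"] by (simp add: cc_smult cc_lat)
      have "cc m (int (M * NN) *s s) = of_nat M * (of_nat NN * cc m s)" by (simp add: cc_smult)
      also have "\<dots> = cc m (int (k l) *s V l + lat z)"
        unfolding h by (simp add: cc_add cc_smult cc_lat cc_vert z_def)
      finally show "cc m (int (M * NN) *s s) = cc m (int (k l) *s V l + lat z)" .
    qed
    have "lat z \<in> S" using S_lat[OF S_0, of z] z0 by simp
    then have "Poly_Mapping.single (lat z) (c ^ (M * NN)) * Poly_Mapping.single (int (k l) *s V l) 1 \<in> J"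
      using k by (intro ideal_inD(4)[OF J] single_MA)
    then have "Poly_Mapping.single s c ^ (M * NN) \<in> J"
      unfolding single_power eq by (simp add: mult_single add.commute)
    then show ?thesis by blast
  qed
  have "\<exists>n. (\<Sum>s\<in>Poly_Mapping.keys f. Poly_Mapping.single s (Poly_Mapping.lookup f s)) ^ n \<in> J"
    using f by (intro radical_sum[OF sring_MA J]) (auto simp: m0_def MI_def intro!: single_MA mono)
  then show ?thesis by (simp flip: pm_sum_single)
qed

text \<open>The monomials of \<open>z + V j\<close> and \<open>z + V i\<close> give a syzygy between
  the two vertex monomials. By \<open>koszul_syzygy\<close> the monomial of \<open>z + V j\<close>
  lies in the ideal of the monomial of \<open>V j\<close> and the \<open>M\<close>-th powers for the
  remaining vertices. It cannot come from the former, as \<open>z\<close> is not in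
  \<open>S\<close>, nor from the latter, by the choice of \<open>M\<close>.\<close>

theorem cohen_macaulay_imp_star:
  assumes CM: "cohen_macaulay (monoid_algebra S :: (int ^ 'd \<Rightarrow>\<^sub>0 'k::field) ring)"
  shows star
  unfolding star_def
proof (intro ballI allI impI, rule ccontr)
  fix z i j assume z: "z \<in> ZA" and ij: "i \<noteq> j" and zi: "z + V i \<in> S" and zj: "z + V j \<in> S" and zS: "z \<notin> S"
  let ?R = "MA :: (int ^ 'd \<Rightarrow>\<^sub>0 'k) set" and ?m = "m0 :: (int ^ 'd \<Rightarrow>\<^sub>0 'k) set"
  note R = sring_MA[where 'k = 'k]
  have "ideal_depth (ring_on ?R) ?m = prime_height (ring_on ?R) ?m"
    using CM m0_maximal[where 'k = 'k] unfolding cohen_macaulay_def monoid_algebra_eq maximal_ring_on[OF R, symmetric] by blast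
  then have dep: "enat (CARD('d)) \<le> ideal_depth (ring_on ?R) ?m" using height_m0[where 'k = 'k] by simp
  \<comment> \<open>The depth is a supremum in \<open>enat\<close>. If all lengths stayed below
    \<open>d\<close>, it would be at most \<open>d - 1\<close>, which is less than \<open>d\<close>
    because \<open>d\<close> is positive.\<close>
  have "\<exists>xs. regular_sequence (ring_on ?R) xs \<and> set xs \<subseteq> ?m \<and> CARD('d) \<le> length xs"
  proof (rule ccontr)
    assume no: "\<not> ?thesis"
    have "ideal_depth (ring_on ?R) ?m \<le> enat (CARD('d) - 1)"
      unfolding ideal_depth_def
    proof (rule SUP_least)
      fix xs assume "xs \<in> {xs. regular_sequence (ring_on ?R) xs \<and> set xs \<subseteq> ?m}"
      then have "\<not> CARD('d) \<le> length xs" using no by blast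
      then show "enat (length xs) \<le> enat (CARD('d) - 1)" by simp
    qed
    then have "enat (CARD('d)) \<le> enat (CARD('d) - 1)" using dep by (rule order_trans[rotated])
    then have "CARD('d) \<le> CARD('d) - 1" by (simp only: enat_ord_simps)
    then show False using zero_less_card_finite[where 'a = 'd] by linarith
  qed
  then obtain xs where xs: "regular_sequence (ring_on ?R) xs" "set xs \<subseteq> ?m" "CARD('d) \<le> length xs"
    by (elim exE conjE)
  note reg = xs(1)[unfolded regular_ring_on[OF R]]
  \<comment> \<open>Exceeding all coordinates of \<open>z\<close>, this \<open>M\<close> gives
    \<open>z + V j - M V l\<close> a negative coordinate at every vertex \<open>l\<close> other than
    \<open>i\<close> and \<open>j\<close>.\<close>
  obtain M where M: "\<And>l. cc l z < of_nat M"
  proof -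
    define M where "M = nat (\<lceil>Max (range (\<lambda>l. cc l z))\<rceil> + 1)"
    have "cc l z < of_nat M" for l
    proof -
      have "cc l z \<le> Max (range (\<lambda>l. cc l z))" by (rule Max_ge) auto
      also have "\<dots> \<le> of_int \<lceil>Max (range (\<lambda>l. cc l z))\<rceil>" by (rule le_of_int_ceiling)
      also have "\<dots> < of_int (\<lceil>Max (range (\<lambda>l. cc l z))\<rceil> + 1)" by simp
      also have "\<dots> \<le> of_int (int M)" unfolding of_int_le_iff M_def int_nat_eq by simp
      finally show ?thesis by simp
    qed
    then show ?thesis by (rule that)
  qed
  have fin: "finite (UNIV - {i, j})" by simp
  from finite_distinct_list[OF fin] obtain ls where ls: "set ls = UNIV - {i, j}" "distinct ls" by (elim exE conjE)
  define rest where "rest = map (\<lambda>l. Poly_Mapping.single (int M *s V l) (1 :: 'k)) ls"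
  let ?x0 = "Poly_Mapping.single (V i) (1 :: 'k)" and ?x1 = "Poly_Mapping.single (V j) (1 :: 'k)"
  let ?y1 = "Poly_Mapping.single (z + V j) (1 :: 'k)" and ?y2 = "Poly_Mapping.single (z + V i) (1 :: 'k)"
  have lenls: "length ls = CARD('d) - 2" using distinct_card[OF ls(2)] ls(1) ij by (simp add: card_Diff_subset)
  have "card {i, j} \<le> CARD('d)" by (rule card_mono) simp_all
  then have len: "length (?x0 # ?x1 # rest) = CARD('d)" using lenls ij by (simp add: rest_def)
  have xR: "set (?x0 # ?x1 # rest) \<subseteq> ?R" by (auto simp: rest_def intro!: single_MA S_col S_smult)
  have tk: "set (take k xs) \<subseteq> ?R" for k using reg set_take_subset[of k xs] by blast
  have "\<exists>r\<in>?R. \<exists>y\<in>igen ?R (set rest). ?y1 = ?x1 * r + y"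
  proof (rule koszul_syzygy[where R = ?R and J = "\<lambda>k. igen ?R (set (take k xs))" and f = "\<lambda>k. xs ! k", OF R xR len[symmetric]])
    show "ideal_in ?R (igen ?R (set (take k xs)))" for k by (rule ideal_in_igen[OF R tk])
    show "igen ?R (set (take 0 xs)) = {0}" by (simp add: igen_empty)
    fix k assume k: "k < CARD('d)"
    then have k': "k < length xs" using xs(3) by simp
    show "xs ! k \<in> ?R" using k' reg nth_mem by blast
    show "igen ?R (set (take (Suc k) xs)) = {xs ! k * r + y | r y. r \<in> ?R \<and> y \<in> igen ?R (set (take k xs))}"
      by (rule igen_take_Suc[OF R k'])
    show "xs ! k * r \<in> igen ?R (set (take k xs)) \<Longrightarrow> r \<in> igen ?R (set (take k xs))" if "r \<in> ?R" for r
      using reg k' that by blast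
    have J: "ideal_in ?R (igen ?R (set (?x0 # ?x1 # rest)))" by (rule ideal_in_igen[OF R xR])
    have "\<exists>N. (xs ! k) ^ N \<in> igen ?R (set (?x0 # ?x1 # rest))"
    proof (rule m0_radical[OF J])
      fix l
      have one: "int 1 *s V m = V m" for m by (simp add: vec_eq_iff)
      consider "l = i" | "l = j" | "l \<in> set ls" using ls(1) by blast
      then show "\<exists>n. Poly_Mapping.single (int n *s V l) (1 :: 'k) \<in> igen ?R (set (?x0 # ?x1 # rest))"
      proof cases
        case 1 then show ?thesis by (intro exI[of _ 1] igen_gen[OF R]) (simp only: one, simp)
      next
        case 2 then show ?thesis by (intro exI[of _ 1] igen_gen[OF R]) (simp only: one, simp)
      next
        case 3 then show ?thesis by (intro exI[of _ M] igen_gen[OF R]) (simp add: rest_def)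
      qed
      show "xs ! k \<in> ?m" using xs(2) k' nth_mem by blast
    qed
    then obtain N where "(xs ! k) ^ N \<in> igen ?R (set (?x0 # ?x1 # rest))" ..
    from igen_set_coeffs[OF R this] obtain hs where "length hs = length (?x0 # ?x1 # rest)" "set hs \<subseteq> ?R"
      "(xs ! k) ^ N = (\<Sum>(x, h)\<leftarrow>zip (?x0 # ?x1 # rest) hs. x * h)" by (elim exE conjE)
    then show "\<exists>N hs. length hs = CARD('d) \<and> set hs \<subseteq> ?R \<and> (xs ! k) ^ N = (\<Sum>(x, h)\<leftarrow>zip (?x0 # ?x1 # rest) hs. x * h)"
      unfolding len by blast
  next
    show "?y1 \<in> ?R" "?y2 \<in> ?R" using zi zj by (simp_all add: single_MA)
    show "?x0 * ?y1 = ?x1 * ?y2" by (simp add: mult_single add_ac)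
  qed
  then obtain r y where ry: "r \<in> ?R" "y \<in> igen ?R (set rest)" "?y1 = ?x1 * r + y" by blast
  \<comment> \<open>The monomials of the ideal generated by \<open>rest\<close>: those divisible by
    one of the powers.\<close>
  define T where "T = {s\<in>S. \<exists>l\<in>set ls. s - int M *s V l \<in> S}"
  have "igen ?R (set rest) \<subseteq> MI T"
  proof (rule igen_subset)
    show "ideal_in ?R (MI T)"
    proof (rule MI_ideal)
      fix s t assume s: "s \<in> S" and "t \<in> T"
      then obtain l where t: "t \<in> S" "l \<in> set ls" "t - int M *s V l \<in> S" unfolding T_def by blast
      have "s + (t - int M *s V l) \<in> S" by (rule S_add[OF s t(3)])
      then show "s + t \<in> T" unfolding T_def using t(2) S_add[OF s t(1)] by (auto simp: add_diff_eq)
    qed (auto simp: T_def)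
    have "int M *s V l \<in> T" if "l \<in> set ls" for l
      unfolding T_def using that S_smult[OF S_col] S_0 by (intro CollectI conjI bexI[of _ l]) simp_all
    then show "set rest \<subseteq> MI T" by (auto simp: rest_def MI_def)
  qed
  then have yT: "Poly_Mapping.keys y \<subseteq> T" using ry(2) unfolding MI_def by blast
  have "z + V j \<notin> T"
  proof
    assume "z + V j \<in> T"
    then obtain l where l: "l \<in> set ls" "z + V j - int M *s V l \<in> S" unfolding T_def by blast
    then have "0 \<le> cc l (z + V j - int M *s V l)" by (intro S_cc_nonneg)
    then show False using M[of l] l(1) ls(1) by (simp add: cc_add cc_diff cc_smult cc_vert)
  qed
  then have "Poly_Mapping.lookup y (z + V j) = 0" using yT by (auto simp: in_keys_iff)
  moreover have "Poly_Mapping.lookup r z = 0" using ry(1) zS unfolding MA_def by (auto simp: in_keys_iff)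
  ultimately have "Poly_Mapping.lookup (?x1 * r + y) (z + V j) = 0" by (simp add: lookup_add lookup_single_mult)
  then have "Poly_Mapping.lookup ?y1 (z + V j) = 0" using ry(3) by (simp only:)
  then show False by simp
qed

end

section \<open>From \<open>star\<close> to the Cohen-Macaulay property\<close>

context simplicial begin

definition gens :: "(int ^ 'd \<Rightarrow>\<^sub>0 'k::field) set" where "gens = range (\<lambda>j. Poly_Mapping.single (a j) 1)"

lemma MA_hull: "(MA :: (int ^ 'd \<Rightarrow>\<^sub>0 'k::field) set) = alg_hull (range iota \<union> gens)"
proof
  have "range iota \<union> gens \<subseteq> (MA :: (int ^ 'd \<Rightarrow>\<^sub>0 'k) set)"
    by (auto simp: gens_def iota_def intro!: single_MA S_0 S_col)
  then show "alg_hull (range iota \<union> gens) \<subseteq> (MA :: (int ^ 'd \<Rightarrow>\<^sub>0 'k) set)" by (rule alg_hull_subset[OF sring_MA])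
  let ?H = "alg_hull (range iota \<union> gens) :: (int ^ 'd \<Rightarrow>\<^sub>0 'k) set"
  have "iota (-1) = (-1 :: int ^ 'd \<Rightarrow>\<^sub>0 'k)" by (simp add: iota_def single_uminus)
  then have H: "sring ?H" by (intro sring_alg_hull) (metis UnI1 rangeI)
  have mono: "Poly_Mapping.single (\<Sum>j\<in>J. int (u j) *s a j) 1 \<in> ?H" for u J
  proof (induction J rule: infinite_finite_induct)
    case (insert j J)
    have "Poly_Mapping.single (a j) 1 \<in> ?H" by (intro alg_hull_gen) (simp add: gens_def)
    then have "Poly_Mapping.single (a j) 1 ^ u j * Poly_Mapping.single (\<Sum>j\<in>J. int (u j) *s a j) 1 \<in> ?H"
      using insert by (intro sring_mult[OF H] sring_power[OF H])
    then show ?case using insert by (simp add: single_power mult_single)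
  qed (simp_all add: sring_one[OF H])
  show "MA \<subseteq> ?H"
  proof
    fix f :: "int ^ 'd \<Rightarrow>\<^sub>0 'k" assume f: "f \<in> MA"
    have "(\<Sum>s\<in>Poly_Mapping.keys f. Poly_Mapping.single s (Poly_Mapping.lookup f s)) \<in> ?H"
    proof (rule sring_sum[OF H])
      fix s assume "s \<in> Poly_Mapping.keys f"
      then have "s \<in> S" using f unfolding MA_def by blast
      then obtain u where u: "s = (\<Sum>j\<in>UNIV. int (u j) *s a j)" by (rule S_E)
      have "iota (Poly_Mapping.lookup f s) * Poly_Mapping.single s 1 \<in> ?H"
        unfolding u by (intro sring_mult[OF H] alg_hull_gen mono) simp
      then show "Poly_Mapping.single s (Poly_Mapping.lookup f s) \<in> ?H" by (simp add: iota_def mult_single)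
    qed
    then show "f \<in> ?H" by (simp flip: pm_sum_single)
  qed
qed

lemma noeth_MA: "noeth (MA :: (int ^ 'd \<Rightarrow>\<^sub>0 'k::field) set)"
  unfolding MA_hull
proof (rule noeth_alg_hull)
  show "finite (gens :: (int ^ 'd \<Rightarrow>\<^sub>0 'k) set)" by (simp add: gens_def)
  show "sring (range iota :: (int ^ 'd \<Rightarrow>\<^sub>0 'k) set)"
    unfolding sring_def
  proof (intro conjI ballI)
    show "1 \<in> (range iota :: (int ^ 'd \<Rightarrow>\<^sub>0 'k) set)" by (rule range_eqI[of _ _ 1]) (simp add: iota_def)
    fix x y :: "int ^ 'd \<Rightarrow>\<^sub>0 'k" assume "x \<in> range iota" "y \<in> range iota"
    then obtain b c where bc: "x = iota b" "y = iota c" by blast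
    show "x - y \<in> range iota" unfolding bc by (rule range_eqI[of _ _ "b - c"]) (simp add: iota_def single_diff)
    show "x * y \<in> range iota" unfolding bc by (rule range_eqI[of _ _ "b * c"]) (simp add: iota_def mult_single)
  qed
  fix x :: "int ^ 'd \<Rightarrow>\<^sub>0 'k" assume "x \<in> range iota" "x \<noteq> 0"
  then obtain c where c: "x = iota c" by blast
  then have "c \<noteq> 0" using \<open>x \<noteq> 0\<close> by (auto simp: iota_def)
  with c show "\<exists>y\<in>range iota. y * x = 1" by (intro bexI[of _ "iota (inverse c)"]) (simp_all add: iota_def mult_single)
qed

text \<open>A chain of \<open>d + 2\<close> primes supplies \<open>d + 1\<close> elements, each in
  one prime but not in the preceding one. By \<open>no_relation\<close> they are independent modulo
  the smallest prime, yet any \<open>d + 1\<close> elements of the algebra are dependent.\<close>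

lemma height_le:
  assumes P: "prime_in MA (P :: (int ^ 'd \<Rightarrow>\<^sub>0 'k::field) set)"
  shows "prime_height (ring_on MA) P \<le> enat (CARD('d))"
  unfolding prime_height_def
proof (rule SUP_least)
  fix Ps :: "(int ^ 'd \<Rightarrow>\<^sub>0 'k) set list"
  assume "Ps \<in> {Ps. Ps \<noteq> [] \<and> last Ps = P \<and> sorted_wrt (\<subset>) Ps \<and> (\<forall>Q\<in>set Ps. primeideal Q (ring_on MA))}"
  then have srt: "sorted_wrt (\<subset>) Ps" and pr: "\<And>Q. Q \<in> set Ps \<Longrightarrow> prime_in MA Q"
    by (simp_all add: prime_ring_on[OF sring_MA])
  show "enat (length Ps - 1) \<le> enat (CARD('d))"
  proof (rule ccontr)
    assume "\<not> ?thesis"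
    then have len: "Suc (CARD('d)) < length Ps" by simp
    have "\<exists>x. x \<in> Ps ! Suc i \<and> x \<notin> Ps ! i" if "i \<le> CARD('d)" for i
      using sorted_wrt_nth_less[OF srt, of i "Suc i"] that len by auto
    then have "\<forall>i. \<exists>x. i \<le> CARD('d) \<longrightarrow> x \<in> Ps ! Suc i \<and> x \<notin> Ps ! i" by blast
    from choice[OF this] obtain x where x: "\<And>i. i \<le> CARD('d) \<Longrightarrow> x i \<in> Ps ! Suc i \<and> x i \<notin> Ps ! i" by blast
    define xs where "xs = map x [0..<Suc (CARD('d))]"
    have lxs: "length xs = Suc (CARD('d))" by (simp add: xs_def)
    obtain B c where B: "finite B" "B \<noteq> {}" "\<forall>\<alpha>\<in>B. length \<alpha> = length xs \<and> c \<alpha> \<noteq> 0"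
      "(\<Sum>\<alpha>\<in>B. Poly_Mapping.single 0 (c \<alpha>) * mon xs \<alpha>) = 0"
      using algebraically_dependent[OF lxs] by (elim exE conjE)
    have "(\<Sum>\<alpha>\<in>B. iota (c \<alpha>) * mon xs \<alpha>) \<notin> Ps ! 0"
    proof (rule no_relation[OF sring_MA ring_hom_iota, where P = "\<lambda>i. Ps ! i"])
      fix i assume "i \<le> length xs"
      then show "prime_in MA (Ps ! i)" using len lxs by (intro pr nth_mem) simp
    next
      fix i assume "i < length xs"
      then have i: "i \<le> CARD('d)" using lxs by simp
      have "xs ! i = x i" using \<open>i < length xs\<close> lxs unfolding xs_def by (simp del: upt_Suc)
      moreover have "Ps ! i \<subset> Ps ! Suc i" using i len by (intro sorted_wrt_nth_less[OF srt]) simp_all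
      ultimately show "xs ! i \<in> Ps ! Suc i \<and> xs ! i \<notin> Ps ! i \<and> Ps ! i \<subseteq> Ps ! Suc i" using x[OF i] by simp
    qed (use B in auto)
    moreover have "Ps ! 0 \<in> set Ps" by (rule nth_mem) (use len in linarith)
    then have "ideal_in MA (Ps ! 0)" using pr unfolding prime_in_def by blast
    ultimately show False using B(4) ideal_inD(2)[of MA "Ps ! 0"] by (simp add: iota_def)
  qed
qed

text \<open>The possible remainders for division by a polynomial of degree \<open>n\<close> that is
  monic in the vertex monomial of \<open>l\<close>: no term is divisible by the leading
  monomial.\<close>

definition low :: "'d \<Rightarrow> nat \<Rightarrow> (int ^ 'd \<Rightarrow>\<^sub>0 'k::field) set" where
  "low l n = {f\<in>MA. \<forall>s\<in>Poly_Mapping.keys f. s - int n *s V l \<notin> S}"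

definition monic :: "'d \<Rightarrow> nat \<Rightarrow> (nat \<Rightarrow> 'k) \<Rightarrow> (int ^ 'd \<Rightarrow>\<^sub>0 'k::field)" where
  "monic l n c = Poly_Mapping.single (int n *s V l) 1 + (\<Sum>i<n. Poly_Mapping.single (int i *s V l) (c i))"

lemma monic_MA: "monic l n c \<in> MA"
  unfolding monic_def by (intro sring_add[OF sring_MA] sring_sum[OF sring_MA] single_MA S_smult S_col)

lemma low_add: "f \<in> low l n \<Longrightarrow> g \<in> low l n \<Longrightarrow> f + g \<in> low l n"
  unfolding low_def using keys_add[of f g] sring_add[OF sring_MA, of f g] by blast

lemma low_0: "0 \<in> low l n" by (simp add: low_def sring_zero[OF sring_MA])

lemma low_sum: "(\<And>i. i \<in> I \<Longrightarrow> f i \<in> low l n) \<Longrightarrow> sum f I \<in> low l n"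
  by (induction I rule: infinite_finite_induct) (simp_all add: low_0 low_add)

text \<open>This is \<open>star_between\<close> based at \<open>s - n V l\<close>: from there
  \<open>S\<close> is reached both by multiples of \<open>V l\<close> and by multiples of
  \<open>V l'\<close>. Hence adding another vertex never creates divisibility by multiples of
  \<open>V l\<close>.\<close>

lemma star_shift:
  assumes star "l \<noteq> l'" "s \<in> S" "s + int i *s V l' - int n *s V l \<in> S"
  shows "s - int n *s V l \<in> S"
proof (rule star_between[OF assms(1), where p = "\<lambda>m. if m = l then int n else 0" and q = "\<lambda>m. if m = l' then int i else 0"])
  show "s - int n *s V l \<in> ZA" using assms(3) by (intro ZA_diff ZA_smult S_ZA S_col assms(3))
  show "s - int n *s V l + lat (\<lambda>m. if m = l then int n else 0) \<in> S" using assms(3) by (simp add: lat_unit)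
  show "s - int n *s V l + lat (\<lambda>m. if m = l' then int i else 0) \<in> S" using assms(4) by (simp add: lat_unit algebra_simps)
qed (use assms(2) in auto)

lemma low_single_mult:
  assumes star "l \<noteq> l'" "g \<in> low l n"
  shows "Poly_Mapping.single (int i *s V l') c * g \<in> low l n"
  unfolding low_def
proof (intro CollectI conjI ballI)
  have g: "g \<in> MA" using assms(3) by (simp add: low_def)
  show "Poly_Mapping.single (int i *s V l') c * g \<in> MA"
    using g by (intro sring_mult[OF sring_MA] single_MA S_smult S_col)
  fix s assume "s \<in> Poly_Mapping.keys (Poly_Mapping.single (int i *s V l') c * g)"
  then obtain t where t: "t \<in> Poly_Mapping.keys g" "s = int i *s V l' + t" using keys_single_mult by blast
  have "t \<in> S" "t - int n *s V l \<notin> S" using t(1) assms(3) g by (auto simp: low_def MA_def)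
  then show "s - int n *s V l \<notin> S" using star_shift[OF assms(1,2), of t i n] t(2) by (auto simp: add.commute)
qed

lemma low_monic_mult:
  assumes star "l \<noteq> l'" "g \<in> low l n"
  shows "monic l' k c * g \<in> low l n"
  unfolding monic_def distrib_right sum_distrib_right
  using assms by (intro low_add low_sum low_single_mult)

text \<open>A monomial divisible by the leading one is traded for monomials of smaller degree, since
  the other terms of \<open>monic l n c\<close> involve fewer copies of \<open>V l\<close>.
  Induction on the degree ends at remainders.\<close>

lemma division:
  fixes c :: "nat \<Rightarrow> 'k::field"
  assumes "r \<in> MA"
  shows "\<exists>q\<in>MA. \<exists>\<rho>\<in>low l n. r = monic l n c * q + \<rho>"
proof -
  let ?P = "\<lambda>r. \<exists>q\<in>MA. \<exists>\<rho>\<in>low l n. r = monic l n c * q + \<rho>"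
  have Padd: "?P (r + r')" if r: "?P r" and r': "?P r'" for r r'
  proof -
    obtain q \<rho> where 1: "q \<in> MA" "\<rho> \<in> low l n" "r = monic l n c * q + \<rho>" using r by blast
    obtain q' \<rho>' where 2: "q' \<in> MA" "\<rho>' \<in> low l n" "r' = monic l n c * q' + \<rho>'" using r' by blast
    have "r + r' = monic l n c * (q + q') + (\<rho> + \<rho>')" unfolding 1(3) 2(3) by (simp add: algebra_simps)
    then show ?thesis using sring_add[OF sring_MA 1(1) 2(1)] low_add[OF 1(2) 2(2)] by blast
  qed
  have P0: "?P 0" using low_0 sring_zero[OF sring_MA] by (intro bexI[of _ 0]) auto
  have Psum: "?P (sum f I)" if "\<And>i. i \<in> I \<Longrightarrow> ?P (f i)" for f :: "'x \<Rightarrow> _" and I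
    using that
  proof (induction I rule: infinite_finite_induct)
    case (insert i I)
    have "?P (f i + sum f I)" by (rule Padd) (use insert in simp_all)
    then show ?case using insert by simp
  qed (use P0 in simp_all)
  have mono: "s \<in> S \<Longrightarrow> ?P (Poly_Mapping.single s b)" for s and b :: 'k
  proof (induction "deg s" arbitrary: s b rule: less_induct)
    case less
    show ?case
    proof (cases "s - int n *s V l \<in> S")
      case False
      then have "Poly_Mapping.single s b \<in> low l n" using less.prems single_MA[of s b] by (simp add: low_def)
      then show ?thesis using sring_zero[OF sring_MA] by (intro bexI[of _ 0] bexI[of _ "Poly_Mapping.single s b"]) simp_all
    next
      case True
      define s' where "s' = s - int n *s V l"
      have s: "s = int n *s V l + s'" by (simp add: s'_def)
      have s'S: "s' \<in> S" using True by (simp add: s'_def)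
      have degV: "deg (int i *s V l) = i" for i by (simp add: deg_def hh_smult hh_col)
      have "?P (Poly_Mapping.single (int i *s V l + s') (- (c i * b)))" if "i < n" for i
      proof (rule less.hyps)
        show "int i *s V l + s' \<in> S" using s'S by (intro S_add S_smult S_col)
        show "deg (int i *s V l + s') < deg s"
          unfolding s using deg_add[OF S_smult[OF S_col] s'S] degV that by simp
      qed
      then have 1: "?P (\<Sum>i<n. Poly_Mapping.single (int i *s V l + s') (- (c i * b)))" by (intro Psum) simp
      have "?P (monic l n c * Poly_Mapping.single s' b)"
        using single_MA[OF s'S, of b] low_0 by (intro bexI[of _ "Poly_Mapping.single s' b"] bexI[of _ 0]) simp_all
      from Padd[OF this 1] show ?thesis
        by (simp add: monic_def distrib_right sum_distrib_right mult_single s single_uminus sum_negf)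
    qed
  qed
  have "?P (\<Sum>s\<in>Poly_Mapping.keys r. Poly_Mapping.single s (Poly_Mapping.lookup r s))"
    using assms by (intro Psum mono) (auto simp: MA_def)
  then show ?thesis by (simp flip: pm_sum_single)
qed

text \<open>A term of \<open>q\<close> of top degree, multiplied by the leading monomial, cannot be
  cancelled, and the result is divisible by that monomial.\<close>

lemma division_unique:
  assumes q: "q \<in> MA" and low: "monic l n c * q \<in> low l n"
  shows "q = 0"
proof (rule ccontr)
  assume "q \<noteq> 0"
  then have ne: "Poly_Mapping.keys q \<noteq> {}" by simp
  define D where "D = Max (deg ` Poly_Mapping.keys q)"
  have "D \<in> deg ` Poly_Mapping.keys q" unfolding D_def using ne by (intro Max_in) auto
  then obtain s where s: "s \<in> Poly_Mapping.keys q" "deg s = D" by auto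
  have sS: "s \<in> S" using s q unfolding MA_def by blast
  have max: "deg t \<le> D" if "t \<in> Poly_Mapping.keys q" for t unfolding D_def using that by (intro Max_ge) auto
  have zero: "Poly_Mapping.lookup q (int n *s V l + s - int i *s V l) = 0" if "i < n" for i
  proof (rule ccontr)
    assume "Poly_Mapping.lookup q (int n *s V l + s - int i *s V l) \<noteq> 0"
    moreover have eq: "int n *s V l + s - int i *s V l = int (n - i) *s V l + s"
      using that by (simp add: vec_eq_iff of_nat_diff algebra_simps)
    ultimately have "int (n - i) *s V l + s \<in> Poly_Mapping.keys q" by (simp add: in_keys_iff)
    then have "deg (int (n - i) *s V l + s) \<le> D" by (rule max)
    moreover have "deg (int (n - i) *s V l + s) = deg (int (n - i) *s V l) + deg s"
      by (rule deg_add[OF S_smult[OF S_col] sS])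
    moreover have "deg (int (n - i) *s V l) = n - i" by (simp add: deg_def hh_smult hh_col)
    ultimately show False using that s(2) by simp
  qed
  have "Poly_Mapping.lookup (monic l n c * q) (int n *s V l + s) = Poly_Mapping.lookup q s"
    using zero by (simp add: monic_def distrib_right sum_distrib_right lookup_add lookup_sum lookup_single_mult)
  then have "int n *s V l + s \<in> Poly_Mapping.keys (monic l n c * q)" using s(1) by (simp add: in_keys_iff)
  then have "int n *s V l + s - int n *s V l \<notin> S" using low unfolding low_def by blast
  then show False using sS by simp
qed

text \<open>Elements of the ideal are divided by the polynomial of \<open>l\<close>. Under
  \<open>star\<close> remainders stay remainders when multiplied by the polynomials of the vertices
  in \<open>K\<close>, so the quotient can be taken in the ideal again. Comparing with the quotient
  \<open>r\<close> of the given product, uniqueness puts \<open>r\<close> into the ideal.\<close>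

lemma monic_regular:
  assumes star "l \<notin> K" "r \<in> MA"
    and r: "monic l (n l) (c l) * r \<in> igen MA ((\<lambda>l. monic l (n l) (c l)) ` K)"
  shows "r \<in> igen MA ((\<lambda>l. monic l (n l) (c l)) ` K)"
proof -
  let ?F = "\<lambda>l. monic l (n l) (c l)" and ?I = "igen MA ((\<lambda>l. monic l (n l) (c l)) ` K)"
  have iI: "ideal_in MA ?I" by (rule ideal_in_igen[OF sring_MA]) (auto intro: monic_MA)
  have split: "\<exists>y\<in>?I. \<exists>\<rho>\<in>low l (n l). x = ?F l * y + \<rho>" if "x \<in> ?I" for x
    using that
  proof induction
    case zero
    show ?case using low_0 igen.zero by (intro bexI[of _ 0]) auto
  next
    case (step p g x)
    obtain y \<rho> where y: "y \<in> ?I" "\<rho> \<in> low l (n l)" "x = ?F l * y + \<rho>" using step(4) by blast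
    obtain l' where l': "l' \<in> K" "g = ?F l'" using step(2) by blast
    obtain q \<rho>' where q: "q \<in> MA" "\<rho>' \<in> low l (n l)" "p = ?F l * q + \<rho>'"
      using division[OF step(1), of l "n l" "c l"] by blast
    have "q * g + y \<in> ?I" using q(1) step(2) y(1) by (rule igen.step)
    moreover have "?F l' * \<rho>' + \<rho> \<in> low l (n l)"
      using assms(1,2) l'(1) q(2) y(2) by (intro low_add low_monic_mult) auto
    moreover have "p * g + x = ?F l * (q * g + y) + (?F l' * \<rho>' + \<rho>)"
      unfolding q(3) y(3) l'(2) by (simp add: algebra_simps)
    ultimately show ?case by blast
  qed
  obtain y \<rho> where y: "y \<in> ?I" "\<rho> \<in> low l (n l)" "?F l * r = ?F l * y + \<rho>" using split[OF r] by blast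
  have "r - y \<in> MA" using assms(3) ideal_inD(1)[OF iI y(1)] by (rule sring_diff[OF sring_MA])
  moreover have "?F l * (r - y) \<in> low l (n l)" using y(2,3) by (simp add: right_diff_distrib)
  ultimately have "r - y = 0" by (rule division_unique)
  then show ?thesis using y(1) by simp
qed

text \<open>Each vertex monomial is algebraic modulo \<open>m\<close>, which yields a monic
  polynomial in it lying in \<open>m\<close>. For distinct vertices these polynomials form a regular
  sequence in any order.\<close>

lemma depth_ge:
  assumes star and m: "maximal_in MA (m :: (int ^ 'd \<Rightarrow>\<^sub>0 'k::field) set)"
  shows "enat (CARD('d)) \<le> ideal_depth (ring_on MA) m"
proof -
  interpret zariski MA m iota
    by unfold_locales (rule sring_MA ring_hom_iota m)+
  obtain ys :: "(int ^ 'd \<Rightarrow>\<^sub>0 'k) list" where ys: "set ys = gens" using finite_list[of "gens :: (int ^ 'd \<Rightarrow>\<^sub>0 'k) set"] by (auto simp: gens_def)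
  have "\<exists>p. monic l (fst p) (snd p) \<in> m" for l
  proof -
    have "\<exists>n c. Poly_Mapping.single (V l) 1 ^ n + (\<Sum>i<n. iota (c i) * Poly_Mapping.single (V l) 1 ^ i) \<in> m"
    proof (rule algebraic_mod_maximal)
      show "set ys \<subseteq> MA" unfolding ys by (auto simp: gens_def intro!: single_MA S_col)
      show "MA \<subseteq> alg_hull (range iota \<union> set ys)" unfolding ys MA_hull ..
    qed (intro single_MA S_col)
    then obtain n c where "Poly_Mapping.single (V l) 1 ^ n + (\<Sum>i<n. iota (c i) * Poly_Mapping.single (V l) 1 ^ i) \<in> m"
      by (elim exE)
    then have "monic l n c \<in> m" by (simp add: single_power monic_def iota_def mult_single)
    then show ?thesis by (intro exI[of _ "(n, c)"]) simp
  qed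
  then have "\<forall>l. \<exists>p. monic l (fst p) (snd p) \<in> m" by blast
  from choice[OF this] obtain p where p: "\<And>l. monic l (fst (p l)) (snd (p l)) \<in> m" by blast
  let ?F = "\<lambda>l. monic l (fst (p l)) (snd (p l))"
  obtain ls :: "'d list" where ls: "set ls = UNIV" "distinct ls" using finite_distinct_list[of "UNIV :: 'd set"] by auto
  have len: "length ls = CARD('d)" using distinct_card[OF ls(2)] ls(1) by simp
  have FR: "set (map ?F ls) \<subseteq> MA" by (auto intro: monic_MA)
  have reg: "regular_sequence (ring_on MA) (map ?F ls)"
    unfolding regular_ring_on[OF sring_MA]
  proof (intro conjI allI impI ballI)
    show "set (map ?F ls) \<subseteq> MA" by (rule FR)
    have "igen MA (set (map ?F ls)) \<subseteq> m" using p by (intro igen_subset[OF iM]) auto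
    then show "igen MA (set (map ?F ls)) \<noteq> MA" using oM sring_one[OF sring_MA] by blast
    fix i and r :: "int ^ 'd \<Rightarrow>\<^sub>0 'k"
    assume i: "i < length (map ?F ls)" and r: "r \<in> MA" "map ?F ls ! i * r \<in> igen MA (set (take i (map ?F ls)))"
    have s: "set (take i (map ?F ls)) = ?F ` set (take i ls)" by (simp add: take_map)
    have "ls ! i \<notin> set (take i ls)" using i ls(2) by (auto simp: distinct_conv_nth in_set_conv_nth)
    then show "r \<in> igen MA (set (take i (map ?F ls)))"
      using monic_regular[OF assms(1) _ r(1), of "ls ! i" "set (take i ls)" "\<lambda>l. fst (p l)" "\<lambda>l. snd (p l)"] r(2) i
      unfolding s by simp
  qed
  have "enat (length (map ?F ls)) \<le> ideal_depth (ring_on MA) m"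
    unfolding ideal_depth_def using reg p by (intro SUP_upper) auto
  then show ?thesis using len by simp
qed

theorem star_imp_cohen_macaulay:
  assumes star
  shows "cohen_macaulay (monoid_algebra S :: (int ^ 'd \<Rightarrow>\<^sub>0 'k::field) ring)"
  unfolding cohen_macaulay_def monoid_algebra_eq
proof (intro conjI allI impI)
  show "cring (ring_on (MA :: (int ^ 'd \<Rightarrow>\<^sub>0 'k) set))" by (rule ring_on_cring[OF sring_MA])
  show "noetherian_ring (ring_on (MA :: (int ^ 'd \<Rightarrow>\<^sub>0 'k) set))" by (rule noeth_ring_on[OF sring_MA noeth_MA])
  fix m :: "(int ^ 'd \<Rightarrow>\<^sub>0 'k) set" assume "maximalideal m (ring_on MA)"
  then have m: "maximal_in MA m" by (simp only: maximal_ring_on[OF sring_MA])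
  have pm: "prime_in MA m" by (rule maximal_in_prime[OF sring_MA m])
  show "ideal_depth (ring_on MA) m = prime_height (ring_on MA) m"
  proof (rule antisym)
    show "ideal_depth (ring_on MA) m \<le> prime_height (ring_on MA) m"
      unfolding ideal_depth_def
      by (rule SUP_least) (use regular_sequence_length_le_height[OF sring_MA pm] in auto)
    show "prime_height (ring_on MA) m \<le> ideal_depth (ring_on MA) m"
      using height_le[OF pm] depth_ge[OF assms m] by (rule order_trans)
  qed
qed

end

section \<open>Normal forms in the Weyl algebra\<close>

definition psum :: "('b \<Rightarrow> 'c::zero \<Rightarrow> 'a::comm_monoid_add) \<Rightarrow> ('b \<Rightarrow>\<^sub>0 'c) \<Rightarrow> 'a" where
  "psum T g = (\<Sum>b\<in>Poly_Mapping.keys g. T b (Poly_Mapping.lookup g b))"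

lemma psum_superset:
  assumes "\<And>b. T b 0 = 0" "finite B" "Poly_Mapping.keys g \<subseteq> B"
  shows "psum T g = (\<Sum>b\<in>B. T b (Poly_Mapping.lookup g b))"
  unfolding psum_def by (rule sum.mono_neutral_left) (use assms in \<open>auto simp: in_keys_iff\<close>)

lemma psum_add:
  assumes "\<And>b. T b 0 = 0" "\<And>b x y. T b (x + y) = T b x + T b y"
  shows "psum T (g + h) = psum T g + psum T h"
proof -
  let ?B = "Poly_Mapping.keys g \<union> Poly_Mapping.keys h"
  have B: "finite ?B" by simp
  show ?thesis
    unfolding psum_superset[where T = T, OF assms(1) B keys_add] psum_superset[where T = T, OF assms(1) B Un_upper1]
      psum_superset[where T = T, OF assms(1) B Un_upper2]
    by (simp add: lookup_add assms(2) sum.distrib)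
qed

lemma psum_single: "T b 0 = 0 \<Longrightarrow> psum T (Poly_Mapping.single b c) = T b c"
  by (cases "c = 0") (simp_all add: psum_def)

lemma psum_zero: "psum T 0 = 0" by (simp add: psum_def)

lemma pm_induct [case_names zero single add]:
  fixes g :: "'b \<Rightarrow>\<^sub>0 'c::comm_monoid_add"
  assumes "P 0" "\<And>b c. P (Poly_Mapping.single b c)" "\<And>g h. P g \<Longrightarrow> P h \<Longrightarrow> P (g + h)"
  shows "P g"
proof -
  have "P (\<Sum>b\<in>B. Poly_Mapping.single b (Poly_Mapping.lookup g b))" for B
    by (induction B rule: infinite_finite_induct) (simp_all add: assms)
  from this[of "Poly_Mapping.keys g"] show ?thesis by (simp flip: pm_sum_single)
qed

lemma lookup_pm_map: "f 0 = 0 \<Longrightarrow> Poly_Mapping.lookup (Poly_Mapping.map f p) k = f (Poly_Mapping.lookup p k)"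
  by (simp add: Poly_Mapping.map.rep_eq when_def)

lemma pm_map_add: "f 0 = 0 \<Longrightarrow> (\<And>x y. f (x + y) = f x + f y) \<Longrightarrow>
    Poly_Mapping.map f (p + q) = Poly_Mapping.map f p + Poly_Mapping.map f q"
  by (rule poly_mapping_eqI) (simp add: lookup_pm_map lookup_add)

lemma pm_map_single: "f 0 = 0 \<Longrightarrow> Poly_Mapping.map f (Poly_Mapping.single b c) = Poly_Mapping.single b (f c)"
  by (rule poly_mapping_eqI) (simp add: lookup_pm_map lookup_single when_def)

abbreviation unit_exp :: "'n \<Rightarrow> ('n \<Rightarrow>\<^sub>0 nat)" where "unit_exp j \<equiv> Poly_Mapping.single j (Suc 0)"

lemma lookup_mderiv:
  fixes p :: "('n, 'k::comm_ring_1) mpoly"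
  shows "Poly_Mapping.lookup (mderiv j p) m = of_nat (Poly_Mapping.lookup m j + 1) * Poly_Mapping.lookup p (m + unit_exp j)"
proof -
  have "Poly_Mapping.lookup (mderiv j p) m =
      (\<Sum>k\<in>Poly_Mapping.keys p. if k - unit_exp j = m then of_nat (Poly_Mapping.lookup k j) * Poly_Mapping.lookup p k else 0)"
    by (simp add: mderiv_def lookup_sum lookup_single when_def)
  also have "\<dots> = (\<Sum>k\<in>Poly_Mapping.keys p. if k = m + unit_exp j then of_nat (Poly_Mapping.lookup k j) * Poly_Mapping.lookup p k else 0)"
  proof (rule sum.cong[OF refl])
    fix k assume "k \<in> Poly_Mapping.keys p"
    show "(if k - unit_exp j = m then of_nat (Poly_Mapping.lookup k j) * Poly_Mapping.lookup p k else 0) =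
      (if k = m + unit_exp j then of_nat (Poly_Mapping.lookup k j) * Poly_Mapping.lookup p k else 0)"
    proof (cases "Poly_Mapping.lookup k j = 0")
      case False
      have "k - unit_exp j = m \<longleftrightarrow> k = m + unit_exp j"
      proof
        assume "k - unit_exp j = m"
        moreover have "k - unit_exp j + unit_exp j = k"
          by (rule poly_mapping_eqI) (use False in \<open>auto simp: lookup_add lookup_minus lookup_single when_def\<close>)
        ultimately show "k = m + unit_exp j" by simp
      qed simp
      then show ?thesis by simp
    qed simp
  qed
  also have "\<dots> = of_nat (Poly_Mapping.lookup (m + unit_exp j) j) * Poly_Mapping.lookup p (m + unit_exp j)"
    by (simp add: in_keys_iff)
  finally show ?thesis by (simp add: lookup_add)
qed

lemma mderiv_add: "mderiv j (p + q) = mderiv j p + mderiv j q"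
  by (rule poly_mapping_eqI) (simp add: lookup_mderiv lookup_add algebra_simps)

lemma mderiv_0: "mderiv j 0 = 0"
  by (rule poly_mapping_eqI) (simp add: lookup_mderiv)

lemma mderiv_single: "mderiv j (Poly_Mapping.single m c) = Poly_Mapping.single (m - unit_exp j) (of_nat (Poly_Mapping.lookup m j) * c)"
  by (cases "c = 0") (simp_all add: mderiv_def)

lemma mderiv_mult:
  fixes p q :: "('n, 'k::comm_ring_1) mpoly"
  shows "mderiv j (p * q) = mderiv j p * q + p * mderiv j q"
proof (induction p rule: pm_induct)
  case (single u b)
  show ?case
  proof (induction q rule: pm_induct)
    case (single v c)
    have 1: "u - unit_exp j + v = u + v - unit_exp j" if "Poly_Mapping.lookup u j \<noteq> 0"
      by (rule poly_mapping_eqI) (use that in \<open>auto simp: lookup_add lookup_minus lookup_single when_def\<close>)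
    have 2: "u + (v - unit_exp j) = u + v - unit_exp j" if "Poly_Mapping.lookup v j \<noteq> 0"
      by (rule poly_mapping_eqI) (use that in \<open>auto simp: lookup_add lookup_minus lookup_single when_def\<close>)
    have e1: "Poly_Mapping.single (u - unit_exp j + v) (of_nat (Poly_Mapping.lookup u j) * b * c) =
        Poly_Mapping.single (u + v - unit_exp j) (of_nat (Poly_Mapping.lookup u j) * (b * c))"
      using 1 by (cases "Poly_Mapping.lookup u j = 0") (simp_all add: mult.assoc)
    have e2: "Poly_Mapping.single (u + (v - unit_exp j)) (b * (of_nat (Poly_Mapping.lookup v j) * c)) =
        Poly_Mapping.single (u + v - unit_exp j) (of_nat (Poly_Mapping.lookup v j) * (b * c))"
      using 2 by (cases "Poly_Mapping.lookup v j = 0") (simp_all add: mult.left_commute)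
    show ?case
      by (simp only: mult_single mderiv_single e1 e2 single_add[symmetric] lookup_add of_nat_add distrib_right)
  qed (simp_all add: mderiv_0 mderiv_add distrib_left add_ac)
qed (simp_all add: mderiv_0 mderiv_add distrib_right add_ac)

text \<open>The factor by which the derivative of order \<open>b\<close> takes the monomial with
  exponent \<open>q + b\<close> to the one with exponent \<open>q\<close>. It is stated for the
  lower exponent and for arbitrary semirings, so that \<open>q\<close> may also be rational.\<close>

definition ffact :: "('n::finite \<Rightarrow>\<^sub>0 nat) \<Rightarrow> ('n \<Rightarrow> 'r::comm_semiring_1) \<Rightarrow> 'r" where
  "ffact b q = (\<Prod>j\<in>UNIV. \<Prod>i<Poly_Mapping.lookup b j. q j + 1 + of_nat i)"

abbreviation expo :: "('n \<Rightarrow>\<^sub>0 nat) \<Rightarrow> 'n \<Rightarrow> 'r::semiring_1" where "expo m j \<equiv> of_nat (Poly_Mapping.lookup m j)"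

lemma lookup_mderiv_pow:
  fixes p :: "('n, 'k::comm_ring_1) mpoly"
  shows "Poly_Mapping.lookup ((mderiv j ^^ n) p) m =
    (\<Prod>i<n. expo m j + 1 + of_nat i) * Poly_Mapping.lookup p (m + Poly_Mapping.single j n)"
proof (induction n arbitrary: m)
  case (Suc n)
  have s: "m + unit_exp j + Poly_Mapping.single j n = m + Poly_Mapping.single j (Suc n)"
    by (simp add: add.assoc single_add[symmetric])
  have "Poly_Mapping.lookup ((mderiv j ^^ Suc n) p) m = (expo m j + 1) *
      ((\<Prod>i<n. expo (m + unit_exp j) j + 1 + of_nat i) * Poly_Mapping.lookup p (m + Poly_Mapping.single j (Suc n)))"
    by (simp only: funpow.simps o_apply lookup_mderiv Suc.IH s of_nat_add of_nat_1)
  also have "(\<Prod>i<n. expo (m + unit_exp j) j + 1 + of_nat i) = (\<Prod>i<n. expo m j + 1 + of_nat (Suc i) :: 'k)"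
    by (simp add: lookup_add add_ac)
  also have "(expo m j + 1) * ((\<Prod>i<n. expo m j + 1 + of_nat (Suc i)) * Poly_Mapping.lookup p (m + Poly_Mapping.single j (Suc n))) =
      (\<Prod>i<Suc n. expo m j + 1 + of_nat i) * Poly_Mapping.lookup p (m + Poly_Mapping.single j (Suc n))"
    by (subst prod.lessThan_Suc_shift) (simp add: mult.assoc)
  finally show ?case .
qed simp

lemma pm_sum_single_UNIV: "(\<Sum>j\<in>UNIV. Poly_Mapping.single j (Poly_Mapping.lookup b j)) = (b :: 'n::finite \<Rightarrow>\<^sub>0 'c::comm_monoid_add)"
  by (rule poly_mapping_eqI) (simp add: lookup_sum lookup_single when_def)

lemma lookup_deriv_monomial:
  fixes p :: "('n::{finite,linorder}, 'k::comm_ring_1) mpoly"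
  shows "Poly_Mapping.lookup (deriv_monomial b p) m = ffact b (expo m) * Poly_Mapping.lookup p (m + b)"
proof -
  have "Poly_Mapping.lookup (foldr (\<lambda>j P. (mderiv j ^^ Poly_Mapping.lookup b j) \<circ> P) xs id p) m =
      (\<Prod>j\<in>set xs. \<Prod>i<Poly_Mapping.lookup b j. expo m j + 1 + of_nat i) *
      Poly_Mapping.lookup p (m + (\<Sum>j\<in>set xs. Poly_Mapping.single j (Poly_Mapping.lookup b j)))" if "distinct xs" for xs
    using that
  proof (induction xs arbitrary: m)
    case (Cons j xs)
    have same: "(\<Prod>l\<in>set xs. \<Prod>i<Poly_Mapping.lookup b l. expo (m + Poly_Mapping.single j (Poly_Mapping.lookup b j)) l + 1 + of_nat i :: 'k) =
        (\<Prod>l\<in>set xs. \<Prod>i<Poly_Mapping.lookup b l. expo m l + 1 + of_nat i)"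
      using Cons.prems by (intro prod.cong refl) (auto simp: lookup_add lookup_single when_def)
    show ?case
      using Cons.prems Cons.IH by (simp add: lookup_mderiv_pow same mult.assoc add.assoc[of m])
  qed simp
  from this[of "sorted_list_of_set UNIV" ] show ?thesis
    by (simp add: deriv_monomial_def ffact_def pm_sum_single_UNIV)
qed

lemma ffact_add:
  fixes q :: "'n::finite \<Rightarrow> 'r::comm_semiring_1"
  shows "ffact (b + c) q = ffact b q * ffact c (\<lambda>j. q j + of_nat (Poly_Mapping.lookup b j))"
proof -
  have "(\<Prod>i<k + l. x + 1 + of_nat i) = (\<Prod>i<k. x + 1 + of_nat i) * (\<Prod>i<l. x + of_nat k + 1 + of_nat i)" for k l and x :: 'r
    by (induction l) (simp_all add: mult.assoc add_ac)
  then show ?thesis by (simp add: ffact_def lookup_add prod.distrib)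
qed

lemma ffact_0: "ffact 0 q = 1" by (simp add: ffact_def)

lemma ffact_unit_exp: "ffact (unit_exp j) q = q j + 1"
proof -
  have "ffact (unit_exp j) q = (\<Prod>l\<in>UNIV. if l = j then q l + 1 else 1)"
    unfolding ffact_def by (intro prod.cong refl) (simp add: lookup_single when_def)
  then show ?thesis by simp
qed

lemma deriv_monomial_add:
  fixes p :: "('n::{finite,linorder}, 'k::comm_ring_1) mpoly"
  shows "deriv_monomial (b + c) p = deriv_monomial b (deriv_monomial c p)"
  by (rule poly_mapping_eqI) (simp add: lookup_deriv_monomial ffact_add lookup_add add.assoc mult.assoc)

lemma deriv_monomial_unit_exp: "deriv_monomial (unit_exp j) = (mderiv j :: ('n::{finite,linorder}, 'k::comm_ring_1) mpoly \<Rightarrow> _)"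
  by (rule ext, rule poly_mapping_eqI) (simp add: lookup_deriv_monomial lookup_mderiv ffact_unit_exp add.commute[of 1])

lemma deriv_monomial_0: "deriv_monomial 0 = (id :: ('n::{finite,linorder}, 'k::comm_ring_1) mpoly \<Rightarrow> _)"
  by (rule ext, rule poly_mapping_eqI) (simp add: lookup_deriv_monomial ffact_0)

lemma deriv_monomial_plus: "deriv_monomial b (p + q) = deriv_monomial b p + deriv_monomial b q"
  by (rule poly_mapping_eqI) (simp add: lookup_deriv_monomial lookup_add distrib_left)

text \<open>Normal forms with coefficients on the left: the key is the exponent of the derivatives
  and the value is the polynomial standing before them.\<close>

type_synonym ('n, 'k) wnf = "('n \<Rightarrow>\<^sub>0 nat) \<Rightarrow>\<^sub>0 ('n, 'k) mpoly"

definition nf :: "('n::{finite,linorder}, 'k::field_char_0) wnf \<Rightarrow> ('n, 'k) mpoly \<Rightarrow> ('n, 'k) mpoly" where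
  "nf g p = psum (\<lambda>b f. f * deriv_monomial b p) g"

lemma nf_add: "nf (g + h) p = nf g p + nf h p"
  unfolding nf_def by (rule psum_add) (simp_all add: distrib_right)
lemma nf_single: "nf (Poly_Mapping.single b f) p = f * deriv_monomial b p"
  unfolding nf_def by (rule psum_single) simp
lemma nf_0: "nf 0 p = 0" by (simp add: nf_def psum_zero)
lemma nf_uminus: "nf (- g) p = - nf g p"
  using nf_add[of g "- g" p] by (simp add: nf_0 eq_neg_iff_add_eq_0 add.commute)
lemma nf_diff: "nf (g - h) p = nf g p - nf h p"
  using nf_add[of g "- h" p] by (simp add: nf_uminus)

text \<open>The Leibniz rule for composing with \<open>mderiv j\<close> on the left.\<close>

definition nf_deriv :: "'n \<Rightarrow> ('n::{finite,linorder}, 'k::field_char_0) wnf \<Rightarrow> ('n, 'k) wnf" where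
  "nf_deriv j g = Poly_Mapping.single (unit_exp j) 1 * g + Poly_Mapping.map (mderiv j) g"

lemma nf_deriv_single: "nf_deriv j (Poly_Mapping.single b f) = Poly_Mapping.single (unit_exp j + b) f + Poly_Mapping.single b (mderiv j f)"
  by (simp add: nf_deriv_def mult_single pm_map_single mderiv_0)
lemma nf_deriv_add: "nf_deriv j (g + h) = nf_deriv j g + nf_deriv j h"
  by (simp add: nf_deriv_def distrib_left pm_map_add mderiv_0 mderiv_add add_ac)
lemma nf_deriv_0: "nf_deriv j 0 = 0"
  using nf_deriv_add[of j 0 0] by simp

lemma nf_left_mult: "nf (Poly_Mapping.single 0 f * g) p = f * nf g p"
  by (induction g rule: pm_induct) (simp_all add: nf_0 nf_add nf_single mult_single distrib_left mult.assoc)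

lemma nf_left_deriv: "nf (nf_deriv j g) p = mderiv j (nf g p)"
  by (induction g rule: pm_induct)
    (simp_all add: nf_0 nf_add nf_single nf_deriv_0 nf_deriv_add nf_deriv_single mderiv_0 mderiv_add mderiv_mult
      deriv_monomial_add deriv_monomial_unit_exp)

definition total :: "('n \<Rightarrow>\<^sub>0 nat) \<Rightarrow> nat" where "total b = (\<Sum>j\<in>Poly_Mapping.keys b. Poly_Mapping.lookup b j)"

lemma total_UNIV: "total b = (\<Sum>j\<in>UNIV. Poly_Mapping.lookup b j)" for b :: "'n::finite \<Rightarrow>\<^sub>0 nat"
  unfolding total_def by (rule sum.mono_neutral_left) (auto simp: in_keys_iff)
lemma total_add: "total (b + c) = total b + total c" for b :: "'n::finite \<Rightarrow>\<^sub>0 nat"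
  by (simp add: total_UNIV lookup_add sum.distrib)
lemma total_eq_0: "total b = 0 \<Longrightarrow> b = 0" for b :: "'n::finite \<Rightarrow>\<^sub>0 nat"
  by (rule poly_mapping_eqI) (simp add: total_UNIV)
lemma total_single: "total (Poly_Mapping.single j c) = c"
  by (cases "c = 0") (simp_all add: total_def)

text \<open>Applied to the monomial whose exponent is a key \<open>b0\<close> of least total degree,
  all other derivatives vanish and \<open>b0\<close> contributes its coefficient times a product of
  factorials, which is nonzero in characteristic zero.\<close>

lemma nf_eq_0:
  assumes "\<And>p. nf g p = 0" shows "g = 0"
proof (rule ccontr)
  assume "g \<noteq> 0"
  then have ne: "Poly_Mapping.keys g \<noteq> {}" by simp
  obtain b0 where b0: "b0 \<in> Poly_Mapping.keys g" "\<And>b. b \<in> Poly_Mapping.keys g \<Longrightarrow> total b0 \<le> total b"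
    using ex_min_if_finite[of "total ` Poly_Mapping.keys g"] ne by (auto simp: not_less)
  have z: "deriv_monomial b (Poly_Mapping.single b0 (1::'b)) = 0" if "b \<in> Poly_Mapping.keys g - {b0}" for b
  proof (rule poly_mapping_eqI)
    fix m
    have "m + b \<noteq> b0"
    proof
      assume e: "m + b = b0"
      then have "total m + total b = total b0" by (simp flip: total_add)
      then have "total m = 0" using b0(2)[of b] that by simp
      then show False using total_eq_0[of m] e that by simp
    qed
    then show "Poly_Mapping.lookup (deriv_monomial b (Poly_Mapping.single b0 (1::'b))) m = Poly_Mapping.lookup 0 m"
      by (simp add: lookup_deriv_monomial lookup_single)
  qed
  have d: "Poly_Mapping.lookup (deriv_monomial b0 (Poly_Mapping.single b0 (1::'b))) 0 = ffact b0 (\<lambda>_. 0)"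
    by (simp add: lookup_deriv_monomial)
  have "ffact b0 (\<lambda>_. 0 :: 'b) \<noteq> 0" unfolding ffact_def by (simp flip: of_nat_Suc)
  then have "deriv_monomial b0 (Poly_Mapping.single b0 (1::'b)) \<noteq> 0" using d by auto
  moreover have "nf g (Poly_Mapping.single b0 1) = Poly_Mapping.lookup g b0 * deriv_monomial b0 (Poly_Mapping.single b0 1)"
    unfolding nf_def psum_def using z by (subst sum.remove[OF _ b0(1)]) simp_all
  moreover have "Poly_Mapping.lookup g b0 \<noteq> 0" using b0(1) by (simp add: in_keys_iff)
  ultimately show False using assms[of "Poly_Mapping.single b0 1"] by simp
qed

lemma nf_inj: "nf g = nf h \<Longrightarrow> g = h"
  using nf_eq_0[of "g - h"] by (simp add: nf_diff)

text \<open>A function \<open>\<phi>\<close> on exponents stands for the formal series \<open>\<Sum>\<phi>(q) x\<^sup>q\<close> with \<open>q \<in> \<rat>\<^sup>n\<close>.\<close>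

definition mult_action :: "('n, 'k::field_char_0) mpoly \<Rightarrow> (('n \<Rightarrow> rat) \<Rightarrow> 'k) \<Rightarrow> ('n \<Rightarrow> rat) \<Rightarrow> 'k" where
  "mult_action f \<phi> q = psum (\<lambda>m c. c * \<phi> (\<lambda>j. q j - expo m j)) f"

definition deriv_action :: "('n::finite \<Rightarrow>\<^sub>0 nat) \<Rightarrow> (('n \<Rightarrow> rat) \<Rightarrow> 'k::field_char_0) \<Rightarrow> ('n \<Rightarrow> rat) \<Rightarrow> 'k" where
  "deriv_action b \<phi> q = of_rat (ffact b q) * \<phi> (\<lambda>j. q j + expo b j)"

definition nf_action :: "('n::{finite,linorder}, 'k::field_char_0) wnf \<Rightarrow> (('n \<Rightarrow> rat) \<Rightarrow> 'k) \<Rightarrow> ('n \<Rightarrow> rat) \<Rightarrow> 'k" where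
  "nf_action g \<phi> q = psum (\<lambda>b f. mult_action f (deriv_action b \<phi>) q) g"

lemma mult_action_add: "mult_action (f + h) \<phi> q = mult_action f \<phi> q + mult_action h \<phi> q"
  unfolding mult_action_def by (rule psum_add) (simp_all add: distrib_right)
lemma mult_action_single: "mult_action (Poly_Mapping.single m c) \<phi> q = c * \<phi> (\<lambda>j. q j - expo m j)"
  unfolding mult_action_def by (rule psum_single) simp
lemma mult_action_0: "mult_action 0 \<phi> q = 0" by (simp add: mult_action_def psum_zero)
lemma mult_action_1: "mult_action 1 \<phi> q = \<phi> q" using mult_action_single[of 0 1 \<phi> q] by simp
lemma mult_action_plus: "mult_action f (\<lambda>q. \<phi> q + \<psi> q) q = mult_action f \<phi> q + mult_action f \<psi> q"
  by (simp add: mult_action_def psum_def distrib_left sum.distrib)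
lemma mult_action_zero: "mult_action f (\<lambda>q. 0) q = 0" by (simp add: mult_action_def psum_def)

lemma mult_action_mult: "mult_action (f * h) \<phi> q = mult_action f (mult_action h \<phi>) q"
proof (induction f arbitrary: q rule: pm_induct)
  case (single u b)
  show ?case
  proof (induction h rule: pm_induct)
    case (single v c)
    show ?case by (simp add: mult_single mult_action_single lookup_add diff_diff_eq mult.assoc)
  qed (simp_all add: mult_action_0 mult_action_add mult_action_single distrib_left)
qed (simp_all add: mult_action_0 mult_action_add distrib_right)

lemma deriv_action_plus: "deriv_action b (\<lambda>q. \<phi> q + \<psi> q) q = deriv_action b \<phi> q + deriv_action b \<psi> q"
  by (simp add: deriv_action_def distrib_left)
lemma deriv_action_zero: "deriv_action b (\<lambda>q. 0) q = 0" by (simp add: deriv_action_def)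
lemma deriv_action_id: "deriv_action 0 \<phi> q = \<phi> q" by (simp add: deriv_action_def ffact_0)
lemma deriv_action_add: "deriv_action (b + c) \<phi> q = deriv_action b (deriv_action c \<phi>) q"
  by (simp add: deriv_action_def ffact_add lookup_add add.assoc of_rat_mult mult.assoc)
lemma deriv_action_unit_exp: "deriv_action (unit_exp j) \<phi> q = of_rat (q j + 1) * \<phi> (q(j := q j + 1))"
proof -
  have "(\<lambda>l. q l + expo (unit_exp j) l) = q(j := q j + 1)" by (auto simp: lookup_single when_def)
  then show ?thesis by (simp add: deriv_action_def ffact_unit_exp)
qed

lemma deriv_action_mult_action: "deriv_action (unit_exp j) (mult_action f \<phi>) q = mult_action (mderiv j f) \<phi> q + mult_action f (deriv_action (unit_exp j) \<phi>) q"
proof (induction f rule: pm_induct)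
  case (single m c)
  have shift: "(\<lambda>l. (q(j := q j + 1)) l - expo m l) = (\<lambda>l. q l - expo m l)(j := q j - expo m j + 1)" by auto
  let ?B = "\<phi> ((\<lambda>l. q l - expo m l)(j := q j - expo m j + 1))"
  have h: "expo m j * c * \<phi> (\<lambda>l. q l - expo (m - unit_exp j) l) = expo m j * c * ?B"
  proof (cases "Poly_Mapping.lookup m j = 0")
    case False
    then have "(\<lambda>l. q l - expo (m - unit_exp j) l) = (\<lambda>l. q l - expo m l)(j := q j - expo m j + 1)"
      by (auto simp: lookup_minus lookup_single when_def of_nat_diff)
    then show ?thesis by simp
  qed simp
  have "mult_action (mderiv j (Poly_Mapping.single m c)) \<phi> q = expo m j * c * ?B"
    unfolding mderiv_single mult_action_single by (rule h)
  moreover have "deriv_action (unit_exp j) (mult_action (Poly_Mapping.single m c) \<phi>) q = of_rat (q j + 1) * (c * ?B)"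
    unfolding mult_action_single deriv_action_unit_exp shift ..
  moreover have "mult_action (Poly_Mapping.single m c) (deriv_action (unit_exp j) \<phi>) q = c * (of_rat (q j - expo m j + 1) * ?B)"
    unfolding mult_action_single deriv_action_unit_exp ..
  ultimately show ?case by (simp only: of_rat_add of_rat_diff of_rat_1 of_rat_of_nat_eq) (simp only: algebra_simps)
qed (simp_all add: mult_action_0 mult_action_add mderiv_0 mderiv_add deriv_action_unit_exp distrib_left)

lemma nf_action_add: "nf_action (g + h) \<phi> = (\<lambda>q. nf_action g \<phi> q + nf_action h \<phi> q)"
  unfolding nf_action_def by (intro ext psum_add) (simp_all add: mult_action_0 mult_action_add)
lemma nf_action_single: "nf_action (Poly_Mapping.single b f) \<phi> = mult_action f (deriv_action b \<phi>)"
  unfolding nf_action_def by (intro ext psum_single) (simp add: mult_action_0)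
lemma nf_action_0: "nf_action 0 \<phi> = (\<lambda>q. 0)" by (rule ext) (simp add: nf_action_def psum_zero)

lemma nf_action_left_mult: "nf_action (Poly_Mapping.single 0 f * g) \<phi> q = mult_action f (nf_action g \<phi>) q"
  by (induction g rule: pm_induct)
    (simp_all add: nf_action_0 nf_action_add nf_action_single mult_single distrib_left mult_action_zero mult_action_plus mult_action_mult)

lemma nf_action_left_deriv: "nf_action (nf_deriv j g) \<phi> q = deriv_action (unit_exp j) (nf_action g \<phi>) q"
proof (induction g rule: pm_induct)
  case (single b f)
  have "deriv_action (unit_exp j + b) \<phi> = deriv_action (unit_exp j) (deriv_action b \<phi>)" by (rule ext) (rule deriv_action_add)
  then show ?case by (simp add: nf_deriv_single nf_action_add nf_action_single deriv_action_mult_action)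
qed (simp_all add: nf_action_0 nf_action_add nf_deriv_0 nf_deriv_add deriv_action_zero deriv_action_plus)

text \<open>The point is that \<open>T\<close> depends on \<open>P\<close> alone. Taking
  \<open>g\<close> to be the identity gives a normal form of \<open>P\<close>, and taking
  \<open>g\<close> arbitrary shows that composition of operators corresponds to composition of their
  actions on series. Both come out of a single induction over the generation of the Weyl
  algebra.\<close>

lemma weyl_left_nf:
  assumes "P \<in> weyl_operators"
  shows "\<exists>T. \<forall>g. \<exists>h. (\<forall>p. nf h p = P (nf g p)) \<and> (\<forall>\<phi>. nf_action h \<phi> = T (nf_action g \<phi>))"
  using assms
proof induction
  case (scalar c)
  show ?case
    by (intro exI[of _ "mult_action (mconst c)"] allI exI[of _ "Poly_Mapping.single 0 (mconst c) * _"])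
      (auto simp: nf_left_mult nf_action_left_mult intro!: ext)
next
  case (var j)
  show ?case
    by (intro exI[of _ "mult_action (mvar j)"] allI exI[of _ "Poly_Mapping.single 0 (mvar j) * _"])
      (auto simp: nf_left_mult nf_action_left_mult intro!: ext)
next
  case (deriv j)
  show ?case
    by (intro exI[of _ "deriv_action (unit_exp j)"] allI exI[of _ "nf_deriv j _"])
      (auto simp: nf_left_deriv nf_action_left_deriv intro!: ext)
next
  case (add P Q)
  obtain T where T: "\<forall>g. \<exists>h. (\<forall>p. nf h p = P (nf g p)) \<and> (\<forall>\<phi>. nf_action h \<phi> = T (nf_action g \<phi>))" using add.IH(1) ..
  obtain U where U: "\<forall>g. \<exists>h. (\<forall>p. nf h p = Q (nf g p)) \<and> (\<forall>\<phi>. nf_action h \<phi> = U (nf_action g \<phi>))" using add.IH(2) ..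
  show ?case
  proof (intro exI[of _ "\<lambda>\<psi> q. T \<psi> q + U \<psi> q"] allI)
    fix g
    obtain h where h: "\<forall>p. nf h p = P (nf g p)" "\<forall>\<phi>. nf_action h \<phi> = T (nf_action g \<phi>)" using T[rule_format, of g] by (elim exE conjE)
    obtain h' where h': "\<forall>p. nf h' p = Q (nf g p)" "\<forall>\<phi>. nf_action h' \<phi> = U (nf_action g \<phi>)" using U[rule_format, of g] by (elim exE conjE)
    show "\<exists>h. (\<forall>p. nf h p = P (nf g p) + Q (nf g p)) \<and> (\<forall>\<phi>. nf_action h \<phi> = (\<lambda>q. T (nf_action g \<phi>) q + U (nf_action g \<phi>) q))"
      by (intro exI[of _ "h + h'"]) (simp add: nf_add nf_action_add h h')
  qed
next
  case (comp P Q)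
  obtain T where T: "\<forall>g. \<exists>h. (\<forall>p. nf h p = P (nf g p)) \<and> (\<forall>\<phi>. nf_action h \<phi> = T (nf_action g \<phi>))" using comp.IH(1) ..
  obtain U where U: "\<forall>g. \<exists>h. (\<forall>p. nf h p = Q (nf g p)) \<and> (\<forall>\<phi>. nf_action h \<phi> = U (nf_action g \<phi>))" using comp.IH(2) ..
  show ?case
  proof (intro exI[of _ "\<lambda>\<psi>. T (U \<psi>)"] allI)
    fix g
    obtain h' where h': "\<forall>p. nf h' p = Q (nf g p)" "\<forall>\<phi>. nf_action h' \<phi> = U (nf_action g \<phi>)" using U[rule_format, of g] by (elim exE conjE)
    obtain h where h: "\<forall>p. nf h p = P (nf h' p)" "\<forall>\<phi>. nf_action h \<phi> = T (nf_action h' \<phi>)" using T[rule_format, of h'] by (elim exE conjE)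
    show "\<exists>h. (\<forall>p. nf h p = (P \<circ> Q) (nf g p)) \<and> (\<forall>\<phi>. nf_action h \<phi> = T (U (nf_action g \<phi>)))"
      by (intro exI[of _ h]) (simp add: h h')
  qed
qed

lemma nf_id: "nf 1 p = p" using nf_single[of 0 1 p] by (simp add: deriv_monomial_0)
lemma nf_action_id: "nf_action 1 \<phi> = \<phi>"
  using nf_action_single[of 0 1 \<phi>] by (intro ext) (simp add: mult_action_1 deriv_action_id)

text \<open>Normal forms are unique by \<open>nf_inj\<close>, so on the Weyl algebra the choice is
  harmless.\<close>

definition weyl_action :: "(('n::{finite,linorder}, 'k::field_char_0) mpoly \<Rightarrow> ('n, 'k) mpoly) \<Rightarrow> (('n \<Rightarrow> rat) \<Rightarrow> 'k) \<Rightarrow> ('n \<Rightarrow> rat) \<Rightarrow> 'k" where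
  "weyl_action P = nf_action (SOME g. nf g = P)"

lemma weyl_action_nf: "weyl_action (nf g) = nf_action g"
proof -
  have "(SOME h. nf h = nf g) = g" by (rule some_equality) (auto intro: nf_inj)
  then show ?thesis by (simp add: weyl_action_def)
qed

lemma weyl_nf: assumes "P \<in> weyl_operators" shows "\<exists>g. P = nf g"
proof -
  obtain T where T: "\<forall>g. \<exists>h. (\<forall>p. nf h p = P (nf g p)) \<and> (\<forall>\<phi>. nf_action h \<phi> = T (nf_action g \<phi>))" using weyl_left_nf[OF assms] ..
  obtain h where h: "\<forall>p. nf h p = P (nf 1 p)" using T[rule_format, of 1] by (elim exE conjE)
  have "P = nf h" by (rule ext) (simp add: h nf_id)
  then show ?thesis ..
qed

text \<open>The map \<open>T\<close> of \<open>weyl_left_nf\<close>, evaluated at the normal form of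
  the identity, is the action of \<open>P\<close>; evaluated at that of \<open>Q\<close>, it is the
  action of the composition.\<close>

lemma weyl_action_comp:
  assumes "P \<in> weyl_operators" "Q \<in> weyl_operators" shows "weyl_action (P \<circ> Q) \<phi> = weyl_action P (weyl_action Q \<phi>)"
proof -
  obtain T where T: "\<forall>g. \<exists>h. (\<forall>p. nf h p = P (nf g p)) \<and> (\<forall>\<phi>. nf_action h \<phi> = T (nf_action g \<phi>))" using weyl_left_nf[OF assms(1)] ..
  obtain h where h: "\<forall>p. nf h p = P (nf 1 p)" "\<forall>\<phi>. nf_action h \<phi> = T (nf_action 1 \<phi>)"
    using T[rule_format, of 1] by (elim exE conjE)
  have P: "P = nf h" by (rule ext) (simp add: h nf_id)
  obtain g where g: "Q = nf g" using weyl_nf[OF assms(2)] ..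
  obtain k where k: "\<forall>p. nf k p = P (nf g p)" "\<forall>\<phi>. nf_action k \<phi> = T (nf_action g \<phi>)" using T[rule_format, of g] by (elim exE conjE)
  have PQ: "P \<circ> Q = nf k" by (rule ext) (simp add: k g)
  have "weyl_action (P \<circ> Q) \<phi> = T (nf_action g \<phi>)" unfolding PQ weyl_action_nf by (simp add: k)
  moreover have "weyl_action P (weyl_action Q \<phi>) = T (nf_action g \<phi>)" unfolding g unfolding P weyl_action_nf by (simp add: h(2) nf_action_id)
  ultimately show ?thesis by simp
qed

lemma weyl_action_add:
  assumes "P \<in> weyl_operators" "Q \<in> weyl_operators"
  shows "weyl_action (\<lambda>p. P p + Q p) \<phi> q = weyl_action P \<phi> q + weyl_action Q \<phi> q"
proof -
  obtain g where g: "P = nf g" using weyl_nf[OF assms(1)] ..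
  obtain h where h: "Q = nf h" using weyl_nf[OF assms(2)] ..
  have "(\<lambda>p. P p + Q p) = nf (g + h)" by (rule ext) (simp add: g h nf_add)
  then show ?thesis by (simp add: g h weyl_action_nf nf_action_add)
qed

lemma weyl_action_mult: "weyl_action (\<lambda>p. f * p) \<phi> q = mult_action f \<phi> q"
proof -
  have "(\<lambda>p. f * p) = nf (Poly_Mapping.single 0 f)" by (rule ext) (simp add: nf_single deriv_monomial_0)
  moreover have "deriv_action 0 \<phi> = \<phi>" by (rule ext) (rule deriv_action_id)
  ultimately show ?thesis by (simp add: weyl_action_nf nf_action_single)
qed

lemma weyl_action_mderiv:
  fixes \<phi> :: "('n::{finite,linorder} \<Rightarrow> rat) \<Rightarrow> 'k::field_char_0"
  shows "weyl_action (mderiv j) \<phi> q = deriv_action (unit_exp j) \<phi> q"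
proof -
  have "(mderiv j :: ('n, 'k) mpoly \<Rightarrow> _) = nf (Poly_Mapping.single (unit_exp j) 1)" by (rule ext) (simp add: nf_single deriv_monomial_unit_exp)
  then show ?thesis by (simp add: weyl_action_nf nf_action_single mult_action_1)
qed

lemma weyl_linear:
  assumes "P \<in> weyl_operators" shows "P (p + q) = P p + P q"
  using assms by (induction arbitrary: p q) (simp_all add: distrib_left mderiv_add add_ac)

lemma weyl_0: "P \<in> weyl_operators \<Longrightarrow> P 0 = 0"
  using weyl_linear[of P 0 0] by simp

lemma mconst_0: "mconst 0 = 0" and mconst_1: "mconst 1 = 1" and mconst_neg: "mconst (- 1) = - 1"
  by (simp_all add: mconst_def single_uminus)

lemma weyl_zero: "(\<lambda>p. 0) \<in> weyl_operators"
proof -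
  have "(\<lambda>p. mconst 0 * p) \<in> weyl_operators" by (rule weyl_operators.scalar)
  then show ?thesis unfolding mconst_0 mult_zero_left .
qed
lemma weyl_id: "id \<in> weyl_operators"
proof -
  have "(\<lambda>p. mconst 1 * p) \<in> weyl_operators" by (rule weyl_operators.scalar)
  then show ?thesis unfolding mconst_1 mult_1 id_def .
qed
lemma weyl_uminus: assumes "P \<in> weyl_operators" shows "(\<lambda>p. - P p) \<in> weyl_operators"
  using weyl_operators.comp[OF weyl_operators.scalar[of "- 1"] assms] by (simp add: mconst_neg o_def)

lemma weyl_sum: "(\<And>i. i \<in> I \<Longrightarrow> P i \<in> weyl_operators) \<Longrightarrow> (\<lambda>p. \<Sum>i\<in>I. P i p) \<in> weyl_operators"
  by (induction I rule: infinite_finite_induct) (simp_all add: weyl_zero weyl_operators.add)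

lemma total_pos_split: 
  fixes m :: "'n::finite \<Rightarrow>\<^sub>0 nat"
  assumes "m \<noteq> 0" obtains j m' where "m = unit_exp j + m'" "total m' < total m"
proof -
  obtain j where j: "Poly_Mapping.lookup m j \<noteq> 0" using assms by (metis poly_mapping_eqI lookup_zero)
  have "m = unit_exp j + (m - unit_exp j)"
    by (rule poly_mapping_eqI) (use j in \<open>auto simp: lookup_add lookup_minus lookup_single when_def\<close>)
  moreover from this have "total m = 1 + total (m - unit_exp j)" using total_add[of "unit_exp j" "m - unit_exp j"] by (simp add: total_single)
  ultimately show ?thesis by (intro that[of j "m - unit_exp j"]) simp_all
qed

lemma weyl_mult: "(\<lambda>p. f * p) \<in> weyl_operators" for f :: "('n::{finite,linorder}, 'k::field_char_0) mpoly"
proof (induction f rule: pm_induct)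
  case zero
  then show ?case by (simp add: weyl_zero)
next
  case (single m c)
  show ?case
  proof (induction "total m" arbitrary: m rule: less_induct)
    case less
    show ?case
    proof (cases "m = 0")
      case True
      then show ?thesis using weyl_operators.scalar[of c] by (simp add: mconst_def)
    next
      case False
      then obtain j m' where m: "m = unit_exp j + m'" "total m' < total m" by (rule total_pos_split)
      have "(\<lambda>p. mvar j * p) \<circ> (\<lambda>p. Poly_Mapping.single m' c * p) \<in> weyl_operators"
        by (intro weyl_operators.comp weyl_operators.var less m(2))
      also have "(\<lambda>p. mvar j * p) \<circ> (\<lambda>p. Poly_Mapping.single m' c * p) = (\<lambda>p. Poly_Mapping.single m c * p)"
        by (rule ext) (simp add: mvar_def m(1) mult.assoc[symmetric] mult_single)
      finally show ?thesis .
    qed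
  qed
next
  case (add g h)
  then show ?case using weyl_operators.add[OF add] by (simp add: distrib_right)
qed

lemma weyl_deriv_monomial: "(deriv_monomial b :: ('n::{finite,linorder}, 'k::field_char_0) mpoly \<Rightarrow> _) \<in> weyl_operators"
proof (induction "total b" arbitrary: b rule: less_induct)
  case less
  show ?case
  proof (cases "b = 0")
    case True
    then show ?thesis by (simp add: deriv_monomial_0 weyl_id)
  next
    case False
    then obtain j b' where b: "b = unit_exp j + b'" "total b' < total b" by (rule total_pos_split)
    have "(mderiv j \<circ> deriv_monomial b' :: ('n, 'k) mpoly \<Rightarrow> _) \<in> weyl_operators"
      by (intro weyl_operators.comp weyl_operators.deriv less b(2))
    also have "mderiv j \<circ> deriv_monomial b' = (deriv_monomial b :: ('n, 'k) mpoly \<Rightarrow> _)"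
      by (rule ext) (simp add: b(1) deriv_monomial_add deriv_monomial_unit_exp)
    finally show ?thesis .
  qed
qed

lemma weyl_algebra_simps [simp]:
  "carrier weyl_algebra = weyl_operators" "P \<otimes>\<^bsub>weyl_algebra\<^esub> Q = P \<circ> Q" "\<one>\<^bsub>weyl_algebra\<^esub> = id"
  "\<zero>\<^bsub>weyl_algebra\<^esub> = (\<lambda>_. 0)" "P \<oplus>\<^bsub>weyl_algebra\<^esub> Q = (\<lambda>p. P p + Q p)"
  by (simp_all add: weyl_algebra_def)

lemma weyl_ring: "ring (weyl_algebra :: (('n::{finite,linorder}, 'k::field_char_0) mpoly \<Rightarrow> ('n, 'k) mpoly) ring)"
proof (rule ringI)
  show "abelian_group (weyl_algebra :: (('n, 'k) mpoly \<Rightarrow> ('n, 'k) mpoly) ring)"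
  proof (rule abelian_groupI)
    fix P :: "('n, 'k) mpoly \<Rightarrow> ('n, 'k) mpoly" assume "P \<in> carrier weyl_algebra"
    then show "\<exists>Q\<in>carrier weyl_algebra. Q \<oplus>\<^bsub>weyl_algebra\<^esub> P = \<zero>\<^bsub>weyl_algebra\<^esub>"
      by (intro bexI[of _ "\<lambda>p. - P p"]) (simp_all add: weyl_uminus)
  qed (auto simp: weyl_zero weyl_operators.add add_ac)
  show "Group.monoid (weyl_algebra :: (('n, 'k) mpoly \<Rightarrow> ('n, 'k) mpoly) ring)"
    by (rule monoidI) (auto simp: weyl_id weyl_operators.comp comp_assoc)
qed (auto simp: o_def weyl_linear)

lemma weyl_a_inv:
  fixes P :: "('n::{finite,linorder}, 'k::field_char_0) mpoly \<Rightarrow> ('n, 'k) mpoly"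
  assumes "P \<in> weyl_operators" shows "\<ominus>\<^bsub>weyl_algebra\<^esub> P = (\<lambda>p. - P p)"
proof -
  interpret ring "weyl_algebra :: (('n, 'k) mpoly \<Rightarrow> ('n, 'k) mpoly) ring" by (rule weyl_ring)
  show ?thesis by (rule minus_equality) (use assms in \<open>simp_all add: weyl_uminus\<close>)
qed

lemma left_ideal_weyl_iff:
  fixes J :: "(('n::{finite,linorder}, 'k::field_char_0) mpoly \<Rightarrow> ('n, 'k) mpoly) set"
  shows "left_ideal J weyl_algebra \<longleftrightarrow> J \<subseteq> weyl_operators \<and> (\<lambda>_. 0) \<in> J \<and> (\<forall>P\<in>J. \<forall>Q\<in>J. (\<lambda>p. P p + Q p) \<in> J) \<and>
    (\<forall>P\<in>weyl_operators. \<forall>Q\<in>J. P \<circ> Q \<in> J)"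
proof
  assume "left_ideal J weyl_algebra"
  then have J: "additive_subgroup J (weyl_algebra :: (('n, 'k) mpoly \<Rightarrow> ('n, 'k) mpoly) ring)"
    "\<forall>P\<in>weyl_operators. \<forall>Q\<in>J. P \<circ> Q \<in> J"
    by (simp_all add: left_ideal_def)
  from J show "J \<subseteq> weyl_operators \<and> (\<lambda>_. 0) \<in> J \<and> (\<forall>P\<in>J. \<forall>Q\<in>J. (\<lambda>p. P p + Q p) \<in> J) \<and>
    (\<forall>P\<in>weyl_operators. \<forall>Q\<in>J. P \<circ> Q \<in> J)"
    using additive_subgroup.a_subset[OF J(1)] additive_subgroup.zero_closed[OF J(1)] additive_subgroup.a_closed[OF J(1)]
    by simp
next
  assume J: "J \<subseteq> weyl_operators \<and> (\<lambda>_. 0) \<in> J \<and> (\<forall>P\<in>J. \<forall>Q\<in>J. (\<lambda>p. P p + Q p) \<in> J) \<and>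
    (\<forall>P\<in>weyl_operators. \<forall>Q\<in>J. P \<circ> Q \<in> J)"
  have neg: "(\<lambda>p. - P p) \<in> J" if "P \<in> J" for P
  proof -
    have "(\<lambda>p. mconst (- 1) * p) \<circ> P \<in> J" using J that weyl_operators.scalar by blast
    then show ?thesis by (simp add: mconst_neg o_def)
  qed
  have "subgroup J (add_monoid (weyl_algebra :: (('n, 'k) mpoly \<Rightarrow> ('n, 'k) mpoly) ring))"
  proof
    fix P assume "P \<in> J"
    moreover have "P \<in> weyl_operators" using J \<open>P \<in> J\<close> by blast
    ultimately show "inv\<^bsub>add_monoid weyl_algebra\<^esub> P \<in> J" using neg weyl_a_inv[of P] by (simp add: a_inv_def)
  qed (use J in auto)
  then have "additive_subgroup J (weyl_algebra :: (('n, 'k) mpoly \<Rightarrow> ('n, 'k) mpoly) ring)" by (rule additive_subgroupI)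
  then show "left_ideal J weyl_algebra" using J by (simp add: left_ideal_def)
qed

lemma weyl_left_ideal_self: "left_ideal weyl_operators (weyl_algebra :: (('n::{finite,linorder}, 'k::field_char_0) mpoly \<Rightarrow> ('n, 'k) mpoly) ring)"
  by (simp add: left_ideal_weyl_iff weyl_zero weyl_operators.add weyl_operators.comp)

lemma gen_left_ideal_weyl:
  fixes G :: "(('n::{finite,linorder}, 'k::field_char_0) mpoly \<Rightarrow> ('n, 'k) mpoly) set"
  assumes "G \<subseteq> weyl_operators"
  shows "left_ideal (gen_left_ideal weyl_algebra G) weyl_algebra" "G \<subseteq> gen_left_ideal weyl_algebra G"
proof -
  have self: "weyl_operators \<in> {J. left_ideal J weyl_algebra \<and> G \<subseteq> J}" using assms weyl_left_ideal_self by blast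
  show "G \<subseteq> gen_left_ideal weyl_algebra G" unfolding gen_left_ideal_def by blast
  show "left_ideal (gen_left_ideal weyl_algebra G) weyl_algebra"
    unfolding left_ideal_weyl_iff
  proof (intro conjI ballI)
    show "gen_left_ideal weyl_algebra G \<subseteq> weyl_operators" unfolding gen_left_ideal_def using self by (rule Inter_lower)
  qed (auto simp: gen_left_ideal_def left_ideal_weyl_iff)
qed

definition annih :: "(('n \<Rightarrow> rat) \<Rightarrow> 'k) \<Rightarrow> (('n::{finite,linorder}, 'k::field_char_0) mpoly \<Rightarrow> ('n, 'k) mpoly) set" where
  "annih \<phi> = {P\<in>weyl_operators. weyl_action P \<phi> = (\<lambda>_. 0)}"

lemma nf_action_of_zero: "nf_action g (\<lambda>_. 0) = (\<lambda>_. 0)"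
proof -
  have "deriv_action b (\<lambda>_. 0 :: 'b) = (\<lambda>_. 0)" for b :: "'a \<Rightarrow>\<^sub>0 nat" by (rule ext) (rule deriv_action_zero)
  then show ?thesis by (intro ext) (simp add: nf_action_def psum_def mult_action_zero)
qed

lemma annih_left_ideal: "left_ideal (annih \<phi>) weyl_algebra"
  unfolding left_ideal_weyl_iff
proof (intro conjI ballI)
  show "annih \<phi> \<subseteq> weyl_operators" by (auto simp: annih_def)
  have "weyl_action (\<lambda>_. 0) \<phi> = (\<lambda>_. 0)" using weyl_action_mult[of 0 \<phi>] by (intro ext) (simp add: mult_action_0)
  then show "(\<lambda>_. 0) \<in> annih \<phi>" by (simp add: annih_def weyl_zero)
next
  fix P Q assume "P \<in> annih \<phi>" "Q \<in> annih \<phi>"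
  then show "(\<lambda>p. P p + Q p) \<in> annih \<phi>" by (auto simp: annih_def weyl_operators.add weyl_action_add intro!: ext)
next
  fix P Q :: "('a, 'b) mpoly \<Rightarrow> ('a, 'b) mpoly" assume P: "P \<in> weyl_operators" and "Q \<in> annih \<phi>"
  then have Q: "Q \<in> weyl_operators" "weyl_action Q \<phi> = (\<lambda>_. 0)" by (auto simp: annih_def)
  obtain g where "P = nf g" using weyl_nf[OF P] ..
  then have "weyl_action P (\<lambda>_. 0) = (\<lambda>_. 0)" by (simp add: weyl_action_nf nf_action_of_zero)
  then show "P \<circ> Q \<in> annih \<phi>" using P Q by (simp add: annih_def weyl_operators.comp weyl_action_comp)
qed

lemma gen_left_ideal_annih: "G \<subseteq> annih \<phi> \<Longrightarrow> gen_left_ideal weyl_algebra G \<subseteq> annih \<phi>"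
  unfolding gen_left_ideal_def using annih_left_ideal by (intro Inter_lower) blast

section \<open>Extension of scalars to the rational functions\<close>

lemma to_fract_numerator: "\<exists>g r. g \<noteq> 0 \<and> to_fract g * a = to_fract r" for a :: "'a::idom fract"
proof -
  obtain p q where "a = Fraction_Field.Fract p q" "q \<noteq> 0" by (cases a)
  then have "to_fract q * a = to_fract p" by (simp add: Fract_conv_to_fract)
  with \<open>q \<noteq> 0\<close> show ?thesis by blast
qed

text \<open>\<open>E\<close> is the tensor product of \<open>k(x)\<close> with the cyclic module of
  \<open>H\<close>, and \<open>\<tau> P\<close> is the class of \<open>P\<close> in it. The purpose
  is to replace computations with cosets of formal sums by membership in \<open>H\<close>: the key
  fact is \<open>\<tau>_eq_0\<close>.\<close>

locale localized_quotient =
  fixes H :: "(('n::{finite,linorder}, 'k::field_char_0) mpoly \<Rightarrow> ('n, 'k) mpoly) set"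
  assumes left_ideal: "left_ideal H weyl_algebra"
begin

abbreviation "M \<equiv> left_quotient_module mult_operator weyl_algebra H"
abbreviation "K \<equiv> ring_of_type_algebra :: ('n, 'k) mpoly fract ring"
abbreviation "E \<equiv> base_change ring_of_type_algebra K to_fract M"
definition quot_class where "quot_class P = (\<lambda>h p. h p + P p) ` H"
definition "MC = quot_class ` weyl_operators"
abbreviation "FG \<equiv> free_Abelian_group (UNIV \<times> MC :: (('n, 'k) mpoly fract \<times> _) set)"
definition "N = generate FG (tensor_relations ring_of_type_algebra K to_fract M)"
definition tensor_class where "tensor_class f = (\<lambda>n. n + f) ` N"
definition tensor_scale where "tensor_scale c = frag_extend (\<lambda>(a, m). frag_of (c * a, m))"
  for c :: "('n, 'k) mpoly fract"
definition \<tau> where "\<tau> P = tensor_class (frag_of (1, quot_class P))"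

lemma H_sub: "P \<in> H \<Longrightarrow> P \<in> weyl_operators"
  and H_0: "(\<lambda>_. 0) \<in> H"
  and H_add: "P \<in> H \<Longrightarrow> Q \<in> H \<Longrightarrow> (\<lambda>p. P p + Q p) \<in> H"
  and H_comp: "P \<in> weyl_operators \<Longrightarrow> Q \<in> H \<Longrightarrow> P \<circ> Q \<in> H"
  using left_ideal unfolding left_ideal_weyl_iff by auto

lemma H_mult: "P \<in> H \<Longrightarrow> (\<lambda>p. f * P p) \<in> H"
  using H_comp[OF weyl_mult] by (simp add: o_def)

lemma H_uminus: "P \<in> H \<Longrightarrow> (\<lambda>p. - P p) \<in> H"
  using H_mult[of P "-1"] by simp

lemma H_diff: "P \<in> H \<Longrightarrow> Q \<in> H \<Longrightarrow> (\<lambda>p. P p - Q p) \<in> H"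
  using H_add[of P "\<lambda>p. - Q p"] H_uminus by simp

lemma H_sum: "(\<And>i. i \<in> I \<Longrightarrow> P i \<in> H) \<Longrightarrow> (\<lambda>p. \<Sum>i\<in>I. P i p) \<in> H"
proof (induction I rule: infinite_finite_induct)
  case (insert i I)
  then have "(\<lambda>p. P i p + (\<Sum>i\<in>I. P i p)) \<in> H" by (intro H_add) auto
  then show ?case using insert.hyps by simp
qed (simp_all add: H_0)

lemma weyl_smult: "P \<in> weyl_operators \<Longrightarrow> (\<lambda>p. f * P p) \<in> weyl_operators"
  for P :: "('n, 'k) mpoly \<Rightarrow> ('n, 'k) mpoly"
  using weyl_operators.comp[OF weyl_mult, of P f] by (simp add: o_def)

lemma qcI: "h \<in> H \<Longrightarrow> x = (\<lambda>p. h p + P p) \<Longrightarrow> x \<in> quot_class P"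
  unfolding quot_class_def by (rule image_eqI)

lemma qcE: assumes "x \<in> quot_class P" obtains h where "h \<in> H" "x = (\<lambda>p. h p + P p)"
  using assms unfolding quot_class_def by (elim imageE)

lemma quot_class_eq: "quot_class P = quot_class Q \<longleftrightarrow> (\<lambda>p. P p - Q p) \<in> H"
proof
  assume "quot_class P = quot_class Q"
  moreover have "P \<in> quot_class P" using H_0 by (rule qcI) simp
  ultimately have "P \<in> quot_class Q" by simp
  then obtain h where "h \<in> H" "P = (\<lambda>p. h p + Q p)" by (rule qcE)
  then show "(\<lambda>p. P p - Q p) \<in> H" by simp
next
  assume d: "(\<lambda>p. P p - Q p) \<in> H"
  show "quot_class P = quot_class Q"
  proof
    show "quot_class P \<subseteq> quot_class Q"
    proof
      fix x assume "x \<in> quot_class P"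
      then obtain h where h: "h \<in> H" "x = (\<lambda>p. h p + P p)" by (rule qcE)
      show "x \<in> quot_class Q" using H_add[OF h(1) d] by (rule qcI) (simp add: h(2))
    qed
    show "quot_class Q \<subseteq> quot_class P"
    proof
      fix x assume "x \<in> quot_class Q"
      then obtain h where h: "h \<in> H" "x = (\<lambda>p. h p + Q p)" by (rule qcE)
      show "x \<in> quot_class P" using H_diff[OF h(1) d] by (rule qcI) (simp add: h(2))
    qed
  qed
qed

lemma coset_quot_class: "H +>\<^bsub>weyl_algebra\<^esub> P = quot_class P"
  unfolding a_r_coset_def r_coset_def quot_class_def by (auto simp: weyl_algebra_def)

lemma carrier_M: "carrier M = MC"
proof -
  have "carrier M = (\<Union>a\<in>carrier (add_monoid weyl_algebra). {quot_class a})"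
    unfolding left_quotient_module_def A_RCOSETS_def RCOSETS_def coset_quot_class[unfolded a_r_coset_def] partial_object.select_convs ..
  then show ?thesis by (auto simp: MC_def weyl_algebra_def)
qed

lemma quot_class_self: "(\<lambda>p. h p + P p) \<in> quot_class P" if "h \<in> H" using that unfolding quot_class_def by blast

lemma add_M: "quot_class P \<oplus>\<^bsub>M\<^esub> quot_class Q = quot_class (\<lambda>p. P p + Q p)"
proof -
  have "quot_class P \<oplus>\<^bsub>M\<^esub> quot_class Q = {(\<lambda>p. x p + y p) | x y. x \<in> quot_class P \<and> y \<in> quot_class Q}"
    unfolding left_quotient_module_def set_add_def set_mult_def by (auto simp: weyl_algebra_def)
  also have "\<dots> = quot_class (\<lambda>p. P p + Q p)"
  proof (intro equalityI subsetI)
    fix z assume "z \<in> {(\<lambda>p. x p + y p) | x y. x \<in> quot_class P \<and> y \<in> quot_class Q}"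
    then obtain x y where xy: "x \<in> quot_class P" "y \<in> quot_class Q" "z = (\<lambda>p. x p + y p)" by blast
    obtain h where "h \<in> H" "x = (\<lambda>p. h p + P p)" using xy(1) by (rule qcE)
    moreover obtain h' where "h' \<in> H" "y = (\<lambda>p. h' p + Q p)" using xy(2) by (rule qcE)
    ultimately have h: "h \<in> H" "h' \<in> H" "z = (\<lambda>p. (h p + P p) + (h' p + Q p))" using xy(3) by simp_all
    then have "z = (\<lambda>p. (h p + h' p) + (P p + Q p))" by (simp add: algebra_simps)
    then show "z \<in> quot_class (\<lambda>p. P p + Q p)" using quot_class_self[OF H_add[OF h(1,2)], of "\<lambda>p. P p + Q p"] by simp
  next
    fix z assume "z \<in> quot_class (\<lambda>p. P p + Q p)"
    then obtain h where h: "h \<in> H" "z = (\<lambda>p. h p + (P p + Q p))" by (rule qcE)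
    show "z \<in> {(\<lambda>p. x p + y p) | x y. x \<in> quot_class P \<and> y \<in> quot_class Q}"
      by (rule CollectI, rule exI[of _ "\<lambda>p. h p + P p"], rule exI[of _ "\<lambda>p. 0 + Q p"])
        (use quot_class_self[OF h(1), of P] quot_class_self[OF H_0, of Q] in \<open>simp add: h(2) add.assoc\<close>)
  qed
  finally show ?thesis .
qed

lemma smult_M: "r \<odot>\<^bsub>M\<^esub> quot_class P = quot_class (\<lambda>p. r * P p)"
proof -
  have "r \<odot>\<^bsub>M\<^esub> quot_class P = (\<Union>w\<in>quot_class P. quot_class (\<lambda>p. r * w p))"
    unfolding left_quotient_module_def by (simp add: coset_quot_class mult_operator_def o_def)
  moreover have "quot_class (\<lambda>p. r * w p) = quot_class (\<lambda>p. r * P p)" if w: "w \<in> quot_class P" for w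
  proof -
    obtain h where "h \<in> H" "w = (\<lambda>p. h p + P p)" using w by (rule qcE)
    then show ?thesis using H_mult[of h r] by (simp add: quot_class_eq algebra_simps)
  qed
  moreover have "quot_class P \<noteq> {}" using quot_class_self[OF H_0, of P] by blast
  ultimately show ?thesis by auto
qed

lemma K_simps [simp]: "carrier K = UNIV" "a \<oplus>\<^bsub>K\<^esub> b = a + b" "a \<otimes>\<^bsub>K\<^esub> b = a * b" "\<one>\<^bsub>K\<^esub> = 1" "\<zero>\<^bsub>K\<^esub> = 0"
  by (simp_all add: ring_of_type_algebra_def)

lemma R_carrier: "carrier (ring_of_type_algebra :: ('n, 'k) mpoly ring) = UNIV"
  by (simp add: ring_of_type_algebra_def)

lemma field_K: "field K" by (rule field_from_type_algebra)

lemma rel_add: "m \<in> MC \<Longrightarrow> frag_of (a + b, m) - frag_of (a, m) - frag_of (b, m) \<in> N"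
  unfolding N_def by (rule generate.incl) (auto simp: tensor_relations_def carrier_M)

lemma rel_add': "P \<in> weyl_operators \<Longrightarrow> Q \<in> weyl_operators \<Longrightarrow>
    frag_of (a, quot_class (\<lambda>p. P p + Q p)) - frag_of (a, quot_class P) - frag_of (a, quot_class Q) \<in> N"
proof -
  assume "P \<in> weyl_operators" "Q \<in> weyl_operators"
  then have "frag_of (a, quot_class P \<oplus>\<^bsub>M\<^esub> quot_class Q) - frag_of (a, quot_class P) - frag_of (a, quot_class Q) \<in> tensor_relations ring_of_type_algebra K to_fract M"
    unfolding tensor_relations_def carrier_M by (intro UnI1 UnI2 CollectI exI conjI) (auto simp: MC_def)
  then show ?thesis unfolding N_def add_M by (rule generate.incl)
qed

lemma rel_smult: "P \<in> weyl_operators \<Longrightarrow> frag_of (a * to_fract r, quot_class P) - frag_of (a, quot_class (\<lambda>p. r * P p)) \<in> N"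
proof -
  assume "P \<in> weyl_operators"
  then have "frag_of (a \<otimes>\<^bsub>K\<^esub> to_fract r, quot_class P) - frag_of (a, r \<odot>\<^bsub>M\<^esub> quot_class P) \<in> tensor_relations ring_of_type_algebra K to_fract M"
    unfolding tensor_relations_def carrier_M by (intro UnI2 CollectI exI conjI) (auto simp: MC_def R_carrier)
  then show ?thesis unfolding N_def smult_M by (auto intro: generate.incl)
qed

lemma MC_add: "m \<in> MC \<Longrightarrow> m' \<in> MC \<Longrightarrow> m \<oplus>\<^bsub>M\<^esub> m' \<in> MC"
  unfolding MC_def using add_M weyl_operators.add by force

lemma MC_smult: "m \<in> MC \<Longrightarrow> r \<odot>\<^bsub>M\<^esub> m \<in> MC"
  unfolding MC_def using smult_M weyl_smult by force

lemma keys_frag_diff: "Poly_Mapping.keys x \<subseteq> S \<Longrightarrow> Poly_Mapping.keys y \<subseteq> S \<Longrightarrow> Poly_Mapping.keys (x - y) \<subseteq> S"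
  for x y :: "'z \<Rightarrow>\<^sub>0 int"
  using keys_diff[of x y] by blast

lemma rels_carrier: "tensor_relations ring_of_type_algebra K to_fract M \<subseteq> carrier FG"
  unfolding tensor_relations_def free_Abelian_group_def carrier_M
  by (auto intro!: keys_frag_diff simp: keys_frag_of MC_add MC_smult dest!: subsetD[OF keys_diff])

lemma N_induct [consumes 1, case_names zero rel diff]:
  assumes "f \<in> N" "P 0" "\<And>f. f \<in> tensor_relations ring_of_type_algebra K to_fract M \<Longrightarrow> P f"
    "\<And>f g. P f \<Longrightarrow> P g \<Longrightarrow> P (f - g)"
  shows "P f"
proof -
  have neg: "P (- g)" if "P g" for g using assms(4)[OF assms(2) that] by simp
  show ?thesis
    using assms(1) unfolding N_def
  proof (induction rule: generate.induct)
    case one then show ?case using assms(2) by simp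
  next
    case (incl h) then show ?case by (rule assms(3))
  next
    case (inv h)
    then have "inv\<^bsub>FG\<^esub> h = - h" using rels_carrier by (intro inv_free_Abelian_group) (auto simp: free_Abelian_group_def)
    then show ?case using neg[OF assms(3)[OF inv]] by simp
  next
    case (eng h g)
    then have "P (h - - g)" by (intro assms(4) neg)
    then show ?case by simp
  qed
qed

lemma N_subgroup: "subgroup N FG"
  unfolding N_def by (rule group.generate_is_subgroup[OF group_free_Abelian_group rels_carrier])

lemma N_0: "0 \<in> N" using subgroup.one_closed[OF N_subgroup] by simp
lemma N_add: "f \<in> N \<Longrightarrow> g \<in> N \<Longrightarrow> f + g \<in> N" using subgroup.m_closed[OF N_subgroup] by simp
lemma N_uminus: assumes "f \<in> N" shows "- f \<in> N"
  using subgroup.m_inv_closed[OF N_subgroup assms] subgroup.mem_carrier[OF N_subgroup assms]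
  by (simp add: free_Abelian_group_def[symmetric] )
lemma N_diff: "f \<in> N \<Longrightarrow> g \<in> N \<Longrightarrow> f - g \<in> N" using N_add[of f "- g"] N_uminus by simp

lemma tensor_class_eq: "tensor_class f = tensor_class g \<longleftrightarrow> f - g \<in> N"
proof
  assume "tensor_class f = tensor_class g"
  moreover have "f \<in> tensor_class f" unfolding tensor_class_def using N_0 by (force simp: image_iff)
  ultimately obtain n where "n \<in> N" "f = n + g" unfolding tensor_class_def by blast
  then show "f - g \<in> N" by simp
next
  assume d: "f - g \<in> N"
  show "tensor_class f = tensor_class g"
  proof
    show "tensor_class f \<subseteq> tensor_class g" unfolding tensor_class_def using N_add[OF _ d] by (force simp: image_iff)
    show "tensor_class g \<subseteq> tensor_class f" unfolding tensor_class_def using N_diff[OF _ d] by (force simp: image_iff)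
  qed
qed

lemma tensor_class_add: "tensor_class f \<oplus>\<^bsub>E\<^esub> tensor_class g = tensor_class (f + g)"
proof -
  have "tensor_class f \<oplus>\<^bsub>E\<^esub> tensor_class g = {x + y | x y. x \<in> tensor_class f \<and> y \<in> tensor_class g}"
    unfolding base_change_def set_mult_def Let_def by auto
  also have "\<dots> = tensor_class (f + g)"
  proof (intro equalityI subsetI)
    fix z assume "z \<in> {x + y | x y. x \<in> tensor_class f \<and> y \<in> tensor_class g}"
    then obtain n m where nm: "n \<in> N" "m \<in> N" "z = (n + f) + (m + g)" unfolding tensor_class_def by blast
    then have "z = (n + m) + (f + g)" by (simp add: algebra_simps)
    then show "z \<in> tensor_class (f + g)" unfolding tensor_class_def using N_add[OF nm(1,2)] by blast
  next
    fix z assume "z \<in> tensor_class (f + g)"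
    then obtain n where n: "n \<in> N" "z = n + (f + g)" unfolding tensor_class_def by blast
    then have "z = (n + f) + (0 + g)" by (simp add: algebra_simps)
    then show "z \<in> {x + y | x y. x \<in> tensor_class f \<and> y \<in> tensor_class g}" unfolding tensor_class_def using n(1) N_0 by blast
  qed
  finally show ?thesis .
qed

lemma coset_tensor_class: "N #>\<^bsub>FG\<^esub> f = tensor_class f"
  unfolding r_coset_def tensor_class_def by auto

lemma carrier_E: "carrier E = tensor_class ` {f. Poly_Mapping.keys f \<subseteq> UNIV \<times> MC}"
proof -
  have "carrier E = (\<Union>f\<in>carrier FG. {tensor_class f})"
    by (simp add: base_change_def Let_def carrier_M N_def[symmetric] RCOSETS_def coset_tensor_class)
  then show ?thesis by (auto simp: free_Abelian_group_def)
qed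

lemma zero_E: "\<zero>\<^bsub>E\<^esub> = tensor_class 0"
  by (simp add: base_change_def Let_def carrier_M N_def[symmetric] tensor_class_def)

lemma tensor_scale_0 [simp]: "tensor_scale c 0 = 0"
  and tensor_scale_add: "tensor_scale c (f + g) = tensor_scale c f + tensor_scale c g"
  and tensor_scale_diff: "tensor_scale c (f - g) = tensor_scale c f - tensor_scale c g"
  and tensor_scale_of: "tensor_scale c (frag_of (a, m)) = frag_of (c * a, m)"
  by (simp_all add: tensor_scale_def frag_extend_add frag_extend_diff)

lemma tensor_scale_N: "f \<in> N \<Longrightarrow> tensor_scale c f \<in> N"
proof (induction rule: N_induct)
  case (rel f)
  then consider (1) a b m where "f = frag_of (a + b, m) - frag_of (a, m) - frag_of (b, m)" "m \<in> MC"
    | (2) a P Q where "f = frag_of (a, quot_class P \<oplus>\<^bsub>M\<^esub> quot_class Q) - frag_of (a, quot_class P) - frag_of (a, quot_class Q)" "P \<in> weyl_operators" "Q \<in> weyl_operators"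
    | (3) a r P where "f = frag_of (a * to_fract r, quot_class P) - frag_of (a, r \<odot>\<^bsub>M\<^esub> quot_class P)" "P \<in> weyl_operators"
    unfolding tensor_relations_def carrier_M K_simps by (auto simp: MC_def)
  then show ?case
  proof cases
    case 1 then show ?thesis using rel_add[of m "c * a" "c * b"] by (simp add: tensor_scale_diff tensor_scale_of distrib_left)
  next
    case 2 then show ?thesis using rel_add'[of P Q "c * a"] by (simp add: tensor_scale_diff tensor_scale_of add_M)
  next
    case 3 then show ?thesis using rel_smult[of P "c * a" r] by (simp add: tensor_scale_diff tensor_scale_of smult_M mult.assoc)
  qed
qed (simp_all add: N_0 tensor_scale_diff N_diff)

lemma tensor_class_smult: "c \<odot>\<^bsub>E\<^esub> tensor_class f = tensor_class (tensor_scale c f)"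
proof -
  have "c \<odot>\<^bsub>E\<^esub> tensor_class f = (\<Union>g\<in>tensor_class f. tensor_class (tensor_scale c g))"
    by (simp add: base_change_def Let_def carrier_M N_def[symmetric] coset_tensor_class tensor_scale_def)
  moreover have "tensor_class (tensor_scale c g) = tensor_class (tensor_scale c f)" if g: "g \<in> tensor_class f" for g
  proof -
    obtain n where "n \<in> N" "g = n + f" using g unfolding tensor_class_def by blast
    then show ?thesis by (simp add: tensor_class_eq tensor_scale_add tensor_scale_N)
  qed
  moreover have "tensor_class f \<noteq> {}" unfolding tensor_class_def using N_0 by blast
  ultimately show ?thesis using SUP_eq_const[of "tensor_class f" "\<lambda>g. tensor_class (tensor_scale c g)"] by simp
qed

lemma tensor_scale_carrier: assumes "Poly_Mapping.keys f \<subseteq> UNIV \<times> MC" shows "Poly_Mapping.keys (tensor_scale c f) \<subseteq> UNIV \<times> MC"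
  using assms by (induction f rule: frag_induction) (auto simp: tensor_scale_diff tensor_scale_of keys_frag_of dest!: subsetD[OF keys_diff])

lemma tensor_scale_plus_N: assumes "Poly_Mapping.keys f \<subseteq> UNIV \<times> MC" shows "tensor_scale (a + b) f - (tensor_scale a f + tensor_scale b f) \<in> N"
  using assms
proof (induction f rule: frag_induction)
  case (one x)
  then show ?case using rel_add[of "snd x" "a * fst x" "b * fst x"]
    by (cases x) (simp add: tensor_scale_of distrib_right diff_diff_add)
next
  case (diff x y)
  then show ?case using N_diff by (fastforce simp: tensor_scale_diff algebra_simps)
qed (simp add: N_0)

lemma tensor_scale_tensor_scale: "tensor_scale (a * b) f = tensor_scale a (tensor_scale b f)"
  using subset_UNIV[of "Poly_Mapping.keys f"] by (induction f rule: frag_induction) (auto simp: tensor_scale_diff tensor_scale_of mult.assoc)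

lemma tensor_scale_1: "tensor_scale 1 f = f"
  using subset_UNIV[of "Poly_Mapping.keys f"] by (induction f rule: frag_induction) (auto simp: tensor_scale_diff tensor_scale_of)

lemma module_E: "module K E"
proof (rule moduleI)
  show "cring K" by (rule cring_from_type_algebra)
  show "abelian_group E"
  proof (rule abelian_groupI)
    fix x y z assume "x \<in> carrier E" "y \<in> carrier E" "z \<in> carrier E"
    then obtain f g h where x: "x = tensor_class f" "y = tensor_class g" "z = tensor_class h" and k: "Poly_Mapping.keys f \<subseteq> UNIV \<times> MC" "Poly_Mapping.keys g \<subseteq> UNIV \<times> MC"
      unfolding carrier_E by blast
    show "x \<oplus>\<^bsub>E\<^esub> y \<in> carrier E" unfolding x tensor_class_add carrier_E
      using k Poly_Mapping.keys_add[of f g] by (intro imageI CollectI) blast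
    show "x \<oplus>\<^bsub>E\<^esub> y \<oplus>\<^bsub>E\<^esub> z = x \<oplus>\<^bsub>E\<^esub> (y \<oplus>\<^bsub>E\<^esub> z)" "x \<oplus>\<^bsub>E\<^esub> y = y \<oplus>\<^bsub>E\<^esub> x"
      "\<zero>\<^bsub>E\<^esub> \<oplus>\<^bsub>E\<^esub> x = x"
      unfolding x zero_E tensor_class_add by (simp_all add: algebra_simps)
    have "tensor_class (- f) \<in> carrier E" unfolding carrier_E using k by (intro imageI CollectI) simp
    then show "\<exists>y\<in>carrier E. y \<oplus>\<^bsub>E\<^esub> x = \<zero>\<^bsub>E\<^esub>"
      by (rule bexI[rotated]) (simp add: x tensor_class_add zero_E)
  qed (auto simp: zero_E carrier_E)
next
  fix a b x y assume "x \<in> carrier E" "y \<in> carrier E"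
  then obtain f g where x: "x = tensor_class f" "y = tensor_class g" and k: "Poly_Mapping.keys f \<subseteq> UNIV \<times> MC"
    unfolding carrier_E by blast
  show "a \<odot>\<^bsub>E\<^esub> x \<in> carrier E" unfolding x tensor_class_smult carrier_E using tensor_scale_carrier[OF k] by blast
  show "(a \<oplus>\<^bsub>K\<^esub> b) \<odot>\<^bsub>E\<^esub> x = a \<odot>\<^bsub>E\<^esub> x \<oplus>\<^bsub>E\<^esub> b \<odot>\<^bsub>E\<^esub> x"
    unfolding x tensor_class_smult tensor_class_add tensor_class_eq K_simps using tensor_scale_plus_N[OF k] .
  show "a \<odot>\<^bsub>E\<^esub> (x \<oplus>\<^bsub>E\<^esub> y) = a \<odot>\<^bsub>E\<^esub> x \<oplus>\<^bsub>E\<^esub> a \<odot>\<^bsub>E\<^esub> y"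
    unfolding x tensor_class_smult tensor_class_add by (simp add: tensor_scale_add)
  show "(a \<otimes>\<^bsub>K\<^esub> b) \<odot>\<^bsub>E\<^esub> x = a \<odot>\<^bsub>E\<^esub> (b \<odot>\<^bsub>E\<^esub> x)" unfolding x tensor_class_smult by (simp add: tensor_scale_tensor_scale)
  show "\<one>\<^bsub>K\<^esub> \<odot>\<^bsub>E\<^esub> x = x" unfolding x tensor_class_smult by (simp add: tensor_scale_1)
qed

lemma vectorspace_E: "vectorspace K E"
  by (intro vectorspace.intro module_E field_K)

lemma \<tau>_carrier: "P \<in> weyl_operators \<Longrightarrow> \<tau> P \<in> carrier E"
  unfolding \<tau>_def carrier_E by (auto simp: keys_frag_of MC_def)

lemma \<tau>_add: "P \<in> weyl_operators \<Longrightarrow> Q \<in> weyl_operators \<Longrightarrow> \<tau> (\<lambda>p. P p + Q p) = \<tau> P \<oplus>\<^bsub>E\<^esub> \<tau> Q"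
  unfolding \<tau>_def tensor_class_add tensor_class_eq using rel_add'[of P Q 1] by (simp add: diff_diff_add)

lemma \<tau>_smult: "P \<in> weyl_operators \<Longrightarrow> \<tau> (\<lambda>p. f * P p) = to_fract f \<odot>\<^bsub>E\<^esub> \<tau> P"
  unfolding \<tau>_def tensor_class_smult tensor_scale_of using rel_smult[of P 1 f] by (simp add: tensor_class_eq N_uminus[of "frag_of (to_fract f, quot_class P) - frag_of (1, quot_class (\<lambda>p. f * P p))", simplified])

lemma \<tau>_zero: "P \<in> H \<Longrightarrow> \<tau> P = \<zero>\<^bsub>E\<^esub>"
proof -
  assume "P \<in> H"
  then have "quot_class P = quot_class (\<lambda>p. 0 * P p)" by (simp add: quot_class_eq)
  then have "\<tau> P = \<tau> (\<lambda>p. 0 * P p)" by (simp add: \<tau>_def)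
  also have "\<dots> = to_fract 0 \<odot>\<^bsub>E\<^esub> \<tau> P" by (rule \<tau>_smult) (use \<open>P \<in> H\<close> H_sub in blast)
  also have "\<dots> = \<zero>\<^bsub>E\<^esub>" using module.smult_l_null[OF module_E \<tau>_carrier[OF H_sub[OF \<open>P \<in> H\<close>]]] by simp
  finally show ?thesis .
qed

text \<open>An elementary tensor with first factor \<open>a\<close> is \<open>a\<close> times a
  tensor with first factor 1, and differences of formal sums are covered by the scalar
  \<open>-1\<close>, up to relations.\<close>

lemma E_generated:
  assumes "\<And>x y. x \<in> T \<Longrightarrow> y \<in> T \<Longrightarrow> x \<oplus>\<^bsub>E\<^esub> y \<in> T" "\<And>a x. x \<in> T \<Longrightarrow> a \<odot>\<^bsub>E\<^esub> x \<in> T"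
    and "\<And>P. P \<in> weyl_operators \<Longrightarrow> \<tau> P \<in> T"
  shows "carrier E \<subseteq> T"
proof
  fix x assume "x \<in> carrier E"
  then obtain f where x: "x = tensor_class f" and f: "Poly_Mapping.keys f \<subseteq> UNIV \<times> MC" unfolding carrier_E by blast
  from f have "Poly_Mapping.keys f \<subseteq> UNIV \<times> MC \<and> tensor_class f \<in> T"
  proof (induction f rule: frag_induction)
    case zero
    have "0 \<odot>\<^bsub>E\<^esub> \<tau> id \<in> T" by (intro assms weyl_id)
    moreover have "0 \<odot>\<^bsub>E\<^esub> \<tau> id = tensor_class 0" using module.smult_l_null[OF module_E \<tau>_carrier[OF weyl_id]] by (simp add: zero_E)
    ultimately show ?case by (simp del: subset_UNIV)
  next
    case (one z)
    then obtain a P where z: "z = (a, quot_class P)" "P \<in> weyl_operators" by (auto simp: MC_def)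
    have "a \<odot>\<^bsub>E\<^esub> \<tau> P \<in> T" using z by (intro assms)
    then show ?case using one by (simp add: z \<tau>_def tensor_class_smult tensor_scale_of keys_frag_of)
  next
    case (diff f g)
    have "tensor_class f \<oplus>\<^bsub>E\<^esub> (-1) \<odot>\<^bsub>E\<^esub> tensor_class g \<in> T" using diff by (intro assms) simp_all
    then have "tensor_class (f + tensor_scale (-1) g) \<in> T" by (simp add: tensor_class_smult tensor_class_add)
    moreover have "tensor_class (f - g) = tensor_class (f + tensor_scale (-1) g)"
    proof -
      have "(tensor_scale 0 g - (g + tensor_scale (-1) g)) + (tensor_scale 0 g - (tensor_scale 0 g + tensor_scale 0 g)) \<in> N"
        using tensor_scale_plus_N[of g 1 "-1"] tensor_scale_plus_N[of g 0 0] diff by (intro N_add) (simp_all add: tensor_scale_1)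
      then show ?thesis unfolding tensor_class_eq by simp
    qed
    ultimately show ?case using diff keys_frag_diff[of f _ g] by simp
  qed
  then show "x \<in> T" by (simp add: x)
qed

text \<open>Arbitrary unless \<open>a\<close> is a polynomial; it is evaluated meaningfully only
  after the denominators have been multiplied away.\<close>

definition numerator :: "('n, 'k) mpoly fract \<Rightarrow> ('n, 'k) mpoly" where "numerator a = (SOME r. to_fract r = a)"
definition representative where "representative m = (SOME P. P \<in> weyl_operators \<and> m = quot_class P)"
text \<open>A formal sum of tensors becomes an operator after multiplication by a common denominator \<open>g\<close>.
  The choice of representatives matters only modulo \<open>H\<close>.\<close>

definition clear where
  "clear g f p = psum (\<lambda>x n. of_int n * (numerator (to_fract g * fst x) * representative (snd x) p)) f"
  for f :: "(('n, 'k) mpoly fract \<times> _) \<Rightarrow>\<^sub>0 int"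

lemma numerator_eq: "to_fract r = a \<Longrightarrow> numerator a = r"
  unfolding numerator_def by (metis (mono_tags, lifting) someI to_fract_eq_iff)

lemma numerator_to_fract: "numerator (to_fract r) = r" by (rule numerator_eq) simp

lemma representative: assumes "P \<in> weyl_operators"
  shows "representative (quot_class P) \<in> weyl_operators" "(\<lambda>p. representative (quot_class P) p - P p) \<in> H"
proof -
  have "representative (quot_class P) \<in> weyl_operators \<and> quot_class P = quot_class (representative (quot_class P))" unfolding representative_def
    by (rule someI[of "\<lambda>Q. Q \<in> weyl_operators \<and> quot_class P = quot_class Q" P]) (simp add: assms)
  then show "representative (quot_class P) \<in> weyl_operators" "(\<lambda>p. representative (quot_class P) p - P p) \<in> H" using quot_class_eq[of "representative (quot_class P)" P] by auto
qed

lemma clear_add: "clear g (f + h) p = clear g f p + clear g h p"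
  unfolding clear_def by (rule psum_add) (simp_all add: algebra_simps)

lemma clear_0: "clear g 0 p = 0" by (simp add: clear_def psum_zero)

lemma clear_diff: "clear g (f - h) p = clear g f p - clear g h p"
  using clear_add[of g "f - h" h p] by simp

lemma clear_of: "clear g (frag_of (a, m)) p = numerator (to_fract g * a) * representative m p"
  unfolding clear_def by (subst psum_single) simp_all

text \<open>Quantifying over all multiples of \<open>g\<close> allows the denominators of the
  finitely many relations in an element of \<open>N\<close> to be combined by a product. Additivity
  in the first factor clears to zero exactly; the other two kinds leave multiples of differences
  between representatives, which lie in \<open>H\<close>.\<close>

lemma clear_relation:
  assumes "f \<in> tensor_relations ring_of_type_algebra K to_fract M"
  shows "\<exists>g. g \<noteq> 0 \<and> (\<forall>g'. g dvd g' \<longrightarrow> clear g' f \<in> H)"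
proof -
  consider (1) a b m where "f = frag_of (a + b, m) - frag_of (a, m) - frag_of (b, m)" "m \<in> MC"
    | (2) a P Q where "f = frag_of (a, quot_class P \<oplus>\<^bsub>M\<^esub> quot_class Q) - frag_of (a, quot_class P) - frag_of (a, quot_class Q)" "P \<in> weyl_operators" "Q \<in> weyl_operators"
    | (3) a r P where "f = frag_of (a * to_fract r, quot_class P) - frag_of (a, r \<odot>\<^bsub>M\<^esub> quot_class P)" "P \<in> weyl_operators"
    using assms unfolding tensor_relations_def carrier_M K_simps by (auto simp: MC_def)
  then show ?thesis
  proof cases
    case 1
    obtain g r where g: "g \<noteq> 0" "to_fract g * a = to_fract r" using to_fract_numerator by blast
    obtain h s where h: "h \<noteq> 0" "to_fract h * b = to_fract s" using to_fract_numerator by blast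
    have "clear (g * h * d) f \<in> H" for d
    proof -
      have "to_fract (g * h * d) * a = (to_fract g * a) * to_fract (h * d)" by simp
      then have a: "to_fract (g * h * d) * a = to_fract (r * (h * d))" unfolding g by simp
      have "to_fract (g * h * d) * b = (to_fract h * b) * to_fract (g * d)" by simp
      then have b: "to_fract (g * h * d) * b = to_fract (s * (g * d))" unfolding h by simp
      have "to_fract (g * h * d) * (a + b) = to_fract (r * (h * d) + s * (g * d))"
        unfolding distrib_left a b by simp
      with a b have "clear (g * h * d) f = (\<lambda>_. 0)"
        by (intro ext) (simp only: 1 clear_diff clear_of numerator_eq[OF a[symmetric]] numerator_eq[OF b[symmetric]] numerator_eq[OF sym], simp add: algebra_simps)
      then show ?thesis using H_0 by simp
    qed
    then show ?thesis using g h by (intro exI[of _ "g * h"]) (auto elim!: dvdE)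
  next
    case 2
    have "clear g f \<in> H" for g
    proof -
      define Z where "Z p = (representative (quot_class (\<lambda>p. P p + Q p)) p - (P p + Q p)) - (representative (quot_class P) p - P p) - (representative (quot_class Q) p - Q p)" for p
      have "Z \<in> H" unfolding Z_def using 2 by (intro H_diff representative weyl_operators.add)
      then have "(\<lambda>p. numerator (to_fract g * a) * Z p) \<in> H" by (rule H_mult)
      also have "(\<lambda>p. numerator (to_fract g * a) * Z p) = clear g f"
        by (rule ext) (simp only: 2 clear_diff clear_of add_M Z_def, simp add: algebra_simps)
      finally show ?thesis .
    qed
    then show ?thesis by (intro exI[of _ 1]) simp
  next
    case 3
    obtain g s where g: "g \<noteq> 0" "to_fract g * a = to_fract s" using to_fract_numerator by blast
    have "clear (g * d) f \<in> H" for d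
    proof -
      have "to_fract (g * d) * a = (to_fract g * a) * to_fract d" by simp
      then have a: "to_fract (g * d) * a = to_fract (s * d)" unfolding g by simp
      have "to_fract (g * d) * (a * to_fract r) = to_fract (s * d) * to_fract r" using a by (simp only: mult.assoc[symmetric])
      then have ar: "to_fract (g * d) * (a * to_fract r) = to_fract (s * d * r)" by simp
      define Z where "Z p = r * (representative (quot_class P) p - P p) - (representative (quot_class (\<lambda>p. r * P p)) p - r * P p)" for p
      have "Z \<in> H" unfolding Z_def using 3 by (intro H_diff H_mult representative weyl_smult)
      then have "(\<lambda>p. (s * d) * Z p) \<in> H" by (rule H_mult)
      also have "(\<lambda>p. (s * d) * Z p) = clear (g * d) f"
        by (rule ext) (simp only: 3 clear_diff clear_of smult_M numerator_eq[OF a[symmetric]] numerator_eq[OF ar[symmetric]] Z_def, simp add: algebra_simps)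
      finally show ?thesis .
    qed
    then show ?thesis using g by (intro exI[of _ g]) (auto elim!: dvdE)
  qed
qed

lemma clear_N: assumes "f \<in> N" shows "\<exists>g. g \<noteq> 0 \<and> (\<forall>g'. g dvd g' \<longrightarrow> clear g' f \<in> H)"
  using assms
proof (induction rule: N_induct)
  case zero
  have "clear g 0 = (\<lambda>_. 0)" for g by (intro ext) (rule clear_0)
  then show ?case using H_0 by (intro exI[of _ 1]) simp
next
  case (rel f)
  then show ?case by (rule clear_relation)
next
  case (diff f h)
  obtain a where a: "a \<noteq> 0" "\<And>g. a dvd g \<Longrightarrow> clear g f \<in> H" using diff by blast
  obtain b where b: "b \<noteq> 0" "\<And>g. b dvd g \<Longrightarrow> clear g h \<in> H" using diff by blast
  have "clear g (f - h) \<in> H" if "a * b dvd g" for g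
  proof -
    have "a dvd g" "b dvd g" using that by (auto intro: dvd_trans[OF _ that])
    then have "(\<lambda>p. clear g f p - clear g h p) \<in> H" by (intro H_diff a b)
    then show ?thesis by (simp add: clear_diff[abs_def])
  qed
  then show ?case using a b by (intro exI[of _ "a * b"]) simp
qed

text \<open>Clearing the tensor of 1 with the class of \<open>P\<close> returns \<open>g\<close>
  times a representative of \<open>P\<close>, and the representative may be exchanged for
  \<open>P\<close> modulo \<open>H\<close>.\<close>

lemma \<tau>_eq_0:
  assumes "P \<in> weyl_operators" "\<tau> P = \<zero>\<^bsub>E\<^esub>"
  obtains g where "g \<noteq> 0" "(\<lambda>p. g * P p) \<in> H"
proof -
  have "frag_of (1, quot_class P) \<in> N" using assms(2) unfolding \<tau>_def zero_E tensor_class_eq by simp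
  from clear_N[OF this] obtain g where g': "g \<noteq> 0 \<and> (\<forall>g'. g dvd g' \<longrightarrow> clear g' (frag_of (1, quot_class P)) \<in> H)" ..
  then have g: "g \<noteq> 0" "clear g (frag_of (1, quot_class P)) \<in> H" using dvd_refl by (blast, blast)
  have eq: "clear g (frag_of (1, quot_class P)) = (\<lambda>p. g * representative (quot_class P) p)" by (rule ext) (simp add: clear_of numerator_to_fract)
  have "(\<lambda>p. g * representative (quot_class P) p) \<in> H" using g(2) unfolding eq .
  from H_diff[OF this H_mult[OF representative(2)[OF assms(1)], of g]]
  have "(\<lambda>p. g * representative (quot_class P) p - g * (representative (quot_class P) p - P p)) \<in> H" .
  also have "(\<lambda>p. g * representative (quot_class P) p - g * (representative (quot_class P) p - P p)) = (\<lambda>p. g * P p)" by (rule ext) (simp add: right_diff_distrib)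
  finally have "(\<lambda>p. g * P p) \<in> H" .
  with g(1) show ?thesis by (rule that)
qed

lemma \<tau>_sum:
  assumes "finite B" "\<And>w. w \<in> B \<Longrightarrow> G w \<in> weyl_operators"
  shows "\<tau> (\<lambda>p. \<Sum>w\<in>B. f w * G w p) = (\<Oplus>\<^bsub>E\<^esub>w\<in>B. to_fract (f w) \<odot>\<^bsub>E\<^esub> \<tau> (G w))"
  using assms
proof (induction B)
  case empty
  interpret E: module K E by (rule module_E)
  show ?case using \<tau>_zero[OF H_0] by simp
next
  case (insert w B)
  interpret E: module K E by (rule module_E)
  have "\<tau> (\<lambda>p. f w * G w p + (\<Sum>w\<in>B. f w * G w p)) = \<tau> (\<lambda>p. f w * G w p) \<oplus>\<^bsub>E\<^esub> \<tau> (\<lambda>p. \<Sum>w\<in>B. f w * G w p)"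
    using insert by (intro \<tau>_add weyl_smult weyl_sum) auto
  then show ?case using insert by (simp add: \<tau>_smult E.finsum_insert \<tau>_carrier E.smult_closed)
qed

theorem vs_dim_le:
  assumes B: "finite B" and G: "\<And>w. w \<in> B \<Longrightarrow> G w \<in> weyl_operators"
    and gen: "\<And>P. P \<in> weyl_operators \<Longrightarrow> \<exists>g f. g \<noteq> 0 \<and> (\<lambda>p. g * P p - (\<Sum>w\<in>B. f w * G w p)) \<in> H"
  shows "vs_dim K E \<le> enat (card B)"
proof -
  interpret vectorspace K E by (rule vectorspace_E)
  let ?X = "\<tau> ` G ` B"
  have X: "finite ?X" "?X \<subseteq> carrier E" using B G \<tau>_carrier by auto
  interpret sp: submodule K "span ?X" E by (rule span_is_submodule[OF X(2)])
  have "carrier E \<subseteq> span ?X"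
  proof (rule E_generated)
    fix P :: "('n, 'k) mpoly \<Rightarrow> ('n, 'k) mpoly" assume P: "P \<in> weyl_operators"
    from gen[OF P] obtain g f where g: "g \<noteq> 0" "(\<lambda>p. g * P p - (\<Sum>w\<in>B. f w * G w p)) \<in> H" by blast
    let ?S = "\<lambda>p. \<Sum>w\<in>B. f w * G w p"
    have S: "?S \<in> weyl_operators" using G by (intro weyl_sum weyl_smult)
    have fin: "(\<Oplus>\<^bsub>E\<^esub>w\<in>C. to_fract (f w) \<odot>\<^bsub>E\<^esub> \<tau> (G w)) \<in> span ?X" if "C \<subseteq> B" for C
    proof -
      have "finite C" using that B finite_subset by blast
      then show ?thesis using that
      proof (induction C)
        case (insert w C)
        have "\<tau> (G w) \<in> span ?X" using in_own_span[OF X(2)] insert.prems by blast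
        then show ?case using insert G \<tau>_carrier
          by (subst finsum_insert) (auto intro!: sp.m_closed sp.smult_closed)
      qed simp
    qed
    have "\<tau> (\<lambda>p. ?S p + (g * P p - ?S p)) = \<tau> ?S \<oplus>\<^bsub>E\<^esub> \<tau> (\<lambda>p. g * P p - ?S p)" by (rule \<tau>_add[OF S H_sub[OF g(2)]])
    then have "\<tau> (\<lambda>p. g * P p) = \<tau> ?S" using \<tau>_zero[OF g(2)] \<tau>_carrier[OF S] by simp
    then have "to_fract g \<odot>\<^bsub>E\<^esub> \<tau> P \<in> span ?X" using fin[of B] \<tau>_sum[OF B G] \<tau>_smult[OF P] by simp
    then have "inverse (to_fract g) \<odot>\<^bsub>E\<^esub> (to_fract g \<odot>\<^bsub>E\<^esub> \<tau> P) \<in> span ?X" by (rule sp.smult_closed[rotated]) simp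
    moreover have "inverse (to_fract g) \<odot>\<^bsub>E\<^esub> (to_fract g \<odot>\<^bsub>E\<^esub> \<tau> P) = \<tau> P"
      using smult_assoc1[of "inverse (to_fract g)" "to_fract g" "\<tau> P"] smult_one[of "\<tau> P"] g(1) \<tau>_carrier[OF P] by simp
    ultimately show "\<tau> P \<in> span ?X" by simp
  qed (auto intro: sp.m_closed sp.smult_closed)
  then have gens: "span ?X = carrier E" using sp.subset by blast
  then have "fin_dim" unfolding fin_dim_def using X by blast
  moreover have "dim \<le> card ?X" using gen_ge_dim[OF X gens] .
  moreover have "card ?X \<le> card B" using card_image_le[OF B] card_image_le[of "G ` B" \<tau>] B by (meson finite_imageI le_trans)
  ultimately show ?thesis by (simp add: vs_dim_def)
qed

text \<open>A relation over \<open>k(x)\<close> is multiplied by a common denominator, and by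
  \<open>\<tau>_eq_0\<close> a further polynomial multiple of it holds in \<open>H\<close> itself.
  Therefore independence has to be verified only for polynomial coefficients.\<close>

theorem vs_dim_ge:
  assumes B: "finite B" and G: "\<And>w. w \<in> B \<Longrightarrow> G w \<in> weyl_operators"
    and indep: "\<And>f w. (\<lambda>p. \<Sum>w\<in>B. f w * G w p) \<in> H \<Longrightarrow> w \<in> B \<Longrightarrow> f w = 0"
  shows "enat (card B) \<le> vs_dim K E"
proof -
  interpret vectorspace K E by (rule vectorspace_E)
  have indep': "f w = 0" if "(\<Oplus>\<^bsub>E\<^esub>w\<in>B. f w \<odot>\<^bsub>E\<^esub> \<tau> (G w)) = \<zero>\<^bsub>E\<^esub>" "w \<in> B" for f w
  proof -
    have "\<forall>w. \<exists>g r. g \<noteq> 0 \<and> to_fract g * f w = to_fract r" using to_fract_numerator by blast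
    then obtain g r where g: "\<And>w. g w \<noteq> 0" "\<And>w. to_fract (g w) * f w = to_fract (r w)" by metis
    define q where "q w = (\<Prod>v\<in>B - {w}. g v) * r w" for w
    define c where "c = to_fract (prod g B)"
    have q: "c * f w = to_fract (q w)" if "w \<in> B" for w
    proof -
      have "c = to_fract (\<Prod>v\<in>B - {w}. g v) * to_fract (g w)"
        unfolding c_def using prod.remove[OF B that, of g] by (simp add: mult.commute)
      then show ?thesis using g(2)[of w] by (simp add: q_def mult.assoc)
    qed
    have "\<zero>\<^bsub>E\<^esub> = c \<odot>\<^bsub>E\<^esub> (\<Oplus>\<^bsub>E\<^esub>w\<in>B. f w \<odot>\<^bsub>E\<^esub> \<tau> (G w))" unfolding that(1) by (rule smult_r_null[symmetric]) simp
    also have "\<dots> = (\<Oplus>\<^bsub>E\<^esub>w\<in>B. c \<odot>\<^bsub>E\<^esub> (f w \<odot>\<^bsub>E\<^esub> \<tau> (G w)))"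
      using G \<tau>_carrier by (intro finsum_smult) auto
    also have "\<dots> = (\<Oplus>\<^bsub>E\<^esub>w\<in>B. to_fract (q w) \<odot>\<^bsub>E\<^esub> \<tau> (G w))"
    proof (rule finsum_cong')
      fix w assume w: "w \<in> B"
      show "c \<odot>\<^bsub>E\<^esub> (f w \<odot>\<^bsub>E\<^esub> \<tau> (G w)) = to_fract (q w) \<odot>\<^bsub>E\<^esub> \<tau> (G w)"
        using smult_assoc1[of c "f w" "\<tau> (G w)"] \<tau>_carrier[OF G[OF w]] q[OF w] by simp
    qed (use G \<tau>_carrier in auto)
    also have "\<dots> = \<tau> (\<lambda>p. \<Sum>w\<in>B. q w * G w p)" by (rule \<tau>_sum[OF B G, symmetric])
    finally have z: "\<tau> (\<lambda>p. \<Sum>w\<in>B. q w * G w p) = \<zero>\<^bsub>E\<^esub>" ..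
    have "(\<lambda>p. \<Sum>w\<in>B. q w * G w p) \<in> weyl_operators" using G by (intro weyl_sum weyl_smult)
    then obtain h where h: "h \<noteq> 0" "(\<lambda>p. h * (\<Sum>w\<in>B. q w * G w p)) \<in> H" using \<tau>_eq_0[OF _ z] by blast
    then have "(\<lambda>p. \<Sum>w\<in>B. (h * q w) * G w p) \<in> H" by (simp add: sum_distrib_left mult.assoc)
    from indep[OF this that(2)] h(1) have "q w = 0" by simp
    moreover have "c \<noteq> 0" unfolding c_def using g(1) B by (simp add: prod_zero_iff)
    ultimately show "f w = 0" using q[OF that(2)] by simp
  qed
  let ?X = "(\<lambda>w. \<tau> (G w)) ` B"
  have X: "finite ?X" "?X \<subseteq> carrier E" using B G \<tau>_carrier by auto
  have pick: "(\<Oplus>\<^bsub>E\<^esub>w\<in>B. (if w = v then 1 else 0 :: ('n, 'k) mpoly fract) \<odot>\<^bsub>E\<^esub> \<tau> (G w)) = \<tau> (G v)" if "v \<in> B" for v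
  proof -
    have "(\<Oplus>\<^bsub>E\<^esub>w\<in>B. (if w = v then 1 else 0 :: ('n, 'k) mpoly fract) \<odot>\<^bsub>E\<^esub> \<tau> (G w)) = (\<Oplus>\<^bsub>E\<^esub>w\<in>B. if v = w then \<tau> (G w) else \<zero>\<^bsub>E\<^esub>)"
      using G \<tau>_carrier smult_one smult_l_null by (intro finsum_cong') auto
    also have "\<dots> = \<tau> (G v)" using B that G \<tau>_carrier by (intro finsum_singleton) auto
    finally show ?thesis .
  qed
  have inj: "inj_on (\<lambda>w. \<tau> (G w)) B"
  proof (rule inj_onI, rule ccontr)
    fix u v assume uv: "u \<in> B" "v \<in> B" "\<tau> (G u) = \<tau> (G v)" "u \<noteq> v"
    let ?d = "\<lambda>v w. if w = v then 1 else 0 :: ('n, 'k) mpoly fract"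
    have "(\<Oplus>\<^bsub>E\<^esub>w\<in>B. (?d u w + (-1) * ?d v w) \<odot>\<^bsub>E\<^esub> \<tau> (G w)) = 
      (\<Oplus>\<^bsub>E\<^esub>w\<in>B. ?d u w \<odot>\<^bsub>E\<^esub> \<tau> (G w) \<oplus>\<^bsub>E\<^esub> (-1) \<odot>\<^bsub>E\<^esub> (?d v w \<odot>\<^bsub>E\<^esub> \<tau> (G w)))"
    proof (rule finsum_cong')
      fix w assume w: "w \<in> B"
      show "(?d u w + (-1) * ?d v w) \<odot>\<^bsub>E\<^esub> \<tau> (G w) = ?d u w \<odot>\<^bsub>E\<^esub> \<tau> (G w) \<oplus>\<^bsub>E\<^esub> (-1) \<odot>\<^bsub>E\<^esub> (?d v w \<odot>\<^bsub>E\<^esub> \<tau> (G w))"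
        using smult_l_distr[of "?d u w" "(-1) * ?d v w" "\<tau> (G w)"] smult_assoc1[of "-1" "?d v w" "\<tau> (G w)"] \<tau>_carrier[OF G[OF w]]
        by (simp only: K_simps UNIV_I simp_thms)
    qed (use G \<tau>_carrier in auto)
    also have "\<dots> = (\<Oplus>\<^bsub>E\<^esub>w\<in>B. ?d u w \<odot>\<^bsub>E\<^esub> \<tau> (G w)) \<oplus>\<^bsub>E\<^esub> (\<Oplus>\<^bsub>E\<^esub>w\<in>B. (-1) \<odot>\<^bsub>E\<^esub> (?d v w \<odot>\<^bsub>E\<^esub> \<tau> (G w)))"
      using G \<tau>_carrier by (intro finsum_addf) auto
    also have "(\<Oplus>\<^bsub>E\<^esub>w\<in>B. (-1) \<odot>\<^bsub>E\<^esub> (?d v w \<odot>\<^bsub>E\<^esub> \<tau> (G w))) = (-1) \<odot>\<^bsub>E\<^esub> (\<Oplus>\<^bsub>E\<^esub>w\<in>B. ?d v w \<odot>\<^bsub>E\<^esub> \<tau> (G w))"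
      using G \<tau>_carrier by (intro finsum_smult[symmetric]) auto
    also have "(\<Oplus>\<^bsub>E\<^esub>w\<in>B. ?d u w \<odot>\<^bsub>E\<^esub> \<tau> (G w)) \<oplus>\<^bsub>E\<^esub> \<dots> = \<tau> (G u) \<oplus>\<^bsub>E\<^esub> (-1) \<odot>\<^bsub>E\<^esub> \<tau> (G u)"
      using pick[OF uv(1)] pick[OF uv(2)] uv(3) by simp
    also have "\<dots> = (1 \<oplus>\<^bsub>K\<^esub> (-1)) \<odot>\<^bsub>E\<^esub> \<tau> (G u)" using smult_l_distr[of 1 "-1" "\<tau> (G u)"] smult_one[of "\<tau> (G u)"] \<tau>_carrier[OF G[OF uv(1)]] by simp
    also have "\<dots> = \<zero>\<^bsub>E\<^esub>" using smult_l_null[OF \<tau>_carrier[OF G[OF uv(1)]]] by simp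
    finally have "?d u u + (-1) * ?d v u = 0" by (rule indep'[OF _ uv(1)])
    then show False using uv(4) by simp
  qed
  have li: "lin_indpt ?X"
  proof (rule ccontr)
    assume "\<not> lin_indpt ?X"
    then obtain a v where a: "lincomb a ?X = \<zero>\<^bsub>E\<^esub>" and v: "v \<in> ?X" and av: "a v \<noteq> \<zero>\<^bsub>K\<^esub>"
      using finite_lin_dep[OF X(1) _ X(2)] by blast
    have "(\<Oplus>\<^bsub>E\<^esub>w\<in>B. a (\<tau> (G w)) \<odot>\<^bsub>E\<^esub> \<tau> (G w)) = lincomb a ?X"
      unfolding lincomb_def using inj G \<tau>_carrier by (intro finsum_reindex[symmetric]) auto
    also note a
    finally have z: "(\<Oplus>\<^bsub>E\<^esub>w\<in>B. a (\<tau> (G w)) \<odot>\<^bsub>E\<^esub> \<tau> (G w)) = \<zero>\<^bsub>E\<^esub>" .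
    from v obtain w where w: "w \<in> B" "v = \<tau> (G w)" by blast
    from indep'[OF z w(1)] av show False unfolding w(2) K_simps by contradiction
  qed
  show ?thesis
  proof (cases fin_dim)
    case True
    from li_le_dim(2)[OF this X(2) li] card_image[OF inj] True show ?thesis by (simp add: vs_dim_def)
  qed (simp add: vs_dim_def)
qed

end

section \<open>Upper bound for the holonomic rank\<close>

lemma mvar_unit_exp: "mvar j = Poly_Mapping.single (unit_exp j) 1" by (simp add: mvar_def)

lemma mderiv_mvar: "mderiv i (mvar j) = (if i = j then 1 else 0)"
  by (simp add: mvar_unit_exp mderiv_single lookup_single when_def)

lemma mderiv_of_nat: "mderiv i (of_nat n) = 0"
proof (induction n)
  case (Suc n)
  have "mderiv i (1 :: ('a, 'b) mpoly) = 0" using mderiv_single[of i 0 1] by simp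
  then show ?case using Suc by (simp add: mderiv_add)
qed (simp add: mderiv_0)

lemma deriv_monomial_theta:
  fixes p :: "('n::{finite,linorder}, 'k::field_char_0) mpoly"
  shows "deriv_monomial u (mvar j * mderiv j p) =
    mvar j * deriv_monomial (u + unit_exp j) p + of_nat (Poly_Mapping.lookup u j) * deriv_monomial u p"
proof (induction "total u" arbitrary: u rule: less_induct)
  case less
  show ?case
  proof (cases "u = 0")
    case True
    then show ?thesis by (simp add: deriv_monomial_0 deriv_monomial_unit_exp)
  next
    case False
    then obtain i u' where u: "u = unit_exp i + u'" "total u' < total u" by (rule total_pos_split)
    have st: "deriv_monomial (unit_exp i + v) q = mderiv i (deriv_monomial v q)" for v and q :: "('n, 'k) mpoly"
      by (simp add: deriv_monomial_add deriv_monomial_unit_exp)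
    have "deriv_monomial u (mvar j * mderiv j p) = mderiv i (mvar j * deriv_monomial (u' + unit_exp j) p + of_nat (Poly_Mapping.lookup u' j) * deriv_monomial u' p)"
      unfolding u(1) st less[OF u(2)] ..
    also have "\<dots> = mderiv i (mvar j) * deriv_monomial (u' + unit_exp j) p + mvar j * deriv_monomial (unit_exp i + (u' + unit_exp j)) p
        + of_nat (Poly_Mapping.lookup u' j) * deriv_monomial (unit_exp i + u') p"
      unfolding st by (simp add: mderiv_add mderiv_mult mderiv_of_nat)
    also have "\<dots> = mvar j * deriv_monomial (u + unit_exp j) p + of_nat (Poly_Mapping.lookup u j) * deriv_monomial u p"
    proof (cases "i = j")
      case True
      have "u' + unit_exp j = u" using u(1) True by (simp add: add.commute)
      then show ?thesis using True by (simp add: u(1) mderiv_mvar lookup_add algebra_simps)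
    next
      case False
      then show ?thesis by (simp add: u(1) mderiv_mvar lookup_add lookup_single add.assoc)
    qed
    finally show ?thesis .
  qed
qed

lemma lookup_mconst_mult: "Poly_Mapping.lookup (mconst c * p) m = c * Poly_Mapping.lookup p m"
  for p :: "('n, 'k::comm_ring_1) mpoly"
proof (induction p rule: pm_induct)
  case (single b d)
  then show ?case by (simp add: mconst_def mult_single lookup_single when_def)
qed (simp_all add: distrib_left lookup_add)

lemma deriv_monomial_mconst: "deriv_monomial u (mconst c * p) = mconst c * deriv_monomial u p"
  by (rule poly_mapping_eqI) (simp add: lookup_deriv_monomial lookup_mconst_mult)

lemma of_int_mconst: "of_int z = mconst (of_int z)"
  by (simp add: mconst_def)

lemma mconst_add: "mconst (c + d) = mconst c + mconst d" by (simp add: mconst_def single_add)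
lemma mconst_mult: "mconst (c * d) = mconst c * mconst d" by (simp add: mconst_def mult_single)
lemma mconst_sum: "mconst (sum c I) = (\<Sum>i\<in>I. mconst (c i))"
  by (induction I rule: infinite_finite_induct) (simp_all add: mconst_add, simp_all add: mconst_def)

lemma deriv_monomial_sum: "deriv_monomial u (sum f I) = (\<Sum>i\<in>I. deriv_monomial u (f i))"
  for f :: "'i \<Rightarrow> ('n::{finite,linorder}, 'k::field_char_0) mpoly"
proof (induction I rule: infinite_finite_induct)
qed (simp_all add: deriv_monomial_plus weyl_0[OF weyl_deriv_monomial])

lemma deriv_operator_psum: "deriv_operator f p = psum (\<lambda>u c. mconst c * deriv_monomial u p) f"
  by (simp add: deriv_operator_def psum_def)

lemma deriv_operator_weyl: "deriv_operator f \<in> weyl_operators"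
  for f :: "('n::{finite,linorder}, 'k::field_char_0) mpoly"
  unfolding deriv_operator_def
  by (intro weyl_sum weyl_operators.comp[OF weyl_mult weyl_deriv_monomial, unfolded o_def])

lemma deriv_operator_binomial:
  "deriv_operator (Poly_Mapping.single u 1 - Poly_Mapping.single v 1) = (\<lambda>p. deriv_monomial u p - deriv_monomial v p)"
proof
  fix p :: "('a, 'b) mpoly"
  have "deriv_operator (Poly_Mapping.single u 1 + Poly_Mapping.single v (- 1)) p = deriv_monomial u p - deriv_monomial v p"
    unfolding deriv_operator_psum
    by (subst psum_add) (simp_all add: psum_single mconst_0 mconst_1 mconst_neg mconst_add distrib_right)
  then show "deriv_operator (Poly_Mapping.single u 1 - Poly_Mapping.single v 1) p = deriv_monomial u p - deriv_monomial v p"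
    by (simp add: single_uminus)
qed

lemma euler_operator_weyl: "euler_operator A \<beta> i \<in> weyl_operators"
  for A :: "int ^ 'n::{finite,linorder} ^ 'd" and \<beta> :: "'k::field_char_0 ^ 'd"
proof -
  have "(\<lambda>p. of_int (A $ i $ j) * p) \<circ> ((\<lambda>p. mvar j * p) \<circ> mderiv j) \<in> (weyl_operators :: (('n, 'k) mpoly \<Rightarrow> ('n, 'k) mpoly) set)" for j
    by (intro weyl_operators.comp weyl_mult weyl_operators.deriv weyl_operators.var)
  then have "(\<lambda>p. of_int (A $ i $ j) * (mvar j * mderiv j p)) \<in> (weyl_operators :: (('n, 'k) mpoly \<Rightarrow> ('n, 'k) mpoly) set)" for j
    unfolding o_def .
  then have "(\<lambda>p. (\<Sum>j\<in>UNIV. of_int (A $ i $ j) * (mvar j * mderiv j p)) + - (mconst (\<beta> $ i) * p)) \<in> weyl_operators"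
    by (intro weyl_operators.add weyl_sum weyl_uminus weyl_mult)
  then show ?thesis by (simp add: euler_operator_def)
qed

lemma exponent_degree_sum: "exponent_degree A u = (\<Sum>j\<in>UNIV. int (Poly_Mapping.lookup u j) *s column j A)"
  by (simp add: exponent_degree_def vec_eq_iff matrix_vector_mult_def column_def mult.commute sum_component)

lemma exponent_degree_add: "exponent_degree A (u + v) = exponent_degree A u + exponent_degree A v"
  by (simp add: exponent_degree_sum lookup_add sum.distrib vec_eq_iff sum_component algebra_simps)

lemma exponent_degree_unit_exp: "exponent_degree A (unit_exp j) = column j A"
proof -
  have "(\<Sum>i\<in>UNIV. int (Poly_Mapping.lookup (unit_exp j) i) *s column i A) = (\<Sum>i\<in>UNIV. if j = i then column i A else 0)"
    by (rule sum.cong) (auto simp: lookup_single when_def vec_eq_iff)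
  then show ?thesis by (simp add: exponent_degree_sum)
qed

lemma hypergeometric_generators:
  fixes A :: "int ^ 'n::{finite,linorder} ^ 'd" and \<beta> :: "'k::field_char_0 ^ 'd"
  shows "left_ideal (hypergeometric_ideal A \<beta>) weyl_algebra"
    and "euler_operator A \<beta> i \<in> hypergeometric_ideal A \<beta>"
    and "exponent_degree A u = exponent_degree A v \<Longrightarrow> (\<lambda>p. deriv_monomial u p - deriv_monomial v p) \<in> hypergeometric_ideal A \<beta>"
proof -
  let ?G = "deriv_operator ` toric_ideal A \<union> range (euler_operator A \<beta>)"
  have sub: "?G \<subseteq> weyl_operators" using deriv_operator_weyl euler_operator_weyl by blast
  note g = gen_left_ideal_weyl[OF sub, folded hypergeometric_ideal_def]
  show "left_ideal (hypergeometric_ideal A \<beta>) weyl_algebra" by (rule g(1))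
  show "euler_operator A \<beta> i \<in> hypergeometric_ideal A \<beta>" using g(2) by blast
  assume e: "exponent_degree A u = exponent_degree A v"
  have r: "ring (ring_of_type_algebra :: ('n, 'k) mpoly ring)" by (rule ring_from_type_algebra)
  have "Poly_Mapping.single u 1 - Poly_Mapping.single v 1 \<in> (toric_ideal A :: ('n, 'k) mpoly set)" (is "?b \<in> _")
    unfolding toric_ideal_def using e
    by (intro subsetD[OF ring.genideal_self[OF r]]) (auto simp: ring_of_type_algebra_def)
  then have "deriv_operator ?b \<in> hypergeometric_ideal A \<beta>" using g(2) by blast
  then show "(\<lambda>p. deriv_monomial u p - deriv_monomial v p) \<in> hypergeometric_ideal A \<beta>"
    by (simp only: deriv_operator_binomial)
qed

text \<open>The ring homomorphism \<open>\<epsilon>\<close> sends the coefficient matrix to the identity, which keeps all pivots nonzero.\<close>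

lemma fraction_free_elimination:
  fixes b :: "'i \<Rightarrow> 'i \<Rightarrow> 'r::idom" and y :: "'i \<Rightarrow> 'p \<Rightarrow> 'r" and \<epsilon> :: "'r \<Rightarrow> 'c::comm_ring_1"
  assumes good_add: "\<And>P Q. good P \<Longrightarrow> good Q \<Longrightarrow> good (\<lambda>p. P p + Q p)"
    and good_mult: "\<And>f P. good P \<Longrightarrow> good (\<lambda>p. f * P p)"
    and good_cancel: "\<And>f P. f \<noteq> 0 \<Longrightarrow> P \<in> Y \<Longrightarrow> good (\<lambda>p. f * P p) \<Longrightarrow> good P"
    and hom: "\<And>f g. \<epsilon> (f - g) = \<epsilon> f - \<epsilon> g" "\<And>f g. \<epsilon> (f * g) = \<epsilon> f * \<epsilon> g"
    and fin: "finite I" and y: "\<And>i. i \<in> I \<Longrightarrow> y i \<in> Y"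
    and b: "\<And>s t. s \<in> I \<Longrightarrow> t \<in> I \<Longrightarrow> \<epsilon> (b s t) = (if s = t then 1 else 0)"
    and sys: "\<And>s. s \<in> I \<Longrightarrow> good (\<lambda>p. \<Sum>t\<in>I. b s t * y t p)"
    and "t \<in> I"
  shows "good (y t)"
  using fin y b sys \<open>t \<in> I\<close>
proof (induction I arbitrary: b t rule: finite_induct)
  case empty
  then show ?case by simp
next
  case (insert o' I)
  \<comment> \<open>One elimination step with pivot \<open>b o' o'\<close>, without division. The
    pivot and the diagonal are sent to 1 and the off-diagonal entries to 0, so the new system is
    again mapped to the identity.\<close>
  define c where "c s t = b o' o' * b s t - b s o' * b o' t" for s t
  have I: "good (y t)" if "t \<in> I" for t
  proof (rule insert.IH[OF _ _ _ that, of c])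
    fix s t assume st: "s \<in> I" "t \<in> I"
    then have "s \<noteq> o'" using insert.hyps by blast
    then show "\<epsilon> (c s t) = (if s = t then 1 else 0)" using st by (simp add: c_def hom insert.prems(2))
  next
    fix s assume s: "s \<in> I"
    have "good (\<lambda>p. b o' o' * (\<Sum>t\<in>insert o' I. b s t * y t p) + (- b s o') * (\<Sum>t\<in>insert o' I. b o' t * y t p))"
      using s by (intro good_add good_mult insert.prems(3)) auto
    also have "(\<lambda>p. b o' o' * (\<Sum>t\<in>insert o' I. b s t * y t p) + (- b s o') * (\<Sum>t\<in>insert o' I. b o' t * y t p)) =
        (\<lambda>p. \<Sum>t\<in>I. c s t * y t p)"
    proof
      fix p
      have "(\<Sum>t\<in>I. c s t * y t p) = b o' o' * (\<Sum>t\<in>I. b s t * y t p) - b s o' * (\<Sum>t\<in>I. b o' t * y t p)"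
        unfolding c_def sum_distrib_left sum_subtractf[symmetric] by (rule sum.cong) (simp_all add: left_diff_distrib mult.assoc)
      then show "b o' o' * (\<Sum>t\<in>insert o' I. b s t * y t p) + (- b s o') * (\<Sum>t\<in>insert o' I. b o' t * y t p) = (\<Sum>t\<in>I. c s t * y t p)"
        using insert.hyps by (simp add: distrib_left mult.left_commute[of "b s o'"])
    qed
    finally show "good (\<lambda>p. \<Sum>t\<in>I. c s t * y t p)" .
  qed (use insert.prems(1) in auto)
  have sum: "good (\<lambda>p. Q p - (\<Sum>t\<in>J. b o' t * y t p))" if "good Q" "J \<subseteq> I" for Q J
  proof -
    have "finite J" using that insert.hyps finite_subset by blast
    then show ?thesis using that(2)
    proof (induction J)
      case empty then show ?case using that by simp
    next
      case (insert j J)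
      then have "good (\<lambda>p. (Q p - (\<Sum>t\<in>J. b o' t * y t p)) + (- b o' j) * y j p)" by (intro good_add good_mult I) auto
      then show ?case using insert.hyps by (simp add: diff_diff_eq add.commute)
    qed
  qed
  have "good (\<lambda>p. (\<Sum>t\<in>insert o' I. b o' t * y t p) - (\<Sum>t\<in>I. b o' t * y t p))"
    using insert.prems(3)[of o'] by (intro sum) auto
  then have "good (\<lambda>p. b o' o' * y o' p)" using insert.hyps by simp
  moreover have "b o' o' \<noteq> 0"
  proof
    assume "b o' o' = 0"
    then have "\<epsilon> 0 = 1" using insert.prems(2)[of o' o'] by simp
    then show False using hom(1)[of 0 0] by simp
  qed
  ultimately have "good (y o')" using insert.prems(1)[of o'] by (intro good_cancel[of "b o' o'" "y o'"]) auto
  then show ?case using I insert.prems by blast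
qed

text \<open>Evaluation at the point whose coordinates are 1 on \<open>T\<close> and 0
  elsewhere.\<close>

definition supp_eval :: "'n set \<Rightarrow> ('n, 'k::comm_ring_1) mpoly \<Rightarrow> 'k" where
  "supp_eval T = psum (\<lambda>m c. if Poly_Mapping.keys m \<subseteq> T then c else 0)"

lemma supp_eval_add: "supp_eval T (f + g) = supp_eval T f + supp_eval T g"
  unfolding supp_eval_def by (rule psum_add) auto

lemma supp_eval_single: "supp_eval T (Poly_Mapping.single m c) = (if Poly_Mapping.keys m \<subseteq> T then c else 0)"
  unfolding supp_eval_def by (subst psum_single) auto

lemma supp_eval_0: "supp_eval T 0 = 0" by (simp add: supp_eval_def psum_zero)

lemma supp_eval_diff: "supp_eval T (f - g) = supp_eval T f - supp_eval T g"
  using supp_eval_add[of T "f - g" g] by simp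

lemma keys_nat_add: "Poly_Mapping.keys (m + m') = Poly_Mapping.keys m \<union> Poly_Mapping.keys m'"
  for m m' :: "'n \<Rightarrow>\<^sub>0 nat"
  by (auto simp: in_keys_iff lookup_add)

lemma supp_eval_mult: "supp_eval T (f * g) = supp_eval T f * supp_eval T g"
proof (induction f rule: pm_induct)
  case (single m c)
  show ?case
  proof (induction g rule: pm_induct)
    case (single m' c')
    then show ?case by (simp add: mult_single supp_eval_single keys_nat_add)
  qed (simp_all add: supp_eval_0 distrib_left supp_eval_add)
qed (simp_all add: supp_eval_0 distrib_right supp_eval_add)

lemma supp_eval_sum: "supp_eval T (sum f I) = (\<Sum>i\<in>I. supp_eval T (f i))"
  by (induction I rule: infinite_finite_induct) (simp_all add: supp_eval_0 supp_eval_add)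

lemma finite_total_le: "finite {v :: 'n::finite \<Rightarrow>\<^sub>0 nat. total v \<le> n}"
proof -
  have "{v :: 'n \<Rightarrow>\<^sub>0 nat. total v \<le> n} \<subseteq> Abs_poly_mapping ` (PiE UNIV (\<lambda>_. {..n}))"
  proof
    fix v :: "'n \<Rightarrow>\<^sub>0 nat" assume v: "v \<in> {v. total v \<le> n}"
    have "Poly_Mapping.lookup v j \<le> total v" for j unfolding total_UNIV by (rule member_le_sum) auto
    then have "Poly_Mapping.lookup v \<in> PiE UNIV (\<lambda>_. {..n})" using v by (auto intro: order_trans)
    then show "v \<in> Abs_poly_mapping ` (PiE UNIV (\<lambda>_. {..n}))" by (rule image_eqI[rotated]) simp
  qed
  then show ?thesis by (rule finite_subset) (intro finite_imageI finite_PiE, simp_all)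
qed

locale hypergeometric = simplicial A sg cc hh
  for A :: "int ^ 'n::{finite,linorder} ^ 'd" and sg cc hh +
  fixes \<beta> :: "'k::field_char_0 ^ 'd"
begin

abbreviation "HH \<equiv> hypergeometric_ideal A \<beta>"
abbreviation "ed \<equiv> exponent_degree A"

sublocale localized_quotient HH
  by unfold_locales (rule hypergeometric_generators(1))

lemma cc_axis: "cc l x = (\<Sum>i\<in>UNIV. of_int (x $ i) * cc l (axis i 1))"
proof -
  have "x = (\<Sum>i\<in>UNIV. (x $ i) *s axis i 1)" by (simp add: basis_expansion)
  then have "cc l x = cc l (\<Sum>i\<in>UNIV. (x $ i) *s axis i 1)" by simp
  then show ?thesis by (simp add: cc_sum cc_smult)
qed

text \<open>The Euler operators are combined with the coefficients of the linear functional
  \<open>cc l\<close> and composed with a derivative on the left. Among the vertex variables only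
  that of \<open>l\<close> then survives, with coefficient 1, and the commutators only contribute to
  the constant \<open>\<kappa>\<close>.\<close>

lemma euler_relation:
  "\<exists>\<kappa> :: ('n, 'k) mpoly. (\<lambda>p. (\<Sum>j\<in>UNIV. mconst (of_rat (cc l (a j))) * mvar j * deriv_monomial (u + unit_exp j) p) - \<kappa> * deriv_monomial u p) \<in> HH"
proof -
  let ?r = "\<lambda>i. of_rat (cc l (axis i 1)) :: 'k"
  define \<kappa> :: "('n, 'k) mpoly" where "\<kappa> = (\<Sum>i\<in>UNIV. mconst (?r i) * (mconst (\<beta> $ i) - (\<Sum>j\<in>UNIV. of_int (A $ i $ j) * of_nat (Poly_Mapping.lookup u j))))"
  have eq: "deriv_monomial u (euler_operator A \<beta> i p) =
    (\<Sum>j\<in>UNIV. of_int (A $ i $ j) * (mvar j * deriv_monomial (u + unit_exp j) p + of_nat (Poly_Mapping.lookup u j) * deriv_monomial u p)) - mconst (\<beta> $ i) * deriv_monomial u p" for i p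
  proof -
    have "deriv_monomial u (q - r) = deriv_monomial u q - deriv_monomial u r" for q r :: "('n, 'k) mpoly"
      using deriv_monomial_plus[of u "q - r" r] by (simp add: algebra_simps)
    then show ?thesis by (simp add: euler_operator_def deriv_monomial_sum of_int_mconst deriv_monomial_mconst deriv_monomial_theta)
  qed
  have "(\<lambda>p. \<Sum>i\<in>UNIV. mconst (?r i) * deriv_monomial u (euler_operator A \<beta> i p)) \<in> HH"
    using H_comp[OF weyl_deriv_monomial hypergeometric_generators(2)] by (intro H_sum H_mult) (simp add: o_def)
  also have "(\<lambda>p. \<Sum>i\<in>UNIV. mconst (?r i) * deriv_monomial u (euler_operator A \<beta> i p)) =
     (\<lambda>p. (\<Sum>j\<in>UNIV. mconst (of_rat (cc l (a j))) * mvar j * deriv_monomial (u + unit_exp j) p) - \<kappa> * deriv_monomial u p)"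
  proof
    fix p
    have c: "mconst (of_rat (cc l (a j))) = (\<Sum>i\<in>UNIV. mconst (?r i) * of_int (A $ i $ j))" for j
      by (subst cc_axis) (simp add: of_rat_sum of_rat_mult mconst_sum mconst_mult of_int_mconst column_def mult.commute)
    have "(\<Sum>j\<in>UNIV. mconst (of_rat (cc l (a j))) * mvar j * deriv_monomial (u + unit_exp j) p) =
      (\<Sum>i\<in>UNIV. mconst (?r i) * (\<Sum>j\<in>UNIV. of_int (A $ i $ j) * (mvar j * deriv_monomial (u + unit_exp j) p)))"
      unfolding c sum_distrib_right sum_distrib_left by (subst sum.swap) (simp add: mult.assoc)
    then show "(\<Sum>i\<in>UNIV. mconst (?r i) * deriv_monomial u (euler_operator A \<beta> i p)) =
      (\<Sum>j\<in>UNIV. mconst (of_rat (cc l (a j))) * mvar j * deriv_monomial (u + unit_exp j) p) - \<kappa> * deriv_monomial u p"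
      unfolding eq \<kappa>_def sum_distrib_right
      by (simp only: sum_subtractf[symmetric] distrib_left sum.distrib)
         (rule sum.cong, rule refl, simp add: algebra_simps sum_distrib_left sum_distrib_right)
  qed
  finally show ?thesis by blast
qed


text \<open>Membership in the \<open>k(x)\<close>-span of the monomials of \<open>Ap\<close>, with
  denominators cleared. Any monomial of degree \<open>w\<close> can represent \<open>w\<close>,
  because congruent monomials agree modulo \<open>HH\<close>.\<close>

definition good where
  "good P \<longleftrightarrow> P \<in> weyl_operators \<and>
    (\<exists>(f :: int ^ 'd \<Rightarrow> ('n, 'k) mpoly) g. g \<noteq> 0 \<and> (\<lambda>p. g * P p - (\<Sum>w\<in>Ap. f w * deriv_monomial (SOME u. ed u = w) p)) \<in> HH)"

lemma good_H: "P \<in> HH \<Longrightarrow> good P"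
  unfolding good_def using H_sub by (intro conjI exI[of _ "\<lambda>_. 0"] exI[of _ 1]) simp_all

lemma good_add: assumes "good P" "good Q" shows "good (\<lambda>p. P p + Q p)"
proof -
  let ?D = "\<lambda>w :: int ^ 'd. deriv_monomial (SOME u. ed u = w)"
  obtain f g where f: "g \<noteq> 0" "(\<lambda>p. g * P p - (\<Sum>w\<in>Ap. f w * ?D w p)) \<in> HH" using assms(1) unfolding good_def by blast
  obtain f' g' where f': "g' \<noteq> 0" "(\<lambda>p. g' * Q p - (\<Sum>w\<in>Ap. f' w * ?D w p)) \<in> HH" using assms(2) unfolding good_def by blast
  have "(\<lambda>p. g' * (g * P p - (\<Sum>w\<in>Ap. f w * ?D w p)) + g * (g' * Q p - (\<Sum>w\<in>Ap. f' w * ?D w p))) \<in> HH"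
    by (intro H_add H_mult f(2) f'(2))
  also have "(\<lambda>p. g' * (g * P p - (\<Sum>w\<in>Ap. f w * ?D w p)) + g * (g' * Q p - (\<Sum>w\<in>Ap. f' w * ?D w p))) =
    (\<lambda>p. (g * g') * (P p + Q p) - (\<Sum>w\<in>Ap. (g' * f w + g * f' w) * ?D w p))"
  proof
    fix p
    have "(\<Sum>w\<in>Ap. (g' * f w + g * f' w) * ?D w p) = g' * (\<Sum>w\<in>Ap. f w * ?D w p) + g * (\<Sum>w\<in>Ap. f' w * ?D w p)"
      unfolding sum_distrib_left sum.distrib[symmetric] by (rule sum.cong) (simp_all add: distrib_right mult.assoc)
    then show "g' * (g * P p - (\<Sum>w\<in>Ap. f w * ?D w p)) + g * (g' * Q p - (\<Sum>w\<in>Ap. f' w * ?D w p)) =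
      (g * g') * (P p + Q p) - (\<Sum>w\<in>Ap. (g' * f w + g * f' w) * ?D w p)"
      by (simp add: right_diff_distrib distrib_left mult.assoc mult.left_commute[of g])
  qed
  finally have "(\<lambda>p. (g * g') * (P p + Q p) - (\<Sum>w\<in>Ap. (g' * f w + g * f' w) * ?D w p)) \<in> HH" .
  then show ?thesis unfolding good_def using assms f(1) f'(1)
    by (intro conjI exI[of _ "\<lambda>w. g' * f w + g * f' w"] exI[of _ "g * g'"]) (auto simp: good_def weyl_operators.add)
qed

lemma good_mult: assumes "good P" shows "good (\<lambda>p. h * P p)"
proof -
  let ?D = "\<lambda>w :: int ^ 'd. deriv_monomial (SOME u. ed u = w)"
  obtain f g where f: "g \<noteq> 0" "(\<lambda>p. g * P p - (\<Sum>w\<in>Ap. f w * ?D w p)) \<in> HH" using assms(1) unfolding good_def by blast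
  have "(\<lambda>p. h * (g * P p - (\<Sum>w\<in>Ap. f w * ?D w p))) \<in> HH" by (intro H_mult f(2))
  then have "(\<lambda>p. g * (h * P p) - (\<Sum>w\<in>Ap. (h * f w) * ?D w p)) \<in> HH"
    by (simp only: right_diff_distrib sum_distrib_left mult.assoc mult.left_commute[of h g])
  then show ?thesis unfolding good_def using assms f(1)
    by (intro conjI exI[of _ "\<lambda>w. h * f w"] exI[of _ g]) (auto simp: good_def weyl_smult)
qed

lemma good_cancel: assumes "h \<noteq> 0" "P \<in> weyl_operators" "good (\<lambda>p. h * P p)" shows "good P"
proof -
  let ?D = "\<lambda>w :: int ^ 'd. deriv_monomial (SOME u. ed u = w)"
  obtain f g where f: "g \<noteq> 0" "(\<lambda>p. g * (h * P p) - (\<Sum>w\<in>Ap. f w * ?D w p)) \<in> HH" using assms(3) unfolding good_def by blast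
  then show ?thesis unfolding good_def using assms(1,2)
    by (intro conjI exI[of _ f] exI[of _ "g * h"]) (auto simp: mult.assoc)
qed

lemma good_0: "good (\<lambda>_. 0)" by (rule good_H[OF H_0])

lemma good_sum: "(\<And>i. i \<in> I \<Longrightarrow> good (P i)) \<Longrightarrow> good (\<lambda>p. \<Sum>i\<in>I. P i p)"
proof (induction I rule: infinite_finite_induct)
  case (insert i I)
  then have "good (\<lambda>p. P i p + (\<Sum>i\<in>I. P i p))" by (intro good_add) auto
  then show ?case using insert.hyps by simp
qed (simp_all add: good_0)

lemma ed_S: "ed u \<in> S" unfolding exponent_degree_sum by (rule S_I)

lemma S_ed: assumes "s \<in> S" shows "\<exists>u. ed u = s"
proof -
  obtain c where "s = (\<Sum>j\<in>UNIV. int (c j) *s a j)" using assms by (rule S_E)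
  then have "ed (Abs_poly_mapping c) = s" by (simp add: exponent_degree_sum)
  then show ?thesis ..
qed

lemma hh_ed: "hh (ed u) = of_nat (total u)"
  by (simp add: exponent_degree_sum hh_sum hh_smult_nat hh_col total_UNIV)

lemma good_congruent:
  assumes "ed u = ed v" "good (deriv_monomial v)" shows "good (deriv_monomial u)"
proof -
  have "good (\<lambda>p. (deriv_monomial u p - deriv_monomial v p) + deriv_monomial v p)"
    by (intro good_add good_H hypergeometric_generators(3) assms)
  then show ?thesis by simp
qed

lemma good_Ap: assumes "ed u \<in> Ap" shows "good (deriv_monomial u)"
proof -
  let ?D = "\<lambda>w :: int ^ 'd. deriv_monomial (SOME u. ed u = w)"
  let ?v = "SOME v. ed v = ed u"
  have v: "ed ?v = ed u" by (rule someI[of "\<lambda>v. ed v = ed u"]) simp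
  have "(\<lambda>p. 1 * deriv_monomial u p - (\<Sum>w\<in>Ap. (if w = ed u then 1 else 0 :: ('n, 'k) mpoly) * ?D w p)) \<in> HH"
  proof -
    have "(\<Sum>w\<in>Ap. (if w = ed u then 1 else 0 :: ('n, 'k) mpoly) * ?D w p) = (\<Sum>w\<in>Ap. if w = ed u then ?D w p else 0)" for p
      by (rule sum.cong) simp_all
    then have "(\<Sum>w\<in>Ap. (if w = ed u then 1 else 0 :: ('n, 'k) mpoly) * ?D w p) = deriv_monomial ?v p" for p
      using assms finite_Ap by simp
    then have eq: "(\<lambda>p. 1 * deriv_monomial u p - (\<Sum>w\<in>Ap. (if w = ed u then 1 else 0 :: ('n, 'k) mpoly) * ?D w p)) = (\<lambda>p. deriv_monomial u p - deriv_monomial ?v p)"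
      by (intro ext) simp
    show ?thesis unfolding eq by (rule hypergeometric_generators(3)[OF v[symmetric]])
  qed
  then show ?thesis unfolding good_def using weyl_deriv_monomial[of u] by (intro conjI exI[of _ "\<lambda>w. if w = ed u then 1 else 0"] exI[of _ 1]) simp_all
qed

text \<open>Induction on the order. For every \<open>s\<close> of that order outside
  \<open>Ap\<close> some \<open>s - V (l s)\<close> lies in \<open>S\<close>, and the Euler relation
  for \<open>l s\<close> at a monomial of this lower order gives one equation. Equations and
  unknowns are both indexed by these \<open>s\<close>, and at the chosen point the equation of
  \<open>s\<close> retains only the unknown \<open>s\<close>.\<close>

lemma good_deriv_monomial: "good (deriv_monomial u)"
proof (induction "total u" arbitrary: u rule: less_induct)
  case less
  define n where "n = total u"
  \<comment> \<open>The homogeneity \<open>hh\<close> identifies the order of a monomial with a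
    property of its degree, so the unknowns are finitely many elements of \<open>S\<close> instead
    of monomials.\<close>
  define I where "I = {s\<in>S. s \<notin> Ap \<and> hh s = of_nat n}"
  define U where "U s = (SOME u. ed u = s)" for s
  have U: "ed (U s) = s" if "s \<in> S" for s unfolding U_def using S_ed[OF that] by (rule someI_ex)
  have "finite I"
  proof -
    have "I \<subseteq> ed ` {v. total v \<le> n}"
    proof
      fix s assume "s \<in> I"
      then obtain v where "ed v = s" "hh s = of_nat n" using S_ed unfolding I_def by blast
      then have "total v \<le> n" using hh_ed[of v] by simp
      then show "s \<in> ed ` {v. total v \<le> n}" using \<open>ed v = s\<close> by blast
    qed
    then show ?thesis using finite_surj[OF finite_total_le] by blast
  qed
  have "\<forall>s\<in>I. \<exists>l u'. ed u' = s - V l" using S_ed unfolding I_def Ap_def by blast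
  then obtain l u' where u': "\<And>s. s \<in> I \<Longrightarrow> ed (u' s) = s - V (l s)" by metis
  define b where "b s t = (\<Sum>j\<in>{j. ed (u' s) + a j = t}. mconst (of_rat (cc (l s) (a j))) * mvar j :: ('n, 'k) mpoly)" for s t
  have "good (deriv_monomial (U t))" if "t \<in> I" for t
  proof (rule fraction_free_elimination[where \<epsilon> = "supp_eval (range sg)" and I = I and b = b and Y = weyl_operators and y = "\<lambda>s. deriv_monomial (U s)" and good = good])
    fix s t assume s: "s \<in> I" and "t \<in> I"
    let ?c = "\<lambda>j. of_rat (cc (l s) (a j)) :: 'k"
    have "supp_eval (range sg) (b s t) = (\<Sum>j\<in>{j. ed (u' s) + a j = t}. if j \<in> range sg then ?c j else 0)"
      unfolding b_def supp_eval_sum by (intro sum.cong refl) (simp add: mconst_def mvar_unit_exp mult_single supp_eval_single)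
    also have "\<dots> = (\<Sum>j\<in>{j. ed (u' s) + a j = t}. if j = sg (l s) then 1 else 0)"
      by (intro sum.cong refl) (auto simp: cc_vert split: if_splits)
    also have "\<dots> = (if ed (u' s) + V (l s) = t then 1 else 0)" by simp
    also have "\<dots> = (if s = t then 1 else 0)" using u'[OF s] by simp
    finally show "supp_eval (range sg) (b s t) = (if s = t then 1 else 0)" .
  next
    fix s assume s: "s \<in> I"
    let ?T = "\<lambda>j p. mconst (of_rat (cc (l s) (a j))) * mvar j * deriv_monomial (u' s + unit_exp j) p"
    have hu: "hh (ed (u' s)) = of_nat n - 1" using u'[OF s] s by (simp add: hh_diff hh_col I_def)
    then have "total (u' s) < n" unfolding hh_ed by linarith
    then have g': "good (deriv_monomial (u' s))" using less n_def by blast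
    obtain \<kappa> :: "('n, 'k) mpoly" where k: "(\<lambda>p. (\<Sum>j\<in>UNIV. ?T j p) - \<kappa> * deriv_monomial (u' s) p) \<in> HH"
      using euler_relation by blast
    have "good (\<lambda>p. ((\<Sum>j\<in>UNIV. ?T j p) - \<kappa> * deriv_monomial (u' s) p) + \<kappa> * deriv_monomial (u' s) p)"
      by (intro good_add good_H[OF k] good_mult g')
    then have all: "good (\<lambda>p. \<Sum>j\<in>UNIV. ?T j p)" by simp
    let ?J = "{j. ed (u' s) + a j \<in> I}"
    \<comment> \<open>The terms whose degree falls into \<open>Ap\<close> are known to be good
      already and are moved to the other side of the equation.\<close>
    have nJ: "good (\<lambda>p. \<Sum>j\<in>- ?J. (- 1) * ?T j p)"
    proof (intro good_sum good_mult good_Ap)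
      fix j assume "j \<in> - ?J"
      moreover have "ed (u' s) + a j \<in> S" by (intro S_add ed_S S_col)
      moreover have "hh (ed (u' s) + a j) = of_nat n" by (simp add: hh_add hu hh_col)
      ultimately show "ed (u' s + unit_exp j) \<in> Ap" by (simp add: I_def exponent_degree_add exponent_degree_unit_exp)
    qed
    have spl: "(\<Sum>j\<in>UNIV. ?T j p) + (\<Sum>j\<in>- ?J. (- 1) * ?T j p) = (\<Sum>j\<in>?J. ?T j p)" for p
      using sum.union_disjoint[of ?J "- ?J" "\<lambda>j. ?T j p"] by (simp add: sum_negf Compl_partition)
    have J: "good (\<lambda>p. \<Sum>j\<in>?J. ?T j p)" using good_add[OF all nJ] unfolding spl .
    let ?E = "\<lambda>j p. (mconst (of_rat (cc (l s) (a j))) * mvar j) * (deriv_monomial (U (ed (u' s) + a j)) p - deriv_monomial (u' s + unit_exp j) p)"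
    have E: "good (\<lambda>p. \<Sum>j\<in>?J. ?E j p)"
    proof (intro good_sum good_mult good_H hypergeometric_generators(3))
      fix j assume "j \<in> ?J"
      then have "ed (u' s) + a j \<in> S" by (simp add: I_def)
      from U[OF this] show "ed (U (ed (u' s) + a j)) = ed (u' s + unit_exp j)" by (simp add: exponent_degree_add exponent_degree_unit_exp)
    qed
    have "(\<lambda>p. (\<Sum>j\<in>?J. ?T j p) + (\<Sum>j\<in>?J. ?E j p)) = (\<lambda>p. \<Sum>t\<in>I. b s t * deriv_monomial (U t) p)"
    proof
      fix p :: "('n, 'k) mpoly"
      have "(\<Sum>j\<in>?J. ?T j p) + (\<Sum>j\<in>?J. ?E j p) = (\<Sum>j\<in>?J. mconst (of_rat (cc (l s) (a j))) * mvar j * deriv_monomial (U (ed (u' s) + a j)) p)"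
        unfolding sum.distrib[symmetric] by (rule sum.cong) (simp_all add: right_diff_distrib)
      also have "\<dots> = (\<Sum>t\<in>I. \<Sum>j\<in>{j\<in>?J. ed (u' s) + a j = t}. mconst (of_rat (cc (l s) (a j))) * mvar j * deriv_monomial (U (ed (u' s) + a j)) p)"
        using \<open>finite I\<close> by (intro sum.group[symmetric]) auto
      also have "\<dots> = (\<Sum>t\<in>I. b s t * deriv_monomial (U t) p)"
        unfolding b_def sum_distrib_right by (intro sum.cong) auto
      finally show "(\<Sum>j\<in>?J. ?T j p) + (\<Sum>j\<in>?J. ?E j p) = (\<Sum>t\<in>I. b s t * deriv_monomial (U t) p)" .
    qed
    then show "good (\<lambda>p. \<Sum>t\<in>I. b s t * deriv_monomial (U t) p)" using good_add[OF J E] by simp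
  qed (use that \<open>finite I\<close> in \<open>auto intro: good_add good_mult good_cancel weyl_deriv_monomial simp: supp_eval_diff supp_eval_mult\<close>)
  moreover have "ed u \<in> Ap \<or> ed u \<in> I" using ed_S[of u] by (simp add: I_def hh_ed n_def)
  ultimately show ?case using good_Ap good_congruent[of u "U (ed u)"] U[OF ed_S[of u]] by auto
qed

lemma good_weyl: assumes "P \<in> weyl_operators" shows "good P"
proof -
  obtain g where "P = nf g" using weyl_nf[OF assms] ..
  moreover have "good (nf g)"
  proof (induction g rule: pm_induct)
    case zero
    have "nf 0 = (\<lambda>p :: ('n, 'k) mpoly. 0)" by (rule ext) (rule nf_0)
    then show ?case using good_0 by simp
  next
    case (single b c)
    have e: "nf (Poly_Mapping.single b c) = (\<lambda>p. c * deriv_monomial b p)" by (rule ext) (rule nf_single)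
    show ?case unfolding e by (rule good_mult[OF good_deriv_monomial])
  next
    case (add g h)
    have e: "nf (g + h) = (\<lambda>p. nf g p + nf h p)" by (rule ext) (rule nf_add)
    show ?case unfolding e by (rule good_add[OF add])
  qed
  ultimately show ?thesis by simp
qed

lemma holonomic_rank_E: "holonomic_rank A \<beta> = vs_dim K E"
  by (simp add: holonomic_rank_def Let_def hypergeometric_module_def)

theorem holonomic_rank_le: "holonomic_rank A \<beta> \<le> enat (card Ap)"
  unfolding holonomic_rank_E
proof (rule vs_dim_le[OF finite_Ap, where G = "\<lambda>w. deriv_monomial (SOME u. ed u = w)"])
  fix P :: "('n, 'k) mpoly \<Rightarrow> ('n, 'k) mpoly" assume "P \<in> weyl_operators"
  from good_weyl[OF this] show "\<exists>g f. g \<noteq> 0 \<and> (\<lambda>p. g * P p - (\<Sum>w\<in>Ap. f w * deriv_monomial (SOME u. ed u = w) p)) \<in> HH"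
    unfolding good_def by blast
qed (rule weyl_deriv_monomial)

end

section \<open>Series solutions\<close>

text \<open>A nowhere vanishing substitute for \<open>1/\<Gamma>(p + 1)\<close>, satisfying the functional equation except at \<open>0\<close>.\<close>

definition inv_gamma :: "rat \<Rightarrow> rat" where
  "inv_gamma p = (if p \<ge> 0 then 1 / (\<Prod>i<nat \<lfloor>p\<rfloor>. frac p + 1 + of_nat i)
     else (if frac p = 0 then 1 else frac p) * (\<Prod>i\<in>{1..<nat (- \<lfloor>p\<rfloor>)}. frac p - of_nat i))"

lemma inv_gamma_nonzero: "inv_gamma p \<noteq> 0"
proof -
  have "frac p + 1 + of_nat i \<noteq> 0" for i using frac_ge_0[of p] of_nat_0_le_iff[of i, where 'a = rat] by linarith
  moreover have "frac p - of_nat i \<noteq> 0" if "i \<ge> 1" for i using frac_lt_1[of p] that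
    by (metis eq_iff_diff_eq_0 linorder_not_less of_nat_1 of_nat_le_iff)
  ultimately show ?thesis by (simp add: inv_gamma_def)
qed

lemma inv_gamma_step: assumes "p \<noteq> 0" shows "p * inv_gamma p = inv_gamma (p - 1)"
proof -
  have f: "frac (p - 1) = frac p" "\<lfloor>p - 1\<rfloor> = \<lfloor>p\<rfloor> - 1" by (simp_all add: frac_def)
  have p: "p = frac p + of_int \<lfloor>p\<rfloor>" by (simp add: frac_def)
  consider (1) "p \<ge> 1" | (2) "0 < p" "p < 1" | (3) "p < 0" using assms by linarith
  then show ?thesis
  proof cases
    case 1
    then obtain n where n: "nat \<lfloor>p\<rfloor> = Suc n" "\<lfloor>p\<rfloor> = int (Suc n)"
      by (metis Suc_pred int_nat_eq le_floor_iff nat_0_le of_int_1 order_trans zero_less_nat_eq zero_less_one_class.zero_le_one zless_nat_conj zless_imp_add1_zle int_one_le_iff_zero_less)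
    have "frac p + 1 + of_nat n = p" using p n(2) by simp
    moreover have "inv_gamma p = 1 / (\<Prod>i<Suc n. frac p + 1 + of_nat i)" using 1 unfolding inv_gamma_def n(1) by simp
    ultimately have "inv_gamma p = 1 / ((\<Prod>i<n. frac p + 1 + of_nat i) * p)" by simp
    moreover have "inv_gamma (p - 1) = 1 / (\<Prod>i<n. frac p + 1 + of_nat i)" using 1 n(2) by (simp add: inv_gamma_def f)
    ultimately show ?thesis using assms by simp
  next
    case 2
    then have "\<lfloor>p\<rfloor> = 0" by linarith
    then have "frac p = p" using p by simp
    then show ?thesis using 2 \<open>\<lfloor>p\<rfloor> = 0\<close> assms by (simp add: inv_gamma_def f)
  next
    case 3
    then have "\<lfloor>p\<rfloor> < 0" by linarith
    then obtain m where m: "nat (- \<lfloor>p\<rfloor>) = m" "\<lfloor>p\<rfloor> = - int m" "m \<ge> 1" by (metis One_nat_def Suc_leI int_nat_eq minus_minus neg_0_le_iff_le nat_zminus_int not_le order_less_imp_le zero_less_nat_eq neg_0_less_iff_less nat_0_le)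
    have e: "nat (- \<lfloor>p - 1\<rfloor>) = Suc m" using m(2) by (simp add: f)
    have "frac p - of_nat m = p" using p m(2) by simp
    then show ?thesis using 3 m(3) e by (simp add: inv_gamma_def f(1) m(1))
  qed
qed

lemma inv_gamma_prod:
  assumes "\<And>i. i < n \<Longrightarrow> p + 1 + of_nat i \<noteq> 0"
  shows "(\<Prod>i<n. p + 1 + of_nat i) * inv_gamma (p + of_nat n) = inv_gamma p"
  using assms
proof (induction n)
  case (Suc n)
  have e: "p + of_nat (Suc n) = p + 1 + of_nat n" "p + 1 + of_nat n - 1 = p + of_nat n" by simp_all
  have s: "(p + 1 + of_nat n) * inv_gamma (p + of_nat (Suc n)) = inv_gamma (p + of_nat n)"
    using inv_gamma_step[of "p + 1 + of_nat n"] Suc.prems[of n] unfolding e by simp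
  show ?case unfolding prod.lessThan_Suc mult.assoc s by (rule Suc.IH) (simp add: Suc.prems)
qed simp

definition neg_supp :: "('n \<Rightarrow> rat) \<Rightarrow> 'n set" where "neg_supp q = {j. q j \<in> \<int> \<and> q j < 0}"

definition gamma_coeff :: "('n::finite \<Rightarrow> rat) \<Rightarrow> 'k::field_char_0" where
  "gamma_coeff q = (\<Prod>j\<in>UNIV. of_rat (inv_gamma (q j)))"

lemma gamma_coeff_nonzero: "gamma_coeff q \<noteq> 0" by (simp add: gamma_coeff_def inv_gamma_nonzero)

lemma neg_supp_shift: "neg_supp (\<lambda>j. q j + expo b j) \<subseteq> neg_supp q"
proof
  fix j assume j: "j \<in> neg_supp (\<lambda>j. q j + expo b j)"
  then have "(q j + expo b j) - expo b j \<in> \<int>" unfolding neg_supp_def by (intro Ints_diff Ints_of_nat) simp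
  moreover have "q j < 0" using j of_nat_0_le_iff[of "Poly_Mapping.lookup b j", where 'a = rat] unfolding neg_supp_def mem_Collect_eq by linarith
  ultimately show "j \<in> neg_supp q" by (simp add: neg_supp_def)
qed

text \<open>If no coordinate leaves the negative integers, no factor of \<open>ffact b q\<close>
  vanishes and the functional equation telescopes. If one does leave, the corresponding product
  passes through 0. Thus a derivative preserves the coefficients within one negative support and
  kills the terms that would cross its boundary.\<close>

lemma gamma_coeff_shift:
  "of_rat (ffact b q) * gamma_coeff (\<lambda>j. q j + expo b j) =
    (if neg_supp (\<lambda>j. q j + expo b j) = neg_supp q then gamma_coeff q else (0 :: 'k::field_char_0))"
proof (cases "neg_supp (\<lambda>j. q j + expo b j) = neg_supp q")
  case True
  have "(\<Prod>i<Poly_Mapping.lookup b j. q j + 1 + of_nat i) * inv_gamma (q j + expo b j) = inv_gamma (q j)" for j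
  proof (rule inv_gamma_prod)
    fix i assume i: "i < Poly_Mapping.lookup b j"
    show "q j + 1 + of_nat i \<noteq> 0"
    proof
      assume "q j + 1 + of_nat i = 0"
      then have q: "q j = of_int (- 1 - int i)" by (simp add: algebra_simps)
      then have "j \<in> neg_supp q" by (simp add: neg_supp_def)
      then have "j \<in> neg_supp (\<lambda>j. q j + expo b j)" using True by simp
      then have "q j + expo b j < 0" by (simp add: neg_supp_def)
      also have "q j + expo b j = of_int (int (Poly_Mapping.lookup b j) - 1 - int i)" by (simp add: q)
      finally have "int (Poly_Mapping.lookup b j) - 1 - int i < 0" by (simp only: of_int_less_0_iff)
      with i show False by linarith
    qed
  qed
  then have "ffact b q * (\<Prod>j\<in>UNIV. inv_gamma (q j + expo b j)) = (\<Prod>j\<in>UNIV. inv_gamma (q j))"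
    unfolding ffact_def prod.distrib[symmetric] by simp
  then have "(of_rat (ffact b q * (\<Prod>j\<in>UNIV. inv_gamma (q j + expo b j))) :: 'k) = of_rat (\<Prod>j\<in>UNIV. inv_gamma (q j))" by (rule arg_cong)
  then show ?thesis using True by (simp add: gamma_coeff_def of_rat_mult of_rat_prod)
next
  case False
  then obtain j where j: "j \<in> neg_supp q" "j \<notin> neg_supp (\<lambda>j. q j + expo b j)" using neg_supp_shift[of q b] by blast
  then obtain z where z: "q j = of_int z" "z < 0" by (auto simp: neg_supp_def elim!: Ints_cases)
  have "of_int (z + int (Poly_Mapping.lookup b j)) = q j + expo b j" by (simp add: z)
  then have "\<not> z + int (Poly_Mapping.lookup b j) < 0" using j(2) unfolding neg_supp_def
    by (metis (mono_tags, lifting) Ints_of_int mem_Collect_eq of_int_less_0_iff)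
  \<comment> \<open>The vanishing factor: the coordinate climbs from \<open>z\<close> and passes 0
    after \<open>- z\<close> steps, and the factors start at \<open>q j + 1\<close>, so the index is
    \<open>- 1 - z\<close>.\<close>
  then have "nat (- 1 - z) < Poly_Mapping.lookup b j" "q j + 1 + of_nat (nat (- 1 - z)) = 0" using z by auto
  then have "(\<Prod>i<Poly_Mapping.lookup b j. q j + 1 + of_nat i) = 0" by (intro prod_zero) auto
  then have "ffact b q = 0" unfolding ffact_def by (intro prod_zero) auto
  then show ?thesis using False by simp
qed

definition lattice_kernel :: "int ^ 'n::finite ^ 'd \<Rightarrow> ('n \<Rightarrow> rat) set" where
  "lattice_kernel A = {z. (\<forall>j. z j \<in> \<int>) \<and> (\<forall>i. (\<Sum>j\<in>UNIV. of_int (A $ i $ j) * z j) = 0)}"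

lemma lattice_kernel_diff: "z \<in> lattice_kernel A \<Longrightarrow> w \<in> lattice_kernel A \<Longrightarrow> (\<lambda>j. z j - w j) \<in> lattice_kernel A"
  by (simp add: lattice_kernel_def right_diff_distrib sum_subtractf)
lemma lattice_kernel_add: "z \<in> lattice_kernel A \<Longrightarrow> w \<in> lattice_kernel A \<Longrightarrow> (\<lambda>j. z j + w j) \<in> lattice_kernel A"
  by (simp add: lattice_kernel_def distrib_left sum.distrib)
lemma lattice_kernel_ed: assumes "exponent_degree A b = exponent_degree A c" shows "(\<lambda>j. expo b j - expo c j) \<in> lattice_kernel A"
proof -
  have "(\<Sum>j\<in>UNIV. A $ i $ j * int (Poly_Mapping.lookup b j)) = (\<Sum>j\<in>UNIV. A $ i $ j * int (Poly_Mapping.lookup c j))" for i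
    using assms by (simp add: exponent_degree_def vec_eq_iff matrix_vector_mult_def)
  then have "(of_int (\<Sum>j\<in>UNIV. A $ i $ j * int (Poly_Mapping.lookup b j)) :: rat) = of_int (\<Sum>j\<in>UNIV. A $ i $ j * int (Poly_Mapping.lookup c j))" for i
    by simp
  then show ?thesis by (simp add: lattice_kernel_def right_diff_distrib sum_subtractf)
qed

text \<open>The hypergeometric gamma series with starting exponent \<open>q0\<close>, truncated to
  the exponents that share its negative support.\<close>

definition gamma_series :: "int ^ 'n::finite ^ 'd \<Rightarrow> ('n \<Rightarrow> rat) \<Rightarrow> ('n \<Rightarrow> rat) \<Rightarrow> 'k::field_char_0" where
  "gamma_series A q0 q = (if (\<lambda>j. q j - q0 j) \<in> lattice_kernel A \<and> neg_supp q = neg_supp q0 then gamma_coeff q else 0)"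

definition minimal_neg_supp :: "int ^ 'n::finite ^ 'd \<Rightarrow> ('n \<Rightarrow> rat) \<Rightarrow> bool" where
  "minimal_neg_supp A q0 \<longleftrightarrow>
    (\<forall>q. (\<lambda>j. q j - q0 j) \<in> lattice_kernel A \<longrightarrow> neg_supp q \<subseteq> neg_supp q0 \<longrightarrow> neg_supp q = neg_supp q0)"

text \<open>The result depends on \<open>b\<close> only through the class of \<open>q + b\<close>,
  which is what the toric operators require. Minimality enters when \<open>q\<close> has the
  negative support of \<open>q0\<close>: adding \<open>b\<close> can only shrink that support, hence
  leaves it unchanged.\<close>

lemma deriv_action_gamma_series:
  assumes "minimal_neg_supp A q0"
  shows "deriv_action b (gamma_series A q0) q =
    (if (\<lambda>j. q j + expo b j - q0 j) \<in> lattice_kernel A \<and> neg_supp q = neg_supp q0 then gamma_coeff q else (0 :: 'k::field_char_0))"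
proof (cases "(\<lambda>j. q j + expo b j - q0 j) \<in> lattice_kernel A")
  case True
  let ?q = "\<lambda>j. q j + expo b j"
  have m: "neg_supp ?q \<subseteq> neg_supp q0 \<Longrightarrow> neg_supp ?q = neg_supp q0" using assms[unfolded minimal_neg_supp_def, THEN spec, of ?q] True by simp
  have "deriv_action b (gamma_series A q0) q = (if neg_supp ?q = neg_supp q0 then of_rat (ffact b q) * gamma_coeff ?q else (0 :: 'k))"
    using True by (simp add: deriv_action_def gamma_series_def)
  also have "\<dots> = (if neg_supp q = neg_supp q0 then gamma_coeff q else 0)"
    unfolding gamma_coeff_shift using m neg_supp_shift[of q b] by auto
  finally show ?thesis using True by simp
qed (simp add: deriv_action_def gamma_series_def)

definition diff_action where
  "diff_action \<phi> f q = psum (\<lambda>u c. c * deriv_action u \<phi> q) f"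

lemma diff_action_add: "diff_action \<phi> (f + g) q = diff_action \<phi> f q + diff_action \<phi> g q"
  unfolding diff_action_def by (rule psum_add) (simp_all add: distrib_right)
lemma diff_action_single: "diff_action \<phi> (Poly_Mapping.single u c) q = c * deriv_action u \<phi> q"
  unfolding diff_action_def by (rule psum_single) simp
lemma diff_action_0: "diff_action \<phi> 0 q = 0" by (simp add: diff_action_def psum_zero)
lemma diff_action_uminus: "diff_action \<phi> (- f) q = - diff_action \<phi> f q"
  using diff_action_add[of \<phi> f "- f" q] by (simp add: diff_action_0 eq_neg_iff_add_eq_0 add.commute)

lemma diff_action_mult_single:
  "diff_action \<phi> (Poly_Mapping.single w c * f) q = c * deriv_action w (diff_action \<phi> f) q"
proof (induction f rule: pm_induct)
  case zero
  have e: "diff_action \<phi> 0 = (\<lambda>_. 0)" by (rule ext) (rule diff_action_0)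
  show ?case unfolding mult_zero_right e by (simp add: deriv_action_zero)
next
  case (single b d)
  have "diff_action \<phi> (Poly_Mapping.single b d) = (\<lambda>q. d * deriv_action b \<phi> q)" by (rule ext) (rule diff_action_single)
  then show ?case by (simp add: mult_single diff_action_single deriv_action_add) (simp add: deriv_action_def)
next
  case (add g h)
  have e: "diff_action \<phi> (g + h) = (\<lambda>q. diff_action \<phi> g q + diff_action \<phi> h q)" by (rule ext) (rule diff_action_add)
  show ?case unfolding e deriv_action_plus using add by (simp add: distrib_left diff_action_add)
qed

lemma diff_action_mult: assumes "\<And>q. diff_action \<phi> f q = 0" shows "diff_action \<phi> (g * f) q = 0"
proof (induction g rule: pm_induct)
  case (single b d)
  have "diff_action \<phi> f = (\<lambda>_. 0)" by (rule ext) (rule assms)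
  then show ?case by (simp add: diff_action_mult_single deriv_action_zero)
qed (simp_all add: diff_action_0 distrib_right diff_action_add)

text \<open>The polynomials in the derivatives that annihilate a given function form an ideal of the
  commutative ring, so it suffices to treat the binomials.\<close>

lemma toric_ideal_annihilates:
  fixes A :: "int ^ 'n::{finite,linorder} ^ 'd" and \<phi> :: "('n \<Rightarrow> rat) \<Rightarrow> 'k::field_char_0"
  assumes "\<And>u v. exponent_degree A u = exponent_degree A v \<Longrightarrow> deriv_action u \<phi> = deriv_action v \<phi>"
    and "f \<in> toric_ideal A"
  shows "diff_action \<phi> f q = 0"
proof -
  let ?R = "ring_of_type_algebra :: ('n, 'k) mpoly ring"
  let ?Z = "{f. \<forall>q. diff_action \<phi> f q = 0}"
  interpret R: cring ?R by (rule cring_from_type_algebra)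
  have s: "carrier ?R = UNIV" "f \<oplus>\<^bsub>?R\<^esub> g = f + g" "f \<otimes>\<^bsub>?R\<^esub> g = f * g" "\<zero>\<^bsub>?R\<^esub> = 0" for f g
    by (simp_all add: ring_of_type_algebra_def)
  have inv: "inv\<^bsub>add_monoid ?R\<^esub> f = - f" for f
    using R.minus_equality[of "- f" f] by (simp add: s a_inv_def)
  have "ideal ?Z ?R"
  proof (rule idealI)
    show "ring ?R" by (rule R.ring_axioms)
    show "subgroup ?Z (add_monoid ?R)"
    proof
      fix f assume "f \<in> ?Z"
      then show "inv\<^bsub>add_monoid ?R\<^esub> f \<in> ?Z" unfolding inv by (simp add: diff_action_uminus)
    qed (auto simp: s diff_action_add diff_action_0)
  next
    fix f g assume "f \<in> ?Z"
    then show "g \<otimes>\<^bsub>?R\<^esub> f \<in> ?Z" "f \<otimes>\<^bsub>?R\<^esub> g \<in> ?Z"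
      using diff_action_mult[of \<phi> f g] by (simp_all add: s mult.commute)
  qed
  moreover have "{Poly_Mapping.single u 1 - Poly_Mapping.single v 1 | u v. exponent_degree A u = exponent_degree A v} \<subseteq> ?Z"
  proof safe
    fix u v :: "'n \<Rightarrow>\<^sub>0 nat" and q assume "exponent_degree A u = exponent_degree A v"
    from assms(1)[OF this] have "diff_action \<phi> (Poly_Mapping.single u 1 + - Poly_Mapping.single v 1) q = 0"
      by (simp only: diff_action_add diff_action_uminus diff_action_single, simp)
    then show "diff_action \<phi> (Poly_Mapping.single u 1 - Poly_Mapping.single v 1) q = 0" by simp
  qed
  ultimately have "toric_ideal A \<subseteq> ?Z" unfolding toric_ideal_def by (rule R.genideal_minimal)
  with assms(2) show ?thesis by blast
qed

lemma weyl_action_deriv_operator: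
  fixes f :: "('n::{finite,linorder}, 'k::field_char_0) mpoly"
  shows "weyl_action (deriv_operator f) \<phi> q = diff_action \<phi> f q"
proof -
  define g :: "('n, 'k) wnf" where "g = Poly_Mapping.map mconst f"
  have "nf (Poly_Mapping.map mconst f) p = deriv_operator f p \<and> nf_action (Poly_Mapping.map mconst f) \<phi> q = diff_action \<phi> f q" for p
  proof (induction f rule: pm_induct)
    case zero
    have "(Poly_Mapping.map mconst (0 :: ('n, 'k) mpoly) :: ('n, 'k) wnf) = 0" by (rule poly_mapping_eqI) (simp add: lookup_pm_map mconst_0)
    then show ?case by (simp add: nf_0 nf_action_0 deriv_operator_psum psum_zero diff_action_0)
  next
    case (single u c)
    have "mult_action (mconst c) \<psi> q = c * \<psi> q" for \<psi> :: "('n \<Rightarrow> rat) \<Rightarrow> 'k" unfolding mconst_def by (simp add: mult_action_single)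
    then show ?case
      by (simp add: pm_map_single mconst_0 nf_single nf_action_single deriv_operator_psum psum_single diff_action_single)
  next
    case (add g h)
    have "deriv_operator (g + h) p = deriv_operator g p + deriv_operator h p"
      unfolding deriv_operator_psum by (rule psum_add) (simp_all add: mconst_0 mconst_add distrib_right)
    then show ?case using add by (simp add: pm_map_add mconst_0 mconst_add nf_add nf_action_add diff_action_add)
  qed
  then have "nf g = deriv_operator f" "nf_action g \<phi> q = diff_action \<phi> f q" unfolding g_def by (auto intro!: ext)
  then show ?thesis using weyl_action_nf[of g] by metis
qed

definition theta :: "'n \<Rightarrow> ('n, 'k::comm_ring_1) mpoly \<Rightarrow> ('n, 'k) mpoly" where "theta j = (\<lambda>p. mvar j * mderiv j p)"

lemma theta_weyl: "(theta j :: ('n::{finite,linorder}, 'k::field_char_0) mpoly \<Rightarrow> _) \<in> weyl_operators"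
  using weyl_operators.comp[OF weyl_operators.var weyl_operators.deriv] by (simp add: theta_def o_def)

lemma weyl_action_theta: "weyl_action (theta j :: ('n::{finite,linorder}, 'k::field_char_0) mpoly \<Rightarrow> _) \<phi> q = of_rat (q j) * \<phi> q"
proof -
  have "weyl_action ((\<lambda>p :: ('n, 'k) mpoly. mvar j * p) \<circ> mderiv j) \<phi> q = mult_action (mvar j) (weyl_action (mderiv j :: ('n, 'k) mpoly \<Rightarrow> _) \<phi>) q"
    using weyl_action_comp[OF weyl_operators.var weyl_operators.deriv, of j j \<phi>] by (simp add: weyl_action_mult)
  also have "\<dots> = of_rat (q j) * \<phi> q"
  proof -
    have u: "(\<lambda>i. q i - expo (unit_exp j) i)(j := q j - expo (unit_exp j) j + 1) = q" by (auto simp: lookup_single when_def)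
    show ?thesis unfolding mvar_unit_exp mult_action_single weyl_action_mderiv deriv_action_unit_exp u by (simp add: lookup_single)
  qed
  finally show ?thesis by (simp add: theta_def o_def)
qed

lemma weyl_action_sum:
  fixes P :: "'i \<Rightarrow> ('n::{finite,linorder}, 'k::field_char_0) mpoly \<Rightarrow> ('n, 'k) mpoly"
  assumes "\<And>i. i \<in> I \<Longrightarrow> P i \<in> weyl_operators"
  shows "weyl_action (\<lambda>p. \<Sum>i\<in>I. P i p) \<phi> q = (\<Sum>i\<in>I. weyl_action (P i) \<phi> q)"
  using assms
proof (induction I rule: infinite_finite_induct)
  case (insert i I)
  have "weyl_action (\<lambda>p. P i p + (\<Sum>i\<in>I. P i p)) \<phi> q = weyl_action (P i) \<phi> q + weyl_action (\<lambda>p. \<Sum>i\<in>I. P i p) \<phi> q"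
    using insert.prems by (intro weyl_action_add weyl_sum) auto
  then show ?case using insert by simp
qed (use weyl_action_mult[of 0 \<phi> q] in \<open>simp_all add: mult_action_0\<close>)

lemma weyl_action_smult:
  assumes "P \<in> weyl_operators" shows "weyl_action (\<lambda>p. f * P p) \<phi> q = mult_action f (weyl_action P \<phi>) q"
  using weyl_action_comp[OF weyl_mult assms, of f \<phi>] by (simp add: o_def weyl_action_mult)

text \<open>For the toric operators this is the independence of \<open>b\<close> in
  \<open>deriv_action_gamma_series\<close>. The Euler operators act diagonally, and their eigenvalue
  at an exponent \<open>q\<close> is \<open>A q - \<beta>\<close>, which vanishes on
  \<open>q0\<close> plus the lattice kernel.\<close>

lemma hypergeometric_annihilates:
  fixes A :: "int ^ 'n::{finite,linorder} ^ 'd" and \<beta> :: "'k::field_char_0 ^ 'd"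
  assumes min: "minimal_neg_supp A q0" and \<beta>: "\<And>i. \<beta> $ i = of_rat (\<Sum>j\<in>UNIV. of_int (A $ i $ j) * q0 j)"
    and P: "P \<in> hypergeometric_ideal A \<beta>"
  shows "weyl_action P (gamma_series A q0) = (\<lambda>_. 0)"
proof -
  let ?\<phi> = "gamma_series A q0 :: _ \<Rightarrow> 'k"
  have "deriv_action u ?\<phi> = deriv_action v ?\<phi>" if "exponent_degree A u = exponent_degree A v" for u v
  proof
    fix q
    have "(\<lambda>j. q j + expo u j - q0 j) \<in> lattice_kernel A \<longleftrightarrow> (\<lambda>j. q j + expo v j - q0 j) \<in> lattice_kernel A"
    proof
      assume "(\<lambda>j. q j + expo u j - q0 j) \<in> lattice_kernel A"
      from lattice_kernel_diff[OF this lattice_kernel_ed[OF that]] show "(\<lambda>j. q j + expo v j - q0 j) \<in> lattice_kernel A" by (simp add: algebra_simps)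
    next
      assume "(\<lambda>j. q j + expo v j - q0 j) \<in> lattice_kernel A"
      from lattice_kernel_add[OF this lattice_kernel_ed[OF that]] show "(\<lambda>j. q j + expo u j - q0 j) \<in> lattice_kernel A" by (simp add: algebra_simps)
    qed
    then show "deriv_action u ?\<phi> q = deriv_action v ?\<phi> q" unfolding deriv_action_gamma_series[OF min] by simp
  qed
  note inv = this
  have t: "deriv_operator f \<in> annih ?\<phi>" if "f \<in> toric_ideal A" for f :: "('n, 'k) mpoly"
  proof -
    have "weyl_action (deriv_operator f) ?\<phi> = (\<lambda>_. 0)"
      by (rule ext, unfold weyl_action_deriv_operator) (rule toric_ideal_annihilates[OF inv that])
    then show ?thesis by (simp add: annih_def deriv_operator_weyl)
  qed
  have neg: "mconst (- c) = - mconst c" for c :: 'k by (simp add: mconst_def single_uminus)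
  have e: "euler_operator A \<beta> i \<in> annih ?\<phi>" for i
  proof -
    have eq: "euler_operator A \<beta> i = (\<lambda>p. (\<Sum>j\<in>UNIV. mconst (of_int (A $ i $ j)) * theta j p) + mconst (- (\<beta> $ i)) * p)"
      unfolding euler_operator_def theta_def of_int_mconst neg by simp
    have "weyl_action (euler_operator A \<beta> i) ?\<phi> q = 0" for q
    proof -
      have mult_action_c: "mult_action (mconst c) \<psi> q = c * \<psi> q" for c and \<psi> :: "('n \<Rightarrow> rat) \<Rightarrow> 'k" unfolding mconst_def by (simp add: mult_action_single)
      have w: "(\<lambda>p. mconst c * theta j p) \<in> (weyl_operators :: (('n, 'k) mpoly \<Rightarrow> _) set)" for c j
        using weyl_operators.comp[OF weyl_mult theta_weyl] by (simp add: o_def)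
      have "weyl_action (euler_operator A \<beta> i) ?\<phi> q = (\<Sum>j\<in>UNIV. of_int (A $ i $ j) * (of_rat (q j) * ?\<phi> q)) - \<beta> $ i * ?\<phi> q"
        unfolding eq by (simp add: weyl_action_add weyl_sum w weyl_mult weyl_action_sum weyl_action_smult theta_weyl weyl_action_mult mult_action_c weyl_action_theta)
      also have "\<dots> = (of_rat (\<Sum>j\<in>UNIV. of_int (A $ i $ j) * q j) - \<beta> $ i) * ?\<phi> q"
        by (simp add: of_rat_sum of_rat_mult left_diff_distrib sum_distrib_right mult.assoc)
      also have "\<dots> = 0"
      proof (cases "(\<lambda>j. q j - q0 j) \<in> lattice_kernel A")
        case True
        then have "(\<Sum>j\<in>UNIV. of_int (A $ i $ j) * q j) = (\<Sum>j\<in>UNIV. of_int (A $ i $ j) * q0 j)"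
          by (simp add: lattice_kernel_def right_diff_distrib sum_subtractf)
        then show ?thesis using \<beta>[of i] by simp
      qed (simp add: gamma_series_def)
      finally show ?thesis .
    qed
    then show ?thesis unfolding annih_def using euler_operator_weyl by (auto intro!: ext)
  qed
  have "hypergeometric_ideal A \<beta> \<subseteq> annih ?\<phi>" unfolding hypergeometric_ideal_def
    by (rule gen_left_ideal_annih) (use t e in auto)
  then show ?thesis using P by (auto simp: annih_def)
qed

text \<open>Comparing total degrees first leaves finitely many exponents below any given one, so
  minima exist in infinite sets; the linear order on exponents, compatible with addition, breaks
  ties.\<close>

definition deglex_le :: "('n::{finite,linorder} \<Rightarrow>\<^sub>0 nat) \<Rightarrow> ('n \<Rightarrow>\<^sub>0 nat) \<Rightarrow> bool" where
  "deglex_le v w \<longleftrightarrow> total v < total w \<or> total v = total w \<and> v \<le> w"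

lemma deglex_le_cancel: "deglex_le (v + u) (w + u) \<longleftrightarrow> deglex_le v w"
  by (simp add: deglex_le_def total_add)
lemma deglex_le_antisym: "deglex_le v w \<Longrightarrow> deglex_le w v \<Longrightarrow> v = w"
  by (auto simp: deglex_le_def)
lemma deglex_le_minimum: assumes "C \<noteq> {}" shows "\<exists>v\<in>C. \<forall>w\<in>C. deglex_le v w"
proof -
  obtain x where x: "x \<in> C" "\<And>y. y \<in> C \<Longrightarrow> total x \<le> total y"
    using ex_has_least_nat[of "\<lambda>v. v \<in> C" _ total] assms by blast
  let ?D = "{v\<in>C. total v = total x}"
  have "finite ?D" by (rule finite_subset[OF _ finite_total_le[of "total x"]]) auto
  then have "Min ?D \<in> ?D" "\<And>w. w \<in> ?D \<Longrightarrow> Min ?D \<le> w" using x(1) Min_in[of ?D] by auto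
  then show ?thesis using x(2) by (intro bexI[of _ "Min ?D"]) (fastforce simp: deglex_le_def order.order_iff_strict)+
qed

text \<open>A sum of two minimal elements is attained in only one way; this is what prevents
  cancellation at the initial exponent.\<close>

lemma deglex_le_sum_eq:
  assumes "deglex_le u v" "deglex_le m n" "u + m = v + n" shows "u = v" "m = n"
proof -
  have "deglex_le (v + m) (v + n)" using assms(2) deglex_le_cancel[of m v n] by (simp add: add.commute)
  then have "deglex_le (v + m) (u + m)" using assms(3) by simp
  then show "u = v" using deglex_le_cancel deglex_le_antisym assms(1) by blast
  then show "m = n" using assms(3) by simp
qed

text \<open>For a parameter coming from a lattice point \<open>a0\<close>, the exponents over it
  that matter have nonnegative integers at all nonvertices, and these integers determine the vertex
  coordinates, which are rational.\<close>

locale integral_parameter = hypergeometric A sg cc hh \<beta>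
  for A :: "int ^ 'n::{finite,linorder} ^ 'd" and sg cc hh and \<beta> :: "'k::field_char_0 ^ 'd" +
  fixes a0 :: "int ^ 'd"
  assumes a0: "a0 \<in> ZA" and \<beta>_a0: "\<beta> $ i = of_int (a0 $ i)"
begin

definition nonvertex where "nonvertex v \<longleftrightarrow> Poly_Mapping.keys v \<inter> range sg = {}"
text \<open>The solution \<open>q\<close> of \<open>A q = a0\<close> whose nonvertex coordinates are those of \<open>v\<close>.\<close>

definition point :: "('n \<Rightarrow>\<^sub>0 nat) \<Rightarrow> 'n \<Rightarrow> rat" where
  "point v j = (if j \<in> range sg then cc (the_inv sg j) (a0 - ed v) else expo v j)"
definition nonvertex_part :: "('n \<Rightarrow>\<^sub>0 nat) \<Rightarrow> 'n \<Rightarrow>\<^sub>0 nat" where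
  "nonvertex_part u = Abs_poly_mapping (\<lambda>j. if j \<in> range sg then 0 else Poly_Mapping.lookup u j)"
abbreviation "neg_vertices v \<equiv> neg_supp (point v)"

lemma point_sg: "point v (sg l) = cc l (a0 - ed v)" by (simp add: point_def the_inv_f_f[OF sg_inj])
lemma lookup_nonvertex_part: "Poly_Mapping.lookup (nonvertex_part u) j = (if j \<in> range sg then 0 else Poly_Mapping.lookup u j)"
  by (simp add: nonvertex_part_def)
lemma nonvertex_part_nonvertex: "nonvertex (nonvertex_part u)" by (auto simp: nonvertex_def in_keys_iff lookup_nonvertex_part)
lemma nonvertex_lookup: "nonvertex v \<Longrightarrow> Poly_Mapping.lookup v (sg l) = 0" by (auto simp: nonvertex_def in_keys_iff)

lemma sum_split_sg: "(\<Sum>j\<in>UNIV. g j) = (\<Sum>l\<in>UNIV. g (sg l)) + (\<Sum>j\<in>- range sg. g j)"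
  for g :: "'n \<Rightarrow> 'x::comm_monoid_add"
proof -
  have "(\<Sum>j\<in>UNIV. g j) = sum g (range sg \<union> - range sg)" by (simp add: Compl_partition)
  also have "\<dots> = sum g (range sg) + sum g (- range sg)" by (rule sum.union_disjoint) auto
  finally show ?thesis by (simp add: sum.reindex[OF sg_inj])
qed

lemma cc_ed: "cc l (ed v) = (\<Sum>j\<in>UNIV. expo v j * cc l (a j))"
  by (simp add: exponent_degree_sum cc_sum cc_smult_nat)

lemma ed_nonvertex_part: "ed u = ed (nonvertex_part u) + lat (\<lambda>l. int (Poly_Mapping.lookup u (sg l)))"
  by (rule cc_eqI) (simp add: cc_add cc_lat cc_ed sum_split_sg lookup_nonvertex_part cc_vert if_distrib cong: if_cong)

lemma ed_ZA: "ed u \<in> ZA" by (rule S_ZA[OF ed_S])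

text \<open>The multiple of \<open>x\<close> by \<open>NN\<close> lies in the lattice of the
  vertices, where the coordinates are integers and the expansion can be compared entrywise; then
  \<open>NN\<close> is divided out.\<close>

lemma cc_expand: assumes "x \<in> ZA" shows "of_int (x $ i) = (\<Sum>l\<in>UNIV. cc l x * of_int (A $ i $ sg l))"
proof -
  obtain c where x: "x = (\<Sum>j\<in>UNIV. c j *s a j)" using assms by (rule ZA_E)
  have "\<forall>j. \<exists>w. int NN *s a j = lat w" using NN(2) by blast
  then obtain W where W: "\<And>j. int NN *s a j = lat (W j)" by metis
  define z where "z l = (\<Sum>j\<in>UNIV. c j * W j l)" for l
  have W': "of_nat NN * cc l (a j) = of_int (W j l)" for l j
    using arg_cong[OF W[of j], of "cc l"] by (simp add: cc_lat cc_smult_nat)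
  have "of_nat NN * cc l x = of_int (z l)" for l
    by (simp add: x cc_sum cc_smult z_def sum_distrib_left mult.left_commute[of "of_nat NN"] W')
  then have z: "cc l x = of_int (z l) / of_nat NN" for l using NN(1) by (simp add: field_simps)
  have "int NN *s x = lat z" by (rule cc_eqI) (use NN(1) in \<open>simp add: cc_smult_nat cc_lat z\<close>)
  then have "int NN * (x $ i) = (\<Sum>l\<in>UNIV. z l * A $ i $ sg l)" by (simp add: lat_def vec_eq_iff sum_component column_def)
  then have "of_int (int NN * (x $ i)) = (of_int (\<Sum>l\<in>UNIV. z l * A $ i $ sg l) :: rat)" by simp
  then show ?thesis using NN(1) by (simp add: z sum_divide_distrib[symmetric] field_simps)
qed

lemma point_A: assumes "nonvertex v" shows "(\<Sum>j\<in>UNIV. of_int (A $ i $ j) * point v j) = of_int (a0 $ i)"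
proof -
  have "of_int ((a0 - ed v) $ i) = (\<Sum>l\<in>UNIV. of_int (A $ i $ sg l) * point v (sg l))"
    using cc_expand[OF ZA_diff[OF a0 ed_ZA]] by (simp add: point_sg mult.commute)
  moreover have "of_int (ed v $ i) = (\<Sum>j\<in>- range sg. of_int (A $ i $ j) * point v j)"
  proof -
    have "(of_int (ed v $ i) :: rat) = (\<Sum>j\<in>UNIV. of_int (A $ i $ j) * expo v j)"
      by (simp add: exponent_degree_def matrix_vector_mult_def)
    also have "\<dots> = (\<Sum>j\<in>- range sg. of_int (A $ i $ j) * expo v j)" unfolding sum_split_sg by (simp add: nonvertex_lookup[OF assms])
    also have "\<dots> = (\<Sum>j\<in>- range sg. of_int (A $ i $ j) * point v j)" by (rule sum.cong) (simp_all add: point_def)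
    finally show ?thesis .
  qed
  ultimately show ?thesis unfolding sum_split_sg by simp
qed

lemma point_inj: assumes "nonvertex v" "nonvertex w" "point v = point w" shows "v = w"
proof (rule poly_mapping_eqI)
  fix j
  show "Poly_Mapping.lookup v j = Poly_Mapping.lookup w j"
  proof (cases "j \<in> range sg")
    case True then show ?thesis by (auto simp: nonvertex_lookup[OF assms(1)] nonvertex_lookup[OF assms(2)])
  next
    case False then show ?thesis using fun_cong[OF assms(3), of j] by (simp add: point_def)
  qed
qed

lemma neg_vertices_sub: "neg_vertices v \<subseteq> range sg"
  by (auto simp: neg_supp_def point_def split: if_splits)

lemma point_lattice_kernel: assumes "nonvertex v" "nonvertex w" "ed w - ed v \<in> L" shows "(\<lambda>j. point w j - point v j) \<in> lattice_kernel A"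
proof -
  obtain z where z: "ed w - ed v = lat z" using assms(3) unfolding L_def by blast
  have "point w j - point v j \<in> \<int>" for j
  proof (cases "j \<in> range sg")
    case True
    then obtain l where j: "j = sg l" by blast
    have "point w j - point v j = - cc l (ed w - ed v)" unfolding j point_sg by (simp add: cc_diff)
    then show ?thesis by (simp add: z cc_lat)
  qed (simp add: point_def)
  moreover have "(\<Sum>j\<in>UNIV. of_int (A $ i $ j) * (point w j - point v j)) = 0" for i
    by (simp add: right_diff_distrib sum_subtractf point_A[OF assms(1)] point_A[OF assms(2)])
  ultimately show ?thesis by (simp add: lattice_kernel_def)
qed

text \<open>If all negative integer coordinates of \<open>q\<close> sit at vertices, its nonvertex
  coordinates are nonnegative integers and define \<open>w\<close>. The kernel equations then
  determine the vertex coordinates and show that the degree changes by an element of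
  \<open>L\<close>.\<close>

lemma lattice_kernel_point:
  assumes "nonvertex v" "(\<lambda>j. q j - point v j) \<in> lattice_kernel A" "neg_supp q \<subseteq> range sg"
  obtains w where "nonvertex w" "q = point w" "ed w - ed v \<in> L"
proof -
  have "\<forall>j. \<exists>z. q j - point v j = of_int z" using assms(2) unfolding lattice_kernel_def by (blast elim: Ints_cases)
  then obtain \<zeta> where \<zeta>: "\<And>j. q j - point v j = of_int (\<zeta> j)" by metis
  have "(of_int (\<Sum>j\<in>UNIV. A $ i $ j * \<zeta> j) :: rat) = 0" for i
    using assms(2) unfolding lattice_kernel_def \<zeta> by simp
  then have "(\<Sum>j\<in>UNIV. A $ i $ j * \<zeta> j) = 0" for i by (simp only: of_int_eq_0_iff)
  then have ker: "(\<Sum>j\<in>UNIV. \<zeta> j *s a j) = 0" by (simp add: vec_eq_iff sum_component column_def mult.commute)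
  define w where "w = Abs_poly_mapping (\<lambda>j. if j \<in> range sg then 0 else nat (int (Poly_Mapping.lookup v j) + \<zeta> j))"
  have lw: "Poly_Mapping.lookup w j = (if j \<in> range sg then 0 else nat (int (Poly_Mapping.lookup v j) + \<zeta> j))" for j
    by (simp add: w_def)
  have nw: "nonvertex w" by (auto simp: nonvertex_def in_keys_iff lw)
  have wJ: "int (Poly_Mapping.lookup w j) = int (Poly_Mapping.lookup v j) + \<zeta> j" if "j \<notin> range sg" for j
  proof -
    have q: "q j = of_int (int (Poly_Mapping.lookup v j) + \<zeta> j)" using \<zeta>[of j] that by (simp add: point_def)
    have "j \<notin> neg_supp q" using assms(3) that by blast
    then have "\<not> q j < 0" by (simp add: neg_supp_def q)
    then have "\<not> int (Poly_Mapping.lookup v j) + \<zeta> j < 0" unfolding q by (simp only: of_int_less_0_iff) simp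
    then show ?thesis using that by (simp add: lw)
  qed
  have "ed w - ed v = (\<Sum>j\<in>UNIV. (int (Poly_Mapping.lookup w j) - int (Poly_Mapping.lookup v j)) *s a j)"
    by (simp add: exponent_degree_sum vec_eq_iff sum_component left_diff_distrib sum_subtractf)
  also have "\<dots> = (\<Sum>j\<in>- range sg. \<zeta> j *s a j)"
    unfolding sum_split_sg by (simp add: nonvertex_lookup nw assms(1) wJ zero_smult)
  also have "\<dots> = - (\<Sum>l\<in>UNIV. \<zeta> (sg l) *s V l)"
    using ker unfolding sum_split_sg by (simp add: eq_neg_iff_add_eq_0 add.commute)
  also have "\<dots> = lat (\<lambda>l. - \<zeta> (sg l))" by (simp add: lat_def smult_neg sum_negf)
  finally have d: "ed w - ed v = lat (\<lambda>l. - \<zeta> (sg l))" .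
  have "q j = point w j" for j
  proof (cases "j \<in> range sg")
    case True
    then obtain l where j: "j = sg l" by blast
    have "cc l (ed w) = cc l (ed v) - of_int (\<zeta> j)"
      using arg_cong[OF d, of "cc l"] by (simp add: cc_diff cc_lat j)
    then show ?thesis using \<zeta>[of j] by (simp add: j point_sg cc_diff)
  next
    case False
    then have "(of_int (int (Poly_Mapping.lookup w j)) :: rat) = of_int (int (Poly_Mapping.lookup v j) + \<zeta> j)" using wJ by simp
    then show ?thesis using \<zeta>[of j] False by (simp add: point_def)
  qed
  then show ?thesis using nw d by (intro that[of w]) (auto simp: L_def)
qed

text \<open>For nonvertex \<open>v0\<close> it indexes the support of the gamma series starting at
  \<open>point v0\<close>.\<close>

definition fiber where "fiber v0 = {v. nonvertex v \<and> ed v - ed v0 \<in> L \<and> neg_vertices v = neg_vertices v0}"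
definition minimal_point where "minimal_point v0 \<longleftrightarrow> nonvertex v0 \<and> (\<forall>v. nonvertex v \<longrightarrow> ed v - ed v0 \<in> L \<longrightarrow> neg_vertices v \<subseteq> neg_vertices v0 \<longrightarrow> neg_vertices v = neg_vertices v0)"
abbreviation \<phi> :: "('n \<Rightarrow>\<^sub>0 nat) \<Rightarrow> ('n \<Rightarrow> rat) \<Rightarrow> 'k" where "\<phi> v0 \<equiv> gamma_series A (point v0)"

lemma \<phi>_annihilated: assumes "minimal_point v0" "P \<in> HH" shows "weyl_action P (\<phi> v0) = (\<lambda>_. 0)"
proof (rule hypergeometric_annihilates[OF _ _ assms(2)])
  have nonvertex: "nonvertex v0" using assms(1) by (simp add: minimal_point_def)
  show "minimal_neg_supp A (point v0)" unfolding minimal_neg_supp_def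
  proof (intro allI impI)
    fix q assume q: "(\<lambda>j. q j - point v0 j) \<in> lattice_kernel A" "neg_supp q \<subseteq> neg_vertices v0"
    then obtain w where "nonvertex w" "q = point w" "ed w - ed v0 \<in> L" using lattice_kernel_point[OF nonvertex q(1)] neg_vertices_sub by blast
    then show "neg_supp q = neg_vertices v0" using assms(1) q(2) unfolding minimal_point_def by blast
  qed
  show "\<beta> $ i = of_rat (\<Sum>j\<in>UNIV. of_int (A $ i $ j) * point v0 j)" for i
    by (simp add: point_A[OF nonvertex] \<beta>_a0)
qed

lemma \<phi>_support: assumes "nonvertex v0" "\<phi> v0 q \<noteq> 0" obtains v where "v \<in> fiber v0" "q = point v"
proof -
  have q: "(\<lambda>j. q j - point v0 j) \<in> lattice_kernel A" "neg_supp q = neg_vertices v0" using assms(2) unfolding gamma_series_def by (auto split: if_splits)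
  obtain w where "nonvertex w" "q = point w" "ed w - ed v0 \<in> L" using lattice_kernel_point[OF assms(1) q(1)] q(2) neg_vertices_sub by blast
  then show ?thesis using q(2) by (intro that[of w]) (auto simp: fiber_def)
qed

lemma \<phi>_fiber: assumes "nonvertex v0" "v \<in> fiber v0" shows "\<phi> v0 (point v) \<noteq> 0"
  using assms point_lattice_kernel[OF assms(1), of v] gamma_coeff_nonzero by (auto simp: gamma_series_def fiber_def)

text \<open>Interpolation: each unwanted exponent differs from \<open>x0\<close> in some coordinate
  \<open>j\<close>, and \<open>theta j\<close> minus the value of that coordinate is an operator
  with eigenvalue zero there and nonzero at \<open>x0\<close>. The product of these factors is still
  diagonal.\<close>

lemma separating_operator:
  assumes "finite B" "\<And>v. v \<in> B \<Longrightarrow> x v \<noteq> x0"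
  shows "\<exists>P p. P \<in> weyl_operators \<and> (\<forall>\<psi> q. weyl_action (P :: ('n, 'k) mpoly \<Rightarrow> _) \<psi> q = p q * \<psi> q) \<and> p x0 \<noteq> 0 \<and> (\<forall>v\<in>B. p (x v) = 0)"
  using assms
proof (induction B)
  case empty
  have "(id :: ('n, 'k) mpoly \<Rightarrow> _) = (\<lambda>p. 1 * p)" by (simp add: fun_eq_iff)
  then have "weyl_action (id :: ('n, 'k) mpoly \<Rightarrow> _) \<psi> q = 1 * \<psi> q" for \<psi> q using weyl_action_mult[of 1 \<psi> q] by (simp only: mult_action_1 mult_1_left)
  then have "id \<in> weyl_operators \<and> (\<forall>\<psi> q. weyl_action (id :: ('n, 'k) mpoly \<Rightarrow> _) \<psi> q = 1 * \<psi> q) \<and> (1 :: 'k) \<noteq> 0 \<and> (\<forall>v\<in>{}. (1 :: 'k) = 0)"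
    using weyl_id by (intro conjI allI) auto
  then show ?case by (rule exI[where x = id, OF exI[where x = "\<lambda>_. 1"]])
next
  case (insert v B)
  then obtain P p where P: "P \<in> weyl_operators" "\<And>\<psi> q. weyl_action (P :: ('n, 'k) mpoly \<Rightarrow> _) \<psi> q = p q * \<psi> q" "p x0 \<noteq> 0" "\<And>v. v \<in> B \<Longrightarrow> p (x v) = 0"
    by (metis insertI2)
  obtain j where j: "x v j \<noteq> x0 j" using insert.prems[of v] by auto
  define Q where "Q = (\<lambda>p :: ('n, 'k) mpoly. theta j p + mconst (- of_rat (x v j)) * p)"
  have Q: "Q \<in> weyl_operators" unfolding Q_def by (intro weyl_operators.add theta_weyl weyl_operators.scalar)
  have Qa: "weyl_action Q \<psi> q = (of_rat (q j) - of_rat (x v j)) * \<psi> q" for \<psi> q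
    unfolding Q_def weyl_action_add[OF theta_weyl weyl_operators.scalar] weyl_action_theta weyl_action_mult
    by (simp add: mconst_def mult_action_single left_diff_distrib)
  have "weyl_action (Q \<circ> P) \<psi> q = (of_rat (q j) - of_rat (x v j)) * p q * \<psi> q" for \<psi> q
    by (simp add: weyl_action_comp[OF Q P(1)] Qa P(2))
  moreover define R where "R = Q \<circ> P"
  ultimately have "R \<in> weyl_operators \<and> (\<forall>\<psi> q. weyl_action R \<psi> q = (of_rat (q j) - of_rat (x v j)) * p q * \<psi> q)
      \<and> (of_rat (x0 j) - of_rat (x v j)) * p x0 \<noteq> 0 \<and> (\<forall>w\<in>insert v B. (of_rat (x w j) - of_rat (x v j)) * p (x w) = 0)"
    using P(3,4) weyl_operators.comp[OF Q P(1)] j by (intro conjI allI) auto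
  then show ?case by (rule exI[where x = R, OF exI[where x = "\<lambda>q. (of_rat (q j) - of_rat (x v j)) * p q"]])
qed

lemma mult_action_keys: "mult_action f \<psi> q = (\<Sum>m\<in>Poly_Mapping.keys f. Poly_Mapping.lookup f m * \<psi> (\<lambda>j. q j - expo m j))"
  by (simp add: mult_action_def psum_def)

lemma point_shift:
  assumes "nonvertex u" "nonvertex v" "(\<lambda>j. point u j + expo m j - expo m' j) = point v"
  shows "u + nonvertex_part m = v + nonvertex_part m'"
proof (rule poly_mapping_eqI)
  fix j
  show "Poly_Mapping.lookup (u + nonvertex_part m) j = Poly_Mapping.lookup (v + nonvertex_part m') j"
  proof (cases "j \<in> range sg")
    case True then show ?thesis using nonvertex_lookup[OF assms(1)] nonvertex_lookup[OF assms(2)] by (auto simp: lookup_add lookup_nonvertex_part)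
  next
    case False
    then have "of_nat (Poly_Mapping.lookup u j + Poly_Mapping.lookup m j) = (of_nat (Poly_Mapping.lookup v j + Poly_Mapping.lookup m' j) :: rat)"
      using fun_cong[OF assms(3), of j] by (simp add: point_def algebra_simps)
    then show ?thesis using False by (simp only: of_nat_eq_iff lookup_add lookup_nonvertex_part) simp
  qed
qed

text \<open>Among all exponents \<open>m\<close> of the coefficients of a relation choose one, of \<open>f i\<close> say, with the least
  nonvertex part. In the relation applied to the series of \<open>i\<close>, the coefficient at the initial
  exponent plus \<open>m\<close> has a single nonzero contribution.\<close>

theorem holonomic_rank_ge:
  assumes B: "finite B" and minimal_point: "\<And>v. v \<in> B \<Longrightarrow> minimal_point v"
    and disj: "\<And>v w. v \<in> B \<Longrightarrow> w \<in> B \<Longrightarrow> v \<noteq> w \<Longrightarrow> fiber v \<inter> fiber w = {}"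
  shows "enat (card B) \<le> holonomic_rank A \<beta>"
proof -
  have nvB: "nonvertex v" if "v \<in> B" for v using minimal_point[OF that] by (simp add: minimal_point_def)
  have "\<exists>u. u \<in> fiber v \<and> (\<forall>w\<in>fiber v. deglex_le u w)" if "v \<in> B" for v
  proof -
    have "v \<in> fiber v" using nvB[OF that] L_0 by (simp add: fiber_def)
    then have "fiber v \<noteq> {}" by blast
    from deglex_le_minimum[OF this] show ?thesis unfolding Bex_def .
  qed
  then obtain \<mu> where \<mu>: "\<And>v. v \<in> B \<Longrightarrow> \<mu> v \<in> fiber v" "\<And>v w. v \<in> B \<Longrightarrow> w \<in> fiber v \<Longrightarrow> deglex_le (\<mu> v) w" by metis
  have nonvertex\<mu>: "nonvertex (\<mu> v)" if "v \<in> B" for v using \<mu>(1)[OF that] by (simp add: fiber_def)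
  \<comment> \<open>An operator for each series, with eigenvalue nonzero at its own initial exponent
    and zero at the initial exponents of the others. These operators will be the independent
    elements.\<close>
  define R where "R v P p \<longleftrightarrow> P \<in> weyl_operators \<and> (\<forall>\<psi> q. weyl_action (P :: ('n, 'k) mpoly \<Rightarrow> _) \<psi> q = p q * \<psi> q) \<and> p (point (\<mu> v)) \<noteq> 0 \<and> (\<forall>w\<in>B - {v}. p (point (\<mu> w)) = 0)" for v P p
  have sep: "\<exists>P p. R v P p" if v: "v \<in> B" for v
    unfolding R_def
  proof (rule separating_operator)
    fix w assume w: "w \<in> B - {v}"
    then have "\<mu> w \<noteq> \<mu> v" using \<mu>(1)[OF v] \<mu>(1)[of w] disj[of v w] v by auto
    then show "point (\<mu> w) \<noteq> point (\<mu> v)" using point_inj nonvertex\<mu> v w by blast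
  qed (use B in simp)
  have "\<forall>v\<in>B. \<exists>z. R v (fst z) (snd z)"
  proof
    fix v assume "v \<in> B"
    then obtain P p where "R v P p" using sep by blast
    then have "R v (fst (P, p)) (snd (P, p))" by simp
    then show "\<exists>z. R v (fst z) (snd z)" by (rule exI)
  qed
  from bchoice[OF this] obtain Z where Z: "\<forall>v\<in>B. R v (fst (Z v)) (snd (Z v))" ..
  define P where "P v = fst (Z v)" for v
  define p where "p v = snd (Z v)" for v
  have R: "R v (P v) (p v)" if "v \<in> B" for v using Z that by (simp add: P_def p_def)
  have P: "\<And>v. v \<in> B \<Longrightarrow> P v \<in> weyl_operators"
      "\<And>v \<psi> q. v \<in> B \<Longrightarrow> weyl_action (P v :: ('n, 'k) mpoly \<Rightarrow> _) \<psi> q = p v q * \<psi> q"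
      "\<And>v. v \<in> B \<Longrightarrow> p v (point (\<mu> v)) \<noteq> 0" "\<And>v w. v \<in> B \<Longrightarrow> w \<in> B \<Longrightarrow> w \<noteq> v \<Longrightarrow> p v (point (\<mu> w)) = 0"
    using R unfolding R_def by auto
  show ?thesis unfolding holonomic_rank_E
  proof (rule vs_dim_ge[OF B, where G = P])
    fix f :: "('n \<Rightarrow>\<^sub>0 nat) \<Rightarrow> ('n, 'k) mpoly" and w0
    assume inH: "(\<lambda>p. \<Sum>w\<in>B. f w * P w p) \<in> HH" and w0: "w0 \<in> B"
    show "f w0 = 0"
    proof (rule ccontr)
      assume "f w0 \<noteq> 0"
      then obtain m0 where "m0 \<in> Poly_Mapping.keys (f w0)" by (metis ex_in_conv keys_eq_empty)
      then have "(\<Union>w\<in>B. nonvertex_part ` Poly_Mapping.keys (f w)) \<noteq> {}" using w0 by blast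
      then obtain r where r: "r \<in> (\<Union>w\<in>B. nonvertex_part ` Poly_Mapping.keys (f w))" "\<And>s. s \<in> (\<Union>w\<in>B. nonvertex_part ` Poly_Mapping.keys (f w)) \<Longrightarrow> deglex_le r s"
        using deglex_le_minimum by meson
      then obtain i m where i: "i \<in> B" and m: "m \<in> Poly_Mapping.keys (f i)" and rm: "r = nonvertex_part m" by blast
      \<comment> \<open>The exponent at which the relation is tested. A coefficient exponent
        \<open>n\<close> contributes only when \<open>q\<close> minus \<open>n\<close> lies in the
        support of the series of \<open>i\<close>. Both summands of
        \<open>\<mu> i + nonvertex_part m\<close> being minimal, \<open>deglex_le_sum_eq\<close>
        leaves only the initial exponent, and the eigenvalues single out
        \<open>w = i\<close>.\<close>
      define q where "q = (\<lambda>j. point (\<mu> i) j + expo m j)"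
      have only: "w = i \<and> n = m" if w: "w \<in> B" and n: "n \<in> Poly_Mapping.keys (f w)"
        and nz: "p w (\<lambda>j. q j - expo n j) * \<phi> i (\<lambda>j. q j - expo n j) \<noteq> 0" for w n
      proof -
        have "\<phi> i (\<lambda>j. q j - expo n j) \<noteq> 0" using nz by auto
        then obtain v where v: "v \<in> fiber i" "(\<lambda>j. q j - expo n j) = point v" by (rule \<phi>_support[OF nvB[OF i]])
        have "nonvertex v" using v(1) by (simp add: fiber_def)
        have e: "\<mu> i + nonvertex_part m = v + nonvertex_part n" by (rule point_shift[OF nonvertex\<mu>[OF i] \<open>nonvertex v\<close>]) (use v(2) in \<open>simp add: q_def\<close>)
        have "deglex_le (nonvertex_part m) (nonvertex_part n)" using r(2) w n rm by blast
        from deglex_le_sum_eq(1)[OF \<mu>(2)[OF i v(1)] this e] have v\<mu>: "v = \<mu> i" by simp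
        have "m = n"
        proof (rule poly_mapping_eqI)
          fix j
          have "(expo m j :: rat) = expo n j" using fun_cong[OF v(2), of j] by (simp add: q_def v\<mu>)
          then show "Poly_Mapping.lookup m j = Poly_Mapping.lookup n j" by simp
        qed
        moreover have "p w (point (\<mu> i)) \<noteq> 0" using nz v(2) v\<mu> by simp
        then have "w = i" using P(4)[OF w i] by blast
        ultimately show ?thesis by simp
      qed
      let ?t = "\<lambda>w n. Poly_Mapping.lookup (f w) n * (p w (\<lambda>j. q j - expo n j) * \<phi> i (\<lambda>j. q j - expo n j))"
      have "0 = weyl_action (\<lambda>p. \<Sum>w\<in>B. f w * P w p) (\<phi> i) q"
        unfolding \<phi>_annihilated[OF minimal_point[OF i] inH] ..
      also have "\<dots> = (\<Sum>w\<in>B. mult_action (f w) (weyl_action (P w) (\<phi> i)) q)"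
        using P(1) by (subst weyl_action_sum) (auto intro: weyl_smult simp: weyl_action_smult)
      also have "\<dots> = (\<Sum>w\<in>B. \<Sum>n\<in>Poly_Mapping.keys (f w). ?t w n)"
        unfolding mult_action_keys using P(2) by (intro sum.cong refl) simp
      also have "\<dots> = (\<Sum>w\<in>B. \<Sum>n\<in>Poly_Mapping.keys (f w). if w = i \<and> n = m then ?t i m else 0)"
      proof (intro sum.cong refl)
        fix w n assume "w \<in> B" "n \<in> Poly_Mapping.keys (f w)"
        then have "\<not> (w = i \<and> n = m) \<Longrightarrow> p w (\<lambda>j. q j - expo n j) * \<phi> i (\<lambda>j. q j - expo n j) = 0" using only by blast
        then show "?t w n = (if w = i \<and> n = m then ?t i m else 0)" by (cases "w = i \<and> n = m") simp_all
      qed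
      also have "\<dots> = (\<Sum>w\<in>B. if w = i then (\<Sum>n\<in>Poly_Mapping.keys (f i). if n = m then ?t i m else 0) else 0)"
        by (intro sum.cong refl) auto
      also have "\<dots> = ?t i m" using B i m by simp
      also have "(\<lambda>j. q j - expo m j) = point (\<mu> i)" by (simp add: q_def)
      finally have "Poly_Mapping.lookup (f i) m * (p i (point (\<mu> i)) * \<phi> i (point (\<mu> i))) = 0" by simp
      then show False using m P(3)[OF i] \<phi>_fiber[OF nvB[OF i] \<mu>(1)[OF i]] by (simp add: in_keys_iff)
    qed
  qed (rule P(1))
qed

text \<open>Within the coset, an exponent with the fewest negative vertices is minimal with respect
  to inclusion.\<close>

lemma ex_minimal_point: assumes "z \<in> ZA" shows "\<exists>v. minimal_point v \<and> ed v - z \<in> L"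
proof -
  obtain s where s: "s \<in> S" "s - z \<in> L" using coset_meets_S[OF assms] by blast
  obtain u where u: "ed u = s" using S_ed[OF s(1)] by blast
  let ?C = "\<lambda>v. nonvertex v \<and> ed v - z \<in> L"
  have "ed (nonvertex_part u) - z = (s - z) - lat (\<lambda>l. int (Poly_Mapping.lookup u (sg l)))" using ed_nonvertex_part[of u] u by (simp add: algebra_simps)
  moreover have "lat (\<lambda>l. int (Poly_Mapping.lookup u (sg l))) \<in> L" by (simp add: L_def)
  ultimately have "?C (nonvertex_part u)" using nonvertex_part_nonvertex L_diff[OF s(2)] by presburger
  from ex_has_least_nat[of ?C, OF this, of "\<lambda>v. card (neg_vertices v)"]
  obtain v where v: "?C v" "\<And>w. ?C w \<Longrightarrow> card (neg_vertices v) \<le> card (neg_vertices w)" by blast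
  have "minimal_point v" unfolding minimal_point_def
  proof (intro conjI allI impI)
    fix w assume w: "nonvertex w" "ed w - ed v \<in> L" "neg_vertices w \<subseteq> neg_vertices v"
    have "ed w - z = (ed w - ed v) + (ed v - z)" by simp
    then have "?C w" using w v(1) L_add[of "ed w - ed v" "ed v - z"] by simp
    from v(2)[OF this] w(3) show "neg_vertices w = neg_vertices v" by (intro card_seteq) simp_all
  qed (use v in simp)
  with v show ?thesis by blast
qed

text \<open>In the coset of \<open>a0\<close> the vertex coordinates of a point are integers. If
  none is negative, they express \<open>a0\<close> as an element of \<open>S\<close> plus
  nonnegative multiples of vertices.\<close>

lemma neg_vertices_empty: assumes "nonvertex v" "ed v - a0 \<in> L" "neg_vertices v = {}" shows "a0 \<in> S"
proof -
  obtain z where z: "ed v - a0 = lat z" using assms(2) unfolding L_def by blast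
  have "0 \<le> - z l" for l
  proof (rule ccontr)
    assume "\<not> 0 \<le> - z l"
    moreover have "point v (sg l) = of_int (- z l)"
      using arg_cong[OF z, of "cc l"] by (simp add: point_sg cc_diff cc_lat)
    ultimately have "sg l \<in> neg_vertices v" by (simp add: neg_supp_def)
    then show False using assms(3) by simp
  qed
  then have "ed v + lat (\<lambda>l. - z l) \<in> S" by (intro S_lat ed_S)
  moreover have "a0 = ed v + lat (\<lambda>l. - z l)" using z lat_diff[of "\<lambda>_. 0" z] lat_0 by (simp add: algebra_simps)
  ultimately show ?thesis by simp
qed

text \<open>In a representation of \<open>a0 + V i\<close> by columns, taking one copy of
  \<open>V i\<close> away can make only that coordinate negative. The negative support is not empty
  because \<open>a0\<close> is not in \<open>S\<close>, and for the same reason no exponent in the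
  coset has a smaller one.\<close>

lemma exceptional_exponent:
  assumes "a0 \<notin> S" "a0 + V i \<in> S"
  shows "\<exists>v. minimal_point v \<and> ed v - a0 \<in> L \<and> neg_vertices v = {sg i}"
proof -
  obtain u where u: "ed u = a0 + V i" using S_ed[OF assms(2)] by blast
  let ?z = "\<lambda>l. int (Poly_Mapping.lookup u (sg l)) - (if l = i then 1 else 0)"
  have V: "lat (\<lambda>l. if l = i then 1 else 0) = V i" using lat_unit[of i 1] by (simp add: vec_eq_iff)
  have "lat ?z = lat (\<lambda>l. int (Poly_Mapping.lookup u (sg l))) - V i" unfolding lat_diff V ..
  moreover have "a0 + V i = ed (nonvertex_part u) + lat (\<lambda>l. int (Poly_Mapping.lookup u (sg l)))" unfolding u[symmetric] by (rule ed_nonvertex_part)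
  moreover have "x - y = z - w" if "x + w = y + z" for x y z w :: "int ^ 'd"
  proof -
    have "x - y = (x + w) - w - y" by simp
    also have "\<dots> = z - w" unfolding that by simp
    finally show ?thesis .
  qed
  ultimately have d: "a0 - ed (nonvertex_part u) = lat ?z" by presburger
  have "lat ?z \<in> L" unfolding L_def by (rule rangeI)
  then have L: "ed (nonvertex_part u) - a0 \<in> L" using L_diff[OF L_0, of "a0 - ed (nonvertex_part u)"] unfolding d[symmetric] by simp
  have pz: "point (nonvertex_part u) (sg l) = of_int (?z l)" for l unfolding point_sg d cc_lat ..
  have sub: "neg_vertices (nonvertex_part u) \<subseteq> {sg i}"
  proof
    fix j assume j: "j \<in> neg_vertices (nonvertex_part u)"
    then obtain l where l: "j = sg l" using neg_vertices_sub by blast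
    then have "?z l < 0" using j pz[of l] unfolding neg_supp_def by (simp only: mem_Collect_eq of_int_less_0_iff)
    then show "j \<in> {sg i}" using l by (simp split: if_splits)
  qed
  have ne: "neg_vertices v \<noteq> {}" if "nonvertex v" "ed v - a0 \<in> L" for v using neg_vertices_empty[OF that] assms(1) by blast
  have neg_vertices: "neg_vertices (nonvertex_part u) = {sg i}" using sub ne[OF nonvertex_part_nonvertex L] by blast
  have "minimal_point (nonvertex_part u)" unfolding minimal_point_def
  proof (intro conjI allI impI nonvertex_part_nonvertex)
    fix v assume v: "nonvertex v" "ed v - ed (nonvertex_part u) \<in> L" "neg_vertices v \<subseteq> neg_vertices (nonvertex_part u)"
    have "ed v - a0 \<in> L" using L_add[OF v(2) L] by simp
    then show "neg_vertices v = neg_vertices (nonvertex_part u)" using ne[OF v(1)] v(3) unfolding neg_vertices by blast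
  qed
  with L neg_vertices show ?thesis by blast
qed

text \<open>One minimal point from each coset other than that of \<open>a0\<close>, together with
  the two exceptional ones, makes one more than the number of cosets. Their fibers are disjoint,
  being told apart by the coset or by the negative support.\<close>

theorem holonomic_rank_gt:
  assumes "a0 \<notin> S" "a0 + V i \<in> S" "a0 + V j \<in> S" "i \<noteq> j"
  shows "enat (simplex_vol A) < holonomic_rank A \<beta>"
proof -
  obtain v1 where v1: "minimal_point v1" "ed v1 - a0 \<in> L" "neg_vertices v1 = {sg i}" using exceptional_exponent assms by blast
  obtain v2 where v2: "minimal_point v2" "ed v2 - a0 \<in> L" "neg_vertices v2 = {sg j}" using exceptional_exponent assms by blast
  let ?C = "coset ` Ap"
  have "\<exists>v. minimal_point v \<and> coset (ed v) = c" if cC: "c \<in> ?C" for c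
  proof -
    obtain w where "w \<in> Ap" "c = coset w" using cC by blast
    then show ?thesis using ex_minimal_point[of w] S_ZA by (auto simp: coset_eq_iff Ap_def)
  qed
  then obtain pick where pick: "\<And>c. c \<in> ?C \<Longrightarrow> minimal_point (pick c)" "\<And>c. c \<in> ?C \<Longrightarrow> coset (ed (pick c)) = c" by metis
  have a0C: "coset a0 \<in> ?C"
  proof -
    obtain w z where w: "w \<in> Ap" "a0 + V i = w + lat z" using Ap_descend[OF assms(2)] by blast
    have "lat (\<lambda>l. if l = i then 1 else 0) \<in> L" unfolding L_def by (rule rangeI)
    moreover have "lat (\<lambda>l. if l = i then 1 else 0) = V i" using lat_unit[of i 1] by (simp add: vec_eq_iff)
    ultimately have V: "V i \<in> L" by simp
    have "a0 - w = (a0 + V i) - V i - w" by simp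
    also have "\<dots> = lat z - V i" unfolding w(2) by simp
    finally have "a0 - w = lat z - V i" .
    moreover have "lat z \<in> L" unfolding L_def by (rule rangeI)
    ultimately have "coset a0 = coset w" unfolding coset_eq_iff using L_diff[OF _ V, of "lat z"] by simp
    then show ?thesis using w(1) by blast
  qed
  let ?P = "pick ` (?C - {coset a0})"
  let ?B = "insert v1 (insert v2 ?P)"
  have c: "coset (ed v1) = coset a0" "coset (ed v2) = coset a0" using v1 v2 by (simp_all add: coset_eq_iff)
  have ij: "sg i \<noteq> sg j" using assms(4) sg_inj by (simp add: inj_eq)
  have notP: "v \<notin> ?P" if "coset (ed v) = coset a0" for v using pick(2) that by force
  have "v1 \<noteq> v2" using v1(3) v2(3) ij by auto
  have "inj_on pick ?C" using pick(2) by (rule inj_on_inverseI)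
  then have "card ?P = card ?C - 1" using a0C finite_Ap by (subst card_image) (auto intro: inj_on_subset)
  moreover have "card ?C > 0" using a0C finite_Ap by (auto simp: card_gt_0_iff)
  ultimately have "card ?B = Suc (simplex_vol A)"
    using notP[OF c(1)] notP[OF c(2)] \<open>v1 \<noteq> v2\<close> finite_Ap by (simp add: vol_eq)
  moreover have "enat (card ?B) \<le> holonomic_rank A \<beta>"
  proof (rule holonomic_rank_ge)
    show "finite ?B" using finite_Ap by simp
    show "minimal_point v" if "v \<in> ?B" for v using that v1 v2 pick by auto
    fix v w assume vw: "v \<in> ?B" "w \<in> ?B" "v \<noteq> w"
    have "coset (ed v) \<noteq> coset (ed w) \<or> neg_vertices v \<noteq> neg_vertices w"
      using vw v1(3) v2(3) ij c pick(2) by auto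
    moreover have "coset (ed x) = coset (ed v) \<and> neg_vertices x = neg_vertices v" if "x \<in> fiber v" for x v using that by (simp add: fiber_def coset_eq_iff)
    ultimately show "fiber v \<inter> fiber w = {}" by blast
  qed
  ultimately show ?thesis by (simp add: less_le_trans[of _ "enat (Suc (simplex_vol A))"])
qed

end

section \<open>Coordinates with respect to the vertices\<close>

lemma full_row_rank_trivial_kernel:
  fixes B :: "'a::field ^ 'n ^ 'd"
  assumes r: "rank B = CARD('d)" and y: "\<And>j. (\<Sum>i\<in>UNIV. y i * B $ i $ j) = 0"
  shows "y i = 0"
proof (rule ccontr)
  assume i: "y i \<noteq> 0"
  let ?W = "(\<lambda>k. row k B) ` (- {i})"
  have "row k B \<in> vec.span ?W" for k
  proof (cases "k = i")
    case True
    have "row i B = (\<Sum>k\<in>- {i}. (- y k / y i) *s row k B)"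
    proof (rule vec_eq_iff[THEN iffD2], rule allI)
      fix j
      have "y i * B $ i $ j + (\<Sum>k\<in>- {i}. y k * B $ k $ j) = 0"
        using y[of j] sum.remove[of UNIV i "\<lambda>k. y k * B $ k $ j"] by (simp add: Compl_eq_Diff_UNIV)
      then have "B $ i $ j = - (\<Sum>k\<in>- {i}. y k * B $ k $ j) / y i" using i by (simp add: field_simps eq_neg_iff_add_eq_0)
      then show "row i B $ j = (\<Sum>k\<in>- {i}. (- y k / y i) *s row k B) $ j"
        by (simp add: row_def sum_component sum_divide_distrib sum_negf)
    qed
    also have "\<dots> \<in> vec.span ?W" by (intro vec.span_sum vec.span_scale vec.span_base) auto
    finally show ?thesis using True by simp
  qed (auto intro: vec.span_base)
  then have "rows B \<subseteq> vec.span ?W" by (auto simp: rows_def)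
  then have "vec.dim (rows B) \<le> card ?W" by (intro vec.dim_le_card) auto
  also have "card ?W \<le> card (- {i} :: 'd set)" by (rule card_image_le) simp
  also have "\<dots> < CARD('d)" by (intro psubset_card_mono) auto
  finally show False using r by (simp add: row_rank_def_gen)
qed

lemma column_map_matrix: "column j (map_matrix f A) $ i = f (A $ i $ j)"
  by (simp add: column_def map_matrix_def)

text \<open>Columns may be repeated, so a vertex of the polytope can have several indices, whereas
  \<open>sg\<close> selects one of them.\<close>

lemma column_lattice_cong:
  fixes A :: "int ^ 'n::finite ^ 'd"
  assumes "T \<subseteq> J" "\<And>j. j \<in> J \<Longrightarrow> \<exists>t\<in>T. column j A = column t A"
  shows "column_lattice A J = column_lattice A T"
proof (intro equalityI subsetI)
  fix x assume "x \<in> column_lattice A J"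
  then obtain c where x: "x = (\<Sum>j\<in>J. c j *s column j A)" unfolding column_lattice_def by blast
  obtain t where t: "\<And>j. j \<in> J \<Longrightarrow> t j \<in> T \<and> column j A = column (t j) A" using assms(2) by metis
  have "x = (\<Sum>s\<in>T. \<Sum>j\<in>{j\<in>J. t j = s}. c j *s column j A)"
    unfolding x using t by (intro sum.group[symmetric]) auto
  also have "\<dots> = (\<Sum>s\<in>T. (\<Sum>j\<in>{j\<in>J. t j = s}. c j) *s column s A)"
  proof (rule sum.cong)
    fix s
    have "(\<Sum>j\<in>{j\<in>J. t j = s}. c j *s column j A) = (\<Sum>j\<in>{j\<in>J. t j = s}. c j *s column s A)"
      using t by (intro sum.cong) auto
    then show "(\<Sum>j\<in>{j\<in>J. t j = s}. c j *s column j A) = (\<Sum>j\<in>{j\<in>J. t j = s}. c j) *s column s A"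
      by (simp add: vec_eq_iff sum_component sum_distrib_right)
  qed simp
  finally show "x \<in> column_lattice A T" unfolding column_lattice_def
    by (intro CollectI exI[of _ "\<lambda>s. \<Sum>j\<in>{j\<in>J. t j = s}. c j"]) simp
next
  fix x assume "x \<in> column_lattice A T"
  then obtain c where x: "x = (\<Sum>j\<in>T. c j *s column j A)" unfolding column_lattice_def by blast
  have "x = (\<Sum>j\<in>J. (if j \<in> T then c j else 0) *s column j A)"
    unfolding x using assms(1) by (intro sum.mono_neutral_cong_left) (auto simp: vec_eq_iff)
  then show "x \<in> column_lattice A J" unfolding column_lattice_def
    by (intro CollectI exI[of _ "\<lambda>j. if j \<in> T then c j else 0"]) simp
qed

text \<open>The extreme points of the simplex are columns. Because the hyperplane avoids the origin,
  their affine independence is linear independence, and full rank forces exactly \<open>d\<close> of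
  them. Barycentric coordinates live over the reals; the rational matrix of the vertices and its
  inverse carry them over to \<open>cc\<close>.\<close>

theorem ex_simplicial:
  fixes A :: "int ^ 'n::finite ^ 'd"
  assumes rank: "rank (map_matrix rat_of_int A) = CARD('d)"
    and hyp: "\<exists>(h :: rat ^ 'd) c. c \<noteq> 0 \<and> (\<forall>j. (\<Sum>i\<in>UNIV. h $ i * rat_of_int (A $ i $ j)) = c)"
    and simp: "\<exists>k. k simplex column_polytope A"
  shows "\<exists>sg cc hh. simplicial A sg cc hh"
proof -
  define r where "r j = column j (map_matrix real_of_int A)" for j
  have r: "r j $ i = real_of_int (A $ i $ j)" for i j by (simp add: r_def column_map_matrix)
  have r_inj: "column j A = column k A" if "r j = r k" for j k
  proof -
    have "real_of_int (A $ i $ j) = real_of_int (A $ i $ k)" for i using that r by metis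
    then show ?thesis by (simp add: vec_eq_iff column_def)
  qed
  have poly: "column_polytope A = convex hull (range r)"
    by (simp add: column_polytope_def columns_def r_def full_SetCompr_eq)
  obtain C where C: "\<not> affine_dependent C" "column_polytope A = convex hull C" using simp unfolding simplex by blast
  have finC: "finite C" by (rule aff_independent_finite[OF C(1)])
  have ext: "x extreme_point_of column_polytope A \<longleftrightarrow> x \<in> C" for x
    unfolding C(2) by (rule extreme_point_of_convex_hull_affine_independent[OF C(1)])
  have Cr: "C \<subseteq> range r"
  proof
    fix x assume "x \<in> C"
    then have "x extreme_point_of (convex hull (range r))" using ext poly by simp
    then show "x \<in> range r" by (rule extreme_point_of_convex_hull)
  qed
  have rC: "r j \<in> convex hull C" for j unfolding C(2)[symmetric] poly by (rule hull_inc) simp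
  have comb: "\<exists>u. (\<forall>v\<in>C. 0 \<le> u v) \<and> (\<Sum>v\<in>C. u v *\<^sub>R v) = r j" for j
    using rC[of j] unfolding convex_hull_finite[OF finC] by blast
  obtain h :: "rat ^ 'd" and c where c: "c \<noteq> 0" "\<And>j. (\<Sum>i\<in>UNIV. h $ i * rat_of_int (A $ i $ j)) = c" using hyp by blast
  define hr where "hr x = (\<Sum>i\<in>UNIV. of_rat (h $ i) * x $ i)" for x :: "real ^ 'd"
  have hr_r: "hr (r j) = of_rat c" for j
    unfolding c(2)[of j, symmetric] hr_def by (simp add: r of_rat_sum of_rat_mult)
  have hrC: "hr v = of_rat c" if "v \<in> C" for v using Cr that hr_r by auto
  \<comment> \<open>Applying the functional of the hyperplane to a linear relation shows that its
    coefficients add up to zero, so it is an affine relation.\<close>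
  have indep: "u v = 0" if "(\<Sum>v\<in>C. u v *\<^sub>R v) = 0" "v \<in> C" for u v
  proof -
    have "0 = hr (\<Sum>v\<in>C. u v *\<^sub>R v)" by (simp add: that(1) hr_def)
    also have "\<dots> = (\<Sum>v\<in>C. u v * hr v)"
      unfolding hr_def sum_distrib_left by (simp add: sum_component sum_distrib_left, subst sum.swap) (simp add: mult.left_commute)
    also have "\<dots> = (\<Sum>v\<in>C. u v) * of_rat c" by (simp add: hrC sum_distrib_right)
    finally have "(\<Sum>v\<in>C. u v) = 0" using c(1) by simp
    then show ?thesis using C(1) that unfolding affine_dependent_explicit_finite[OF finC] by blast
  qed
  have "independent C" unfolding independent_explicit using finC indep by blast
  then have "card C \<le> CARD('d)" using independent_bound[of C] by simp
  \<comment> \<open>With fewer than \<open>d\<close> vertices some nonzero functional would vanish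
    on all of them, hence on all columns, which are convex combinations of vertices; this
    contradicts the rank.\<close>
  moreover have "CARD('d) \<le> card C"
  proof (rule ccontr)
    assume "\<not> CARD('d) \<le> card C"
    obtain jx where jx: "\<And>v. v \<in> C \<Longrightarrow> r (jx v) = v" using Cr by (metis f_inv_into_f subsetD)
    obtain y :: "'d \<Rightarrow> rat" where y: "\<exists>i. y i \<noteq> 0" "\<And>v. v \<in> C \<Longrightarrow> (\<Sum>i\<in>UNIV. of_int (A $ i $ jx v) * y i) = 0"
      using homogeneous_system_nontrivial[OF finC, of "UNIV :: 'd set" "\<lambda>v i. of_int (A $ i $ jx v)"] \<open>\<not> CARD('d) \<le> card C\<close> by auto
    define yr where "yr x = (\<Sum>i\<in>UNIV. of_rat (y i) * x $ i)" for x :: "real ^ 'd"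
    have yr_r: "yr (r j) = of_rat (\<Sum>i\<in>UNIV. of_int (A $ i $ j) * y i)" for j
      unfolding yr_def by (simp add: r of_rat_sum of_rat_mult mult.commute)
    have yC: "yr v = 0" if "v \<in> C" for v using yr_r[of "jx v"] y(2)[OF that] jx[OF that] by simp
    have "yr (r j) = 0" for j
    proof -
      obtain u where u: "(\<Sum>v\<in>C. u v *\<^sub>R v) = r j" using comb by blast
      have "yr (\<Sum>v\<in>C. u v *\<^sub>R v) = (\<Sum>v\<in>C. u v * yr v)"
        unfolding yr_def sum_distrib_left by (simp add: sum_component sum_distrib_left, subst sum.swap) (simp add: mult.left_commute)
      then show ?thesis by (simp add: u yC)
    qed
    then have "(\<Sum>i\<in>UNIV. y i * map_matrix rat_of_int A $ i $ j) = 0" for j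
      using yr_r[of j] by (simp add: map_matrix_def mult.commute)
    from full_row_rank_trivial_kernel[OF rank this] y(1) show False by blast
  qed
  ultimately obtain b where b: "bij_betw b (UNIV :: 'd set) C" using finC by (metis bij_betw_iff_card finite_class.finite_UNIV le_antisym)
  have "b l \<in> range r" for l using bij_betwE[OF b] Cr by blast
  then have "\<forall>l. \<exists>j. b l = r j" by blast
  then obtain sg where sg: "\<And>l. r (sg l) = b l" by metis
  have indep_sg: "z l = 0" if "(\<Sum>l\<in>UNIV. z l *\<^sub>R r (sg l)) = 0" for z l
  proof -
    have "(\<Sum>v\<in>C. z (the_inv b v) *\<^sub>R v) = (\<Sum>l\<in>UNIV. z (the_inv b (b l)) *\<^sub>R b l)"
      using sum.reindex_bij_betw[OF b, of "\<lambda>v. z (the_inv b v) *\<^sub>R v"] by simp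
    also have "\<dots> = 0" using that b by (simp add: the_inv_f_f bij_betw_def sg)
    finally have "z (the_inv b (b l)) = 0" using b by (intro indep) (auto simp: bij_betw_def)
    then show ?thesis using b by (simp add: the_inv_f_f bij_betw_def)
  qed
  \<comment> \<open>The columns at the chosen vertices; the inverse matrix computes the coordinates
    \<open>cc\<close>.\<close>
  define B :: "rat ^ 'd ^ 'd" where "B = (\<chi> i l. of_int (A $ i $ sg l))"
  have "inj ((*v) B)"
  proof (rule injI)
    fix x y :: "rat ^ 'd" assume e: "B *v x = B *v y"
    have "(\<Sum>l\<in>UNIV. of_rat (x $ l - y $ l) *\<^sub>R r (sg l)) $ i = 0" for i
    proof -
      have "(\<Sum>l\<in>UNIV. (x $ l - y $ l) * of_int (A $ i $ sg l)) = (B *v x) $ i - (B *v y) $ i"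
        by (simp add: matrix_vector_mult_def B_def left_diff_distrib sum_subtractf mult.commute)
      then have "(of_rat (\<Sum>l\<in>UNIV. (x $ l - y $ l) * of_int (A $ i $ sg l)) :: real) = 0" using e by simp
      then show ?thesis by (simp add: sum_component r of_rat_sum of_rat_mult)
    qed
    then have "(\<Sum>l\<in>UNIV. of_rat (x $ l - y $ l) *\<^sub>R r (sg l)) = 0" by (simp add: vec_eq_iff)
    from indep_sg[of "\<lambda>l. of_rat (x $ l - y $ l)", OF this] show "x = y" by (simp add: vec_eq_iff)
  qed
  then obtain B' where B': "B' ** B = mat 1" using matrix_left_invertible_injective by blast
  then have BB': "B ** B' = mat 1" by (rule matrix_left_right_inverse1)
  define q where "q x = (\<chi> i. rat_of_int (x $ i))" for x :: "int ^ 'd"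
  define cc where "cc l x = (B' *v q x) $ l" for l x
  define hh where "hh x = (\<Sum>i\<in>UNIV. h $ i * q x $ i) / c" for x
  have expand: "B *v (\<chi> l. cc l x) = q x" for x
    unfolding cc_def by (simp add: matrix_vector_mul_assoc BB')
  have vi: "vertex_indices A = {j. r j \<in> C}" unfolding vertex_indices_def r_def[symmetric] ext ..
  have rng: "range b = C" using b by (simp add: bij_betw_def)
  have "simplicial A sg cc hh"
  proof
    show "cc l (x + y) = cc l x + cc l y" for l x y
    proof -
      have "q (x + y) = q x + q y" by (simp add: q_def vec_eq_iff)
      then show ?thesis by (simp add: cc_def matrix_vector_right_distrib)
    qed
    show "cc l (column (sg m) A) = (if l = m then 1 else 0)" for l m
    proof -
      have "q (column (sg m) A) = B *v axis m 1" by (simp add: q_def B_def vec_eq_iff column_def matrix_vector_mult_def axis_def if_distrib cong: if_cong)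
      then have "cc l (column (sg m) A) = (B' *v (B *v axis m 1)) $ l" by (simp add: cc_def)
      also have "\<dots> = axis m 1 $ l" by (simp only: matrix_vector_mul_assoc B' matrix_vector_mul_lid)
      finally show ?thesis by (simp add: axis_def)
    qed
    \<comment> \<open>Both \<open>cc\<close> and the convex coefficients expand the same column in
      the vertices, so by independence they coincide, and the latter are nonnegative.\<close>
    show "0 \<le> cc l (column j A)" for l j
    proof -
      obtain u where u: "\<And>v. v \<in> C \<Longrightarrow> 0 \<le> u v" "(\<Sum>v\<in>C. u v *\<^sub>R v) = r j" using comb by blast
      have "(\<Sum>v\<in>C. u v *\<^sub>R v) = (\<Sum>l\<in>UNIV. u (r (sg l)) *\<^sub>R r (sg l))"
        using sum.reindex_bij_betw[OF b, of "\<lambda>v. u v *\<^sub>R v"] by (simp add: sg)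
      moreover have "r j = (\<Sum>l\<in>UNIV. of_rat (cc l (column j A)) *\<^sub>R r (sg l))"
      proof (rule vec_eq_iff[THEN iffD2], rule allI)
        fix i
        have "rat_of_int (A $ i $ j) = (B *v (\<chi> l. cc l (column j A))) $ i" unfolding expand by (simp add: q_def column_def)
        also have "\<dots> = (\<Sum>l\<in>UNIV. cc l (column j A) * of_int (A $ i $ sg l))" by (simp add: matrix_vector_mult_def B_def mult.commute)
        finally have "(of_rat (rat_of_int (A $ i $ j)) :: real) = of_rat (\<Sum>l\<in>UNIV. cc l (column j A) * of_int (A $ i $ sg l))" by simp
        then show "r j $ i = (\<Sum>l\<in>UNIV. of_rat (cc l (column j A)) *\<^sub>R r (sg l)) $ i" by (simp add: sum_component r of_rat_sum of_rat_mult)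
      qed
      ultimately have "(\<Sum>l\<in>UNIV. (u (r (sg l)) - of_rat (cc l (column j A))) *\<^sub>R r (sg l)) = 0"
        using u(2) by (simp add: scaleR_left_diff_distrib sum_subtractf)
      from indep_sg[of "\<lambda>l. u (r (sg l)) - of_rat (cc l (column j A))", OF this, of l]
      have "u (r (sg l)) = of_rat (cc l (column j A))" by simp
      moreover have "0 \<le> u (r (sg l))" using rng by (intro u(1)) (auto simp: sg)
      ultimately show ?thesis by simp
    qed
    show "x = 0" if "\<And>l. cc l x = 0" for x
    proof -
      have "q x = B *v 0" unfolding expand[of x, symmetric] using that by (simp add: zero_vec_def)
      then have "q x = 0" by simp
      then show ?thesis by (simp add: q_def vec_eq_iff)
    qed
    show "hh (x + y) = hh x + hh y" for x y
      by (simp add: hh_def q_def distrib_left sum.distrib add_divide_distrib)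
    show "hh (column j A) = 1" for j using c by (simp add: hh_def q_def column_def)
    show "column_lattice A (vertex_indices A) = column_lattice A (range sg)"
    proof (rule column_lattice_cong)
      show "range sg \<subseteq> vertex_indices A" using rng by (auto simp: vi sg)
      fix j assume "j \<in> vertex_indices A"
      then obtain l where "r j = r (sg l)" using rng unfolding vi sg by auto
      then show "\<exists>t\<in>range sg. column j A = column t A" using r_inj by blast
    qed
  qed
  then show ?thesis by blast
qed

theorem theorem6p7:
  fixes A :: "int ^ 'n::{finite,linorder} ^ 'd"
  assumes "rank (map_matrix rat_of_int A) = CARD('d)"
    and "\<exists>(h :: rat ^ 'd) c. c \<noteq> 0 \<and> (\<forall>j. (\<Sum>i\<in>UNIV. h $ i * rat_of_int (A $ i $ j)) = c)"
    and "\<exists>k. k simplex column_polytope A"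
  shows "cohen_macaulay (monoid_algebra (cone_monoid A) :: (int ^ 'd \<Rightarrow>\<^sub>0 'k::field_char_0) ring)
     \<longleftrightarrow> (exceptional_set A :: ('k ^ 'd) set) = {}"
proof -
  obtain sg cc hh where s: "simplicial A sg cc hh" using ex_simplicial[OF assms] by blast
  interpret simplicial A sg cc hh by (rule s)
  have "star \<longleftrightarrow> (exceptional_set A :: ('k ^ 'd) set) = {}"
  proof
    assume star
    have "holonomic_rank A \<beta> \<le> enat (simplex_vol A)" for \<beta> :: "'k ^ 'd"
    proof -
      interpret hypergeometric A sg cc hh \<beta> by unfold_locales
      show ?thesis using holonomic_rank_le star_card_Ap[OF \<open>star\<close>] by simp
    qed
    then show "(exceptional_set A :: ('k ^ 'd) set) = {}" by (auto simp: exceptional_set_def not_less)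
  next
    assume e: "(exceptional_set A :: ('k ^ 'd) set) = {}"
    show star unfolding star_def
    proof (intro ballI allI impI, rule ccontr)
      fix z i j assume z: "z \<in> ZA" and ij: "i \<noteq> j" "z + V i \<in> S" "z + V j \<in> S" "z \<notin> S"
      \<comment> \<open>The violating lattice point itself, mapped into the field, serves as the
        exceptional parameter.\<close>
      define \<beta> :: "'k ^ 'd" where "\<beta> = (\<chi> i. of_int (z $ i))"
      interpret integral_parameter A sg cc hh \<beta> z by unfold_locales (simp_all add: z \<beta>_def)
      have "\<beta> \<in> exceptional_set A" using holonomic_rank_gt ij by (simp add: exceptional_set_def)
      with e show False by simp
    qed
  qed
  then show ?thesis using cohen_macaulay_imp_star star_imp_cohen_macaulay by blast
qed

end
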